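(* Let $L_\infty/L$ be an infinite Galois extension with group $\Gamma$, and $\Gamma\supseteq\Gamma_1\supseteq\Gamma_2\supseteq\cdots$ open normal subgroups with $\bigcap_n\Gamma_n=1$. Suppose that $\Gamma$ is abelian, that $p\nmid|\Gamma/\Gamma_1|$, and that $\Gamma_1$ is a torsionfree pro-$p$ group of finite rank. Then $o_\infty^*$ is a free $\Lambda(\Gamma)$-module of rank $1$ if and only if the natural map $k_1\to k_\infty^{\Gamma_1}$ is an isomorphism.
   Context: $L/\mathbb{Q}_p$ finite with uniformizer $\pi$ and residue field $k_L$. $L_n=L_\infty^{\Gamma_n}$, $o_n$ the integral closure of $o_L$ in $L_n$, $o_n^*=\mathrm{Hom}_{o_L}(o_n,o_L)$, $k_n=o_n/\pi o_n$. $\Lambda(\Gamma)=\varprojlim_n o_L[\Gamma/\Gamma_n]$; $o_\infty^*=\varprojlim_n o_n^*$ (transition maps dual to the inclusions $o_n\subseteq o_{n+1}$), a $\Lambda(\Gamma)$-module; $k_\infty=\varinjlim_n k_n$ with its $\Gamma$-action. *)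

theory Defs
  imports
    "HOL-Analysis.Analysis"
    "HOL-Number_Theory.Residues"
    "HOL-Algebra.Algebra"
begin

section \<open>Limits of sequences of rings\<close>

text \<open>All sequences are indexed by the integers \<open>n \<ge> 1\<close>.\<close>

definition inverse_limit ::
    "(nat \<Rightarrow> ('a, 'm) ring_scheme) \<Rightarrow> (nat \<Rightarrow> 'a \<Rightarrow> 'a) \<Rightarrow> (nat \<Rightarrow> 'a) ring" where
  "inverse_limit R \<phi> =
    \<lparr> carrier = {x \<in> (\<Pi>\<^sub>E n\<in>{1..}. carrier (R n)). \<forall>n\<ge>1. \<phi> n (x (Suc n)) = x n},
      monoid.mult = (\<lambda>x y. \<lambda>n\<in>{1..}. x n \<otimes>\<^bsub>R n\<^esub> y n),
      one = (\<lambda>n\<in>{1..}. \<one>\<^bsub>R n\<^esub>),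
      ring.zero = (\<lambda>n\<in>{1..}. \<zero>\<^bsub>R n\<^esub>),
      add = (\<lambda>x y. \<lambda>n\<in>{1..}. x n \<oplus>\<^bsub>R n\<^esub> y n) \<rparr>"

text \<open>The direct limit is the quotient of the disjoint union; \<open>\<phi> n m\<close>, for \<open>n \<le> m\<close>, is the
  transition map from \<open>R n\<close> to \<open>R m\<close>.\<close>

definition direct_limit_rel ::
    "(nat \<Rightarrow> ('a, 'm) ring_scheme) \<Rightarrow> (nat \<Rightarrow> nat \<Rightarrow> 'a \<Rightarrow> 'a) \<Rightarrow> ((nat \<times> 'a) \<times> (nat \<times> 'a)) set" where
  "direct_limit_rel R \<phi> =
    {((n, x), (m, y)) | n x m y.
       1 \<le> n \<and> 1 \<le> m \<and> x \<in> carrier (R n) \<and> y \<in> carrier (R m) \<and>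
       (\<exists>k. n \<le> k \<and> m \<le> k \<and> \<phi> n k x = \<phi> m k y)}"

definition direct_limit_in ::
    "(nat \<Rightarrow> ('a, 'm) ring_scheme) \<Rightarrow> (nat \<Rightarrow> nat \<Rightarrow> 'a \<Rightarrow> 'a) \<Rightarrow> nat \<Rightarrow> 'a \<Rightarrow> (nat \<times> 'a) set" where
  "direct_limit_in R \<phi> n x = direct_limit_rel R \<phi> `` {(n, x)}"

definition direct_limit ::
    "(nat \<Rightarrow> ('a, 'm) ring_scheme) \<Rightarrow> (nat \<Rightarrow> nat \<Rightarrow> 'a \<Rightarrow> 'a) \<Rightarrow> (nat \<times> 'a) set ring" where
  "direct_limit R \<phi> =
    \<lparr> carrier = (SIGMA n:{1..}. carrier (R n)) // direct_limit_rel R \<phi>,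
      monoid.mult = (\<lambda>c d. \<Union>(n, x)\<in>c. \<Union>(m, y)\<in>d. direct_limit_in R \<phi> (max n m)
               (\<phi> n (max n m) x \<otimes>\<^bsub>R (max n m)\<^esub> \<phi> m (max n m) y)),
      one = direct_limit_in R \<phi> 1 \<one>\<^bsub>R 1\<^esub>,
      ring.zero = direct_limit_in R \<phi> 1 \<zero>\<^bsub>R 1\<^esub>,
      add = (\<lambda>c d. \<Union>(n, x)\<in>c. \<Union>(m, y)\<in>d. direct_limit_in R \<phi> (max n m)
               (\<phi> n (max n m) x \<oplus>\<^bsub>R (max n m)\<^esub> \<phi> m (max n m) y)) \<rparr>"


section \<open>Finite extensions of \<open>\<rat>\<^sub>p\<close> and rings of integers\<close>

definition padic_integers :: "nat \<Rightarrow> (nat \<Rightarrow> int) ring" where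
  "padic_integers p =
     inverse_limit (\<lambda>n. residue_ring (int p ^ n)) (\<lambda>n x. x mod (int p ^ n))"

text \<open>A subfield \<open>L\<close> of \<open>E\<close> is a finite extension of \<open>\<rat>\<^sub>p\<close> by means of an embedding \<open>\<iota>\<close> of
  \<open>\<int>\<^sub>p\<close> into \<open>L\<close>; the copy of \<open>\<rat>\<^sub>p\<close> in \<open>L\<close> is the field of fractions of the image of \<open>\<iota>\<close>.\<close>

definition finite_extension_of_Qp ::
    "nat \<Rightarrow> ('a, 'm) ring_scheme \<Rightarrow> 'a set \<Rightarrow> ((nat \<Rightarrow> int) \<Rightarrow> 'a) \<Rightarrow> bool" where
  "finite_extension_of_Qp p E L \<iota> \<longleftrightarrow>
     subfield L E \<and>
     \<iota> \<in> ring_hom (padic_integers p) E \<and> inj_on \<iota> (carrier (padic_integers p)) \<and>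
     \<iota> ` carrier (padic_integers p) \<subseteq> L \<and>
     ring.finite_dimension E (generate_field E (\<iota> ` carrier (padic_integers p))) L"

text \<open>The polynomials of HOL-Algebra are lists of coefficients, the leading one first.\<close>

definition integral_closure :: "('a, 'm) ring_scheme \<Rightarrow> 'a set \<Rightarrow> 'a set \<Rightarrow> 'a set" where
  "integral_closure E A B =
     {x \<in> B. \<exists>cs. set cs \<subseteq> A \<and> ring.eval E (\<one>\<^bsub>E\<^esub> # cs) x = \<zero>\<^bsub>E\<^esub>}"

text \<open>In a local ring the maximal ideal consists of the non-units.\<close>

definition uniformizer :: "('a, 'm) ring_scheme \<Rightarrow> 'a \<Rightarrow> bool" where
  "uniformizer R \<pi> \<longleftrightarrow>
     \<pi> \<in> carrier R \<and> maximalideal (PIdl\<^bsub>R\<^esub> \<pi>) R \<and> PIdl\<^bsub>R\<^esub> \<pi> = carrier R - Units R"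


section \<open>Galois groups and their Krull topology\<close>

definition Gal :: "('a, 'm) ring_scheme \<Rightarrow> 'a set \<Rightarrow> ('a \<Rightarrow> 'a) monoid" where
  "Gal E K = (BijGroup (carrier E))
     \<lparr>carrier := {\<sigma> \<in> Bij (carrier E). \<sigma> \<in> ring_hom E E \<and> (\<forall>x\<in>K. \<sigma> x = x)}\<rparr>"

definition fixed_field :: "('a, 'm) ring_scheme \<Rightarrow> ('a \<Rightarrow> 'a) set \<Rightarrow> 'a set" where
  "fixed_field E H = {x \<in> carrier E. \<forall>\<sigma>\<in>H. \<sigma> x = x}"

definition galois_extension :: "('a, 'm) ring_scheme \<Rightarrow> 'a set \<Rightarrow> bool" where
  "galois_extension E K \<longleftrightarrow>
     field E \<and> subfield K E \<and>
     (\<forall>x\<in>carrier E. ring.algebraic E K x) \<and>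
     fixed_field E (carrier (Gal E K)) = K"

definition krull_topology :: "('a, 'm) ring_scheme \<Rightarrow> 'a set \<Rightarrow> ('a \<Rightarrow> 'a) topology" where
  "krull_topology E K = topology_generated_by
     {\<sigma> <#\<^bsub>Gal E K\<^esub> carrier (Gal E M) | \<sigma> M.
        \<sigma> \<in> carrier (Gal E K) \<and> subfield M E \<and> K \<subseteq> M \<and> ring.finite_dimension E K M}"


section \<open>Pro-\<open>p\<close> groups\<close>

definition topological_group :: "('g, 'm) monoid_scheme \<Rightarrow> 'g topology \<Rightarrow> bool" where
  "topological_group G T \<longleftrightarrow>
     group G \<and> topspace T = carrier G \<and>
     continuous_map (prod_topology T T) T (\<lambda>(x, y). x \<otimes>\<^bsub>G\<^esub> y) \<and>
     continuous_map T T (\<lambda>x. inv\<^bsub>G\<^esub> x)"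

definition profinite_group :: "('g, 'm) monoid_scheme \<Rightarrow> 'g topology \<Rightarrow> bool" where
  "profinite_group G T \<longleftrightarrow>
     topological_group G T \<and> compact_space T \<and> Hausdorff_space T \<and>
     (\<forall>U. openin T U \<and> \<one>\<^bsub>G\<^esub> \<in> U \<longrightarrow> (\<exists>H. subgroup H G \<and> openin T H \<and> H \<subseteq> U))"

definition pro_p_group :: "nat \<Rightarrow> ('g, 'm) monoid_scheme \<Rightarrow> 'g topology \<Rightarrow> bool" where
  "pro_p_group p G T \<longleftrightarrow>
     profinite_group G T \<and>
     (\<forall>N. N \<lhd> G \<and> openin T N \<longrightarrow> (\<exists>k. card (carrier (G Mod N)) = p ^ k))"

text \<open>The rank of a profinite group is the supremum of the minimal numbers of topological
  generators of its closed subgroups.\<close>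

definition finite_rank :: "('g, 'm) monoid_scheme \<Rightarrow> 'g topology \<Rightarrow> bool" where
  "finite_rank G T \<longleftrightarrow>
     (\<exists>r. \<forall>H. subgroup H G \<and> closedin T H \<longrightarrow>
        (\<exists>S. S \<subseteq> H \<and> finite S \<and> card S \<le> r \<and> T closure_of (generate G S) = H))"

definition torsion_free :: "('g, 'm) monoid_scheme \<Rightarrow> bool" where
  "torsion_free G \<longleftrightarrow>
     (\<forall>x\<in>carrier G. \<forall>n::nat. 0 < n \<and> x [^]\<^bsub>G\<^esub> n = \<one>\<^bsub>G\<^esub> \<longrightarrow> x = \<one>\<^bsub>G\<^esub>)"


section \<open>Group rings and the Iwasawa algebra\<close>

definition group_ring ::
    "('r, 'm) ring_scheme \<Rightarrow> ('g, 'n) monoid_scheme \<Rightarrow> ('g \<Rightarrow> 'r) ring" where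
  "group_ring R G =
    \<lparr> carrier = {a \<in> carrier G \<rightarrow>\<^sub>E carrier R. finite {g \<in> carrier G. a g \<noteq> \<zero>\<^bsub>R\<^esub>}},
      monoid.mult = (\<lambda>a b. \<lambda>g\<in>carrier G.
               \<Oplus>\<^bsub>R\<^esub>h\<in>{h \<in> carrier G. a h \<noteq> \<zero>\<^bsub>R\<^esub>}. a h \<otimes>\<^bsub>R\<^esub> b (inv\<^bsub>G\<^esub> h \<otimes>\<^bsub>G\<^esub> g)),
      one = (\<lambda>g\<in>carrier G. if g = \<one>\<^bsub>G\<^esub> then \<one>\<^bsub>R\<^esub> else \<zero>\<^bsub>R\<^esub>),
      ring.zero = (\<lambda>g\<in>carrier G. \<zero>\<^bsub>R\<^esub>),
      add = (\<lambda>a b. \<lambda>g\<in>carrier G. a g \<oplus>\<^bsub>R\<^esub> b g) \<rparr>"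

definition group_ring_map ::
    "('r, 'm) ring_scheme \<Rightarrow> ('g, 'n) monoid_scheme \<Rightarrow> ('h, 'k) monoid_scheme \<Rightarrow>
     ('g \<Rightarrow> 'h) \<Rightarrow> ('g \<Rightarrow> 'r) \<Rightarrow> ('h \<Rightarrow> 'r)" where
  "group_ring_map R G H \<phi> a =
     (\<lambda>h\<in>carrier H. \<Oplus>\<^bsub>R\<^esub>g\<in>{g \<in> carrier G. a g \<noteq> \<zero>\<^bsub>R\<^esub> \<and> \<phi> g = h}. a g)"

text \<open>The projection from \<open>G / N (n + 1)\<close> to \<open>G / N n\<close> sends a coset \<open>C\<close> to \<open>C N n\<close>.\<close>

definition iwasawa_algebra ::
    "('r, 'm) ring_scheme \<Rightarrow> ('g, 'n) monoid_scheme \<Rightarrow> (nat \<Rightarrow> 'g set) \<Rightarrow>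
     (nat \<Rightarrow> 'g set \<Rightarrow> 'r) ring" where
  "iwasawa_algebra R G N =
     inverse_limit (\<lambda>n. group_ring R (G Mod N n))
       (\<lambda>n. group_ring_map R (G Mod N (Suc n)) (G Mod N n) (\<lambda>C. C <#>\<^bsub>G\<^esub> N n))"

definition free_module_of_rank ::
    "('r, 'm) ring_scheme \<Rightarrow> ('r, 'v, 'n) module_scheme \<Rightarrow> nat \<Rightarrow> bool" where
  "free_module_of_rank R M d \<longleftrightarrow>
     Module.module R M \<and>
     (\<exists>b \<in> {..<d} \<rightarrow> carrier M. \<forall>x\<in>carrier M.
        \<exists>!c. c \<in> {..<d} \<rightarrow>\<^sub>E carrier R \<and> x = (\<Oplus>\<^bsub>M\<^esub>i\<in>{..<d}. c i \<odot>\<^bsub>M\<^esub> b i))"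


section \<open>The modules \<open>o\<^sub>\<infinity>\<^sup>*\<close> and \<open>k\<^sub>\<infinity>\<close>\<close>

definition linear_dual :: "('a, 'm) ring_scheme \<Rightarrow> 'a set \<Rightarrow> 'a set \<Rightarrow> ('a \<Rightarrow> 'a) set" where
  "linear_dual E A B =
     {f \<in> B \<rightarrow>\<^sub>E A.
        (\<forall>x\<in>B. \<forall>y\<in>B. f (x \<oplus>\<^bsub>E\<^esub> y) = f x \<oplus>\<^bsub>E\<^esub> f y) \<and>
        (\<forall>a\<in>A. \<forall>x\<in>B. f (a \<otimes>\<^bsub>E\<^esub> x) = a \<otimes>\<^bsub>E\<^esub> f x)}"

text \<open>
  \<open>A\<close> is the base ring, \<open>B n\<close> the \<open>n\<close>-th ring of integers.  The transition maps are the
  restrictions.  The group acts contragrediently, \<open>(\<gamma> f)(x) = f (\<gamma>\<^sup>-\<^sup>1 x)\<close>; on the dual of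
  \<open>B n\<close> this action factors through \<open>G / N n\<close>, so that \<open>f (\<gamma>\<^sup>-\<^sup>1 x)\<close> takes a single value for
  \<open>\<gamma>\<close> in a given coset.  The multiplication and unit fields of the record play no role for
  modules.\<close>

definition dual_limit ::
    "('a, 'm) ring_scheme \<Rightarrow> 'a set \<Rightarrow> (nat \<Rightarrow> 'a set) \<Rightarrow>
     ('a \<Rightarrow> 'a, 'n) monoid_scheme \<Rightarrow> (nat \<Rightarrow> ('a \<Rightarrow> 'a) set) \<Rightarrow>
     (nat \<Rightarrow> ('a \<Rightarrow> 'a) set \<Rightarrow> 'a, nat \<Rightarrow> 'a \<Rightarrow> 'a) module" where
  "dual_limit E A B G N =
    \<lparr> carrier = {f \<in> (\<Pi>\<^sub>E n\<in>{1..}. linear_dual E A (B n)).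
                  \<forall>n\<ge>1. restrict (f (Suc n)) (B n) = f n},
      monoid.mult = undefined,
      one = undefined,
      ring.zero = (\<lambda>n\<in>{1..}. \<lambda>x\<in>B n. \<zero>\<^bsub>E\<^esub>),
      add = (\<lambda>f g. \<lambda>n\<in>{1..}. \<lambda>x\<in>B n. f n x \<oplus>\<^bsub>E\<^esub> g n x),
      smult = (\<lambda>a f. \<lambda>n\<in>{1..}. \<lambda>x\<in>B n.
                 \<Oplus>\<^bsub>E\<^esub>C\<in>carrier (G Mod N n).
                   a n C \<otimes>\<^bsub>E\<^esub> the_elem ((\<lambda>\<gamma>. f n ((inv\<^bsub>G\<^esub> \<gamma>) x)) ` C)) \<rparr>"

definition reduction :: "('a, 'm) ring_scheme \<Rightarrow> 'a set \<Rightarrow> 'a \<Rightarrow> 'a set ring" where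
  "reduction E B \<pi> = (E\<lparr>carrier := B\<rparr>) Quot (PIdl\<^bsub>E\<lparr>carrier := B\<rparr>\<^esub> \<pi>)"

text \<open>The map induced by the inclusion of \<open>B n\<close> into \<open>B m\<close> sends a coset \<open>Y\<close> to \<open>Y + \<pi> B m\<close>.\<close>

definition reduction_map ::
    "('a, 'm) ring_scheme \<Rightarrow> (nat \<Rightarrow> 'a set) \<Rightarrow> 'a \<Rightarrow> nat \<Rightarrow> nat \<Rightarrow> 'a set \<Rightarrow> 'a set" where
  "reduction_map E B \<pi> n m Y = Y <+>\<^bsub>E\<^esub> (PIdl\<^bsub>E\<lparr>carrier := B m\<rparr>\<^esub> \<pi>)"

definition reduction_limit ::
    "('a, 'm) ring_scheme \<Rightarrow> (nat \<Rightarrow> 'a set) \<Rightarrow> 'a \<Rightarrow> (nat \<times> 'a set) set ring" where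
  "reduction_limit E B \<pi> = direct_limit (\<lambda>n. reduction E (B n) \<pi>) (reduction_map E B \<pi>)"

text \<open>An automorphism acts on residue classes by taking images of sets, and on elements of the
  direct limit by acting on all their representatives.\<close>

definition reduction_limit_action ::
    "('a \<Rightarrow> 'a) \<Rightarrow> (nat \<times> 'a set) set \<Rightarrow> (nat \<times> 'a set) set" where
  "reduction_limit_action \<sigma> c = (\<lambda>(n, Y). (n, \<sigma> ` Y)) ` c"

definition reduction_limit_invariants ::
    "('a, 'm) ring_scheme \<Rightarrow> (nat \<Rightarrow> 'a set) \<Rightarrow> 'a \<Rightarrow> ('a \<Rightarrow> 'a) set \<Rightarrow>
     (nat \<times> 'a set) set ring" where
  "reduction_limit_invariants E B \<pi> H = (reduction_limit E B \<pi>)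
     \<lparr>carrier := {c \<in> carrier (reduction_limit E B \<pi>).
                    \<forall>\<sigma>\<in>H. reduction_limit_action \<sigma> c = c}\<rparr>"

end

theory Submission
  imports Defs
begin

text \<open>
  Put \<open>A = oL\<close> and let \<open>B n\<close> be the ring of integers of the fixed field of \<open>N n\<close>.  A functional \<open>b\<close> on \<open>B n\<close> is
  a free generator of the dual lattice over the group ring of \<open>\<Gamma> / N n\<close> iff \<open>b (\<gamma> x) \<in> \<pi>A\<close> for all \<open>\<gamma>\<close> forces
  \<open>x \<in> \<pi>B n\<close>.  At level \<open>1\<close> such a \<open>b\<close> exists because the group ring is reduced modulo \<open>\<pi>\<close>.  Lift it to the
  limit.  The vectors violating the criterion at level \<open>n\<close> form a stable submodule; as \<open>N 1\<close> acts through a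
  \<open>p\<close>-group, it contains a vector that is nonzero and \<open>N 1\<close>-invariant modulo \<open>\<pi>\<close>.  If invariants modulo \<open>\<pi>\<close>
  lift to \<open>B 1\<close>, this contradicts the choice of \<open>b\<close> at level \<open>1\<close>.  Conversely, a generator identifies \<open>B n\<close> with
  the functions on \<open>\<Gamma> / N n\<close>, whose invariants modulo \<open>\<pi>\<close> lift.\<close>

section \<open>Linear algebra over a discrete valuation ring\<close>

text \<open>No basis of \<open>B n\<close> over \<open>A\<close> is chosen in advance. Its place is
  taken by finitely many trace functionals that separate points, and functionals are extended one
  kernel at a time. The traces come from families \<open>a\<close>, \<open>y\<close> for which the
  sum of \<open>a k\<close> times g(\<open>y k\<close>) is 1 for g = 1 and 0 otherwise; the same
  identity yields independence of the group elements, integrality as boundedness of powers, and the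
  Galois correspondence at finite level. At level 1, with residue field k and finite group G, the
  ring k[G] is reduced because p does not divide the order of G, and finite because k is. A
  repeating power of an annihilating element gives an idempotent, which serves to enlarge a vector
  until its annihilator modulo \<pi> vanishes; a trace-orthogonal vector turns the result into the
  functional \<open>b\<close>. Testing modulo \<pi> suffices for a reason in the style of Nakayama:
  an element whose orbit values vanish can be divided by \<pi> again and again, while no nonzero
  element is divisible by all powers of \<pi>.\<close>

lemma (in abelian_monoid) finsum_swap:
  assumes "finite I" "finite J" "\<And>i j. i \<in> I \<Longrightarrow> j \<in> J \<Longrightarrow> f i j \<in> carrier G"
  shows "(\<Oplus>i\<in>I. \<Oplus>j\<in>J. f i j) = (\<Oplus>j\<in>J. \<Oplus>i\<in>I. f i j)"
  using assms(1,3)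
proof (induction I)
  case empty
  show ?case by (simp add: finsum_zero)
next
  case (insert i I)
  have "(\<Oplus>i\<in>insert i I. \<Oplus>j\<in>J. f i j) = (\<Oplus>j\<in>J. f i j) \<oplus> (\<Oplus>i\<in>I. \<Oplus>j\<in>J. f i j)"
    using insert by (intro finsum_insert) (auto intro!: finsum_closed)
  also have "\<dots> = (\<Oplus>j\<in>J. f i j) \<oplus> (\<Oplus>j\<in>J. \<Oplus>i\<in>I. f i j)"
    using insert by simp
  also have "\<dots> = (\<Oplus>j\<in>J. f i j \<oplus> (\<Oplus>i\<in>I. f i j))"
    using insert by (intro finsum_addf[symmetric]) (auto intro!: finsum_closed)
  also have "\<dots> = (\<Oplus>j\<in>J. \<Oplus>i\<in>insert i I. f i j)"
    using insert by (intro finsum_cong' finsum_insert[symmetric]) (auto intro!: finsum_closed)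
  finally show ?case .
qed

lemma (in abelian_monoid) finsum_mem:
  assumes "M \<subseteq> carrier G" "\<zero> \<in> M" "\<And>x y. x \<in> M \<Longrightarrow> y \<in> M \<Longrightarrow> x \<oplus> y \<in> M"
    and "\<And>i. i \<in> I \<Longrightarrow> f i \<in> M"
  shows "(\<Oplus>i\<in>I. f i) \<in> M"
proof (cases "finite I")
  case True
  then show ?thesis using assms(4)
  proof (induction I)
    case (insert i I)
    then have "(\<Oplus>i\<in>insert i I. f i) = f i \<oplus> (\<Oplus>i\<in>I. f i)"
      using assms(1) by (intro finsum_insert) auto
    then show ?case using insert assms(3) by auto
  qed (use assms in simp)
qed (use assms in simp)

lemma (in abelian_monoid) finsum_delta:
  assumes "finite I" "i \<in> I" "f i \<in> carrier G"
    and "\<And>j. j \<in> I \<Longrightarrow> j \<noteq> i \<Longrightarrow> f j = \<zero>"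
  shows "(\<Oplus>j\<in>I. f j) = f i"
proof -
  have "(\<Oplus>j\<in>I. f j) = (\<Oplus>j\<in>insert i (I - {i}). f j)"
    using assms(2) by (simp add: insert_absorb)
  also have "\<dots> = f i \<oplus> (\<Oplus>j\<in>I - {i}. f j)"
  proof (intro finsum_insert)
    show "f \<in> I - {i} \<rightarrow> carrier G" using assms(4) by auto
  qed (use assms in auto)
  also have "(\<Oplus>j\<in>I - {i}. f j) = (\<Oplus>j\<in>I - {i}. \<zero>)"
    using assms(4) by (intro finsum_cong') auto
  also have "f i \<oplus> (\<Oplus>j\<in>I - {i}. \<zero>) = f i" using assms by (simp add: finsum_zero)
  finally show ?thesis .
qed

section \<open>Inverses and cancellation in fields\<close>

lemma (in field) inv_mem [simp, intro]:
  "x \<in> carrier R \<Longrightarrow> x \<noteq> \<zero> \<Longrightarrow> inv x \<in> carrier R"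
  by (simp add: field_Units)

lemma (in field) inv_l [simp]: "x \<in> carrier R \<Longrightarrow> x \<noteq> \<zero> \<Longrightarrow> inv x \<otimes> x = \<one>"
  by (simp add: field_Units)

lemma (in field) inv_r [simp]: "x \<in> carrier R \<Longrightarrow> x \<noteq> \<zero> \<Longrightarrow> x \<otimes> inv x = \<one>"
  by (simp add: field_Units)

lemma (in field) inv_r' [simp]:
  "x \<in> carrier R \<Longrightarrow> x \<noteq> \<zero> \<Longrightarrow> y \<in> carrier R \<Longrightarrow> x \<otimes> (inv x \<otimes> y) = y"
  by (simp add: m_assoc[symmetric])

lemma (in field) inv_l' [simp]:
  "x \<in> carrier R \<Longrightarrow> x \<noteq> \<zero> \<Longrightarrow> y \<in> carrier R \<Longrightarrow> inv x \<otimes> (x \<otimes> y) = y"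
  by (simp add: m_assoc[symmetric])

lemma (in field) inv_nz [simp]: "x \<in> carrier R \<Longrightarrow> x \<noteq> \<zero> \<Longrightarrow> inv x \<noteq> \<zero>"
  by (metis inv_l l_null zero_not_one)

lemma (in field) pow_nz [simp]: "x \<in> carrier R \<Longrightarrow> x \<noteq> \<zero> \<Longrightarrow> x [^] (n::nat) \<noteq> \<zero>"
  by (induction n) (auto simp: integral_iff)

lemma (in field) inv_mult:
  "x \<in> carrier R \<Longrightarrow> x \<noteq> \<zero> \<Longrightarrow> y \<in> carrier R \<Longrightarrow> y \<noteq> \<zero> \<Longrightarrow> inv (x \<otimes> y) = inv x \<otimes> inv y"
  by (intro comm_inv_char) (auto simp: m_ac)

lemma (in field) pow_inv_cancel [simp]:
  "x \<in> carrier R \<Longrightarrow> x \<noteq> \<zero> \<Longrightarrow> x [^] (n::nat) \<otimes> inv x [^] n = \<one>"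
  by (induction n) (auto simp: m_ac)

lemma (in field) inv_pow_cancel [simp]:
  "x \<in> carrier R \<Longrightarrow> x \<noteq> \<zero> \<Longrightarrow> inv x [^] (n::nat) \<otimes> x [^] n = \<one>"
  by (metis inv_mem m_comm nat_pow_closed pow_inv_cancel)

lemma (in field) inv_pow_cancel' [simp]:
  "x \<in> carrier R \<Longrightarrow> x \<noteq> \<zero> \<Longrightarrow> y \<in> carrier R \<Longrightarrow> inv x [^] (n::nat) \<otimes> (x [^] n \<otimes> y) = y"
  by (simp add: m_assoc[symmetric])

lemma (in field) pow_inv_cancel' [simp]:
  "x \<in> carrier R \<Longrightarrow> x \<noteq> \<zero> \<Longrightarrow> y \<in> carrier R \<Longrightarrow> x [^] (n::nat) \<otimes> (inv x [^] n \<otimes> y) = y"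
  by (simp add: m_assoc[symmetric])

lemma (in field) inv_pow: "x \<in> carrier R \<Longrightarrow> x \<noteq> \<zero> \<Longrightarrow> inv (x [^] (n::nat)) = inv x [^] n"
  by (intro comm_inv_char) auto

text \<open>Once \<open>a_ac\<close> has sorted a sum, an element and its negative can be separated
  by one other summand. These rules cancel across that gap, so that \<open>ring_norm\<close> below
  can serve as a normaliser for ring identities.\<close>

lemma (in cring) add_cancel_simps:
  assumes "x \<in> carrier R" "y \<in> carrier R"
  shows "x \<oplus> (y \<oplus> \<ominus> x) = y" "\<ominus> x \<oplus> (y \<oplus> x) = y"
    and "z \<in> carrier R \<Longrightarrow> x \<oplus> (y \<oplus> (\<ominus> x \<oplus> z)) = y \<oplus> z"
    and "z \<in> carrier R \<Longrightarrow> \<ominus> x \<oplus> (y \<oplus> (x \<oplus> z)) = y \<oplus> z"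
    and "z \<in> carrier R \<Longrightarrow> x \<oplus> (y \<oplus> (z \<oplus> \<ominus> x)) = y \<oplus> z"
    and "z \<in> carrier R \<Longrightarrow> \<ominus> x \<oplus> (y \<oplus> (z \<oplus> x)) = y \<oplus> z"
  using assms by (simp_all add: a_lcomm[of x] a_lcomm[of "\<ominus> x"] r_neg l_neg r_neg1 r_neg2)

lemma (in field) mult_cancel_simps:
  assumes "x \<in> carrier R" "x \<noteq> \<zero>" "y \<in> carrier R"
  shows "x \<otimes> (y \<otimes> inv x) = y" "inv x \<otimes> (y \<otimes> x) = y"
    and "z \<in> carrier R \<Longrightarrow> x \<otimes> (y \<otimes> (inv x \<otimes> z)) = y \<otimes> z"
    and "z \<in> carrier R \<Longrightarrow> inv x \<otimes> (y \<otimes> (x \<otimes> z)) = y \<otimes> z"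
  using assms by (simp_all add: m_lcomm[of x] m_lcomm[of "inv x"])

lemmas (in cring) ring_norm = minus_eq l_distr r_distr l_minus r_minus minus_add m_ac a_ac
  l_neg r_neg r_neg1 r_neg2 add_cancel_simps

text \<open>Throughout, \<open>x \<in> \<pi>B\<close> is written as \<open>inv \<pi> \<otimes> x \<in> B\<close>.\<close>

locale dvr_field = field E for E (structure) +
  fixes L A :: "'a set" and \<pi> :: 'a
  assumes subfield_L: "subfield L E" and subring_A: "subring A E" and A_L: "A \<subseteq> L"
    and pi_A: "\<pi> \<in> A" and pi_nz [simp]: "\<pi> \<noteq> \<zero>" and inv_pi_notin: "inv \<pi> \<notin> A"
    and factor: "x \<in> A \<Longrightarrow> x \<noteq> \<zero> \<Longrightarrow> \<exists>(j::nat) u. u \<in> A \<and> inv u \<in> A \<and> x = \<pi> [^] j \<otimes> u"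
    and frac: "x \<in> L \<Longrightarrow> \<exists>j::nat. \<pi> [^] j \<otimes> x \<in> A"
begin

abbreviation \<omega> where "\<omega> \<equiv> inv \<pi>"

lemma L_carrier: "L \<subseteq> carrier E" using subfieldE(3)[OF subfield_L] .

lemma L_mem [simp]: "x \<in> L \<Longrightarrow> x \<in> carrier E" using L_carrier by blast

lemma A_mem_L [simp]: "x \<in> A \<Longrightarrow> x \<in> L" using A_L by blast

lemma A_mem: "x \<in> A \<Longrightarrow> x \<in> carrier E" by simp

lemma subring_L: "subring L E" using subfieldE(1)[OF subfield_L] .

lemma A_closed [simp]:
  "\<zero> \<in> A" "\<one> \<in> A" "x \<in> A \<Longrightarrow> y \<in> A \<Longrightarrow> x \<oplus> y \<in> A" "x \<in> A \<Longrightarrow> y \<in> A \<Longrightarrow> x \<otimes> y \<in> A"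
  "x \<in> A \<Longrightarrow> \<ominus> x \<in> A"
  using subringE[OF subring_A] by auto

lemma L_closed [simp]:
  "\<zero> \<in> L" "\<one> \<in> L" "x \<in> L \<Longrightarrow> y \<in> L \<Longrightarrow> x \<oplus> y \<in> L" "x \<in> L \<Longrightarrow> y \<in> L \<Longrightarrow> x \<otimes> y \<in> L"
  "x \<in> L \<Longrightarrow> \<ominus> x \<in> L"
  using subringE[OF subring_L] by auto

lemma A_minus [simp]: "x \<in> A \<Longrightarrow> y \<in> A \<Longrightarrow> x \<ominus> y \<in> A" by (simp add: minus_eq)
lemma L_minus [simp]: "x \<in> L \<Longrightarrow> y \<in> L \<Longrightarrow> x \<ominus> y \<in> L" by (simp add: minus_eq)

lemma A_pow [simp]: "x \<in> A \<Longrightarrow> x [^] (n::nat) \<in> A" by (induction n) auto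
lemma L_pow [simp]: "x \<in> L \<Longrightarrow> x [^] (n::nat) \<in> L" by (induction n) auto

lemma L_inv [simp]: "x \<in> L \<Longrightarrow> x \<noteq> \<zero> \<Longrightarrow> inv x \<in> L"
  using subfield_m_inv(1)[OF subfield_L] by auto

lemma pi_mem [simp]: "\<pi> \<in> carrier E" "\<pi> \<in> A" "\<pi> \<in> L" using pi_A by auto

lemma omega_L [simp]: "\<omega> \<in> L" by simp

lemma omega_mem [simp]: "\<omega> \<in> carrier E" by simp

lemma A_finsum: "(\<And>i. i \<in> I \<Longrightarrow> f i \<in> A) \<Longrightarrow> (\<Oplus>i\<in>I. f i) \<in> A"
  by (rule finsum_mem) auto

text \<open>A positive exponent in the factorisation x = \<pi>^j u would absorb
  \<open>\<omega>\<close> and put \<open>\<omega> \<otimes> x\<close> into \<open>A\<close>; so j =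
  0 and \<open>x\<close> is the unit u.\<close>

lemma unit_A: assumes "x \<in> A" "\<omega> \<otimes> x \<notin> A" shows "x \<noteq> \<zero>" "inv x \<in> A"
proof -
  show nz: "x \<noteq> \<zero>" using assms by auto
  obtain j :: nat and u where u: "u \<in> A" "inv u \<in> A" "x = \<pi> [^] j \<otimes> u"
    using factor assms(1) nz by blast
  have "j = 0"
  proof (cases j)
    case (Suc i)
    then have "\<omega> \<otimes> x = \<pi> [^] i \<otimes> u" using u by (simp add: m_ac mult_cancel_simps)
    then show ?thesis using u assms by auto
  qed simp
  then show "inv x \<in> A" using u by simp
qed

text \<open>An element with the least exponent of \<pi> divides all the others. This supplies pivots
  for elimination and shows that the ideal generated by \<open>S\<close> is principal.\<close>

lemma min_val:
  assumes "S \<subseteq> A" "s0 \<in> S" "s0 \<noteq> \<zero>"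
  obtains s where "s \<in> S" "s \<noteq> \<zero>" "\<And>x. x \<in> S \<Longrightarrow> x \<otimes> inv s \<in> A"
proof -
  define P where "P = (\<lambda>j::nat. \<exists>s\<in>S. s \<noteq> \<zero> \<and> (\<exists>u. u \<in> A \<and> inv u \<in> A \<and> s = \<pi> [^] j \<otimes> u))"
  have "\<exists>j. P j" using factor[of s0] assms unfolding P_def by blast
  then have Pj: "P (LEAST j. P j)" by (rule LeastI_ex)
  define j where "j = (LEAST j. P j)"
  obtain s u where s: "s \<in> S" "s \<noteq> \<zero>" "u \<in> A" "inv u \<in> A" "s = \<pi> [^] j \<otimes> u"
    using Pj unfolding P_def j_def by blast
  have unz: "u \<noteq> \<zero>" using s by auto
  have "x \<otimes> inv s \<in> A" if x: "x \<in> S" for x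
  proof (cases "x = \<zero>")
    case True then show ?thesis using s assms(1) by auto
  next
    case False
    then obtain i :: nat and v where v: "v \<in> A" "inv v \<in> A" "x = \<pi> [^] i \<otimes> v"
      using factor[of x] assms(1) x by blast
    then have "P i" using x False unfolding P_def by blast
    then have "j \<le> i" unfolding j_def by (rule Least_le)
    then obtain d where d: "i = j + d" using le_Suc_ex by blast
    have "inv s = \<omega> [^] j \<otimes> inv u" using s unz by (simp add: inv_mult inv_pow)
    then have "x \<otimes> inv s = \<pi> [^] d \<otimes> (v \<otimes> inv u)"
      using v s unz unfolding d by (simp add: nat_pow_mult[symmetric] m_ac)
    then show ?thesis using v s by simp
  qed
  then show ?thesis using that s by blast
qed

text \<open>After clearing a denominator, write \<pi>^j x = \<pi>^i u with a unit u. Since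
  \<open>x\<close> is not in \<open>A\<close>, i < j, so the inverse of \<open>x\<close> contains at
  least one factor \<pi>; the third conclusion records this factor.\<close>

lemma valuation_ring:
  assumes "x \<in> L" "x \<notin> A"
  shows "x \<noteq> \<zero>" "inv x \<in> A" "\<omega> \<otimes> inv x \<in> A"
proof -
  show nz: "x \<noteq> \<zero>" using assms by auto
  obtain j :: nat where j: "\<pi> [^] j \<otimes> x \<in> A" using frac assms by blast
  have "\<pi> [^] j \<otimes> x \<noteq> \<zero>" using nz assms by (simp add: integral_iff)
  then obtain i :: nat and u where u: "u \<in> A" "inv u \<in> A" "\<pi> [^] j \<otimes> x = \<pi> [^] i \<otimes> u"
    using factor j by blast
  have unz: "u \<noteq> \<zero>"
    using u assms nz by (metis L_mem integral_iff nat_pow_closed pi_mem(1) pi_nz pow_nz r_null)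
  have x: "x = \<omega> [^] j \<otimes> (\<pi> [^] i \<otimes> u)" using u(3) assms by (metis L_mem inv_pow_cancel' pi_mem(1) pi_nz)
  have "i < j"
  proof (rule ccontr)
    assume "\<not> i < j"
    then obtain d where "i = j + d" using le_Suc_ex not_less by metis
    then have "x = \<pi> [^] d \<otimes> u" using u unfolding x by (simp add: nat_pow_mult[symmetric] m_assoc)
    then show False using u assms by simp
  qed
  then obtain d where d: "j = Suc (i + d)" using less_imp_Suc_add by blast
  have "x = \<omega> [^] (Suc d) \<otimes> u"
    using u unfolding x d by (simp add: nat_pow_mult[symmetric] m_ac)
  then have "inv x = \<pi> [^] Suc d \<otimes> inv u"
    using u unz by (intro comm_inv_char) (auto simp: m_ac)
  then show "inv x \<in> A" "\<omega> \<otimes> inv x \<in> A" using u by (auto simp: m_ac)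
qed

text \<open>A nonzero \<open>x\<close> is a unit times some integral power of \<pi>, possibly
  negative, so one division too many would place \<open>\<omega>\<close> itself in
  \<open>A\<close>.\<close>

lemma separated:
  assumes "x \<in> L" "\<And>j::nat. \<omega> [^] j \<otimes> x \<in> A" shows "x = \<zero>"
proof (rule ccontr)
  assume nz: "x \<noteq> \<zero>"
  obtain k :: nat where k: "\<pi> [^] k \<otimes> x \<in> A" using frac assms by blast
  have "\<pi> [^] k \<otimes> x \<noteq> \<zero>" using nz assms by (simp add: integral_iff)
  then obtain i :: nat and u where u: "u \<in> A" "inv u \<in> A" "\<pi> [^] k \<otimes> x = \<pi> [^] i \<otimes> u"
    using factor k by blast
  have unz: "u \<noteq> \<zero>" using u \<open>\<pi> [^] k \<otimes> x \<noteq> \<zero>\<close> by auto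
  have "\<omega> [^] Suc i \<otimes> x \<in> A" using assms(2) by blast
  then have "(\<pi> [^] k \<otimes> (\<omega> [^] Suc i \<otimes> x)) \<otimes> inv u \<in> A" using u by simp
  also have "(\<pi> [^] k \<otimes> (\<omega> [^] Suc i \<otimes> x)) \<otimes> inv u = \<omega> [^] Suc i \<otimes> (\<pi> [^] k \<otimes> x) \<otimes> inv u"
    using assms by (simp add: m_ac)
  also have "\<dots> = \<omega>" using u unz unfolding u(3) by (simp add: m_ac mult_cancel_simps)
  finally show False using inv_pi_notin by simp
qed

lemma common_denominator:
  assumes "finite S" "S \<subseteq> L"
  obtains j :: nat where "\<And>s. s \<in> S \<Longrightarrow> \<pi> [^] j \<otimes> s \<in> A"
proof -
  have "\<exists>j::nat. \<forall>s\<in>S. \<pi> [^] j \<otimes> s \<in> A" using assms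
  proof (induction S)
    case (insert x S)
    then obtain j :: nat where j: "\<forall>s\<in>S. \<pi> [^] j \<otimes> s \<in> A" by auto
    obtain i :: nat where i: "\<pi> [^] i \<otimes> x \<in> A" using frac insert by blast
    have "\<pi> [^] (i + j) \<otimes> s \<in> A" if s: "s \<in> insert x S" for s
    proof (cases "s = x")
      case True
      have "\<pi> [^] (i + j) \<otimes> x = \<pi> [^] j \<otimes> (\<pi> [^] i \<otimes> x)"
        using insert by (simp add: nat_pow_mult[symmetric] m_ac)
      then show ?thesis using i True by simp
    next
      case False
      then have "s \<in> S" using s by simp
      then have "\<pi> [^] (i + j) \<otimes> s = \<pi> [^] i \<otimes> (\<pi> [^] j \<otimes> s)"
        using insert by (simp add: nat_pow_mult[symmetric] m_ac subset_iff)
      then show ?thesis using j \<open>s \<in> S\<close> by simp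
    qed
    then show ?case by blast
  qed simp
  then show ?thesis using that by blast
qed

section \<open>Submodules over A and their integral functionals\<close>

definition submod :: "'a set \<Rightarrow> bool" where
  "submod M \<longleftrightarrow> M \<subseteq> carrier E \<and> \<zero> \<in> M \<and> (\<forall>x\<in>M. \<forall>y\<in>M. x \<oplus> y \<in> M) \<and> (\<forall>a\<in>A. \<forall>x\<in>M. a \<otimes> x \<in> M)"

text \<open>Only the values on \<open>M\<close> are constrained; outside \<open>M\<close> the
  function is arbitrary. Restriction to a smaller submodule therefore keeps the same function, see
  \<open>lin_subset\<close>.\<close>

definition lin :: "'a set \<Rightarrow> ('a \<Rightarrow> 'a) \<Rightarrow> bool" where
  "lin M f \<longleftrightarrow> f \<in> M \<rightarrow> A \<and> (\<forall>x\<in>M. \<forall>y\<in>M. f (x \<oplus> y) = f x \<oplus> f y) \<and>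
     (\<forall>a\<in>A. \<forall>x\<in>M. f (a \<otimes> x) = a \<otimes> f x)"

lemma submodD:
  assumes "submod M"
  shows "x \<in> M \<Longrightarrow> x \<in> carrier E" "\<zero> \<in> M" "x \<in> M \<Longrightarrow> y \<in> M \<Longrightarrow> x \<oplus> y \<in> M"
    "a \<in> A \<Longrightarrow> x \<in> M \<Longrightarrow> a \<otimes> x \<in> M" "x \<in> M \<Longrightarrow> \<ominus> x \<in> M" "x \<in> M \<Longrightarrow> y \<in> M \<Longrightarrow> x \<ominus> y \<in> M"
proof -
  show 1: "x \<in> M \<Longrightarrow> x \<in> carrier E" "\<zero> \<in> M" "\<And>x y. x \<in> M \<Longrightarrow> y \<in> M \<Longrightarrow> x \<oplus> y \<in> M"
    "a \<in> A \<Longrightarrow> x \<in> M \<Longrightarrow> a \<otimes> x \<in> M" for x a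
    using assms by (auto simp: submod_def)
  show 2: "\<ominus> x \<in> M" if "x \<in> M" for x
  proof -
    have "\<ominus> \<one> \<otimes> x \<in> M" using 1(4) that by simp
    then show ?thesis using 1(1) that by (simp add: l_minus)
  qed
  show "x \<in> M \<Longrightarrow> y \<in> M \<Longrightarrow> x \<ominus> y \<in> M" using 1 2 by (simp add: minus_eq)
qed

lemma submod_finsum: "submod M \<Longrightarrow> (\<And>i. i \<in> I \<Longrightarrow> f i \<in> M) \<Longrightarrow> (\<Oplus>i\<in>I. f i) \<in> M"
  by (rule finsum_mem) (auto dest: submodD)

lemma linD:
  assumes "lin M f"
  shows "x \<in> M \<Longrightarrow> f x \<in> A" "x \<in> M \<Longrightarrow> y \<in> M \<Longrightarrow> f (x \<oplus> y) = f x \<oplus> f y"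
    "a \<in> A \<Longrightarrow> x \<in> M \<Longrightarrow> f (a \<otimes> x) = a \<otimes> f x"
  using assms by (auto simp: lin_def)

lemma lin_zero: assumes "lin M f" "submod M" shows "f \<zero> = \<zero>"
proof -
  have "f (\<zero> \<otimes> \<zero>) = \<zero> \<otimes> f \<zero>" using linD(3)[OF assms(1), of \<zero> \<zero>] submodD(2)[OF assms(2)] by simp
  then show ?thesis using linD(1)[OF assms(1)] submodD[OF assms(2)] by simp
qed

lemma lin_uminus: assumes "lin M f" "submod M" "x \<in> M" shows "f (\<ominus> x) = \<ominus> f x"
proof -
  have "f (\<ominus> \<one> \<otimes> x) = \<ominus> \<one> \<otimes> f x" using linD(3)[OF assms(1)] assms(3) by simp
  then show ?thesis using linD(1)[OF assms(1,3)] submodD(1)[OF assms(2,3)] by (simp add: l_minus)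
qed

lemma lin_minus:
  assumes "lin M f" "submod M" "x \<in> M" "y \<in> M" shows "f (x \<ominus> y) = f x \<ominus> f y"
  using assms by (simp add: minus_eq linD(2) submodD lin_uminus)

lemma lin_finsum:
  assumes "lin M f" "submod M" "finite I" "\<And>i. i \<in> I \<Longrightarrow> x i \<in> M"
  shows "f (\<Oplus>i\<in>I. x i) = (\<Oplus>i\<in>I. f (x i))"
  using assms(3,4)
proof (induction I)
  case empty then show ?case using lin_zero assms by simp
next
  case (insert i I)
  have "f (\<Oplus>i\<in>insert i I. x i) = f (x i \<oplus> (\<Oplus>i\<in>I. x i))"
    using insert submodD(1)[OF assms(2)] by (subst finsum_insert) auto
  also have "\<dots> = f (x i) \<oplus> (\<Oplus>i\<in>I. f (x i))"
    using insert submod_finsum[OF assms(2), of I x] linD(2)[OF assms(1), of "x i" "\<Oplus>i\<in>I. x i"] by simp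
  also have "\<dots> = (\<Oplus>i\<in>insert i I. f (x i))"
    using insert linD(1)[OF assms(1)] by (subst finsum_insert) auto
  finally show ?case .
qed

lemma lin_finsum_smult:
  assumes "lin M f" "submod M" "finite I" "\<And>i. i \<in> I \<Longrightarrow> x i \<in> M" "\<And>i. i \<in> I \<Longrightarrow> a i \<in> A"
  shows "f (\<Oplus>i\<in>I. a i \<otimes> x i) = (\<Oplus>i\<in>I. a i \<otimes> f (x i))"
proof -
  have "f (\<Oplus>i\<in>I. a i \<otimes> x i) = (\<Oplus>i\<in>I. f (a i \<otimes> x i))"
    using assms submodD(4)[OF assms(2)] by (intro lin_finsum) auto
  also have "\<dots> = (\<Oplus>i\<in>I. a i \<otimes> f (x i))"
    using assms by (intro finsum_cong') (auto simp: linD)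
  finally show ?thesis .
qed

lemma lin_omega:
  assumes "lin M f" "submod M" "x \<in> carrier E" "\<omega> \<otimes> x \<in> M" shows "f x = \<pi> \<otimes> f (\<omega> \<otimes> x)"
  using linD(3)[OF assms(1), of \<pi> "\<omega> \<otimes> x"] assms by simp

lemma lin_subset: "lin M f \<Longrightarrow> M' \<subseteq> M \<Longrightarrow> lin M' f"
  unfolding lin_def by blast

text \<open>The image of a functional is a principal ideal, hence its kernel is a direct summand.\<close>

lemma lin_extend_kernel:
  assumes "submod M" "lin M \<psi>" "lin {x \<in> M. \<psi> x = \<zero>} \<phi>"
  obtains \<phi>' where "lin M \<phi>'" "\<And>x. x \<in> M \<Longrightarrow> \<psi> x = \<zero> \<Longrightarrow> \<phi>' x = \<phi> x"
proof (cases "\<forall>x\<in>M. \<psi> x = \<zero>")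
  case True
  then have "{x \<in> M. \<psi> x = \<zero>} = M" by auto
  then show ?thesis using that assms(3) by metis
next
  case False
  then obtain x0 where x0: "x0 \<in> M" "\<psi> x0 \<noteq> \<zero>" by auto
  have "\<psi> ` M \<subseteq> A" using linD(1)[OF assms(2)] by auto
  then obtain s where s: "s \<in> \<psi> ` M" "s \<noteq> \<zero>" "\<And>x. x \<in> \<psi> ` M \<Longrightarrow> x \<otimes> inv s \<in> A"
    using x0 min_val[of "\<psi> ` M" "\<psi> x0"] by blast
  then obtain y where y: "y \<in> M" "s = \<psi> y" by auto
  have sA: "s \<in> A" using y linD(1)[OF assms(2)] by auto
  define c where "c x = \<psi> x \<otimes> inv s" for x
  have c: "c x \<in> A" if "x \<in> M" for x using s that unfolding c_def by auto
  \<comment> \<open>The value \<open>s = \<psi> y\<close> generates the image of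
    \<open>\<psi>\<close>, so \<open>pr\<close> is the projection onto the kernel along
    \<open>y\<close>; composing \<open>\<phi>\<close> with it extends \<open>\<phi>\<close>.\<close>
  define pr where "pr x = x \<ominus> c x \<otimes> y" for x
  have pr: "pr x \<in> M" "\<psi> (pr x) = \<zero>" if x: "x \<in> M" for x
  proof -
    have cyM: "c x \<otimes> y \<in> M" using submodD(4)[OF assms(1) c[OF x] y(1)] .
    show "pr x \<in> M" unfolding pr_def using submodD(6)[OF assms(1) x cyM] .
    have "\<psi> (pr x) = \<psi> x \<ominus> \<psi> (c x \<otimes> y)"
      unfolding pr_def using lin_minus[OF assms(2,1) x cyM] .
    also have "\<psi> (c x \<otimes> y) = c x \<otimes> s" using linD(3)[OF assms(2)] c x y by simp
    also have "c x \<otimes> s = \<psi> x" unfolding c_def using sA s(2) linD(1)[OF assms(2) x] by (simp add: m_assoc)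
    finally show "\<psi> (pr x) = \<zero>" using linD(1)[OF assms(2) x] by (simp add: r_neg minus_eq)
  qed
  have prK: "pr x \<in> {x \<in> M. \<psi> x = \<zero>}" if "x \<in> M" for x using pr that by blast
  have cy: "c (u \<oplus> v) = c u \<oplus> c v" if "u \<in> M" "v \<in> M" for u v
    using that sA s(2) linD[OF assms(2)] unfolding c_def by (simp add: l_distr)
  have cm: "c (a \<otimes> u) = a \<otimes> c u" if "a \<in> A" "u \<in> M" for a u
    using that sA s(2) linD[OF assms(2)] unfolding c_def by (simp add: m_assoc)
  have pra: "pr (u \<oplus> v) = pr u \<oplus> pr v" if "u \<in> M" "v \<in> M" for u v
    unfolding pr_def cy[OF that] using that c[OF that(1)] c[OF that(2)] y submodD(1)[OF assms(1)]
    by (simp add: minus_eq l_distr minus_add a_ac)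
  have prm: "pr (a \<otimes> u) = a \<otimes> pr u" if "a \<in> A" "u \<in> M" for a u
    unfolding pr_def cm[OF that] using that c[OF that(2)] y submodD(1)[OF assms(1)]
    by (simp add: minus_eq r_distr r_minus m_assoc)
  have "lin M (\<lambda>x. \<phi> (pr x))"
    unfolding lin_def using linD[OF assms(3)] prK pra prm by (simp add: Pi_iff)
  moreover have "\<phi> (pr x) = \<phi> x" if x: "x \<in> M" "\<psi> x = \<zero>" for x
  proof -
    have "c x = \<zero>" unfolding c_def using x sA s(2) by simp
    then have "pr x = x" unfolding pr_def using x y submodD(1)[OF assms(1)] by (simp add: minus_eq)
    then show ?thesis by simp
  qed
  ultimately show ?thesis using that by blast
qed

lemma submod_kernel:
  assumes "submod M" "lin M \<psi>" shows "submod {x \<in> M. \<psi> x = \<zero>}"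
  using submodD[OF assms(1)] linD[OF assms(2)] lin_zero[OF assms(2,1)]
  unfolding submod_def by auto

text \<open>Induction on the number of functionals: extend from the joint kernel to the kernel of
  one functional, then to \<open>M\<close> by \<open>lin_extend_kernel\<close>. Functionals thus
  extend from saturated submodules without the choice of a basis.\<close>

lemma lin_extend:
  assumes "finite I" "submod M" "\<And>i. i \<in> I \<Longrightarrow> lin M (\<psi> i)"
    and "lin {x \<in> M. \<forall>i\<in>I. \<psi> i x = \<zero>} \<phi>"
  shows "\<exists>\<phi>'. lin M \<phi>' \<and> (\<forall>x\<in>M. (\<forall>i\<in>I. \<psi> i x = \<zero>) \<longrightarrow> \<phi>' x = \<phi> x)"
  using assms
proof (induction I arbitrary: M)
  case empty
  then show ?case by auto
next
  case (insert i I)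
  let ?M = "{x \<in> M. \<psi> i x = \<zero>}"
  have "lin {x \<in> ?M. \<forall>i\<in>I. \<psi> i x = \<zero>} \<phi>"
    using insert.prems(3) by (rule lin_subset) auto
  moreover have "submod ?M" using insert.prems by (intro submod_kernel) auto
  moreover have "lin ?M (\<psi> j)" if "j \<in> I" for j
    using that by (intro lin_subset[OF insert.prems(2)]) auto
  ultimately obtain \<phi>1 where p1: "lin ?M \<phi>1" "\<forall>x\<in>?M. (\<forall>i\<in>I. \<psi> i x = \<zero>) \<longrightarrow> \<phi>1 x = \<phi> x"
    using insert.IH[of ?M] by blast
  obtain \<phi>2 where "lin M \<phi>2" "\<And>x. x \<in> M \<Longrightarrow> \<psi> i x = \<zero> \<Longrightarrow> \<phi>2 x = \<phi>1 x"
    using lin_extend_kernel[OF insert.prems(1) insert.prems(2)[of i] p1(1)] by blast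
  then show ?case using p1(2) by (intro exI[of _ \<phi>2]) auto
qed

text \<open>Noetherianity of lattices.\<close>

lemma noetherian_sequence:
  fixes t :: "nat \<Rightarrow> 'a \<Rightarrow> 'a" and w :: "nat \<Rightarrow> 'a"
  assumes F: "submod F" and fA: "\<And>k x y. k < R \<Longrightarrow> x \<in> F \<Longrightarrow> y \<in> F \<Longrightarrow> t k (x \<ominus> y) = t k x \<ominus> t k y"
    and fm: "\<And>k a x. k < R \<Longrightarrow> a \<in> A \<Longrightarrow> x \<in> F \<Longrightarrow> t k (a \<otimes> x) = a \<otimes> t k x"
    and ft: "\<And>x. x \<in> F \<Longrightarrow> (\<And>k. k < R \<Longrightarrow> t k x = \<zero>) \<Longrightarrow> x = \<zero>"
    and "r \<le> R" "\<And>i. w i \<in> F" "\<And>i k. k < R \<Longrightarrow> t k (w i) \<in> A"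
    and "\<And>i k. r \<le> k \<Longrightarrow> k < R \<Longrightarrow> t k (w i) = \<zero>"
  shows "\<exists>i. \<forall>M. submod M \<and> (\<forall>j<i. w j \<in> M) \<longrightarrow> w i \<in> M"
  using assms(5-)
proof (induction r arbitrary: w)
  case 0
  then have "w 0 = \<zero>" using ft by auto
  then show ?case using submodD(2) by (intro exI[of _ 0]) auto
next
  case (Suc r)
  show ?case
  proof (cases "\<forall>i. t r (w i) = \<zero>")
    case True
    have "t k (w i) = \<zero>" if "r \<le> k" "k < R" for i k
      using True Suc.prems(4)[of k i] that by (cases "k = r") auto
    then show ?thesis using Suc.IH[of w] Suc.prems by simp
  next
    case False
    then obtain i1 where i1: "t r (w i1) \<noteq> \<zero>" by blast
    have "range (\<lambda>i. t r (w i)) \<subseteq> A" using Suc.prems by auto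
    then obtain s where s: "s \<in> range (\<lambda>i. t r (w i))" "s \<noteq> \<zero>"
      "\<And>x. x \<in> range (\<lambda>i. t r (w i)) \<Longrightarrow> x \<otimes> inv s \<in> A"
      using i1 min_val[of "range (\<lambda>i. t r (w i))" "t r (w i1)"] by blast
    then obtain i0 where i0: "s = t r (w i0)" by auto
    have sA: "s \<in> A" using Suc.prems i0 by auto
    \<comment> \<open>The pivot \<open>w i0\<close> has the least valuation at coordinate
      \<open>r\<close> among all terms. Subtracting its multiples from the later terms clears
      coordinate \<open>r\<close> and lowers the number of live coordinates from
      \<open>Suc r\<close> to \<open>r\<close>.\<close>
    define a where "a i = t r (w (Suc i0 + i)) \<otimes> inv s" for i
    have a: "a i \<in> A" for i using s unfolding a_def by auto
    define v where "v i = w (Suc i0 + i) \<ominus> a i \<otimes> w i0" for i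
    have vF: "v i \<in> F" for i unfolding v_def by (intro submodD(6)[OF F] submodD(4)[OF F] Suc.prems(2) a)
    have tv: "t k (v i) = t k (w (Suc i0 + i)) \<ominus> a i \<otimes> t k (w i0)" if "k < R" for k i
      unfolding v_def using fA[OF that] fm[OF that] Suc.prems(2) a submodD(4)[OF F] by simp
    have "\<exists>i. \<forall>M. submod M \<and> (\<forall>j<i. v j \<in> M) \<longrightarrow> v i \<in> M"
    proof (rule Suc.IH)
      show "t k (v i) \<in> A" if "k < R" for i k using tv[OF that] Suc.prems(3)[OF that] a by simp
      show "t k (v i) = \<zero>" if k: "r \<le> k" "k < R" for i k
      proof (cases "k = r")
        case True
        have "t r (w (Suc i0 + i)) \<in> A" using Suc.prems by auto
        then show ?thesis unfolding True using tv[OF k(2), of i] sA s(2) unfolding True i0[symmetric] a_def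
          by (simp add: m_assoc minus_eq r_neg)
      next
        case False
        then show ?thesis using tv[OF k(2), of i] Suc.prems(4)[of k] k a[of i] by (simp add: minus_eq)
      qed
    qed (use Suc.prems vF in auto)
    then obtain i where i: "\<And>M. submod M \<Longrightarrow> (\<forall>j<i. v j \<in> M) \<Longrightarrow> v i \<in> M" by blast
    have "w (Suc i0 + i) \<in> M" if M: "submod M" "\<forall>j<Suc i0 + i. w j \<in> M" for M
    proof -
      \<comment> \<open>The vector \<open>v j\<close> combines \<open>w (Suc i0 + j)\<close> with
        \<open>w i0\<close>, and both precede \<open>w (Suc i0 + i)\<close>; so the dependence found
        for \<open>v\<close> pulls back to \<open>w\<close>.\<close>
      have "v j \<in> M" if "j < i" for j
        unfolding v_def using M(2) that a submodD[OF M(1)] by simp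
      then have "v i \<in> M" using i M by blast
      then have "v i \<oplus> a i \<otimes> w i0 \<in> M" using M a submodD[OF M(1)] by simp
      moreover have "v i \<oplus> a i \<otimes> w i0 = w (Suc i0 + i)"
        unfolding v_def using Suc.prems(2) submodD(1)[OF F] a by (simp add: minus_eq a_assoc l_neg)
      ultimately show ?thesis by simp
    qed
    then show ?thesis by blast
  qed
qed

text \<open>Gaussian elimination over the valuation ring.\<close>

lemma unit_vector_multiple:
  fixes S :: "('g \<Rightarrow> 'a) set"
  assumes "finite J" "i \<notin> J" "\<And>s j. s \<in> S \<Longrightarrow> j \<in> insert i J \<Longrightarrow> s j \<in> A"
    and "\<And>s s' a a'. s \<in> S \<Longrightarrow> s' \<in> S \<Longrightarrow> a \<in> A \<Longrightarrow> a' \<in> A \<Longrightarrow> \<exists>s''\<in>S. \<forall>j\<in>insert i J. s'' j = a \<otimes> s j \<oplus> a' \<otimes> s' j"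
    and "\<And>c. (\<And>j. j \<in> insert i J \<Longrightarrow> c j \<in> A) \<Longrightarrow> (\<And>s. s \<in> S \<Longrightarrow> (\<Oplus>j\<in>insert i J. c j \<otimes> s j) = \<zero>) \<Longrightarrow>
            (\<forall>j\<in>insert i J. c j = \<zero>)"
  shows "\<exists>s\<in>S. s i \<noteq> \<zero> \<and> (\<forall>j\<in>J. s j = \<zero>)"
  using assms
proof (induction J arbitrary: S)
  case empty
  show ?case
  proof (rule ccontr)
    assume "\<not> ?thesis"
    then have "\<forall>j\<in>insert i {}. \<one> = \<zero>"
      using empty by (intro empty.prems(4)) auto
    then show False by simp
  qed
next
  case (insert j J)
  let ?J = "insert i (insert j J)"
  have fin: "finite ?J" using insert by simp
  have "\<exists>s0\<in>S. s0 j \<noteq> \<zero>"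
  proof (rule ccontr)
    assume "\<not> ?thesis"
    then have z: "s j = \<zero>" if "s \<in> S" for s using that by blast
    have "\<forall>k\<in>?J. (if k = j then \<one> else \<zero>) = \<zero>"
    proof (rule insert.prems(4))
      show "(\<Oplus>k\<in>?J. (if k = j then \<one> else \<zero>) \<otimes> s k) = \<zero>" if s: "s \<in> S" for s
      proof -
        have "(\<Oplus>k\<in>?J. (if k = j then \<one> else \<zero>) \<otimes> s k) = (\<Oplus>k\<in>?J. \<zero>)"
          using z[OF s] insert.prems(2)[OF s] by (intro finsum_cong') auto
        then show ?thesis by (simp add: finsum_zero)
      qed
    qed auto
    then show False by auto
  qed
  then obtain s0 where s0: "s0 \<in> S" "s0 j \<noteq> \<zero>" by blast
  have s0A: "s0 k \<in> A" if "k \<in> ?J" for k using insert.prems(2)[OF s0(1)] that by blast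
  \<comment> \<open>With the pivot \<open>s0\<close> at hand, it suffices to solve the smaller
    problem among the vectors vanishing at \<open>j\<close>.\<close>
  define S' where "S' = {s \<in> S. s j = \<zero>}"
  have iJ: "i \<noteq> j" "i \<notin> J" using insert by auto
  have "\<exists>s\<in>S'. s i \<noteq> \<zero> \<and> (\<forall>j\<in>J. s j = \<zero>)"
  proof (rule insert.IH)
    show "i \<notin> J" using iJ by simp
    show "s k \<in> A" if "s \<in> S'" "k \<in> insert i J" for s k
      using insert.prems(2)[of s k] that unfolding S'_def by auto
    show "\<exists>s''\<in>S'. \<forall>k\<in>insert i J. s'' k = a \<otimes> s k \<oplus> a' \<otimes> s' k"
      if "s \<in> S'" "s' \<in> S'" "a \<in> A" "a' \<in> A" for s s' a a'
    proof -
      obtain s'' where s'': "s'' \<in> S" "\<forall>k\<in>?J. s'' k = a \<otimes> s k \<oplus> a' \<otimes> s' k"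
        using insert.prems(3)[of s s' a a'] \<open>s \<in> S'\<close> \<open>s' \<in> S'\<close> \<open>a \<in> A\<close> \<open>a' \<in> A\<close>
        unfolding S'_def by (metis (mono_tags, lifting) mem_Collect_eq)
      then have "s'' j = \<zero>" using that unfolding S'_def by simp
      then show ?thesis using s'' unfolding S'_def by blast
    qed
    fix c assume c: "\<And>k. k \<in> insert i J \<Longrightarrow> c k \<in> A"
      and c0: "\<And>s. s \<in> S' \<Longrightarrow> (\<Oplus>k\<in>insert i J. c k \<otimes> s k) = \<zero>"
    \<comment> \<open>A relation \<open>c\<close> on \<open>S'\<close> becomes a relation on all of
      \<open>S\<close> after scaling by the pivot entry \<open>s0 j\<close>; the coefficient at
      \<open>j\<close> is chosen so that \<open>s0\<close> itself satisfies it.\<close>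
    define c' where "c' k = (if k = j then \<ominus> (\<Oplus>k\<in>insert i J. c k \<otimes> s0 k) else s0 j \<otimes> c k)" for k
    have sumA: "(\<Oplus>k\<in>insert i J. c k \<otimes> s0 k) \<in> A" using c s0A by (intro A_finsum) auto
    have c'A: "c' k \<in> A" if "k \<in> ?J" for k
      using that sumA c s0A unfolding c'_def by auto
    have "\<forall>k\<in>?J. c' k = \<zero>"
    proof (rule insert.prems(4)[OF c'A])
      fix s assume s: "s \<in> S"
      have sA: "s k \<in> A" if "k \<in> ?J" for k using insert.prems(2)[OF s] that by blast
      obtain s'' where s'': "s'' \<in> S" "\<forall>k\<in>?J. s'' k = s0 j \<otimes> s k \<oplus> (\<ominus> s j) \<otimes> s0 k"
        using insert.prems(3)[of s s0 "s0 j" "\<ominus> s j"] s s0 s0A sA by auto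
      have "s'' j = \<zero>" using s''(2) s0A[of j] sA[of j] by (simp add: ring_norm)
      then have s''S: "s'' \<in> S'" using s'' unfolding S'_def by blast
      have ins: "?J = insert j (insert i J)" by blast
      have "(\<Oplus>k\<in>?J. c' k \<otimes> s k) = c' j \<otimes> s j \<oplus> (\<Oplus>k\<in>insert i J. c' k \<otimes> s k)"
        unfolding ins using insert.hyps iJ c'A sA by (intro finsum_insert) auto
      also have "(\<Oplus>k\<in>insert i J. c' k \<otimes> s k) = (\<Oplus>k\<in>insert i J. c k \<otimes> s'' k \<oplus> s j \<otimes> (c k \<otimes> s0 k))"
      proof (intro finsum_cong')
        fix k assume k: "k \<in> insert i J"
        then have "k \<noteq> j" using iJ insert.hyps by auto
        moreover have "s'' k = s0 j \<otimes> s k \<oplus> \<ominus> s j \<otimes> s0 k" using s''(2) k by blast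
        ultimately show "c' k \<otimes> s k = c k \<otimes> s'' k \<oplus> s j \<otimes> (c k \<otimes> s0 k)"
          using k c[OF k] sA[of k] s0A[of k] s0A[of j] sA[of j] unfolding c'_def
          by (simp add: ring_norm)
      qed (use c sA s0A s''(2) in auto)
      also have "\<dots> = (\<Oplus>k\<in>insert i J. c k \<otimes> s'' k) \<oplus> (\<Oplus>k\<in>insert i J. s j \<otimes> (c k \<otimes> s0 k))"
        using c sA s0A s''(2) by (intro finsum_addf) auto
      also have "(\<Oplus>k\<in>insert i J. s j \<otimes> (c k \<otimes> s0 k)) = s j \<otimes> (\<Oplus>k\<in>insert i J. c k \<otimes> s0 k)"
        using c sA s0A insert.hyps by (intro finsum_rdistr[symmetric]) auto
      finally show "(\<Oplus>k\<in>?J. c' k \<otimes> s k) = \<zero>"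
        using c0[OF s''S] sumA sA[of j] unfolding c'_def by (simp add: ring_norm)
    qed
    then have "s0 j \<otimes> c k = \<zero>" if "k \<in> insert i J" for k
      using that iJ insert.hyps unfolding c'_def by (auto split: if_splits)
    then show "\<forall>k\<in>insert i J. c k = \<zero>" using s0 s0A c by (auto simp: integral_iff)
  qed
  then show ?case unfolding S'_def by auto
qed

end

section \<open>Trace coordinates and integrality\<close>

text \<open>A finite abelian Galois extension \<open>F\<close> of \<open>L\<close>, with an abstract
  group acting through \<open>act\<close>. The group elements are not taken to be functions, because
  the group will be a quotient of the Galois group, whose elements are cosets.\<close>

locale galois_level = dvr_field E L A \<pi> for E (structure) and L A \<pi> +
  fixes G :: "('g, 'n) monoid_scheme" and F :: "'a set" and act :: "'g \<Rightarrow> 'a \<Rightarrow> 'a"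
  assumes comm_G: "comm_group G" and fin_G [simp]: "finite (carrier G)"
    and subfield_F: "subfield F E" and L_F: "L \<subseteq> F"
    and act_closed [simp]: "g \<in> carrier G \<Longrightarrow> x \<in> F \<Longrightarrow> act g x \<in> F"
    and act_add: "g \<in> carrier G \<Longrightarrow> x \<in> F \<Longrightarrow> y \<in> F \<Longrightarrow> act g (x \<oplus> y) = act g x \<oplus> act g y"
    and act_mult: "g \<in> carrier G \<Longrightarrow> x \<in> F \<Longrightarrow> y \<in> F \<Longrightarrow> act g (x \<otimes> y) = act g x \<otimes> act g y"
    and act_comp: "g \<in> carrier G \<Longrightarrow> h \<in> carrier G \<Longrightarrow> x \<in> F \<Longrightarrow> act (g \<otimes>\<^bsub>G\<^esub> h) x = act g (act h x)"
    and act_id [simp]: "x \<in> F \<Longrightarrow> act \<one>\<^bsub>G\<^esub> x = x"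
    and act_L [simp]: "g \<in> carrier G \<Longrightarrow> x \<in> L \<Longrightarrow> act g x = x"
    and act_fixed: "x \<in> F \<Longrightarrow> (\<And>g. g \<in> carrier G \<Longrightarrow> act g x = x) \<Longrightarrow> x \<in> L"
    and faithful: "g \<in> carrier G \<Longrightarrow> g \<noteq> \<one>\<^bsub>G\<^esub> \<Longrightarrow> \<exists>x\<in>F. act g x \<noteq> x"
begin

sublocale GG: comm_group G by (rule comm_G)

declare L_mem [simp del]

lemma F_carrier: "F \<subseteq> carrier E" using subfieldE(3)[OF subfield_F] .

lemma F_mem [simp]: "x \<in> F \<Longrightarrow> x \<in> carrier E" using F_carrier by blast

lemma L_mem_F [simp]: "x \<in> L \<Longrightarrow> x \<in> F" using L_F by blast

lemma F_closed [simp]: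
  "\<zero> \<in> F" "\<one> \<in> F" "x \<in> F \<Longrightarrow> y \<in> F \<Longrightarrow> x \<oplus> y \<in> F" "x \<in> F \<Longrightarrow> y \<in> F \<Longrightarrow> x \<otimes> y \<in> F"
  "x \<in> F \<Longrightarrow> \<ominus> x \<in> F"
  using subringE[OF subfieldE(1)[OF subfield_F]] by auto

lemma F_minus [simp]: "x \<in> F \<Longrightarrow> y \<in> F \<Longrightarrow> x \<ominus> y \<in> F" by (simp add: minus_eq)

lemma F_pow [simp]: "x \<in> F \<Longrightarrow> x [^] (n::nat) \<in> F" by (induction n) auto

lemma F_inv [simp]: "x \<in> F \<Longrightarrow> x \<noteq> \<zero> \<Longrightarrow> inv x \<in> F"
  using subfield_m_inv(1)[OF subfield_F] by auto

lemma F_finsum: "(\<And>i. i \<in> I \<Longrightarrow> f i \<in> F) \<Longrightarrow> (\<Oplus>i\<in>I. f i) \<in> F"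
  by (rule finsum_mem) auto

lemma act_uminus: assumes "g \<in> carrier G" "x \<in> F" shows "act g (\<ominus> x) = \<ominus> act g x"
proof -
  have "act g (\<ominus> \<one> \<otimes> x) = \<ominus> \<one> \<otimes> act g x" using assms by (subst act_mult) auto
  then show ?thesis using assms by (simp add: l_minus)
qed

lemma act_minus: "g \<in> carrier G \<Longrightarrow> x \<in> F \<Longrightarrow> y \<in> F \<Longrightarrow> act g (x \<ominus> y) = act g x \<ominus> act g y"
  by (simp add: minus_eq act_add act_uminus)

lemma act_finsum:
  assumes "g \<in> carrier G" "finite I" "\<And>i. i \<in> I \<Longrightarrow> f i \<in> F"
  shows "act g (\<Oplus>i\<in>I. f i) = (\<Oplus>i\<in>I. act g (f i))"
  using assms(2,3)
proof (induction I)
  case (insert i I)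
  have "act g (\<Oplus>i\<in>insert i I. f i) = act g (f i \<oplus> (\<Oplus>i\<in>I. f i))"
    using insert by (subst finsum_insert) auto
  also have "\<dots> = act g (f i) \<oplus> (\<Oplus>i\<in>I. act g (f i))"
    using insert F_finsum[of I f] assms(1) by (simp add: act_add)
  also have "\<dots> = (\<Oplus>i\<in>insert i I. act g (f i))"
    using insert assms(1) by (subst finsum_insert) auto
  finally show ?case .
qed (use assms(1) in simp)

lemma act_pow: "g \<in> carrier G \<Longrightarrow> x \<in> F \<Longrightarrow> act g (x [^] (n::nat)) = act g x [^] n"
  by (induction n) (auto simp: act_mult)

lemma act_inv_cancel [simp]:
  assumes "g \<in> carrier G" "x \<in> F"
  shows "act g (act (inv\<^bsub>G\<^esub> g) x) = x" "act (inv\<^bsub>G\<^esub> g) (act g x) = x"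
  using assms by (simp_all flip: act_comp)

lemma bij_mult: "h \<in> carrier G \<Longrightarrow> bij_betw (\<lambda>g. h \<otimes>\<^bsub>G\<^esub> g) (carrier G) (carrier G)"
  by (rule bij_betw_byWitness[of _ "\<lambda>g. inv\<^bsub>G\<^esub> h \<otimes>\<^bsub>G\<^esub> g"]) (auto simp: GG.m_assoc[symmetric])

lemma finsum_bij:
  assumes "bij_betw p (carrier G) (carrier G)" "\<And>g. g \<in> carrier G \<Longrightarrow> f g \<in> carrier E"
  shows "(\<Oplus>g\<in>carrier G. f (p g)) = (\<Oplus>g\<in>carrier G. f g)"
proof -
  have "(\<Oplus>g\<in>carrier G. f g) = (\<Oplus>g\<in>p ` carrier G. f g)"
    using assms(1) by (simp add: bij_betw_def)
  also have "\<dots> = (\<Oplus>g\<in>carrier G. f (p g))"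
    using assms by (intro finsum_reindex) (auto simp: bij_betw_def)
  finally show ?thesis by simp
qed

lemma finsum_shift:
  assumes "h \<in> carrier G" "\<And>g. g \<in> carrier G \<Longrightarrow> f g \<in> carrier E"
  shows "(\<Oplus>g\<in>carrier G. f (h \<otimes>\<^bsub>G\<^esub> g)) = (\<Oplus>g\<in>carrier G. f g)"
  by (rule finsum_bij[OF bij_mult[OF assms(1)] assms(2)])

definition tr where "tr z = (\<Oplus>g\<in>carrier G. act g z)"

lemma tr_F: "z \<in> F \<Longrightarrow> tr z \<in> F" unfolding tr_def by (rule F_finsum) auto

lemma tr_act: assumes "h \<in> carrier G" "z \<in> F" shows "tr (act h z) = tr z"
proof -
  have "tr (act h z) = (\<Oplus>g\<in>carrier G. act (h \<otimes>\<^bsub>G\<^esub> g) z)"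
    unfolding tr_def using assms by (intro finsum_cong') (auto simp: GG.m_comm[of h] act_comp)
  also have "\<dots> = tr z" unfolding tr_def using assms by (intro finsum_shift) auto
  finally show ?thesis .
qed

lemma tr_L [simp]: assumes "z \<in> F" shows "tr z \<in> L"
proof (rule act_fixed)
  fix h assume h: "h \<in> carrier G"
  have "act h (tr z) = (\<Oplus>g\<in>carrier G. act h (act g z))"
    unfolding tr_def using assms h by (intro act_finsum) auto
  also have "\<dots> = (\<Oplus>g\<in>carrier G. act (h \<otimes>\<^bsub>G\<^esub> g) z)"
    using assms h by (intro finsum_cong') (auto simp: act_comp)
  also have "\<dots> = tr z" unfolding tr_def using assms h by (intro finsum_shift) auto
  finally show "act h (tr z) = tr z" .
qed (use assms tr_F in auto)

lemma tr_add: assumes "x \<in> F" "y \<in> F" shows "tr (x \<oplus> y) = tr x \<oplus> tr y"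
proof -
  have "tr (x \<oplus> y) = (\<Oplus>g\<in>carrier G. act g x \<oplus> act g y)"
    unfolding tr_def using assms by (intro finsum_cong') (auto simp: act_add)
  then show ?thesis unfolding tr_def using assms by (simp add: finsum_addf)
qed

lemma tr_smult: "l \<in> L \<Longrightarrow> x \<in> F \<Longrightarrow> tr (l \<otimes> x) = l \<otimes> tr x"
  unfolding tr_def by (subst finsum_rdistr) (auto simp: act_mult intro!: finsum_cong')

text \<open>Sums \<open>\<Sum> a\<^sub>k \<otimes> y\<^sub>k\<close> in \<open>F \<otimes> F\<close>, viewed as functions on the group.  They are closed under products, so
  an element vanishing off the identity is a product of factors each killing one group element.\<close>

inductive_set tensors :: "('g \<Rightarrow> 'a) set" where
  zero: "(\<lambda>g. \<zero>) \<in> tensors"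
| add: "f \<in> tensors \<Longrightarrow> a \<in> F \<Longrightarrow> y \<in> F \<Longrightarrow> (\<lambda>g. f g \<oplus> a \<otimes> act g y) \<in> tensors"

lemma tensors_closed: "f \<in> tensors \<Longrightarrow> g \<in> carrier G \<Longrightarrow> f g \<in> F"
  by (induction rule: tensors.induct) auto

text \<open>The factor \<open>\<alpha> \<otimes> act g z \<oplus> \<beta>\<close> is a tensor of two
  terms, and multiplicativity of \<open>act g\<close> merges each of them with each term of
  \<open>f\<close>.\<close>

lemma tensors_mult:
  assumes "f \<in> tensors" "\<alpha> \<in> F" "\<beta> \<in> F" "z \<in> F"
  shows "\<exists>f'\<in>tensors. \<forall>g\<in>carrier G. f' g = f g \<otimes> (\<alpha> \<otimes> act g z \<oplus> \<beta>)"
  using assms(1)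
proof induction
  case zero
  then show ?case using assms by (intro bexI[OF _ tensors.zero]) auto
next
  case (add f a y)
  then obtain f' where f': "f' \<in> tensors" "\<forall>g\<in>carrier G. f' g = f g \<otimes> (\<alpha> \<otimes> act g z \<oplus> \<beta>)" by blast
  let ?f = "\<lambda>g. (f' g \<oplus> (a \<otimes> \<alpha>) \<otimes> act g (y \<otimes> z)) \<oplus> (a \<otimes> \<beta>) \<otimes> act g y"
  have "?f \<in> tensors" using f'(1) add assms by (intro tensors.add) auto
  moreover have "?f g = (f g \<oplus> a \<otimes> act g y) \<otimes> (\<alpha> \<otimes> act g z \<oplus> \<beta>)" if g: "g \<in> carrier G" for g
    using f'(2) g add assms tensors_closed[OF add(1) g] by (simp add: act_mult ring_norm)
  ultimately show ?case by (intro bexI[of _ ?f]) auto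
qed

lemma tensors_delta:
  assumes "finite T" "T \<subseteq> carrier G" "\<one>\<^bsub>G\<^esub> \<notin> T"
  shows "\<exists>f\<in>tensors. f \<one>\<^bsub>G\<^esub> = \<one> \<and> (\<forall>g\<in>T. f g = \<zero>)"
  using assms
proof (induction T)
  case empty
  have "(\<lambda>g. \<zero> \<oplus> \<one> \<otimes> act g \<one>) \<in> tensors" by (intro tensors.intros) auto
  then show ?case by (rule bexI[rotated]) auto
next
  case (insert h T)
  then obtain f where f: "f \<in> tensors" "f \<one>\<^bsub>G\<^esub> = \<one>" "\<forall>g\<in>T. f g = \<zero>" by auto
  have h: "h \<in> carrier G" "h \<noteq> \<one>\<^bsub>G\<^esub>" using insert by auto
  then obtain x where x: "x \<in> F" "act h x \<noteq> x" using faithful by blast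
  have hx: "act h x \<in> F" using x h by simp
  \<comment> \<open>The new factor (g(x) - h(x)) / d equals 1 at the identity and 0 at g =
    h.\<close>
  define d where "d = x \<ominus> act h x"
  have d: "d \<in> F" "d \<noteq> \<zero>" using x hx unfolding d_def by auto
  obtain f' where f': "f' \<in> tensors"
    "\<forall>g\<in>carrier G. f' g = f g \<otimes> (inv d \<otimes> act g x \<oplus> \<ominus> (inv d \<otimes> act h x))"
    using tensors_mult[OF f(1), of "inv d" "\<ominus> (inv d \<otimes> act h x)" x] d x hx by auto
  have "inv d \<otimes> x \<oplus> \<ominus> (inv d \<otimes> act h x) = inv d \<otimes> d"
    using d x hx by (simp add: d_def minus_eq r_distr r_minus)
  then have "f' \<one>\<^bsub>G\<^esub> = \<one>" using f' f(2) x d by simp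
  moreover have "f' h = \<zero>"
    using f'(2) h d hx tensors_closed[OF f(1) h(1)] by (simp add: r_neg)
  moreover have "f' g = \<zero>" if g: "g \<in> T" for g
  proof -
    have "g \<in> carrier G" using insert g by auto
    then show ?thesis using f'(2) f(3) g d x hx by simp
  qed
  ultimately show ?case using f'(1) by blast
qed

text \<open>These families play the role of a basis and its trace-dual basis, although
  \<open>r\<close> may exceed the degree. The identity splits off the diagonal component of the
  tensor square of \<open>F\<close> over \<open>L\<close>, and comes from faithfulness of the
  action.\<close>

lemma coordinates:
  obtains r :: nat and a y where "\<And>k. k < r \<Longrightarrow> a k \<in> F" "\<And>k. k < r \<Longrightarrow> y k \<in> F"
    "\<And>g. g \<in> carrier G \<Longrightarrow> (\<Oplus>k\<in>{..<r}. a k \<otimes> act g (y k)) = (if g = \<one>\<^bsub>G\<^esub> then \<one> else \<zero>)"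
proof -
  obtain f where f: "f \<in> tensors" "f \<one>\<^bsub>G\<^esub> = \<one>" "\<forall>g\<in>carrier G - {\<one>\<^bsub>G\<^esub>}. f g = \<zero>"
    using tensors_delta[of "carrier G - {\<one>\<^bsub>G\<^esub>}"] by auto
  have "\<exists>(r::nat) a y. (\<forall>k<r. a k \<in> F \<and> y k \<in> F) \<and>
      (\<forall>g\<in>carrier G. (\<Oplus>k\<in>{..<r}. a k \<otimes> act g (y k)) = f g)" using f(1)
  proof induction
    case zero
    show ?case by (rule exI[of _ 0]) auto
  next
    case (add f a y)
    then obtain r :: nat and a' y' where *: "\<forall>k<r. a' k \<in> F \<and> y' k \<in> F"
      "\<forall>g\<in>carrier G. (\<Oplus>k\<in>{..<r}. a' k \<otimes> act g (y' k)) = f g" by blast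
    define a'' where "a'' = a'(r := a)"
    define y'' where "y'' = y'(r := y)"
    have "(\<Oplus>k\<in>{..<Suc r}. a'' k \<otimes> act g (y'' k)) = f g \<oplus> a \<otimes> act g y" if g: "g \<in> carrier G" for g
    proof -
      have "(\<Oplus>k\<in>{..<Suc r}. a'' k \<otimes> act g (y'' k))
          = a'' r \<otimes> act g (y'' r) \<oplus> (\<Oplus>k\<in>{..<r}. a'' k \<otimes> act g (y'' k))"
        unfolding lessThan_Suc using * g add by (intro finsum_insert) (auto simp: a''_def y''_def)
      also have "(\<Oplus>k\<in>{..<r}. a'' k \<otimes> act g (y'' k)) = (\<Oplus>k\<in>{..<r}. a' k \<otimes> act g (y' k))"
        using * g by (intro finsum_cong') (auto simp: a''_def y''_def)
      also have "\<dots> = f g" using * g by blast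
      finally show ?thesis using g add tensors_closed[OF add(1) g]
        by (simp add: a''_def y''_def a_comm)
    qed
    moreover have "\<forall>k<Suc r. a'' k \<in> F \<and> y'' k \<in> F"
      using * add by (auto simp: a''_def y''_def less_Suc_eq)
    ultimately show ?case by blast
  qed
  then obtain r :: nat and a y where *: "\<forall>k<r. a k \<in> F \<and> y k \<in> F"
      "\<forall>g\<in>carrier G. (\<Oplus>k\<in>{..<r}. a k \<otimes> act g (y k)) = f g" by blast
  show ?thesis using that[of r a y] * f by auto
qed

abbreviation B where "B \<equiv> integral_closure E A F"

end

section \<open>Coordinates given by traces, and integrality as boundedness\<close>

locale galois_coords = galois_level E L A \<pi> G F act
  for E (structure) and L A \<pi> G F act +
  fixes r :: nat and a y :: "nat \<Rightarrow> 'a"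
  assumes aF [simp]: "k < r \<Longrightarrow> a k \<in> F" and yF [simp]: "k < r \<Longrightarrow> y k \<in> F"
    and coords: "g \<in> carrier G \<Longrightarrow>
      (\<Oplus>k\<in>{..<r}. a k \<otimes> act g (y k)) = (if g = \<one>\<^bsub>G\<^esub> then \<one> else \<zero>)"
begin

text \<open>The coefficient of \<open>a k\<close> in the expansion of \<open>z\<close>, see
  \<open>expand\<close>. The \<open>a k\<close> may be dependent, so expansions are not unique, but
  these particular coefficients are linear in \<open>z\<close>.\<close>

definition t where "t k z = tr (z \<otimes> y k)"

lemma t_L [simp]: "k < r \<Longrightarrow> z \<in> F \<Longrightarrow> t k z \<in> L" unfolding t_def by simp

lemma t_add: "k < r \<Longrightarrow> x \<in> F \<Longrightarrow> z \<in> F \<Longrightarrow> t k (x \<oplus> z) = t k x \<oplus> t k z"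
  unfolding t_def by (simp add: l_distr tr_add)

lemma t_smult: "k < r \<Longrightarrow> l \<in> L \<Longrightarrow> z \<in> F \<Longrightarrow> t k (l \<otimes> z) = l \<otimes> t k z"
  unfolding t_def by (simp add: m_assoc tr_smult)

lemma t_zero: "k < r \<Longrightarrow> t k \<zero> = \<zero>"
  using t_smult[of k \<zero> \<zero>] by simp

lemma t_minus: "k < r \<Longrightarrow> x \<in> F \<Longrightarrow> z \<in> F \<Longrightarrow> t k (x \<ominus> z) = t k x \<ominus> t k z"
  using t_add[of k x "\<ominus> \<one> \<otimes> z"] t_smult[of k "\<ominus> \<one>" z] by (simp add: minus_eq l_minus)

lemma t_finsum:
  assumes "k < r" "finite I" "\<And>i. i \<in> I \<Longrightarrow> c i \<in> L" "\<And>i. i \<in> I \<Longrightarrow> x i \<in> F"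
  shows "t k (\<Oplus>i\<in>I. c i \<otimes> x i) = (\<Oplus>i\<in>I. c i \<otimes> t k (x i))"
  using assms(2-)
proof (induction I)
  case empty show ?case using assms by (simp add: t_zero)
next
  case (insert i I)
  have "t k (\<Oplus>i\<in>insert i I. c i \<otimes> x i) = t k (c i \<otimes> x i \<oplus> (\<Oplus>i\<in>I. c i \<otimes> x i))"
    using insert by (subst finsum_insert) auto
  also have "\<dots> = c i \<otimes> t k (x i) \<oplus> (\<Oplus>i\<in>I. c i \<otimes> t k (x i))"
    using insert F_finsum[of I "\<lambda>i. c i \<otimes> x i"] assms(1) by (simp add: t_add t_smult)
  also have "\<dots> = (\<Oplus>i\<in>insert i I. c i \<otimes> t k (x i))"
    using insert assms(1) by (subst finsum_insert) auto
  finally show ?case .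
qed

text \<open>After interchanging the sums over k and over the group, each group element g contributes
  g(z) times the defining sum of \<open>a\<close> and \<open>y\<close>, which survives only for g =
  1.\<close>

lemma expand: assumes z: "z \<in> F" shows "(\<Oplus>k\<in>{..<r}. t k z \<otimes> a k) = z"
proof -
  have "(\<Oplus>k\<in>{..<r}. t k z \<otimes> a k) = (\<Oplus>k\<in>{..<r}. \<Oplus>g\<in>carrier G. act g z \<otimes> (a k \<otimes> act g (y k)))"
  proof (intro finsum_cong')
    fix k assume k: "k \<in> {..<r}"
    have "t k z \<otimes> a k = (\<Oplus>g\<in>carrier G. act g (z \<otimes> y k) \<otimes> a k)"
      unfolding t_def tr_def using z k by (intro finsum_ldistr) auto
    also have "\<dots> = (\<Oplus>g\<in>carrier G. act g z \<otimes> (a k \<otimes> act g (y k)))"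
      using z k by (intro finsum_cong') (auto simp: act_mult m_ac)
    finally show "t k z \<otimes> a k = (\<Oplus>g\<in>carrier G. act g z \<otimes> (a k \<otimes> act g (y k)))" .
  qed (use z in \<open>auto intro!: finsum_closed\<close>)
  also have "\<dots> = (\<Oplus>g\<in>carrier G. \<Oplus>k\<in>{..<r}. act g z \<otimes> (a k \<otimes> act g (y k)))"
    using z by (intro finsum_swap) auto
  also have "\<dots> = (\<Oplus>g\<in>carrier G. if g = \<one>\<^bsub>G\<^esub> then z else \<zero>)"
  proof (intro finsum_cong')
    fix g assume g: "g \<in> carrier G"
    have "(\<Oplus>k\<in>{..<r}. act g z \<otimes> (a k \<otimes> act g (y k))) = act g z \<otimes> (\<Oplus>k\<in>{..<r}. a k \<otimes> act g (y k))"
      using z g by (intro finsum_rdistr[symmetric]) auto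
    also have "\<dots> = (if g = \<one>\<^bsub>G\<^esub> then z else \<zero>)" using coords[OF g] z g by auto
    finally show "(\<Oplus>k\<in>{..<r}. act g z \<otimes> (a k \<otimes> act g (y k))) = (if g = \<one>\<^bsub>G\<^esub> then z else \<zero>)" .
  qed (use z in auto)
  also have "\<dots> = z" using z by (subst finsum_delta[of _ "\<one>\<^bsub>G\<^esub>"]) auto
  finally show ?thesis .
qed

lemma t_inj: assumes "z \<in> F" "\<And>k. k < r \<Longrightarrow> t k z = \<zero>" shows "z = \<zero>"
proof -
  have "(\<Oplus>k\<in>{..<r}. t k z \<otimes> a k) = (\<Oplus>k\<in>{..<r}. \<zero>)"
    using assms by (intro finsum_cong') auto
  then show ?thesis using expand[OF assms(1)] by (simp add: finsum_zero)
qed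

text \<open>The elements t_k(z a_l) form a matrix for multiplication by \<open>z\<close> in these
  coordinates.\<close>

lemma t_mult:
  assumes "k < r" "z \<in> F" "w \<in> F"
  shows "t k (z \<otimes> w) = (\<Oplus>l\<in>{..<r}. t l w \<otimes> t k (z \<otimes> a l))"
proof -
  have "z \<otimes> w = z \<otimes> (\<Oplus>l\<in>{..<r}. t l w \<otimes> a l)" using expand[OF assms(3)] by simp
  also have "\<dots> = (\<Oplus>l\<in>{..<r}. z \<otimes> (t l w \<otimes> a l))"
    using assms by (intro finsum_rdistr) auto
  also have "\<dots> = (\<Oplus>l\<in>{..<r}. t l w \<otimes> (z \<otimes> a l))"
    using assms by (intro finsum_cong') (auto simp: m_ac)
  finally have "t k (z \<otimes> w) = t k (\<Oplus>l\<in>{..<r}. t l w \<otimes> (z \<otimes> a l))" by simp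
  also have "\<dots> = (\<Oplus>l\<in>{..<r}. t l w \<otimes> t k (z \<otimes> a l))"
    using assms by (intro t_finsum) auto
  finally show ?thesis .
qed

text \<open>Elements whose coordinates have denominator at most \<pi>^j. These lattices exhaust
  \<open>F\<close>, so lying in a common one is what boundedness means here.\<close>

definition Lat :: "nat \<Rightarrow> 'a set" where
  "Lat j = {w \<in> F. \<forall>k<r. \<pi> [^] j \<otimes> t k w \<in> A}"

lemma submod_Lat: "submod (Lat j)"
  unfolding submod_def Lat_def by (auto simp: t_zero t_add t_smult r_distr m_lcomm[of "\<pi> [^] j"])

lemma Lat_F: "w \<in> Lat j \<Longrightarrow> w \<in> F" by (simp add: Lat_def)

lemma Lat_smult:
  assumes z: "z \<in> F" "\<And>k l. k < r \<Longrightarrow> l < r \<Longrightarrow> \<pi> [^] c \<otimes> t k (z \<otimes> a l) \<in> A" and w: "w \<in> Lat j"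
  shows "z \<otimes> w \<in> Lat (j + c)"
proof -
  have wF: "w \<in> F" using w by (rule Lat_F)
  have "\<pi> [^] (j + c) \<otimes> t k (z \<otimes> w) \<in> A" if k: "k < r" for k
  proof -
    have "\<pi> [^] (j + c) \<otimes> t k (z \<otimes> w) = \<pi> [^] (j + c) \<otimes> (\<Oplus>l\<in>{..<r}. t l w \<otimes> t k (z \<otimes> a l))"
      using t_mult[OF k z(1) wF] by simp
    also have "\<dots> = (\<Oplus>l\<in>{..<r}. \<pi> [^] (j + c) \<otimes> (t l w \<otimes> t k (z \<otimes> a l)))"
      using k z wF by (intro finsum_rdistr) auto
    also have "\<dots> = (\<Oplus>l\<in>{..<r}. (\<pi> [^] j \<otimes> t l w) \<otimes> (\<pi> [^] c \<otimes> t k (z \<otimes> a l)))"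
      using k z wF by (intro finsum_cong') (auto simp: nat_pow_mult[symmetric] m_ac)
    also have "\<dots> \<in> A"
    proof (rule A_finsum)
      show "(\<pi> [^] j \<otimes> t l w) \<otimes> (\<pi> [^] c \<otimes> t k (z \<otimes> a l)) \<in> A" if "l \<in> {..<r}" for l
        using w z(2)[OF k, of l] that by (rule_tac A_closed(4)) (auto simp: Lat_def)
    qed
    finally show ?thesis .
  qed
  then show ?thesis using z wF by (simp add: Lat_def)
qed

lemma Lat_denominator:
  assumes "finite S" "S \<subseteq> F" obtains j where "S \<subseteq> Lat j"
proof -
  have "finite ((\<lambda>(k, s). t k s) ` ({..<r} \<times> S))" using assms by auto
  moreover have "((\<lambda>(k, s). t k s) ` ({..<r} \<times> S)) \<subseteq> L" using assms by auto
  ultimately obtain j :: nat where "\<And>s. s \<in> (\<lambda>(k, s). t k s) ` ({..<r} \<times> S) \<Longrightarrow> \<pi> [^] j \<otimes> s \<in> A"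
    using common_denominator by blast
  then have "S \<subseteq> Lat j" using assms unfolding Lat_def by auto
  then show ?thesis using that by blast
qed

text \<open>The constant \<open>c\<close> is a common denominator of the finitely many products
  \<open>a k \<otimes> a l\<close>, hence independent of the factors. Two uses of
  \<open>Lat_smult\<close> bring in the factors in turn.\<close>

lemma Lat_mult: obtains c where "\<And>i j w z. w \<in> Lat i \<Longrightarrow> z \<in> Lat j \<Longrightarrow> w \<otimes> z \<in> Lat (i + j + c)"
proof -
  have fin: "finite ((\<lambda>(k, l). a k \<otimes> a l) ` ({..<r} \<times> {..<r}))" by simp
  have "((\<lambda>(k, l). a k \<otimes> a l) ` ({..<r} \<times> {..<r})) \<subseteq> F" by auto
  then obtain c where c: "((\<lambda>(k, l). a k \<otimes> a l) ` ({..<r} \<times> {..<r})) \<subseteq> Lat c"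
    using Lat_denominator[OF fin] by blast
  have "w \<otimes> z \<in> Lat (i + j + c)" if wz: "w \<in> Lat i" "z \<in> Lat j" for w z i j
  proof -
    have wF: "w \<in> F" using wz Lat_F by blast
    have "\<pi> [^] (i + c) \<otimes> t k (w \<otimes> a l) \<in> A" if kl: "k < r" "l < r" for k l
    proof -
      have "a l \<otimes> w \<in> Lat (i + c)"
      proof (rule Lat_smult)
        show "\<pi> [^] c \<otimes> t k (a l \<otimes> a l') \<in> A" if "k < r" "l' < r" for k l'
        proof -
          have "a l \<otimes> a l' \<in> Lat c" using c that kl by auto
          then show ?thesis using that by (simp add: Lat_def)
        qed
      qed (use wz kl in auto)
      then show ?thesis using kl wF by (simp add: Lat_def m_comm)
    qed
    then have "w \<otimes> z \<in> Lat (j + (i + c))" using wz wF by (intro Lat_smult) auto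
    then show ?thesis by (simp add: ac_simps)
  qed
  then show ?thesis using that by blast
qed

lemma eval_in_submod:
  assumes "submod M" "x \<in> carrier E" "set cs \<subseteq> A" "\<And>j. j < length cs \<Longrightarrow> x [^] (i + j) \<in> M"
  shows "x [^] (i::nat) \<otimes> eval cs x \<in> M"
  using assms(3,4)
proof (induction cs)
  case Nil
  then show ?case using assms by (simp add: submodD)
next
  case (Cons c cs)
  have ev: "eval cs x \<in> carrier E" using Cons assms by (intro eval_in_carrier) auto
  have "x [^] i \<otimes> eval (c # cs) x = c \<otimes> x [^] (i + length cs) \<oplus> x [^] i \<otimes> eval cs x"
    using Cons assms ev by (simp add: r_distr m_ac nat_pow_mult[symmetric])
  also have "\<dots> \<in> M"
  proof (rule submodD(3)[OF assms(1)])
    show "c \<otimes> x [^] (i + length cs) \<in> M" using Cons.prems by (intro submodD(4)[OF assms(1)]) auto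
    show "x [^] i \<otimes> eval cs x \<in> M" using Cons by auto
  qed
  finally show ?case .
qed

text \<open>A monic equation expresses high powers by lower ones, so all powers stay in one lattice.
  Conversely, \<open>noetherian_sequence\<close> makes some scaled power depend on the earlier ones,
  which is a monic equation. Closure of integers under sums and products thereby becomes a matter of
  estimates.\<close>

lemma integral_iff_bounded:
  assumes x: "x \<in> F"
  shows "x \<in> B \<longleftrightarrow> (\<exists>j. \<forall>i::nat. x [^] i \<in> Lat j)"
proof
  assume "x \<in> B"
  then obtain cs where cs: "set cs \<subseteq> A" "eval (\<one> # cs) x = \<zero>" by (auto simp: integral_closure_def)
  define d where "d = length cs"
  have "(\<lambda>i::nat. x [^] i) ` {..<d} \<subseteq> F" using x by auto
  then obtain j where j: "(\<lambda>i::nat. x [^] i) ` {..<d} \<subseteq> Lat j"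
    using Lat_denominator[of "(\<lambda>i::nat. x [^] i) ` {..<d}"] by blast
  have ev: "eval cs x \<in> carrier E" using cs x A_mem by (intro eval_in_carrier) auto
  have xd: "x [^] d = \<ominus> eval cs x"
    using cs(2) x ev unfolding d_def by (simp add: sum_zero_eq_neg)
  have "x [^] i \<in> Lat j" for i :: nat
  proof (induction i rule: less_induct)
    case (less i)
    show ?case
    proof (cases "i < d")
      case True then show ?thesis using j by auto
    next
      case False
      then obtain m where m: "i = m + d" using le_Suc_ex not_less by (metis add.commute)
      have "x [^] m \<otimes> eval cs x \<in> Lat j"
        using x cs less m d_def by (intro eval_in_submod submod_Lat) auto
      then have "\<ominus> (x [^] m \<otimes> eval cs x) \<in> Lat j" by (rule submodD(5)[OF submod_Lat])
      moreover have "\<ominus> (x [^] m \<otimes> eval cs x) = x [^] i"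
        unfolding m using x ev by (simp add: nat_pow_mult[symmetric] xd r_minus)
      ultimately show ?thesis by simp
    qed
  qed
  then show "\<exists>j. \<forall>i::nat. x [^] i \<in> Lat j" by blast
next
  assume "\<exists>j. \<forall>i::nat. x [^] i \<in> Lat j"
  then obtain j where j: "\<And>i::nat. x [^] i \<in> Lat j" by blast
  have sF: "submod F" unfolding submod_def by auto
  have "\<exists>i::nat. \<forall>M. submod M \<and> (\<forall>l<i. \<pi> [^] j \<otimes> x [^] l \<in> M) \<longrightarrow> \<pi> [^] j \<otimes> x [^] i \<in> M"
  proof (rule noetherian_sequence[where F = F and R = r and r = r and t = t and w = "\<lambda>i. \<pi> [^] j \<otimes> x [^] i"])
    show "t k (\<pi> [^] j \<otimes> x [^] i) \<in> A" if "k < r" for i :: nat and k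
      using j[of i] that x by (simp add: Lat_def t_smult)
  qed (use sF x t_minus t_smult t_inj in auto)
  then obtain i :: nat where i: "\<And>M. submod M \<Longrightarrow> (\<forall>l<i. \<pi> [^] j \<otimes> x [^] l \<in> M) \<Longrightarrow> \<pi> [^] j \<otimes> x [^] i \<in> M"
    by blast
  define w where "w i = \<pi> [^] j \<otimes> x [^] i" for i :: nat
  have wc: "w i \<in> carrier E" for i using x unfolding w_def by simp
  \<comment> \<open>The span over \<open>A\<close> of the first \<open>n\<close> scaled powers,
    written as values of polynomials with \<open>n\<close> coefficients, so that membership of the
    next power is already an integral equation.\<close>
  define P where "P n = {\<pi> [^] j \<otimes> eval cs x | cs. set cs \<subseteq> A \<and> length cs = n}" for n
  have ev: "eval cs x \<in> carrier E" if "set cs \<subseteq> A" for cs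
    using that x A_mem by (intro eval_in_carrier) auto
  have P_Suc: "P (Suc n) = {c \<otimes> w n \<oplus> z | c z. c \<in> A \<and> z \<in> P n}" for n
  proof -
    have "\<pi> [^] j \<otimes> eval (c # cs) x = c \<otimes> w n \<oplus> \<pi> [^] j \<otimes> eval cs x"
      if "c \<in> A" "set cs \<subseteq> A" "length cs = n" for c cs
      using that x ev unfolding w_def by (simp add: r_distr m_lcomm)
    then have e: "(\<exists>cs. v = \<pi> [^] j \<otimes> eval cs x \<and> set cs \<subseteq> A \<and> length cs = Suc n) \<longleftrightarrow>
      (\<exists>c cs. v = c \<otimes> w n \<oplus> \<pi> [^] j \<otimes> eval cs x \<and> c \<in> A \<and> set cs \<subseteq> A \<and> length cs = n)" for v
      unfolding length_Suc_conv by (metis insert_subset list.simps(15))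
    show ?thesis unfolding P_def using e by (simp add: set_eq_iff) blast
  qed
  have sP: "submod (P n)" for n
  proof (induction n)
    case 0
    have "P 0 = {\<zero>}" unfolding P_def by auto
    then show ?case unfolding submod_def by auto
  next
    case (Suc n)
    note D = submodD[OF Suc]
    show ?case unfolding submod_def
    proof (intro conjI ballI subsetI)
      show "v \<in> carrier E" if "v \<in> P (Suc n)" for v using that wc D(1) unfolding P_Suc by auto
      show "\<zero> \<in> P (Suc n)"
        unfolding P_Suc using wc D(2) by (intro CollectI exI[of _ \<zero>]) simp
    next
      fix v v' assume "v \<in> P (Suc n)" "v' \<in> P (Suc n)"
      then obtain c z c' z' where *: "c \<in> A" "z \<in> P n" "v = c \<otimes> w n \<oplus> z"
        "c' \<in> A" "z' \<in> P n" "v' = c' \<otimes> w n \<oplus> z'" unfolding P_Suc by blast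
      have "v \<oplus> v' = (c \<oplus> c') \<otimes> w n \<oplus> (z \<oplus> z')"
        using * wc D(1) by (simp add: ring_norm)
      moreover have "c \<oplus> c' \<in> A" "z \<oplus> z' \<in> P n" using * D(3) by auto
      ultimately show "v \<oplus> v' \<in> P (Suc n)" unfolding P_Suc by blast
    next
      fix b v assume b: "b \<in> A" and "v \<in> P (Suc n)"
      then obtain c z where *: "c \<in> A" "z \<in> P n" "v = c \<otimes> w n \<oplus> z" unfolding P_Suc by blast
      have "b \<otimes> v = (b \<otimes> c) \<otimes> w n \<oplus> b \<otimes> z" using * wc b D(1) by (simp add: r_distr m_assoc)
      moreover have "b \<otimes> c \<in> A" "b \<otimes> z \<in> P n" using * b D(4) by auto
      ultimately show "b \<otimes> v \<in> P (Suc n)" unfolding P_Suc by blast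
    qed
  qed
  have P_mono: "P n \<subseteq> P (Suc n)" for n
  proof
    fix z assume z: "z \<in> P n"
    then show "z \<in> P (Suc n)" unfolding P_Suc using submodD(1)[OF sP z] wc
      by (intro CollectI exI[of _ \<zero>] exI[of _ z]) simp
  qed
  have P_pow: "w l \<in> P n" if "l < n" for l n using that
  proof (induction n)
    case (Suc n)
    show ?case
    proof (cases "l = n")
      case True
      show ?thesis unfolding True P_Suc using submodD(2)[OF sP] wc
        by (intro CollectI exI[of _ \<one>] exI[of _ \<zero>]) simp
    next
      case False
      then show ?thesis using Suc P_mono by auto
    qed
  qed simp
  have "w i \<in> P i" unfolding w_def by (rule i[OF sP]) (use P_pow in \<open>auto simp: w_def\<close>)
  then have "\<ominus> w i \<in> P i" by (rule submodD(5)[OF sP])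
  then obtain cs where cs: "set cs \<subseteq> A" "length cs = i" "\<ominus> w i = \<pi> [^] j \<otimes> eval cs x"
    unfolding P_def by blast
  have "\<pi> [^] j \<otimes> eval (\<one> # cs) x = w i \<oplus> \<ominus> w i"
    unfolding cs(3) using cs(2) x ev[OF cs(1)] by (simp add: w_def r_distr)
  also have "\<dots> = \<zero>" by (rule r_neg[OF wc])
  finally have "eval (\<one> # cs) x = \<zero>"
    using ev[of "\<one> # cs"] cs(1) integral[of "\<pi> [^] j" "eval (\<one> # cs) x"] by simp
  then show "x \<in> B" using cs x by (auto simp: integral_closure_def)
qed

end

section \<open>Operators of the group, and the action on integers\<close>

context galois_level
begin

text \<open>The action on \<open>F\<close> of an element of the twisted group ring. Coefficients in
  \<open>F\<close>, and not only in \<open>A\<close>, are allowed so that independence of the group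
  elements over \<open>F\<close> can be stated.\<close>

definition op :: "('g \<Rightarrow> 'a) \<Rightarrow> 'a \<Rightarrow> 'a" where
  "op c x = (\<Oplus>g\<in>carrier G. c g \<otimes> act g x)"

lemma op_F [simp]: "c \<in> carrier G \<rightarrow> F \<Longrightarrow> x \<in> F \<Longrightarrow> op c x \<in> F"
  unfolding op_def by (rule F_finsum) (auto dest: funcset_mem)

lemma B_F [simp]: "x \<in> B \<Longrightarrow> x \<in> F" by (simp add: integral_closure_def)

lemma A_B: "x \<in> A \<Longrightarrow> x \<in> B"
  unfolding integral_closure_def by (auto simp: r_neg intro!: exI[of _ "[\<ominus> x]"])

lemma A_subset_B [simp]: "\<zero> \<in> B" "\<one> \<in> B"
  by (auto intro: A_B)

lemma eval_act:
  assumes "g \<in> carrier G" "set cs \<subseteq> A" "x \<in> F"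
  shows "eval cs x \<in> F \<and> eval cs (act g x) = act g (eval cs x)"
  using assms(2)
proof (induction cs)
  case Nil
  then show ?case using assms by simp
next
  case (Cons c cs)
  then show ?case using assms by (simp add: act_add act_mult act_pow)
qed

lemma B_act [simp]: assumes "g \<in> carrier G" "x \<in> B" shows "act g x \<in> B"
proof -
  obtain cs where cs: "set cs \<subseteq> A" "eval (\<one> # cs) x = \<zero>" and x: "x \<in> F"
    using assms(2) unfolding integral_closure_def by blast
  have "eval (\<one> # cs) (act g x) = act g (eval (\<one> # cs) x)"
  proof (rule eval_act[OF assms(1), THEN conjunct2])
    show "set (\<one> # cs) \<subseteq> A" using cs(1) by simp
  qed (rule x)
  also have "\<dots> = \<zero>" unfolding cs(2) using assms(1) by (intro act_L) auto
  finally have "eval (\<one> # cs) (act g x) = \<zero>" .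
  then show ?thesis unfolding integral_closure_def using cs(1) act_closed[OF assms(1) x] by blast
qed

end

context galois_coords
begin

text \<open>An explicit form of the independence of group elements: each coefficient is read off
  from the values at the \<open>y k\<close>. Besides injectivity, this bounds the denominators of
  the coefficients.\<close>

lemma op_recover:
  assumes c: "c \<in> carrier G \<rightarrow> F" and h: "h \<in> carrier G"
  shows "(\<Oplus>k\<in>{..<r}. op c (y k) \<otimes> act h (a k)) = c h"
proof -
  have cg: "c g \<in> F" if "g \<in> carrier G" for g using c that by blast
  have "(\<Oplus>k\<in>{..<r}. op c (y k) \<otimes> act h (a k))
      = (\<Oplus>k\<in>{..<r}. \<Oplus>g\<in>carrier G. c g \<otimes> act h (a k \<otimes> act (inv\<^bsub>G\<^esub> h \<otimes>\<^bsub>G\<^esub> g) (y k)))"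
  proof (intro finsum_cong')
    fix k assume k: "k \<in> {..<r}"
    have "op c (y k) \<otimes> act h (a k) = (\<Oplus>g\<in>carrier G. (c g \<otimes> act g (y k)) \<otimes> act h (a k))"
      unfolding op_def using k h cg by (intro finsum_ldistr) auto
    also have "\<dots> = (\<Oplus>g\<in>carrier G. c g \<otimes> act h (a k \<otimes> act (inv\<^bsub>G\<^esub> h \<otimes>\<^bsub>G\<^esub> g) (y k)))"
    proof (intro finsum_cong')
      fix g assume g: "g \<in> carrier G"
      have "act h (act (inv\<^bsub>G\<^esub> h \<otimes>\<^bsub>G\<^esub> g) (y k)) = act g (y k)"
        using g h k by (simp add: act_comp)
      then show "(c g \<otimes> act g (y k)) \<otimes> act h (a k) = c g \<otimes> act h (a k \<otimes> act (inv\<^bsub>G\<^esub> h \<otimes>\<^bsub>G\<^esub> g) (y k))"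
        using g h k cg by (simp add: act_mult m_ac)
    qed (use k h cg in auto)
    finally show "op c (y k) \<otimes> act h (a k)
      = (\<Oplus>g\<in>carrier G. c g \<otimes> act h (a k \<otimes> act (inv\<^bsub>G\<^esub> h \<otimes>\<^bsub>G\<^esub> g) (y k)))" .
  qed (use h cg in \<open>auto intro!: finsum_closed\<close>)
  also have "\<dots> = (\<Oplus>g\<in>carrier G. \<Oplus>k\<in>{..<r}. c g \<otimes> act h (a k \<otimes> act (inv\<^bsub>G\<^esub> h \<otimes>\<^bsub>G\<^esub> g) (y k)))"
    using h cg by (intro finsum_swap) auto
  also have "\<dots> = (\<Oplus>g\<in>carrier G. if g = h then c h else \<zero>)"
  proof (intro finsum_cong')
    fix g assume g: "g \<in> carrier G"
    let ?g = "inv\<^bsub>G\<^esub> h \<otimes>\<^bsub>G\<^esub> g"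
    have gh: "?g = \<one>\<^bsub>G\<^esub> \<longleftrightarrow> g = h"
      using g h by (metis GG.inv_closed GG.inv_inv GG.l_inv GG.inv_equality)
    have "(\<Oplus>k\<in>{..<r}. c g \<otimes> act h (a k \<otimes> act ?g (y k))) = c g \<otimes> (\<Oplus>k\<in>{..<r}. act h (a k \<otimes> act ?g (y k)))"
      using h g cg by (intro finsum_rdistr[symmetric]) auto
    also have "(\<Oplus>k\<in>{..<r}. act h (a k \<otimes> act ?g (y k))) = act h (\<Oplus>k\<in>{..<r}. a k \<otimes> act ?g (y k))"
      using h g by (intro act_finsum[symmetric]) auto
    also have "\<dots> = (if g = h then \<one> else \<zero>)"
      using coords[of ?g] h g gh by simp
    finally show "(\<Oplus>k\<in>{..<r}. c g \<otimes> act h (a k \<otimes> act ?g (y k))) = (if g = h then c h else \<zero>)"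
      using cg g by (simp split: if_splits)
  qed (use cg h in auto)
  also have "\<dots> = c h" using cg h by (subst finsum_delta[of _ h]) auto
  finally show ?thesis .
qed

lemma coords_B_mult: assumes x: "x \<in> B" and z: "z \<in> B" shows "x \<otimes> z \<in> B"
proof -
  obtain i j where i: "\<And>n::nat. x [^] n \<in> Lat i" and j: "\<And>n::nat. z [^] n \<in> Lat j"
    using integral_iff_bounded[of x] integral_iff_bounded[of z] x z by auto
  obtain c where c: "\<And>i j w z. w \<in> Lat i \<Longrightarrow> z \<in> Lat j \<Longrightarrow> w \<otimes> z \<in> Lat (i + j + c)"
    using Lat_mult by blast
  have "(x \<otimes> z) [^] n \<in> Lat (i + j + c)" for n :: nat
    using c[OF i j, of n n] x z by (simp add: nat_pow_distrib)
  then show ?thesis using integral_iff_bounded[of "x \<otimes> z"] x z by auto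
qed

lemma coords_B_add: assumes x: "x \<in> B" and z: "z \<in> B" shows "x \<oplus> z \<in> B"
proof -
  obtain i j where i: "\<And>n::nat. x [^] n \<in> Lat i" and j: "\<And>n::nat. z [^] n \<in> Lat j"
    using integral_iff_bounded[of x] integral_iff_bounded[of z] x z by auto
  obtain c where c: "\<And>i j w z. w \<in> Lat i \<Longrightarrow> z \<in> Lat j \<Longrightarrow> w \<otimes> z \<in> Lat (i + j + c)"
    using Lat_mult by blast
  have xF: "x \<in> carrier E" and zF: "z \<in> carrier E" using x z by auto
  \<comment> \<open>The extra monomial x^k z^l lets the induction on n distribute one factor
    \<open>x \<oplus> z\<close> at a time, in place of a binomial expansion.\<close>
  have *: "(x \<oplus> z) [^] n \<otimes> (x [^] k \<otimes> z [^] l) \<in> Lat (i + j + c)" for n k l :: nat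
  proof (induction n arbitrary: k l)
    case 0
    then show ?case using c[OF i j, of k l] xF zF by simp
  next
    case (Suc n)
    have "(x \<oplus> z) [^] Suc n \<otimes> (x [^] k \<otimes> z [^] l) =
      (x \<oplus> z) [^] n \<otimes> (x [^] Suc k \<otimes> z [^] l) \<oplus> (x \<oplus> z) [^] n \<otimes> (x [^] k \<otimes> z [^] Suc l)"
      using xF zF by (simp add: r_distr l_distr m_ac)
    then show ?case using submodD(3)[OF submod_Lat Suc[of "Suc k" l] Suc[of k "Suc l"]] by simp
  qed
  have "(x \<oplus> z) [^] n \<in> Lat (i + j + c)" for n :: nat
    using *[of n 0 0] xF zF by simp
  then show ?thesis using integral_iff_bounded[of "x \<oplus> z"] x z by auto
qed

text \<open>For a suitable c, multiplication by \<pi>^c z maps every lattice \<open>Lat j\<close>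
  into itself, so the powers of this element stay in any lattice that contains 1.\<close>

lemma coords_B_scale: assumes z: "z \<in> F" obtains j :: nat where "\<pi> [^] j \<otimes> z \<in> B"
proof -
  have "(\<lambda>l. z \<otimes> a l) ` {..<r} \<subseteq> F" using z by auto
  then obtain c where c: "(\<lambda>l. z \<otimes> a l) ` {..<r} \<subseteq> Lat c"
    using Lat_denominator[of "(\<lambda>l. z \<otimes> a l) ` {..<r}"] by blast
  define z' where "z' = \<pi> [^] c \<otimes> z"
  have z'F: "z' \<in> F" using z unfolding z'_def by simp
  have step: "z' \<otimes> w \<in> Lat j" if w: "w \<in> Lat j" for w j
  proof -
    have "z \<otimes> w \<in> Lat (j + c)"
    proof (rule Lat_smult[OF z _ w])
      show "\<pi> [^] c \<otimes> t k (z \<otimes> a l) \<in> A" if "k < r" "l < r" for k l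
      proof -
        have "z \<otimes> a l \<in> Lat c" using c that by blast
        then show ?thesis using that by (simp add: Lat_def)
      qed
    qed
    moreover have "\<pi> [^] j \<otimes> t k (z' \<otimes> w) = \<pi> [^] (j + c) \<otimes> t k (z \<otimes> w)" if "k < r" for k
      unfolding z'_def using that z Lat_F[OF w] t_smult[of k "\<pi> [^] c" "z \<otimes> w"]
      by (simp add: m_assoc nat_pow_mult[symmetric])
    ultimately show ?thesis using z'F Lat_F[OF w] by (simp add: Lat_def)
  qed
  obtain j where j: "{\<one>} \<subseteq> Lat j" using Lat_denominator[of "{\<one>}"] by auto
  have "z' [^] n \<in> Lat j" for n :: nat
  proof (induction n)
    case (Suc n)
    then show ?case using step[OF Suc] z'F by (simp add: m_comm)
  qed (use j in simp)
  then have "z' \<in> B" using integral_iff_bounded[OF z'F] by auto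
  then show ?thesis using that unfolding z'_def by blast
qed

text \<open>Powers of an element of \<open>L\<close> outside \<open>A\<close> have unbounded
  denominators: if they were bounded, a fixed nonzero multiple of a coordinate of 1 would be
  divisible by every power of \<pi>.\<close>

lemma coords_B_L: assumes x: "x \<in> B" "x \<in> L" shows "x \<in> A"
proof (rule ccontr)
  assume "x \<notin> A"
  then have v: "x \<noteq> \<zero>" "inv x \<in> A" "\<omega> \<otimes> inv x \<in> A" using valuation_ring x by auto
  obtain k where k: "k < r" "t k \<one> \<noteq> \<zero>" using t_inj[of \<one>] by auto
  obtain j where j: "\<And>i::nat. x [^] i \<in> Lat j" using integral_iff_bounded[of x] x by auto
  have "\<pi> [^] j \<otimes> t k \<one> = \<zero>"
  proof (rule separated)
    fix i :: nat
    have "t k (x [^] i) = x [^] i \<otimes> t k \<one>" using t_smult[of k "x [^] i" \<one>] x k by simp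
    moreover have "\<pi> [^] j \<otimes> t k (x [^] i) \<in> A" using j[of i] k by (simp add: Lat_def)
    ultimately have "\<pi> [^] j \<otimes> (x [^] i \<otimes> t k \<one>) \<in> A" by simp
    then have "(\<omega> \<otimes> inv x) [^] i \<otimes> (\<pi> [^] j \<otimes> (x [^] i \<otimes> t k \<one>)) \<in> A" using v by simp
    moreover have "(\<omega> \<otimes> inv x) [^] i \<otimes> (\<pi> [^] j \<otimes> (x [^] i \<otimes> t k \<one>)) = \<omega> [^] i \<otimes> (\<pi> [^] j \<otimes> t k \<one>)"
    proof -
      have "(\<omega> \<otimes> inv x) [^] i \<otimes> (\<pi> [^] j \<otimes> (x [^] i \<otimes> t k \<one>))
        = (inv x [^] i \<otimes> x [^] i) \<otimes> (\<omega> [^] i \<otimes> (\<pi> [^] j \<otimes> t k \<one>))"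
        using v x k by (simp add: nat_pow_distrib m_ac)
      then show ?thesis using v x k by simp
    qed
    ultimately show "\<omega> [^] i \<otimes> (\<pi> [^] j \<otimes> t k \<one>) \<in> A" by simp
  qed (use k in simp)
  then show False using k by (simp add: integral_iff)
qed

end

section \<open>The ring of integers of a finite level\<close>

context galois_level
begin

lemma B_closed [simp]:
  "x \<in> B \<Longrightarrow> z \<in> B \<Longrightarrow> x \<oplus> z \<in> B" "x \<in> B \<Longrightarrow> z \<in> B \<Longrightarrow> x \<otimes> z \<in> B"
  "x \<in> B \<Longrightarrow> \<ominus> x \<in> B" "x \<in> B \<Longrightarrow> z \<in> B \<Longrightarrow> x \<ominus> z \<in> B"
proof -
  obtain r :: nat and a y where c: "\<And>k. k < r \<Longrightarrow> a k \<in> F" "\<And>k. k < r \<Longrightarrow> y k \<in> F"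
    "\<And>g. g \<in> carrier G \<Longrightarrow> (\<Oplus>k\<in>{..<r}. a k \<otimes> act g (y k)) = (if g = \<one>\<^bsub>G\<^esub> then \<one> else \<zero>)"
    using coordinates by blast
  interpret galois_coords E L A \<pi> G F act r a y by unfold_locales (use c in auto)
  show 1: "\<And>x z. x \<in> B \<Longrightarrow> z \<in> B \<Longrightarrow> x \<oplus> z \<in> B" and 2: "\<And>x z. x \<in> B \<Longrightarrow> z \<in> B \<Longrightarrow> x \<otimes> z \<in> B"
    using coords_B_add coords_B_mult by auto
  show 3: "\<ominus> x \<in> B" if "x \<in> B" for x
    using 2[of "\<ominus> \<one>" x] A_B[of "\<ominus> \<one>"] that by (simp add: l_minus)
  show "x \<in> B \<Longrightarrow> z \<in> B \<Longrightarrow> x \<ominus> z \<in> B" using 1 3 by (simp add: minus_eq)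
qed

lemma B_scale: assumes "z \<in> F" obtains j :: nat where "\<pi> [^] j \<otimes> z \<in> B"
proof -
  obtain r :: nat and a y where c: "\<And>k. k < r \<Longrightarrow> a k \<in> F" "\<And>k. k < r \<Longrightarrow> y k \<in> F"
    "\<And>g. g \<in> carrier G \<Longrightarrow> (\<Oplus>k\<in>{..<r}. a k \<otimes> act g (y k)) = (if g = \<one>\<^bsub>G\<^esub> then \<one> else \<zero>)"
    using coordinates by blast
  interpret galois_coords E L A \<pi> G F act r a y by unfold_locales (use c in auto)
  show ?thesis using coords_B_scale[OF assms] that by blast
qed

lemma B_L: assumes "x \<in> B" "x \<in> L" shows "x \<in> A"
proof -
  obtain r :: nat and a y where c: "\<And>k. k < r \<Longrightarrow> a k \<in> F" "\<And>k. k < r \<Longrightarrow> y k \<in> F"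
    "\<And>g. g \<in> carrier G \<Longrightarrow> (\<Oplus>k\<in>{..<r}. a k \<otimes> act g (y k)) = (if g = \<one>\<^bsub>G\<^esub> then \<one> else \<zero>)"
    using coordinates by blast
  interpret galois_coords E L A \<pi> G F act r a y by unfold_locales (use c in auto)
  show ?thesis using coords_B_L[OF assms] .
qed

lemma A_B_smult [simp]: "b \<in> A \<Longrightarrow> x \<in> B \<Longrightarrow> b \<otimes> x \<in> B"
  by (rule B_closed(2)[OF A_B])

lemma submod_B: "submod B" unfolding submod_def by auto

lemma subring_B: "subring B E"
  by (rule subringI) auto

lemma B_finsum: "(\<And>i. i \<in> I \<Longrightarrow> f i \<in> B) \<Longrightarrow> (\<Oplus>i\<in>I. f i) \<in> B"
  by (rule finsum_mem) auto

lemma tr_B [simp]: assumes "x \<in> B" shows "tr x \<in> A"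
proof (rule B_L)
  show "tr x \<in> B" unfolding tr_def using assms by (intro B_finsum) simp
qed (use assms in simp)

lemma common_denominator_B:
  assumes "finite S" "S \<subseteq> F" obtains j :: nat where "\<And>s. s \<in> S \<Longrightarrow> \<pi> [^] j \<otimes> s \<in> B"
proof -
  have "\<exists>j::nat. \<forall>s\<in>S. \<pi> [^] j \<otimes> s \<in> B" using assms
  proof (induction S)
    case (insert x S)
    then obtain j :: nat where j: "\<forall>s\<in>S. \<pi> [^] j \<otimes> s \<in> B" by auto
    obtain i :: nat where i: "\<pi> [^] i \<otimes> x \<in> B" using B_scale[of x] insert by blast
    have "\<pi> [^] (i + j) \<otimes> s \<in> B" if s: "s \<in> insert x S" for s
    proof (cases "s = x")
      case True
      have "\<pi> [^] (i + j) \<otimes> x = \<pi> [^] j \<otimes> (\<pi> [^] i \<otimes> x)"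
        using insert by (simp add: nat_pow_mult[symmetric] m_ac)
      then show ?thesis using i True by simp
    next
      case False
      then have "s \<in> S" using s by simp
      then have "\<pi> [^] (i + j) \<otimes> s = \<pi> [^] i \<otimes> (\<pi> [^] j \<otimes> s)"
        using insert by (simp add: nat_pow_mult[symmetric] m_ac subset_iff)
      then show ?thesis using j \<open>s \<in> S\<close> by simp
    qed
    then show ?case by blast
  qed simp
  then show ?thesis using that by blast
qed

text \<open>Multiplying each \<open>y k\<close> by a power of \<pi> and dividing each
  \<open>a k\<close> by it preserves the coordinate identity. With integral \<open>y k\<close>, the
  coordinates of integers lie in \<open>A\<close>.\<close>

lemma integral_coordinates:
  obtains r :: nat and a y where "galois_coords E L A \<pi> G F act r a y" "\<And>k. k < r \<Longrightarrow> y k \<in> B"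
proof -
  obtain r :: nat and a y where c: "\<And>k. k < r \<Longrightarrow> a k \<in> F" "\<And>k. k < r \<Longrightarrow> y k \<in> F"
    "\<And>g. g \<in> carrier G \<Longrightarrow> (\<Oplus>k\<in>{..<r}. a k \<otimes> act g (y k)) = (if g = \<one>\<^bsub>G\<^esub> then \<one> else \<zero>)"
    using coordinates by blast
  have "y ` {..<r} \<subseteq> F" using c by auto
  then obtain j :: nat where j: "\<And>s. s \<in> y ` {..<r} \<Longrightarrow> \<pi> [^] j \<otimes> s \<in> B"
    using common_denominator_B[of "y ` {..<r}"] by blast
  have "galois_coords E L A \<pi> G F act r (\<lambda>k. \<omega> [^] j \<otimes> a k) (\<lambda>k. \<pi> [^] j \<otimes> y k)"
  proof unfold_locales
    show "(\<Oplus>k\<in>{..<r}. \<omega> [^] j \<otimes> a k \<otimes> act g (\<pi> [^] j \<otimes> y k)) = (if g = \<one>\<^bsub>G\<^esub> then \<one> else \<zero>)"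
      if g: "g \<in> carrier G" for g
    proof -
      have "(\<Oplus>k\<in>{..<r}. \<omega> [^] j \<otimes> a k \<otimes> act g (\<pi> [^] j \<otimes> y k)) = (\<Oplus>k\<in>{..<r}. a k \<otimes> act g (y k))"
      proof (intro finsum_cong')
        fix k assume k: "k \<in> {..<r}"
        have "\<omega> [^] j \<otimes> a k \<otimes> act g (\<pi> [^] j \<otimes> y k) = (\<omega> [^] j \<otimes> \<pi> [^] j) \<otimes> (a k \<otimes> act g (y k))"
          using c k g by (simp add: act_mult m_ac del: inv_pow_cancel pow_inv_cancel)
        then show "\<omega> [^] j \<otimes> a k \<otimes> act g (\<pi> [^] j \<otimes> y k) = a k \<otimes> act g (y k)"
          using c k g by simp
      qed (use c g in auto)
      then show ?thesis using c(3)[OF g] by simp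
    qed
  qed (use c in auto)
  then show ?thesis using that[of r "\<lambda>k. \<omega> [^] j \<otimes> a k" "\<lambda>k. \<pi> [^] j \<otimes> y k"] j by auto
qed

lemma separated_B:
  assumes "x \<in> F" "\<And>j::nat. \<omega> [^] j \<otimes> x \<in> B" shows "x = \<zero>"
proof -
  obtain r :: nat and a y where c: "galois_coords E L A \<pi> G F act r a y" "\<And>k. k < r \<Longrightarrow> y k \<in> B"
    using integral_coordinates by blast
  interpret galois_coords E L A \<pi> G F act r a y by (rule c(1))
  show ?thesis
  proof (rule t_inj[OF assms(1)])
    fix k assume k: "k < r"
    show "t k x = \<zero>"
    proof (rule separated)
      show "\<omega> [^] j \<otimes> t k x \<in> A" for j :: nat
      proof -
        have "\<omega> [^] j \<otimes> x \<otimes> y k \<in> B" using B_closed(2)[OF assms(2) c(2)[OF k]] .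
        then have "t k (\<omega> [^] j \<otimes> x) \<in> A" unfolding t_def by (rule tr_B)
        then show ?thesis using t_smult[of k "\<omega> [^] j" x] k assms(1) by simp
      qed
    qed (use k assms in simp)
  qed
qed

lemma lin_trace: "z \<in> B \<Longrightarrow> lin B (\<lambda>x. tr (x \<otimes> z))"
  unfolding lin_def by (auto simp: l_distr tr_add m_assoc tr_smult)

text \<open>The invariants of \<open>H\<close> are the joint kernel of the finitely many integral
  functionals sending x to t_k(h x - x), so \<open>lin_extend\<close> applies. This is what makes
  restriction of functionals between levels surjective.\<close>

lemma extend_from_invariants:
  assumes H: "H \<subseteq> carrier G" and "lin {x \<in> B. \<forall>h\<in>H. act h x = x} \<phi>"
  obtains \<phi>' where "lin B \<phi>'" "\<And>x. x \<in> B \<Longrightarrow> (\<And>h. h \<in> H \<Longrightarrow> act h x = x) \<Longrightarrow> \<phi>' x = \<phi> x"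
proof -
  obtain r :: nat and a y where c: "galois_coords E L A \<pi> G F act r a y" "\<And>k. k < r \<Longrightarrow> y k \<in> B"
    using integral_coordinates by blast
  interpret galois_coords E L A \<pi> G F act r a y by (rule c(1))
  define \<psi> where "\<psi> = (\<lambda>(h, k) x. t k (act h x \<ominus> x))"
  have fH: "finite H" using finite_subset[OF H] by simp
  have lin\<psi>: "lin B (\<psi> i)" if iI: "i \<in> H \<times> {..<r}" for i
  proof -
    obtain h k where i: "i = (h, k)" "h \<in> carrier G" "k < r" using iI H by auto
    have 1: "act h (x \<oplus> z) \<ominus> (x \<oplus> z) = (act h x \<ominus> x) \<oplus> (act h z \<ominus> z)" if "x \<in> F" "z \<in> F" for x z
      using i that by (simp add: act_add minus_eq minus_add a_ac)
    have 2: "act h (b \<otimes> x) \<ominus> b \<otimes> x = b \<otimes> (act h x \<ominus> x)" if "x \<in> F" "b \<in> A" for x b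
      using i that by (simp add: act_mult minus_eq r_distr r_minus)
    have "t k (act h x \<ominus> x) \<in> A" if "x \<in> B" for x
      using i that c(2)[of k] unfolding t_def by simp
    then show ?thesis using i unfolding lin_def \<psi>_def by (auto simp: 1 2 t_add t_smult)
  qed
  have ker: "(\<forall>i\<in>H \<times> {..<r}. \<psi> i x = \<zero>) \<longleftrightarrow> (\<forall>h\<in>H. act h x = x)" if x: "x \<in> B" for x
  proof
    assume *: "\<forall>i\<in>H \<times> {..<r}. \<psi> i x = \<zero>"
    show "\<forall>h\<in>H. act h x = x"
    proof
      fix h assume h: "h \<in> H"
      then have hG: "h \<in> carrier G" using H by auto
      have "act h x \<ominus> x = \<zero>"
      proof (rule t_inj)
        show "t k (act h x \<ominus> x) = \<zero>" if "k < r" for k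
          using bspec[OF *, of "(h, k)"] h that by (simp add: \<psi>_def)
      qed (use hG x in simp)
      then show "act h x = x" using x hG by simp
    qed
  next
    assume *: "\<forall>h\<in>H. act h x = x"
    show "\<forall>i\<in>H \<times> {..<r}. \<psi> i x = \<zero>"
      using * x by (auto simp: \<psi>_def t_zero minus_eq r_neg)
  qed
  have "{x \<in> B. \<forall>i\<in>H \<times> {..<r}. \<psi> i x = \<zero>} = {x \<in> B. \<forall>h\<in>H. act h x = x}" using ker by blast
  then have K: "lin {x \<in> B. \<forall>i\<in>H \<times> {..<r}. \<psi> i x = \<zero>} \<phi>" using assms(2) by simp
  have fin: "finite (H \<times> {..<r})" using fH by simp
  obtain \<phi>' where \<phi>': "lin B \<phi>'" "\<forall>x\<in>B. (\<forall>i\<in>H \<times> {..<r}. \<psi> i x = \<zero>) \<longrightarrow> \<phi>' x = \<phi> x"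
    using lin_extend[OF fin submod_B lin\<psi> K] by blast
  show ?thesis using that[OF \<phi>'(1)] \<phi>'(2) ker by blast
qed

text \<open>The line through \<open>x\<close> is the joint kernel of the \<open>2 \<times> 2\<close> minors.\<close>

lemma unimodular_functional:
  assumes x: "x \<in> B" "\<omega> \<otimes> x \<notin> B"
  obtains \<phi> where "lin B \<phi>" "\<phi> x = \<one>"
proof -
  obtain r :: nat and a y where c: "galois_coords E L A \<pi> G F act r a y" "\<And>k. k < r \<Longrightarrow> y k \<in> B"
    using integral_coordinates by blast
  interpret galois_coords E L A \<pi> G F act r a y by (rule c(1))
  have tA [simp]: "t k z \<in> A" if "k < r" "z \<in> B" for k z using c(2) that unfolding t_def by simp
  have xnz: "x \<noteq> \<zero>" using x by auto
  define \<psi> where "\<psi> = (\<lambda>(k, l) z. t k z \<otimes> t l x \<ominus> t l z \<otimes> t k x)"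
  let ?I = "{..<r} \<times> {..<r}"
  let ?K = "{z \<in> B. \<forall>i\<in>?I. \<psi> i z = \<zero>}"
  have lin\<psi>: "lin B (\<psi> i)" if "i \<in> ?I" for i
    using that x unfolding lin_def \<psi>_def
    by (auto simp: t_add t_smult ring_norm)
  have K: "z \<otimes> inv x \<in> A" if z: "z \<in> ?K" for z
  proof -
    have zB: "z \<in> B" using z by blast
    obtain l where l: "l < r" "t l x \<noteq> \<zero>" using t_inj[of x] xnz x by auto
    define q where "q = t l z \<otimes> inv (t l x)"
    have q: "q \<in> L" using zB l x unfolding q_def by simp
    have qx: "z = q \<otimes> x"
    proof -
      have "t k (z \<ominus> q \<otimes> x) = \<zero>" if k: "k < r" for k
      proof -
        have "\<psi> (k, l) z = \<zero>" using z k l by blast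
        then have "t k z \<otimes> t l x \<ominus> t l z \<otimes> t k x = \<zero>" by (simp add: \<psi>_def)
        then have *: "t k z \<otimes> t l x = t l z \<otimes> t k x" using zB x k l by simp
        have "q \<otimes> t k x = inv (t l x) \<otimes> (t l z \<otimes> t k x)"
          unfolding q_def using zB x k l by (simp add: m_ac)
        also have "\<dots> = inv (t l x) \<otimes> (t k z \<otimes> t l x)" using * by simp
        also have "\<dots> = t k z" using zB x k l by (simp add: mult_cancel_simps)
        finally show ?thesis using zB x k q by (simp add: t_minus t_smult)
      qed
      then have "z \<ominus> q \<otimes> x = \<zero>" using zB x q by (rule_tac t_inj) simp_all
      then show ?thesis using zB x q by simp
    qed
    \<comment> \<open>If \<open>q\<close> were not integral, its inverse would lie in \<pi>A, and x
      = z / q would be divisible by \<pi>.\<close>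
    have "q \<in> A"
    proof (rule ccontr)
      assume "q \<notin> A"
      then have v: "q \<noteq> \<zero>" "inv q \<in> A" "\<omega> \<otimes> inv q \<in> A" using valuation_ring q by auto
      have "\<omega> \<otimes> x = (\<omega> \<otimes> inv q) \<otimes> z" unfolding qx using v x q by (simp add: m_assoc)
      also have "\<dots> \<in> B" using v(3) zB by (rule_tac A_B_smult) auto
      finally show False using x by simp
    qed
    then show ?thesis unfolding qx using x q xnz by (simp add: m_assoc)
  qed
  have Klin: "lin ?K (\<lambda>z. z \<otimes> inv x)"
    unfolding lin_def using K x xnz by (auto simp: l_distr m_assoc)
  have fin: "finite ?I" by simp
  obtain \<phi> where \<phi>: "lin B \<phi>" "\<forall>z\<in>B. (\<forall>i\<in>?I. \<psi> i z = \<zero>) \<longrightarrow> \<phi> z = z \<otimes> inv x"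
    using lin_extend[OF fin submod_B lin\<psi> Klin] by blast
  have "\<forall>i\<in>?I. \<psi> i x = \<zero>" using x by (auto simp: \<psi>_def m_comm minus_eq r_neg)
  then have "\<phi> x = \<one>" using \<phi>(2) x xnz by simp
  then show ?thesis using that \<phi> by blast
qed

lemma op_zero:
  assumes "c \<in> carrier G \<rightarrow> F" "\<And>x. x \<in> B \<Longrightarrow> op c x = \<zero>" "g \<in> carrier G" shows "c g = \<zero>"
proof -
  obtain r :: nat and a y where c: "galois_coords E L A \<pi> G F act r a y" "\<And>k. k < r \<Longrightarrow> y k \<in> B"
    using integral_coordinates by blast
  interpret galois_coords E L A \<pi> G F act r a y by (rule c(1))
  have "(\<Oplus>k\<in>{..<r}. op c (y k) \<otimes> act g (a k)) = (\<Oplus>k\<in>{..<r}. \<zero>)"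
    using assms c(2) by (intro finsum_cong') auto
  then show ?thesis using op_recover[OF assms(1,3)] by (simp add: finsum_zero)
qed

lemma op_inj:
  assumes "c \<in> carrier G \<rightarrow> F" "d \<in> carrier G \<rightarrow> F" "\<And>x. x \<in> B \<Longrightarrow> op c x = op d x" "g \<in> carrier G"
  shows "c g = d g"
proof -
  have cg: "c g \<in> F" "d g \<in> F" if "g \<in> carrier G" for g
    using assms(1,2) that by (auto dest: funcset_mem)
  have "c g \<ominus> d g = \<zero>"
  proof (rule op_zero[of "\<lambda>g. c g \<ominus> d g"])
    fix x assume x: "x \<in> B"
    have "op (\<lambda>g. c g \<ominus> d g) x \<oplus> op d x = (\<Oplus>g\<in>carrier G. (c g \<ominus> d g) \<otimes> act g x \<oplus> d g \<otimes> act g x)"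
      unfolding op_def using x cg by (intro finsum_addf[symmetric]) auto
    also have "\<dots> = op c x" unfolding op_def
      using x cg by (intro finsum_cong') (auto simp: minus_eq l_distr l_minus a_assoc l_neg)
    finally have "op (\<lambda>g. c g \<ominus> d g) x \<oplus> op c x = op c x" using assms(3)[OF x] by simp
    moreover have "op (\<lambda>g. c g \<ominus> d g) x \<in> F" "op c x \<in> F" using x cg by auto
    ultimately show "op (\<lambda>g. c g \<ominus> d g) x = \<zero>" by (metis F_mem add.r_cancel_one)
  qed (use assms cg in auto)
  then show ?thesis using cg assms(4) by simp
qed

end

section \<open>Generators of the dual lattice\<close>

context galois_level
begin

text \<open>\<open>b\<close> generates the dual lattice as a module over the group ring, tested modulo \<open>\<pi>\<close>.\<close>

definition dual_generator :: "('a \<Rightarrow> 'a) \<Rightarrow> bool" where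
  "dual_generator b \<longleftrightarrow> lin B b \<and>
     (\<forall>x\<in>B. (\<forall>g\<in>carrier G. \<omega> \<otimes> b (act g x) \<in> A) \<longrightarrow> \<omega> \<otimes> x \<in> B)"

lemma omega_act: "g \<in> carrier G \<Longrightarrow> x \<in> F \<Longrightarrow> act g (\<omega> \<otimes> x) = \<omega> \<otimes> act g x"
  by (simp add: act_mult)

lemma lin_omega_B:
  assumes "lin B b" "x \<in> B" "\<omega> \<otimes> x \<in> B" shows "b (\<omega> \<otimes> x) = \<omega> \<otimes> b x"
proof -
  have "b x = \<pi> \<otimes> b (\<omega> \<otimes> x)" using lin_omega[OF assms(1) submod_B _ assms(3)] assms(2) by simp
  then show ?thesis using linD(1)[OF assms(1,3)] by simp
qed

text \<open>If all orbit values vanish, the criterion allows division by \<pi>, and the quotient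
  again has vanishing orbit values; an element divisible by every power of \<pi> is zero.\<close>

lemma dual_generator_inj:
  assumes b: "dual_generator b" and x: "x \<in> B" "\<And>g. g \<in> carrier G \<Longrightarrow> b (act g x) = \<zero>"
  shows "x = \<zero>"
proof -
  have lin: "lin B b" using b by (simp add: dual_generator_def)
  have "\<omega> [^] j \<otimes> x \<in> B \<and> (\<forall>g\<in>carrier G. b (act g (\<omega> [^] j \<otimes> x)) = \<zero>)" for j :: nat
  proof (induction j)
    case 0 then show ?case using x by simp
  next
    case (Suc j)
    let ?z = "\<omega> [^] j \<otimes> x"
    have z: "\<omega> \<otimes> ?z \<in> B" using Suc b unfolding dual_generator_def by simp
    have eq: "\<omega> [^] Suc j \<otimes> x = \<omega> \<otimes> ?z" using x by (simp add: m_ac)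
    have "b (act g (\<omega> \<otimes> ?z)) = \<zero>" if g: "g \<in> carrier G" for g
    proof -
      have e: "act g (\<omega> \<otimes> ?z) = \<omega> \<otimes> act g ?z" using g Suc by (intro omega_act) auto
      have "\<omega> \<otimes> act g ?z \<in> B" using B_act[OF g z] unfolding e .
      then have "b (\<omega> \<otimes> act g ?z) = \<omega> \<otimes> b (act g ?z)" using Suc g by (intro lin_omega_B lin) auto
      then show ?thesis unfolding e using Suc g by simp
    qed
    then show ?case unfolding eq using z by blast
  qed
  then show ?thesis using separated_B[of x] x by simp
qed

lemma dual_generator_eqI:
  assumes b: "dual_generator b" and "x \<in> B" "z \<in> B" "\<And>g. g \<in> carrier G \<Longrightarrow> b (act g x) = b (act g z)"
  shows "x = z"
proof -
  have lin: "lin B b" using b by (simp add: dual_generator_def)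
  have "x \<ominus> z = \<zero>"
  proof (rule dual_generator_inj[OF b])
    show "b (act g (x \<ominus> z)) = \<zero>" if g: "g \<in> carrier G" for g
      using assms g linD(1)[OF lin, of "act g z"]
      by (simp add: act_minus lin_minus[OF lin submod_B])
  qed (use assms in simp)
  then show ?thesis using assms by simp
qed

lemma carrier_split: "insert \<one>\<^bsub>G\<^esub> (carrier G - {\<one>\<^bsub>G\<^esub>}) = carrier G" by auto

text \<open>Elimination gives an element whose orbit values are supported at the identity, with some
  nonzero value there; the criterion then removes the factors \<pi> from it. The translates of the
  result are the basis of \<open>B\<close> dual to the translates of \<open>b\<close>.\<close>

lemma dual_generator_dual_basis:
  assumes b: "dual_generator b"
  obtains x where "x \<in> B" "\<And>g. g \<in> carrier G \<Longrightarrow> b (act g x) = (if g = \<one>\<^bsub>G\<^esub> then \<one> else \<zero>)"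
proof -
  have lin: "lin B b" using b by (simp add: dual_generator_def)
  note bA = linD(1)[OF lin]
  let ?J = "carrier G - {\<one>\<^bsub>G\<^esub>}"
  let ?S = "(\<lambda>x g. b (act g x)) ` B"
  have "\<exists>s\<in>?S. s \<one>\<^bsub>G\<^esub> \<noteq> \<zero> \<and> (\<forall>j\<in>?J. s j = \<zero>)"
  proof (rule unit_vector_multiple, unfold carrier_split)
    show "\<exists>s''\<in>?S. \<forall>j\<in>carrier G. s'' j = a \<otimes> s j \<oplus> a' \<otimes> s' j"
      if sS: "s \<in> ?S" "s' \<in> ?S" and a: "a \<in> A" "a' \<in> A" for s s' a a'
    proof -
      obtain x x' where x: "x \<in> B" "x' \<in> B" "s = (\<lambda>g. b (act g x))" "s' = (\<lambda>g. b (act g x'))"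
        using sS by blast
      have "b (act j (a \<otimes> x \<oplus> a' \<otimes> x')) = a \<otimes> s j \<oplus> a' \<otimes> s' j" if "j \<in> carrier G" for j
        using that x a by (simp add: act_add act_mult linD[OF lin])
      then show ?thesis using x a by (intro bexI[of _ "\<lambda>g. b (act g (a \<otimes> x \<oplus> a' \<otimes> x'))"]) auto
    qed
    fix c assume c: "\<And>j. j \<in> carrier G \<Longrightarrow> c j \<in> A"
      and c0: "\<And>s. s \<in> ?S \<Longrightarrow> (\<Oplus>j\<in>carrier G. c j \<otimes> s j) = \<zero>"
    have opB: "op c x \<in> B" if "x \<in> B" for x
      unfolding op_def using c that by (intro B_finsum) simp
    \<comment> \<open>Because the group is abelian, the orbit values of \<open>op c x\<close> are
      the relation \<open>c\<close> evaluated at translates of \<open>x\<close>, so they vanish.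
      Independence of the group elements then gives c = 0.\<close>
    have "op c x = \<zero>" if x: "x \<in> B" for x
    proof (rule dual_generator_inj[OF b opB[OF x]])
      fix h assume h: "h \<in> carrier G"
      have "act h (op c x) = (\<Oplus>g\<in>carrier G. act h (c g \<otimes> act g x))"
        unfolding op_def using c x h by (intro act_finsum) auto
      also have "\<dots> = (\<Oplus>g\<in>carrier G. c g \<otimes> act g (act h x))"
        using c x h by (intro finsum_cong') (auto simp: act_mult GG.m_comm[of h] simp flip: act_comp)
      finally have "b (act h (op c x)) = b (\<Oplus>g\<in>carrier G. c g \<otimes> act g (act h x))" by simp
      also have "\<dots> = (\<Oplus>g\<in>carrier G. c g \<otimes> b (act g (act h x)))"
        using c x h by (intro lin_finsum_smult[OF lin submod_B]) auto
      also have "\<dots> = \<zero>" using x h by (intro c0) auto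
      finally show "b (act h (op c x)) = \<zero>" .
    qed
    then show "\<forall>j\<in>carrier G. c j = \<zero>" using op_zero[of c] c by auto
  qed (use bA in auto)
  then obtain x where x: "x \<in> B" "b (act \<one>\<^bsub>G\<^esub> x) \<noteq> \<zero>" "\<forall>j\<in>?J. b (act j x) = \<zero>" by auto
  obtain j :: nat and u where u: "u \<in> A" "inv u \<in> A" "b x = \<pi> [^] j \<otimes> u"
    using factor[of "b x"] x bA by auto
  have unz: "u \<noteq> \<zero>" using u x by auto
  \<comment> \<open>Induction on the exponent \<open>j\<close> of \<pi> in the value at the
    identity: each step divides the vector by \<pi>, and the unit \<open>u\<close> is divided out at
    the end.\<close>
  have "\<exists>x\<in>B. \<forall>g\<in>carrier G. b (act g x) = (if g = \<one>\<^bsub>G\<^esub> then \<one> else \<zero>)"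
    if "x \<in> B" "\<forall>g\<in>carrier G. b (act g x) = (if g = \<one>\<^bsub>G\<^esub> then \<pi> [^] j \<otimes> u else \<zero>)" for x and j :: nat
    using that
  proof (induction j arbitrary: x)
    case 0
    have "b (act g (inv u \<otimes> x)) = (if g = \<one>\<^bsub>G\<^esub> then \<one> else \<zero>)" if g: "g \<in> carrier G" for g
    proof -
      have "b (act g (inv u \<otimes> x)) = inv u \<otimes> b (act g x)"
        using g 0 u by (simp add: act_mult linD(3)[OF lin])
      then show ?thesis using 0 u unz g by simp
    qed
    then show ?case using 0 u by (intro bexI[of _ "inv u \<otimes> x"]) auto
  next
    case (Suc j)
    have om: "\<omega> \<otimes> b (act g x) = (if g = \<one>\<^bsub>G\<^esub> then \<pi> [^] j \<otimes> u else \<zero>)" if "g \<in> carrier G" for g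
      using Suc.prems(2) that u by (simp add: m_ac mult_cancel_simps)
    have "\<omega> \<otimes> b (act g x) \<in> A" if "g \<in> carrier G" for g
      unfolding om[OF that] using u by simp
    then have wx: "\<omega> \<otimes> x \<in> B" using b Suc.prems(1) unfolding dual_generator_def by blast
    show ?case
    proof (rule Suc.IH[OF wx], intro ballI)
      fix g assume g: "g \<in> carrier G"
      have e: "act g (\<omega> \<otimes> x) = \<omega> \<otimes> act g x" using g Suc by (intro omega_act) auto
      have "\<omega> \<otimes> act g x \<in> B" using B_act[OF g wx] unfolding e .
      then have "b (\<omega> \<otimes> act g x) = \<omega> \<otimes> b (act g x)" using Suc.prems g by (intro lin_omega_B lin) auto
      then show "b (act g (\<omega> \<otimes> x)) = (if g = \<one>\<^bsub>G\<^esub> then \<pi> [^] j \<otimes> u else \<zero>)"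
        unfolding e using om[OF g] by simp
    qed
  qed
  from this[of x j] have "\<exists>x\<in>B. \<forall>g\<in>carrier G. b (act g x) = (if g = \<one>\<^bsub>G\<^esub> then \<one> else \<zero>)"
    using x u by auto
  then show ?thesis using that by blast
qed

lemma dual_basis_coefficient:
  assumes b: "lin B b" and x: "x \<in> B"
    "\<And>g. g \<in> carrier G \<Longrightarrow> b (act g x) = (if g = \<one>\<^bsub>G\<^esub> then \<one> else \<zero>)"
    and c: "\<And>g. g \<in> carrier G \<Longrightarrow> c g \<in> A" and h: "h \<in> carrier G"
  shows "b (act h (\<Oplus>g\<in>carrier G. c g \<otimes> act (inv\<^bsub>G\<^esub> g) x)) = c h"
proof -
  have "act h (\<Oplus>g\<in>carrier G. c g \<otimes> act (inv\<^bsub>G\<^esub> g) x) = (\<Oplus>g\<in>carrier G. act h (c g \<otimes> act (inv\<^bsub>G\<^esub> g) x))"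
    using c x h by (intro act_finsum) auto
  also have "\<dots> = (\<Oplus>g\<in>carrier G. c g \<otimes> act (h \<otimes>\<^bsub>G\<^esub> inv\<^bsub>G\<^esub> g) x)"
    using c x h by (intro finsum_cong') (auto simp: act_mult act_comp)
  finally have "b (act h (\<Oplus>g\<in>carrier G. c g \<otimes> act (inv\<^bsub>G\<^esub> g) x))
      = b (\<Oplus>g\<in>carrier G. c g \<otimes> act (h \<otimes>\<^bsub>G\<^esub> inv\<^bsub>G\<^esub> g) x)" by simp
  also have "\<dots> = (\<Oplus>g\<in>carrier G. c g \<otimes> b (act (h \<otimes>\<^bsub>G\<^esub> inv\<^bsub>G\<^esub> g) x))"
    using c x h by (intro lin_finsum_smult[OF b submod_B]) auto
  also have "\<dots> = (\<Oplus>g\<in>carrier G. if g = h then c h else \<zero>)"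
  proof (intro finsum_cong')
    fix g assume g: "g \<in> carrier G"
    have "h \<otimes>\<^bsub>G\<^esub> inv\<^bsub>G\<^esub> g = \<one>\<^bsub>G\<^esub> \<longleftrightarrow> g = h"
      using g h by (metis GG.inv_closed GG.inv_inv GG.r_inv GG.inv_equality)
    then show "c g \<otimes> b (act (h \<otimes>\<^bsub>G\<^esub> inv\<^bsub>G\<^esub> g) x) = (if g = h then c h else \<zero>)"
      using x(2)[of "h \<otimes>\<^bsub>G\<^esub> inv\<^bsub>G\<^esub> g"] g h c[OF g] by auto
  qed (use c h in auto)
  also have "\<dots> = c h" using c h by (subst finsum_delta[of _ h]) auto
  finally show ?thesis .
qed

lemma dual_generator_surj:
  assumes b: "dual_generator b" and c: "\<And>g. g \<in> carrier G \<Longrightarrow> c g \<in> A"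
  obtains x where "x \<in> B" "\<And>g. g \<in> carrier G \<Longrightarrow> b (act g x) = c g"
proof -
  have lin: "lin B b" using b by (simp add: dual_generator_def)
  obtain x where x: "x \<in> B" "\<And>g. g \<in> carrier G \<Longrightarrow> b (act g x) = (if g = \<one>\<^bsub>G\<^esub> then \<one> else \<zero>)"
    using dual_generator_dual_basis[OF b] by blast
  have "(\<Oplus>g\<in>carrier G. c g \<otimes> act (inv\<^bsub>G\<^esub> g) x) \<in> B" using c x by (intro B_finsum) simp
  then show ?thesis by (rule that) (rule dual_basis_coefficient[OF lin x c])
qed

text \<open>The dual element forces the coefficients: \<open>c g\<close> is the value of
  \<open>\<phi>\<close> at its translate by the inverse of g. They do represent
  \<open>\<phi>\<close>, because every z in \<open>B\<close> expands in these translates with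
  coefficients b(g z).\<close>

lemma dual_generator_free:
  assumes b: "dual_generator b" and \<phi>: "lin B \<phi>"
  shows "\<exists>!c. c \<in> carrier G \<rightarrow>\<^sub>E A \<and> (\<forall>x\<in>B. \<phi> x = (\<Oplus>g\<in>carrier G. c g \<otimes> b (act g x)))"
proof -
  have lin: "lin B b" using b by (simp add: dual_generator_def)
  note bA = linD(1)[OF lin]
  obtain x where x: "x \<in> B" "\<And>g. g \<in> carrier G \<Longrightarrow> b (act g x) = (if g = \<one>\<^bsub>G\<^esub> then \<one> else \<zero>)"
    using dual_generator_dual_basis[OF b] by blast
  define c where "c = (\<lambda>g\<in>carrier G. \<phi> (act (inv\<^bsub>G\<^esub> g) x))"
  have "c \<in> carrier G \<rightarrow>\<^sub>E A" using linD(1)[OF \<phi>] x unfolding c_def by auto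
  moreover have "\<phi> z = (\<Oplus>g\<in>carrier G. c g \<otimes> b (act g z))" if z: "z \<in> B" for z
  proof -
    have "z = (\<Oplus>g\<in>carrier G. b (act g z) \<otimes> act (inv\<^bsub>G\<^esub> g) x)"
    proof (rule dual_generator_eqI[OF b z])
      show "(\<Oplus>g\<in>carrier G. b (act g z) \<otimes> act (inv\<^bsub>G\<^esub> g) x) \<in> B"
        using z x bA by (intro B_finsum) simp
      show "b (act h z) = b (act h (\<Oplus>g\<in>carrier G. b (act g z) \<otimes> act (inv\<^bsub>G\<^esub> g) x))"
        if "h \<in> carrier G" for h
        using dual_basis_coefficient[OF lin x, of "\<lambda>g. b (act g z)" h] that bA z by simp
    qed
    then have "\<phi> z = \<phi> (\<Oplus>g\<in>carrier G. b (act g z) \<otimes> act (inv\<^bsub>G\<^esub> g) x)" by simp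
    also have "\<dots> = (\<Oplus>g\<in>carrier G. b (act g z) \<otimes> \<phi> (act (inv\<^bsub>G\<^esub> g) x))"
      using z x bA by (intro lin_finsum_smult[OF \<phi> submod_B]) auto
    also have "\<dots> = (\<Oplus>g\<in>carrier G. c g \<otimes> b (act g z))"
      using z x bA linD(1)[OF \<phi>] by (intro finsum_cong') (auto simp: c_def m_comm)
    finally show ?thesis .
  qed
  moreover have "d = c"
    if d: "d \<in> carrier G \<rightarrow>\<^sub>E A" "\<forall>z\<in>B. \<phi> z = (\<Oplus>g\<in>carrier G. d g \<otimes> b (act g z))" for d
  proof (rule PiE_ext[OF d(1)])
    show "c \<in> carrier G \<rightarrow>\<^sub>E A" by fact
    fix h assume h: "h \<in> carrier G"
    have dA: "d g \<in> A" if "g \<in> carrier G" for g using d(1) that by auto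
    have "c h = \<phi> (act (inv\<^bsub>G\<^esub> h) x)" using h by (simp add: c_def)
    also have "\<dots> = (\<Oplus>g\<in>carrier G. d g \<otimes> b (act g (act (inv\<^bsub>G\<^esub> h) x)))" using d(2) h x by simp
    also have "\<dots> = (\<Oplus>g\<in>carrier G. if g = h then d h else \<zero>)"
    proof (intro finsum_cong')
      fix g assume g: "g \<in> carrier G"
      have gh: "g \<otimes>\<^bsub>G\<^esub> inv\<^bsub>G\<^esub> h = \<one>\<^bsub>G\<^esub> \<longleftrightarrow> g = h"
        using g h by (metis GG.inv_closed GG.inv_inv GG.r_inv GG.inv_equality)
      have "act g (act (inv\<^bsub>G\<^esub> h) x) = act (g \<otimes>\<^bsub>G\<^esub> inv\<^bsub>G\<^esub> h) x" using g h x by (simp add: act_comp)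
      then show "d g \<otimes> b (act g (act (inv\<^bsub>G\<^esub> h) x)) = (if g = h then d h else \<zero>)"
        using x(2)[of "g \<otimes>\<^bsub>G\<^esub> inv\<^bsub>G\<^esub> h"] g h dA[OF g] gh by auto
    qed (use dA h in auto)
    also have "\<dots> = d h" using dA h by (subst finsum_delta[of _ h]) auto
    finally show "d h = c h" by simp
  qed
  ultimately show ?thesis by blast
qed

text \<open>Evaluation against a generator identifies \<open>B\<close> with the functions \<open>G \<rightarrow> A\<close>, for which invariants
  modulo \<open>\<pi>\<close> lift.\<close>

lemma dual_generator_lift_invariants:
  assumes b: "dual_generator b" and P: "subgroup P G"
    and x: "x \<in> B" "\<And>g. g \<in> P \<Longrightarrow> \<omega> \<otimes> (act g x \<ominus> x) \<in> B"
  obtains z where "z \<in> B" "\<And>g. g \<in> P \<Longrightarrow> act g z = z" "\<omega> \<otimes> (x \<ominus> z) \<in> B"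
proof -
  have lin: "lin B b" using b by (simp add: dual_generator_def)
  note bA = linD(1)[OF lin]
  have PG: "g \<in> carrier G" if "g \<in> P" for g using subgroup.subset[OF P] that by blast
  define f where "f g = b (act g x)" for g
  \<comment> \<open>A representative of the coset gP. The choice depends on the coset alone, so
    \<open>f\<close> composed with \<open>rep\<close> is exactly invariant under \<open>P\<close>,
    while it agrees with \<open>f\<close> modulo \<pi>.\<close>
  define rep where "rep g = (SOME g'. \<exists>h\<in>P. g' = g \<otimes>\<^bsub>G\<^esub> h)" for g
  have rep: "\<exists>h\<in>P. rep g = g \<otimes>\<^bsub>G\<^esub> h" for g
    unfolding rep_def by (rule someI_ex) (use subgroup.one_closed[OF P] in blast)
  have rep_G: "rep g \<in> carrier G" if "g \<in> carrier G" for g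
    using rep[of g] that PG by auto
  have rep_cong: "rep (g \<otimes>\<^bsub>G\<^esub> h) = rep g" if g: "g \<in> carrier G" and h: "h \<in> P" for g h
  proof -
    have "(\<exists>h'\<in>P. g' = g \<otimes>\<^bsub>G\<^esub> h \<otimes>\<^bsub>G\<^esub> h') \<longleftrightarrow> (\<exists>h'\<in>P. g' = g \<otimes>\<^bsub>G\<^esub> h')" for g'
    proof
      assume "\<exists>h'\<in>P. g' = g \<otimes>\<^bsub>G\<^esub> h \<otimes>\<^bsub>G\<^esub> h'"
      then obtain h' where "h' \<in> P" "g' = g \<otimes>\<^bsub>G\<^esub> (h \<otimes>\<^bsub>G\<^esub> h')" using g h PG GG.m_assoc by metis
      then show "\<exists>h'\<in>P. g' = g \<otimes>\<^bsub>G\<^esub> h'" using subgroup.m_closed[OF P h] by blast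
    next
      assume "\<exists>h'\<in>P. g' = g \<otimes>\<^bsub>G\<^esub> h'"
      then obtain h' where h': "h' \<in> P" "g' = g \<otimes>\<^bsub>G\<^esub> h'" by blast
      have "inv\<^bsub>G\<^esub> h \<otimes>\<^bsub>G\<^esub> h' \<in> P" using subgroup.m_closed[OF P] subgroup.m_inv_closed[OF P] h h' by blast
      moreover have "g' = g \<otimes>\<^bsub>G\<^esub> h \<otimes>\<^bsub>G\<^esub> (inv\<^bsub>G\<^esub> h \<otimes>\<^bsub>G\<^esub> h')"
      proof -
        have "h \<otimes>\<^bsub>G\<^esub> (inv\<^bsub>G\<^esub> h \<otimes>\<^bsub>G\<^esub> h') = h'"
          using PG[OF h] PG[OF h'(1)] by (simp flip: GG.m_assoc)
        then show ?thesis using g PG[OF h] PG[OF h'(1)] h'(2) by (simp add: GG.m_assoc)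
      qed
      ultimately show "\<exists>h'\<in>P. g' = g \<otimes>\<^bsub>G\<^esub> h \<otimes>\<^bsub>G\<^esub> h'" by blast
    qed
    then show ?thesis unfolding rep_def by simp
  qed
  have fP: "\<omega> \<otimes> (f (g \<otimes>\<^bsub>G\<^esub> h) \<ominus> f g) \<in> A" if g: "g \<in> carrier G" and h: "h \<in> P" for g h
  proof -
    let ?d = "act h x \<ominus> x"
    have hG: "h \<in> carrier G" using PG h by blast
    have d: "?d \<in> B" using x hG by simp
    have "f (g \<otimes>\<^bsub>G\<^esub> h) \<ominus> f g = b (act g ?d)"
      unfolding f_def using g hG x by (simp add: act_comp act_minus lin_minus[OF lin submod_B])
    moreover have w: "\<omega> \<otimes> act g ?d \<in> B"
      using B_act[OF g x(2)[OF h]] omega_act[of g ?d] g d by simp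
    ultimately have "\<omega> \<otimes> (f (g \<otimes>\<^bsub>G\<^esub> h) \<ominus> f g) = b (\<omega> \<otimes> act g ?d)"
      using lin_omega_B[OF lin _ w] d g by simp
    then show ?thesis using bA[OF w] by simp
  qed
  obtain z where z: "z \<in> B" "\<And>g. g \<in> carrier G \<Longrightarrow> b (act g z) = f (rep g)"
    using dual_generator_surj[OF b, of "\<lambda>g. f (rep g)"] rep_G x bA unfolding f_def by auto
  have inv: "act h z = z" if h: "h \<in> P" for h
  proof (rule dual_generator_eqI[OF b])
    show "b (act g (act h z)) = b (act g z)" if g: "g \<in> carrier G" for g
    proof -
      have "b (act g (act h z)) = b (act (g \<otimes>\<^bsub>G\<^esub> h) z)" using g PG[OF h] z by (simp add: act_comp)
      also have "\<dots> = b (act g z)" using z(2) g PG[OF h] rep_cong[OF g h] by simp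
      finally show ?thesis .
    qed
  qed (use z PG[OF h] in auto)
  have "\<omega> \<otimes> b (act g (x \<ominus> z)) \<in> A" if g: "g \<in> carrier G" for g
  proof -
    obtain h where h: "h \<in> P" "rep g = g \<otimes>\<^bsub>G\<^esub> h" using rep by blast
    have m: "f g \<in> A" "f (rep g) \<in> A" using g rep_G[OF g] x bA unfolding f_def by auto
    have "b (act g (x \<ominus> z)) = f g \<ominus> f (rep g)"
      using g x z z(2)[OF g] by (simp add: act_minus lin_minus[OF lin submod_B] f_def)
    also have "\<dots> = \<ominus> (f (rep g) \<ominus> f g)" using m by (simp add: minus_eq minus_add a_comm)
    finally have "\<omega> \<otimes> b (act g (x \<ominus> z)) = \<ominus> (\<omega> \<otimes> (f (rep g) \<ominus> f g))" using m by (simp add: r_minus)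
    then show ?thesis using fP[OF g h(1)] h(2) by simp
  qed
  then have "\<omega> \<otimes> (x \<ominus> z) \<in> B" using b x z unfolding dual_generator_def by simp
  then show ?thesis using that z inv by blast
qed

end

section \<open>Group rings of finite abelian groups\<close>

lemma (in cring) binomial_expansion:
  assumes x: "x \<in> carrier R" and y: "y \<in> carrier R"
  shows "(x \<oplus> y) [^] n = (\<Oplus>k\<in>{..n}. [(n choose k)] \<cdot> (x [^] k \<otimes> y [^] (n - k)))"
proof (induction n)
  case 0
  then show ?case using x y by simp
next
  case (Suc n)
  let ?f = "\<lambda>k. [(n choose k)] \<cdot> (x [^] k \<otimes> y [^] (n - k))"
  let ?g = "\<lambda>k. [(n choose k)] \<cdot> (x [^] k \<otimes> y [^] (Suc n - k))"
  have 1: "(\<Oplus>k\<in>{..n}. ?f k) \<otimes> x = (\<Oplus>k\<in>{..n}. [(n choose k)] \<cdot> (x [^] Suc k \<otimes> y [^] (n - k)))"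
  proof -
    have "(\<Oplus>k\<in>{..n}. ?f k) \<otimes> x = (\<Oplus>k\<in>{..n}. ?f k \<otimes> x)"
      using x y by (intro finsum_ldistr) auto
    also have "\<dots> = (\<Oplus>k\<in>{..n}. [(n choose k)] \<cdot> (x [^] Suc k \<otimes> y [^] (n - k)))"
      using x y by (intro finsum_cong') (auto simp: add_pow_ldistr add_pow_rdistr m_ac)
    finally show ?thesis .
  qed
  have 2: "(\<Oplus>k\<in>{..n}. ?f k) \<otimes> y = (\<Oplus>k\<in>{..n}. ?g k)"
  proof -
    have "(\<Oplus>k\<in>{..n}. ?f k) \<otimes> y = (\<Oplus>k\<in>{..n}. ?f k \<otimes> y)"
      using x y by (intro finsum_ldistr) auto
    also have "\<dots> = (\<Oplus>k\<in>{..n}. ?g k)"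
      using x y by (intro finsum_cong') (auto simp: add_pow_ldistr add_pow_rdistr m_ac Suc_diff_le)
    finally show ?thesis .
  qed
  have 3: "(\<Oplus>k\<in>{..n}. ?g k) = (\<Oplus>k\<in>{..Suc n}. ?g k)"
    using x y by (subst finsum_Suc) (auto simp: binomial_eq_0 intro!: finsum_closed)
  have 4: "(\<Oplus>k\<in>{..Suc n}. ?g k) = (\<Oplus>k\<in>{..n}. ?g (Suc k)) \<oplus> ?g 0"
    using x y by (intro finsum_Suc2) auto
  have "(x \<oplus> y) [^] Suc n = (\<Oplus>k\<in>{..n}. ?f k) \<otimes> x \<oplus> (\<Oplus>k\<in>{..n}. ?f k) \<otimes> y"
    using x y Suc by (simp add: r_distr)
  also have "\<dots> = (\<Oplus>k\<in>{..n}. [(n choose k)] \<cdot> (x [^] Suc k \<otimes> y [^] (n - k))) \<oplus>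
      ((\<Oplus>k\<in>{..n}. ?g (Suc k)) \<oplus> ?g 0)"
    unfolding 1 2 3 4 ..
  also have "\<dots> = ((\<Oplus>k\<in>{..n}. [(n choose k)] \<cdot> (x [^] Suc k \<otimes> y [^] (n - k))) \<oplus>
      (\<Oplus>k\<in>{..n}. ?g (Suc k))) \<oplus> ?g 0"
    using x y by (intro a_assoc[symmetric]) (auto intro!: finsum_closed)
  also have "(\<Oplus>k\<in>{..n}. [(n choose k)] \<cdot> (x [^] Suc k \<otimes> y [^] (n - k))) \<oplus> (\<Oplus>k\<in>{..n}. ?g (Suc k))
      = (\<Oplus>k\<in>{..n}. [(n choose k)] \<cdot> (x [^] Suc k \<otimes> y [^] (n - k)) \<oplus> ?g (Suc k))"
    using x y by (intro finsum_addf[symmetric]) auto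
  also have "\<dots> = (\<Oplus>k\<in>{..n}. [(Suc n choose Suc k)] \<cdot> (x [^] Suc k \<otimes> y [^] (Suc n - Suc k)))"
    using x y by (intro finsum_cong') (auto simp: add.nat_pow_mult[symmetric])
  also have "\<dots> \<oplus> ?g 0 = (\<Oplus>k\<in>{..Suc n}. [(Suc n choose k)] \<cdot> (x [^] k \<otimes> y [^] (Suc n - k)))"
    using x y by (subst finsum_Suc2) auto
  finally show ?case .
qed

text \<open>The multiple of p is kept as an explicit term, because the rings of application are
  group rings over \<open>A\<close>, where p is only known to be divisible by \<pi>.\<close>

lemma (in cring) freshman:
  fixes p :: nat
  assumes p: "Factorial_Ring.prime p" and x: "x \<in> carrier R" and y: "y \<in> carrier R"
  obtains z where "z \<in> carrier R" "(x \<oplus> y) [^] p = x [^] p \<oplus> y [^] p \<oplus> [p] \<cdot> z"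
proof -
  let ?f = "\<lambda>k. [(p choose k)] \<cdot> (x [^] k \<otimes> y [^] (p - k))"
  have f: "?f \<in> A \<rightarrow> carrier R" for A using x y by auto
  obtain q where q: "p = Suc (Suc q)"
    using prime_ge_2_nat[OF p] by (metis Suc_le_D numeral_2_eq_2 Suc_le_mono)
  let ?M = "{[p] \<cdot> z | z. z \<in> carrier R}"
  have "(\<Oplus>k\<in>{..q}. ?f (Suc k)) \<in> ?M"
  proof (rule finsum_mem)
    show "\<zero> \<in> ?M" by (intro CollectI exI[of _ \<zero>]) simp
    fix u v assume "u \<in> ?M" "v \<in> ?M"
    then obtain a b where ab: "a \<in> carrier R" "b \<in> carrier R" "u = [p] \<cdot> a" "v = [p] \<cdot> b" by blast
    then have "u \<oplus> v = [p] \<cdot> (a \<oplus> b)" by (simp add: add.nat_pow_distrib)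
    then show "u \<oplus> v \<in> ?M" using ab by blast
  next
    fix k assume "k \<in> {..q}"
    then have "p dvd (p choose Suc k)" using q by (intro dvd_choose_prime p) auto
    then obtain m where "(p choose Suc k) = p * m" by (rule dvdE)
    then have "?f (Suc k) = [p] \<cdot> ([m] \<cdot> (x [^] Suc k \<otimes> y [^] (p - Suc k)))"
      using x y by (simp add: add.nat_pow_pow mult.commute)
    then show "?f (Suc k) \<in> ?M" using x y by blast
  qed auto
  then obtain z where z: "z \<in> carrier R" "(\<Oplus>k\<in>{..q}. ?f (Suc k)) = [p] \<cdot> z" by blast
  have "(x \<oplus> y) [^] p = (\<Oplus>k\<in>{..Suc (Suc q)}. ?f k)"
    using binomial_expansion[OF x y, of p] unfolding q .
  also have "\<dots> = ?f (Suc (Suc q)) \<oplus> (\<Oplus>k\<in>{..Suc q}. ?f k)" by (rule finsum_Suc[OF f])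
  also have "(\<Oplus>k\<in>{..Suc q}. ?f k) = (\<Oplus>k\<in>{..q}. ?f (Suc k)) \<oplus> ?f 0" by (rule finsum_Suc2[OF f])
  also have "?f (Suc (Suc q)) = x [^] p" using x y unfolding q by simp
  also have "?f 0 = y [^] p" using x y by simp
  finally have "(x \<oplus> y) [^] p = x [^] p \<oplus> y [^] p \<oplus> [p] \<cdot> z"
    using x y z by (simp add: a_ac)
  then show ?thesis using that z by blast
qed

section \<open>The group ring over A and its action\<close>

context galois_level
begin

abbreviation AR where "AR \<equiv> E\<lparr>carrier := A\<rparr>"
abbreviation GR where "GR \<equiv> group_ring AR G"

lemma finsum_AR:
  assumes "\<And>i. i \<in> I \<Longrightarrow> f i \<in> A" shows "finsum AR f I = finsum E f I"
proof (cases "finite I")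
  case True
  interpret AR: ring AR by (rule subring_is_ring[OF subring_A])
  show ?thesis using True assms
  proof (induction I)
    case (insert i I)
    have "finsum AR f (insert i I) = f i \<oplus>\<^bsub>AR\<^esub> finsum AR f I"
      using insert by (intro AR.finsum_insert) auto
    also have "\<dots> = f i \<oplus> finsum E f I" using insert by simp
    also have "\<dots> = finsum E f (insert i I)"
      using insert by (intro finsum_insert[symmetric]) auto
    finally show ?case .
  qed simp
qed (simp add: finsum_def finprod_def)

lemma GR_carrier: "carrier GR = carrier G \<rightarrow>\<^sub>E A"
  by (auto simp: group_ring_def)

lemma GR_mem: "c \<in> carrier GR \<Longrightarrow> g \<in> carrier G \<Longrightarrow> c g \<in> A"
  by (auto simp: GR_carrier)

lemma GR_mem_F [simp]: "c \<in> carrier GR \<Longrightarrow> g \<in> carrier G \<Longrightarrow> c g \<in> F"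
  using GR_mem by simp

lemma GR_Pi: "c \<in> carrier GR \<Longrightarrow> c \<in> carrier G \<rightarrow> F" by auto

lemma GR_add: "g \<in> carrier G \<Longrightarrow> (c \<oplus>\<^bsub>GR\<^esub> d) g = c g \<oplus> d g"
  by (simp add: group_ring_def)

lemma GR_zero: "g \<in> carrier G \<Longrightarrow> \<zero>\<^bsub>GR\<^esub> g = \<zero>"
  by (simp add: group_ring_def)

lemma GR_one: "g \<in> carrier G \<Longrightarrow> \<one>\<^bsub>GR\<^esub> g = (if g = \<one>\<^bsub>G\<^esub> then \<one> else \<zero>)"
  by (simp add: group_ring_def)

lemma GR_mult:
  assumes c: "c \<in> carrier GR" and d: "d \<in> carrier GR" and g: "g \<in> carrier G"
  shows "(c \<otimes>\<^bsub>GR\<^esub> d) g = (\<Oplus>h\<in>carrier G. c h \<otimes> d (inv\<^bsub>G\<^esub> h \<otimes>\<^bsub>G\<^esub> g))"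
proof -
  have dm: "d (inv\<^bsub>G\<^esub> h \<otimes>\<^bsub>G\<^esub> g) \<in> A" if "h \<in> carrier G" for h using GR_mem[OF d] g that by simp
  have "(c \<otimes>\<^bsub>GR\<^esub> d) g = finsum AR (\<lambda>h. c h \<otimes> d (inv\<^bsub>G\<^esub> h \<otimes>\<^bsub>G\<^esub> g)) {h \<in> carrier G. c h \<noteq> \<zero>}"
    using g by (simp add: group_ring_def)
  also have "\<dots> = (\<Oplus>h\<in>{h \<in> carrier G. c h \<noteq> \<zero>}. c h \<otimes> d (inv\<^bsub>G\<^esub> h \<otimes>\<^bsub>G\<^esub> g))"
    using GR_mem[OF c] dm by (intro finsum_AR) auto
  also have "\<dots> = (\<Oplus>h\<in>carrier G. c h \<otimes> d (inv\<^bsub>G\<^esub> h \<otimes>\<^bsub>G\<^esub> g))"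
    using GR_mem[OF c] dm by (intro add.finprod_mono_neutral_cong_left) auto
  finally show ?thesis .
qed

lemma GR_ext:
  "c \<in> carrier GR \<Longrightarrow> d \<in> carrier GR \<Longrightarrow> (\<And>g. g \<in> carrier G \<Longrightarrow> c g = d g) \<Longrightarrow> c = d"
  unfolding GR_carrier by (rule PiE_ext)

text \<open>By \<open>op_inj\<close> the group ring acts faithfully on \<open>B\<close>, so
  identities between convolutions can be tested as identities between composed operators.\<close>

lemma GR_eqI:
  assumes "c \<in> carrier GR" "d \<in> carrier GR" "\<And>x. x \<in> B \<Longrightarrow> op c x = op d x" shows "c = d"
  by (rule GR_ext[OF assms(1,2)]) (rule op_inj[OF GR_Pi[OF assms(1)] GR_Pi[OF assms(2)] assms(3)])

lemma GR_closed:
  "\<zero>\<^bsub>GR\<^esub> \<in> carrier GR" "\<one>\<^bsub>GR\<^esub> \<in> carrier GR"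
  "c \<in> carrier GR \<Longrightarrow> d \<in> carrier GR \<Longrightarrow> c \<oplus>\<^bsub>GR\<^esub> d \<in> carrier GR"
  "c \<in> carrier GR \<Longrightarrow> d \<in> carrier GR \<Longrightarrow> c \<otimes>\<^bsub>GR\<^esub> d \<in> carrier GR"
proof -
  show "\<zero>\<^bsub>GR\<^esub> \<in> carrier GR" "\<one>\<^bsub>GR\<^esub> \<in> carrier GR" by (auto simp: group_ring_def)
  show "c \<oplus>\<^bsub>GR\<^esub> d \<in> carrier GR" if "c \<in> carrier GR" "d \<in> carrier GR"
    using GR_mem[OF that(1)] GR_mem[OF that(2)] unfolding GR_carrier by (auto simp: group_ring_def)
  show "c \<otimes>\<^bsub>GR\<^esub> d \<in> carrier GR" if c: "c \<in> carrier GR" and d: "d \<in> carrier GR"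
  proof -
    have "(c \<otimes>\<^bsub>GR\<^esub> d) g \<in> A" if g: "g \<in> carrier G" for g
      unfolding GR_mult[OF c d g] using GR_mem[OF c] GR_mem[OF d] g by (intro A_finsum) simp
    moreover have "(c \<otimes>\<^bsub>GR\<^esub> d) \<in> extensional (carrier G)" by (simp add: group_ring_def)
    ultimately show ?thesis unfolding GR_carrier by (auto simp: PiE_iff)
  qed
qed

lemma op_B [simp]: "c \<in> carrier GR \<Longrightarrow> x \<in> B \<Longrightarrow> op c x \<in> B"
  unfolding op_def using GR_mem by (intro B_finsum) simp

lemma op_in_F [simp]: "c \<in> carrier GR \<Longrightarrow> x \<in> F \<Longrightarrow> op c x \<in> F"
  using op_F[OF GR_Pi] .

lemma op_add:
  assumes "c \<in> carrier GR" "d \<in> carrier GR" "x \<in> F"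
  shows "op (c \<oplus>\<^bsub>GR\<^esub> d) x = op c x \<oplus> op d x"
proof -
  have "op (c \<oplus>\<^bsub>GR\<^esub> d) x = (\<Oplus>g\<in>carrier G. c g \<otimes> act g x \<oplus> d g \<otimes> act g x)"
    unfolding op_def using assms by (intro finsum_cong') (auto simp: GR_add l_distr)
  then show ?thesis unfolding op_def using assms by (simp add: finsum_addf)
qed

lemma op_zero_GR: "x \<in> F \<Longrightarrow> op \<zero>\<^bsub>GR\<^esub> x = \<zero>"
proof -
  assume x: "x \<in> F"
  have "op \<zero>\<^bsub>GR\<^esub> x = (\<Oplus>g\<in>carrier G. \<zero>)"
    unfolding op_def using x by (intro finsum_cong') (auto simp: GR_zero)
  then show ?thesis by (simp add: finsum_zero)
qed

definition single :: "'a \<Rightarrow> 'g \<Rightarrow> 'g \<Rightarrow> 'a" where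
  "single a g = (\<lambda>h\<in>carrier G. if h = g then a else \<zero>)"

lemma single_closed: "a \<in> A \<Longrightarrow> single a g \<in> carrier GR"
  by (auto simp: GR_carrier single_def)

lemma op_single: assumes "a \<in> A" "g \<in> carrier G" "x \<in> F" shows "op (single a g) x = a \<otimes> act g x"
proof -
  have "op (single a g) x = (\<Oplus>h\<in>carrier G. if h = g then a \<otimes> act g x else \<zero>)"
    unfolding op_def using assms by (intro finsum_cong') (auto simp: single_def)
  also have "\<dots> = a \<otimes> act g x" using assms by (subst finsum_delta[of _ g]) auto
  finally show ?thesis .
qed

lemma GR_one_single: "\<one>\<^bsub>GR\<^esub> = single \<one> \<one>\<^bsub>G\<^esub>"
  by (rule GR_ext[OF GR_closed(2) single_closed]) (auto simp: GR_one single_def)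

lemma op_one: "x \<in> F \<Longrightarrow> op \<one>\<^bsub>GR\<^esub> x = x"
  by (simp add: GR_one_single op_single)

lemma op_mult:
  assumes c: "c \<in> carrier GR" and d: "d \<in> carrier GR" and x: "x \<in> F"
  shows "op (c \<otimes>\<^bsub>GR\<^esub> d) x = op c (op d x)"
proof -
  let ?s = "\<lambda>h g. c h \<otimes> (d (inv\<^bsub>G\<^esub> h \<otimes>\<^bsub>G\<^esub> g) \<otimes> act g x)"
  have m: "?s h g \<in> carrier E" if "h \<in> carrier G" "g \<in> carrier G" for h g using that c d x by simp
  have "op c (op d x) = (\<Oplus>h\<in>carrier G. \<Oplus>g\<in>carrier G. ?s h g)" unfolding op_def[of c]
  proof (intro finsum_cong')
    fix h assume h: "h \<in> carrier G"
    have "act h (op d x) = (\<Oplus>g\<in>carrier G. act h (d g \<otimes> act g x))"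
      unfolding op_def using h d x by (intro act_finsum) auto
    also have "\<dots> = (\<Oplus>g\<in>carrier G. d g \<otimes> act (h \<otimes>\<^bsub>G\<^esub> g) x)"
      using h d x GR_mem[OF d] by (intro finsum_cong') (auto simp: act_mult act_comp)
    also have "\<dots> = (\<Oplus>g\<in>carrier G. d (inv\<^bsub>G\<^esub> h \<otimes>\<^bsub>G\<^esub> (h \<otimes>\<^bsub>G\<^esub> g)) \<otimes> act (h \<otimes>\<^bsub>G\<^esub> g) x)"
      using h d x by (intro finsum_cong') (auto simp flip: GG.m_assoc)
    also have "\<dots> = (\<Oplus>g\<in>carrier G. d (inv\<^bsub>G\<^esub> h \<otimes>\<^bsub>G\<^esub> g) \<otimes> act g x)"
      using h d x by (intro finsum_shift[of h "\<lambda>g. d (inv\<^bsub>G\<^esub> h \<otimes>\<^bsub>G\<^esub> g) \<otimes> act g x"]) auto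
    finally have "c h \<otimes> act h (op d x) = c h \<otimes> (\<Oplus>g\<in>carrier G. d (inv\<^bsub>G\<^esub> h \<otimes>\<^bsub>G\<^esub> g) \<otimes> act g x)" by simp
    also have "\<dots> = (\<Oplus>g\<in>carrier G. ?s h g)"
      using h c d x by (intro finsum_rdistr) auto
    finally show "c h \<otimes> act h (op d x) = (\<Oplus>g\<in>carrier G. ?s h g)" .
  qed (use m in \<open>auto intro!: finsum_closed\<close>)
  also have "\<dots> = (\<Oplus>g\<in>carrier G. \<Oplus>h\<in>carrier G. ?s h g)" using m by (intro finsum_swap) auto
  also have "\<dots> = op (c \<otimes>\<^bsub>GR\<^esub> d) x" unfolding op_def
  proof (intro finsum_cong')
    fix g assume g: "g \<in> carrier G"
    have "(\<Oplus>h\<in>carrier G. ?s h g) = (\<Oplus>h\<in>carrier G. (c h \<otimes> d (inv\<^bsub>G\<^esub> h \<otimes>\<^bsub>G\<^esub> g)) \<otimes> act g x)"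
      using g c d x by (intro finsum_cong') (auto simp: m_assoc)
    also have "\<dots> = (c \<otimes>\<^bsub>GR\<^esub> d) g \<otimes> act g x"
      unfolding GR_mult[OF c d g] using g c d x by (intro finsum_ldistr[symmetric]) auto
    finally show "(\<Oplus>h\<in>carrier G. ?s h g) = (c \<otimes>\<^bsub>GR\<^esub> d) g \<otimes> act g x" .
  qed (use GR_closed(4)[OF c d] x in auto)
  finally show ?thesis by simp
qed

lemma op_act:
  assumes d: "d \<in> carrier GR" and g: "g \<in> carrier G" and x: "x \<in> F"
  shows "act g (op d x) = op d (act g x)"
proof -
  have "act g (op d x) = (\<Oplus>h\<in>carrier G. act g (d h \<otimes> act h x))"
    unfolding op_def using g d x by (intro act_finsum) auto
  also have "\<dots> = op d (act g x)" unfolding op_def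
    using g x d GR_mem[OF d] by (intro finsum_cong') (auto simp: act_mult GG.m_comm[of g] simp flip: act_comp)
  finally show ?thesis .
qed

text \<open>The group is abelian, and the coefficients lie in \<open>A\<close>, where the action is
  trivial.\<close>

lemma op_commute:
  assumes c: "c \<in> carrier GR" and d: "d \<in> carrier GR" and x: "x \<in> F"
  shows "op c (op d x) = op d (op c x)"
proof -
  have "op c (op d x) = (\<Oplus>g\<in>carrier G. \<Oplus>h\<in>carrier G. c g \<otimes> (d h \<otimes> act h (act g x)))"
    unfolding op_def[of c]
  proof (intro finsum_cong')
    fix g assume g: "g \<in> carrier G"
    show "c g \<otimes> act g (op d x) = (\<Oplus>h\<in>carrier G. c g \<otimes> (d h \<otimes> act h (act g x)))"
      unfolding op_act[OF d g x] unfolding op_def using g c d x by (intro finsum_rdistr) auto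
  qed (use c d x in \<open>auto intro!: finsum_closed\<close>)
  also have "\<dots> = (\<Oplus>h\<in>carrier G. \<Oplus>g\<in>carrier G. c g \<otimes> (d h \<otimes> act h (act g x)))"
    using c d x by (intro finsum_swap) auto
  also have "\<dots> = op d (op c x)" unfolding op_def[of d]
  proof (intro finsum_cong')
    fix h assume h: "h \<in> carrier G"
    have "act h (op c x) = (\<Oplus>g\<in>carrier G. act h (c g \<otimes> act g x))"
      unfolding op_def using h c x by (intro act_finsum) auto
    also have "\<dots> = (\<Oplus>g\<in>carrier G. c g \<otimes> act h (act g x))"
      using h x c GR_mem[OF c] by (intro finsum_cong') (auto simp: act_mult)
    finally have "d h \<otimes> act h (op c x) = (\<Oplus>g\<in>carrier G. d h \<otimes> (c g \<otimes> act h (act g x)))"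
      using h c d x by (simp add: finsum_rdistr)
    also have "\<dots> = (\<Oplus>g\<in>carrier G. c g \<otimes> (d h \<otimes> act h (act g x)))"
      using h c d x by (intro finsum_cong') (auto simp: m_ac)
    finally show "(\<Oplus>g\<in>carrier G. c g \<otimes> (d h \<otimes> act h (act g x))) = d h \<otimes> act h (op c x)" by simp
  qed (use c d x in auto)
  finally show ?thesis .
qed

text \<open>Associativity is that of composition, and commutativity is \<open>op_commute\<close>; no
  convolution sum is manipulated.\<close>

lemma GR_cring: "cring GR"
proof (rule cringI)
  note cl = GR_closed
  show "abelian_group GR"
  proof (rule abelian_groupI)
    show "(c \<oplus>\<^bsub>GR\<^esub> d) \<oplus>\<^bsub>GR\<^esub> e = c \<oplus>\<^bsub>GR\<^esub> (d \<oplus>\<^bsub>GR\<^esub> e)"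
      if "c \<in> carrier GR" "d \<in> carrier GR" "e \<in> carrier GR" for c d e
      using that cl by (intro GR_ext) (auto simp: GR_add a_assoc)
    show "c \<oplus>\<^bsub>GR\<^esub> d = d \<oplus>\<^bsub>GR\<^esub> c" if "c \<in> carrier GR" "d \<in> carrier GR" for c d
      using that cl by (intro GR_ext) (auto simp: GR_add a_comm)
    show "\<zero>\<^bsub>GR\<^esub> \<oplus>\<^bsub>GR\<^esub> c = c" if "c \<in> carrier GR" for c
      using that cl by (intro GR_ext) (auto simp: GR_add GR_zero)
    show "\<exists>d\<in>carrier GR. d \<oplus>\<^bsub>GR\<^esub> c = \<zero>\<^bsub>GR\<^esub>" if c: "c \<in> carrier GR" for c
    proof
      show m: "(\<lambda>g\<in>carrier G. \<ominus> c g) \<in> carrier GR" using GR_mem[OF c] by (auto simp: GR_carrier)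
      show "(\<lambda>g\<in>carrier G. \<ominus> c g) \<oplus>\<^bsub>GR\<^esub> c = \<zero>\<^bsub>GR\<^esub>"
        using c m cl by (intro GR_ext) (auto simp: GR_add GR_zero l_neg)
    qed
  qed (use cl in auto)
  show "comm_monoid GR"
  proof (rule comm_monoidI)
    show "(c \<otimes>\<^bsub>GR\<^esub> d) \<otimes>\<^bsub>GR\<^esub> e = c \<otimes>\<^bsub>GR\<^esub> (d \<otimes>\<^bsub>GR\<^esub> e)"
      if "c \<in> carrier GR" "d \<in> carrier GR" "e \<in> carrier GR" for c d e
      using that cl by (intro GR_eqI) (auto simp: op_mult)
    show "c \<otimes>\<^bsub>GR\<^esub> d = d \<otimes>\<^bsub>GR\<^esub> c" if "c \<in> carrier GR" "d \<in> carrier GR" for c d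
      using that cl by (intro GR_eqI) (auto simp: op_mult op_commute)
    show "\<one>\<^bsub>GR\<^esub> \<otimes>\<^bsub>GR\<^esub> c = c" if "c \<in> carrier GR" for c
      using that cl by (intro GR_eqI) (auto simp: op_mult op_one)
  qed (use cl in auto)
  show "(c \<oplus>\<^bsub>GR\<^esub> d) \<otimes>\<^bsub>GR\<^esub> e = c \<otimes>\<^bsub>GR\<^esub> e \<oplus>\<^bsub>GR\<^esub> d \<otimes>\<^bsub>GR\<^esub> e"
    if "c \<in> carrier GR" "d \<in> carrier GR" "e \<in> carrier GR" for c d e
    using that cl by (intro GR_eqI) (auto simp: op_mult op_add)
qed

sublocale GR: cring GR by (rule GR_cring)

lemma op_add_right:
  assumes "c \<in> carrier GR" "x \<in> F" "z \<in> F" shows "op c (x \<oplus> z) = op c x \<oplus> op c z"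
proof -
  have "op c (x \<oplus> z) = (\<Oplus>g\<in>carrier G. c g \<otimes> act g x \<oplus> c g \<otimes> act g z)"
    unfolding op_def using assms by (intro finsum_cong') (auto simp: act_add r_distr)
  then show ?thesis unfolding op_def using assms by (simp add: finsum_addf)
qed

lemma op_smult:
  assumes "c \<in> carrier GR" "x \<in> F" "l \<in> L" shows "op c (l \<otimes> x) = l \<otimes> op c x"
proof -
  have "op c (l \<otimes> x) = (\<Oplus>g\<in>carrier G. l \<otimes> (c g \<otimes> act g x))"
    unfolding op_def using assms by (intro finsum_cong') (auto simp: act_mult m_ac)
  then show ?thesis unfolding op_def using assms by (simp add: finsum_rdistr)
qed

lemma op_uminus: assumes "c \<in> carrier GR" "x \<in> F" shows "op (\<ominus>\<^bsub>GR\<^esub> c) x = \<ominus> op c x"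
proof -
  have "op (\<ominus>\<^bsub>GR\<^esub> c) x \<oplus> op c x = \<zero>"
    using assms by (simp add: GR.l_neg op_zero_GR flip: op_add)
  then show ?thesis using assms by (intro sum_zero_eq_neg) auto
qed

lemma op_minus: assumes "c \<in> carrier GR" "d \<in> carrier GR" "x \<in> F"
  shows "op (c \<ominus>\<^bsub>GR\<^esub> d) x = op c x \<ominus> op d x"
  using assms by (simp add: GR.minus_eq minus_eq op_add op_uminus)

lemma op_minus_right: assumes "c \<in> carrier GR" "x \<in> F" "z \<in> F"
  shows "op c (x \<ominus> z) = op c x \<ominus> op c z"
  using assms op_add_right[of c x "\<ominus> \<one> \<otimes> z"] op_smult[of c z "\<ominus> \<one>"] by (simp add: minus_eq l_minus)

lemma GR_uminus: assumes "c \<in> carrier GR" "g \<in> carrier G" shows "(\<ominus>\<^bsub>GR\<^esub> c) g = \<ominus> c g"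
proof -
  have "(\<ominus>\<^bsub>GR\<^esub> c) g \<oplus> c g = \<zero>"
    using assms by (simp add: GR.l_neg GR_zero flip: GR_add)
  then show ?thesis using assms by (intro sum_zero_eq_neg) auto
qed

lemma GR_minus: "c \<in> carrier GR \<Longrightarrow> d \<in> carrier GR \<Longrightarrow> g \<in> carrier G \<Longrightarrow> (c \<ominus>\<^bsub>GR\<^esub> d) g = c g \<ominus> d g"
  by (simp add: GR.minus_eq minus_eq GR_add GR_uminus)

end

section \<open>Reduction modulo \<open>\<pi>\<close>\<close>

context galois_level
begin

text \<open>The kernel of reduction to the group ring over the residue field; that quotient is never
  formed as a ring.\<close>

definition pi_dvd :: "('g \<Rightarrow> 'a) \<Rightarrow> bool" where
  "pi_dvd c \<longleftrightarrow> (\<forall>g\<in>carrier G. \<omega> \<otimes> c g \<in> A)"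

lemma pi_dvd_zero: "pi_dvd \<zero>\<^bsub>GR\<^esub>" by (simp add: pi_dvd_def GR_zero)

lemma pi_dvd_add:
  "c \<in> carrier GR \<Longrightarrow> d \<in> carrier GR \<Longrightarrow> pi_dvd c \<Longrightarrow> pi_dvd d \<Longrightarrow> pi_dvd (c \<oplus>\<^bsub>GR\<^esub> d)"
  by (simp add: pi_dvd_def GR_add r_distr)

lemma pi_dvd_uminus: "c \<in> carrier GR \<Longrightarrow> pi_dvd c \<Longrightarrow> pi_dvd (\<ominus>\<^bsub>GR\<^esub> c)"
  by (simp add: pi_dvd_def GR_uminus r_minus)

lemma pi_dvd_minus:
  "c \<in> carrier GR \<Longrightarrow> d \<in> carrier GR \<Longrightarrow> pi_dvd c \<Longrightarrow> pi_dvd d \<Longrightarrow> pi_dvd (c \<ominus>\<^bsub>GR\<^esub> d)"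
  by (simp add: GR.minus_eq pi_dvd_add pi_dvd_uminus)

lemma pi_dvd_mult:
  assumes c: "c \<in> carrier GR" and d: "d \<in> carrier GR" and p: "pi_dvd c"
  shows "pi_dvd (c \<otimes>\<^bsub>GR\<^esub> d)"
  unfolding pi_dvd_def
proof
  fix g assume g: "g \<in> carrier G"
  have dm: "d (inv\<^bsub>G\<^esub> h \<otimes>\<^bsub>G\<^esub> g) \<in> A" if "h \<in> carrier G" for h using GR_mem[OF d] that g by simp
  have "\<omega> \<otimes> (c \<otimes>\<^bsub>GR\<^esub> d) g = (\<Oplus>h\<in>carrier G. \<omega> \<otimes> (c h \<otimes> d (inv\<^bsub>G\<^esub> h \<otimes>\<^bsub>G\<^esub> g)))"
    unfolding GR_mult[OF c d g] using c dm by (intro finsum_rdistr) auto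
  also have "\<dots> = (\<Oplus>h\<in>carrier G. (\<omega> \<otimes> c h) \<otimes> d (inv\<^bsub>G\<^esub> h \<otimes>\<^bsub>G\<^esub> g))"
    using c dm by (intro finsum_cong') (auto simp: m_assoc)
  also have "\<dots> \<in> A"
  proof (rule A_finsum)
    show "(\<omega> \<otimes> c h) \<otimes> d (inv\<^bsub>G\<^esub> h \<otimes>\<^bsub>G\<^esub> g) \<in> A" if "h \<in> carrier G" for h
      using p dm[OF that] that unfolding pi_dvd_def by (metis A_closed(4))
  qed
  finally show "\<omega> \<otimes> (c \<otimes>\<^bsub>GR\<^esub> d) g \<in> A" .
qed

lemma pi_dvd_mult_left:
  "c \<in> carrier GR \<Longrightarrow> d \<in> carrier GR \<Longrightarrow> pi_dvd c \<Longrightarrow> pi_dvd (d \<otimes>\<^bsub>GR\<^esub> c)"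
  using pi_dvd_mult[of c d] by (simp add: GR.m_comm)

lemma pi_dvd_op:
  assumes c: "c \<in> carrier GR" "pi_dvd c" and x: "x \<in> B" shows "\<omega> \<otimes> op c x \<in> B"
proof -
  have "\<omega> \<otimes> op c x = (\<Oplus>g\<in>carrier G. \<omega> \<otimes> (c g \<otimes> act g x))"
    unfolding op_def using c x by (intro finsum_rdistr) auto
  also have "\<dots> = (\<Oplus>g\<in>carrier G. (\<omega> \<otimes> c g) \<otimes> act g x)"
    using c x by (intro finsum_cong') (auto simp: m_assoc)
  also have "\<dots> \<in> B" using c(2) x unfolding pi_dvd_def by (intro B_finsum A_B_smult) auto
  finally show ?thesis .
qed

lemma op_omega:
  "c \<in> carrier GR \<Longrightarrow> x \<in> F \<Longrightarrow> op c (\<omega> \<otimes> x) = \<omega> \<otimes> op c x"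
  by (simp add: op_smult)

lemma op_omega_B:
  assumes "c \<in> carrier GR" "x \<in> F" "\<omega> \<otimes> x \<in> B" shows "\<omega> \<otimes> op c x \<in> B"
  using op_B[OF assms(1,3)] unfolding op_omega[OF assms(1,2)] .

lemma single_mult:
  assumes "a \<in> A" "a' \<in> A" "g \<in> carrier G" "h \<in> carrier G"
  shows "single a g \<otimes>\<^bsub>GR\<^esub> single a' h = single (a \<otimes> a') (g \<otimes>\<^bsub>G\<^esub> h)"
proof (rule GR_eqI)
  fix x assume x: "x \<in> B"
  show "op (single a g \<otimes>\<^bsub>GR\<^esub> single a' h) x = op (single (a \<otimes> a') (g \<otimes>\<^bsub>G\<^esub> h)) x"
    using assms x single_closed by (simp add: op_mult op_single act_mult act_comp m_assoc)
qed (use assms single_closed GR_closed in auto)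

lemma single_pow:
  assumes "a \<in> A" "g \<in> carrier G"
  shows "single a g [^]\<^bsub>GR\<^esub> (n::nat) = single (a [^] n) (g [^]\<^bsub>G\<^esub> n)"
proof (induction n)
  case 0
  then show ?case by (simp add: GR_one_single)
next
  case (Suc n)
  then show ?case using assms by (simp add: single_mult)
qed

end

locale galois_level_p = galois_level E L A \<pi> G F act
  for E (structure) and L A \<pi> and G :: "('g, 'n) monoid_scheme" and F act +
  fixes p :: nat
  assumes prime_p: "Factorial_Ring.prime p" and pi_dvd_p: "\<omega> \<otimes> ([p] \<cdot> \<one>) \<in> A"
begin

lemma pi_dvd_add_pow: assumes "c \<in> carrier GR" shows "pi_dvd (add_pow GR p c)"
proof -
  have *: "add_pow GR n c g = [n] \<cdot> (c g)" if g: "g \<in> carrier G" for g and n :: nat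
  proof (induction n)
    case 0 then show ?case using g by (simp add: GR_zero)
  next
    case (Suc n) then show ?case using g assms by (simp add: GR_add)
  qed
  have "\<omega> \<otimes> ([p] \<cdot> (c g)) \<in> A" if g: "g \<in> carrier G" for g
  proof -
    have "[p] \<cdot> (c g) = ([p] \<cdot> \<one>) \<otimes> c g" using g assms by (simp add: add_pow_ldistr)
    then have "\<omega> \<otimes> ([p] \<cdot> (c g)) = (\<omega> \<otimes> ([p] \<cdot> \<one>)) \<otimes> c g" using g assms by (simp add: m_assoc)
    then show ?thesis using pi_dvd_p GR_mem[OF assms g] by simp
  qed
  then show ?thesis unfolding pi_dvd_def by (simp add: *)
qed

lemma GR_freshman:
  assumes c: "c \<in> carrier GR" and d: "d \<in> carrier GR"
  obtains e where "e \<in> carrier GR" "pi_dvd e"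
    "(c \<oplus>\<^bsub>GR\<^esub> d) [^]\<^bsub>GR\<^esub> p = c [^]\<^bsub>GR\<^esub> p \<oplus>\<^bsub>GR\<^esub> d [^]\<^bsub>GR\<^esub> p \<oplus>\<^bsub>GR\<^esub> e"
proof -
  obtain z where z: "z \<in> carrier GR"
    "(c \<oplus>\<^bsub>GR\<^esub> d) [^]\<^bsub>GR\<^esub> p = c [^]\<^bsub>GR\<^esub> p \<oplus>\<^bsub>GR\<^esub> d [^]\<^bsub>GR\<^esub> p \<oplus>\<^bsub>GR\<^esub> add_pow GR p z"
    using GR.freshman[OF prime_p c d] by blast
  show ?thesis by (rule that[OF _ _ z(2)]) (use z pi_dvd_add_pow in auto)
qed

lemma p_pos: "0 < p" using prime_p by (simp add: prime_gt_0_nat)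

text \<open>The p-th power map is additive modulo \<pi>, and p^k-th powers of g - 1 follow by
  iteration. When g^(p^k) = 1, this makes g - 1 nilpotent modulo \<pi>.\<close>

lemma augmentation_pow:
  assumes g: "g \<in> carrier G"
  shows "\<exists>e\<in>carrier GR. pi_dvd e \<and> (single \<one> g \<ominus>\<^bsub>GR\<^esub> \<one>\<^bsub>GR\<^esub>) [^]\<^bsub>GR\<^esub> (p ^ k)
    = (single \<one> (g [^]\<^bsub>G\<^esub> (p ^ k)) \<ominus>\<^bsub>GR\<^esub> \<one>\<^bsub>GR\<^esub>) \<oplus>\<^bsub>GR\<^esub> e"
proof (induction k)
  case 0
  have s: "single \<one> g \<in> carrier GR" by (simp add: single_closed)
  show ?case using g s pi_dvd_zero by (intro bexI[of _ "\<zero>\<^bsub>GR\<^esub>"]) auto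
next
  case (Suc k)
  let ?g = "g [^]\<^bsub>G\<^esub> (p ^ k)"
  let ?y = "single \<one> ?g \<ominus>\<^bsub>GR\<^esub> \<one>\<^bsub>GR\<^esub>"
  have gG: "?g \<in> carrier G" using g by simp
  have s: "single \<one> h \<in> carrier GR" for h by (simp add: single_closed)
  then have y: "?y \<in> carrier GR" by simp
  obtain e where e: "e \<in> carrier GR" "pi_dvd e"
    "(single \<one> g \<ominus>\<^bsub>GR\<^esub> \<one>\<^bsub>GR\<^esub>) [^]\<^bsub>GR\<^esub> (p ^ k) = ?y \<oplus>\<^bsub>GR\<^esub> e" using Suc by blast
  obtain e1 where e1: "e1 \<in> carrier GR" "pi_dvd e1"
    "(?y \<oplus>\<^bsub>GR\<^esub> e) [^]\<^bsub>GR\<^esub> p = ?y [^]\<^bsub>GR\<^esub> p \<oplus>\<^bsub>GR\<^esub> e [^]\<^bsub>GR\<^esub> p \<oplus>\<^bsub>GR\<^esub> e1"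
    using GR_freshman[OF y e(1)] by blast
  \<comment> \<open>Expanding (y + 1)^p, the p-th power of a single group element, expresses y^p by
    g^(p^(k+1)) - 1 without a sign (-1)^p.\<close>
  obtain e2 where e2: "e2 \<in> carrier GR" "pi_dvd e2"
    "(?y \<oplus>\<^bsub>GR\<^esub> \<one>\<^bsub>GR\<^esub>) [^]\<^bsub>GR\<^esub> p = ?y [^]\<^bsub>GR\<^esub> p \<oplus>\<^bsub>GR\<^esub> \<one>\<^bsub>GR\<^esub> [^]\<^bsub>GR\<^esub> p \<oplus>\<^bsub>GR\<^esub> e2"
    using GR_freshman[OF y GR.one_closed] by blast
  have "?y \<oplus>\<^bsub>GR\<^esub> \<one>\<^bsub>GR\<^esub> = single \<one> ?g" using s by (simp add: GR.minus_eq GR.a_assoc GR.l_neg)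
  then have "single \<one> (?g [^]\<^bsub>G\<^esub> p) = ?y [^]\<^bsub>GR\<^esub> p \<oplus>\<^bsub>GR\<^esub> \<one>\<^bsub>GR\<^esub> \<oplus>\<^bsub>GR\<^esub> e2"
    using e2(3) single_pow[of \<one> ?g p] gG by simp
  moreover have "?g [^]\<^bsub>G\<^esub> p = g [^]\<^bsub>G\<^esub> (p ^ Suc k)" using g by (simp add: GG.nat_pow_pow mult.commute)
  ultimately have sg: "single \<one> (g [^]\<^bsub>G\<^esub> (p ^ Suc k)) = ?y [^]\<^bsub>GR\<^esub> p \<oplus>\<^bsub>GR\<^esub> \<one>\<^bsub>GR\<^esub> \<oplus>\<^bsub>GR\<^esub> e2" by simp
  have ep: "pi_dvd (e [^]\<^bsub>GR\<^esub> p)"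
  proof -
    obtain m where "p = Suc m" using p_pos gr0_implies_Suc by blast
    then show ?thesis using e by (simp add: pi_dvd_mult_left)
  qed
  let ?e = "e [^]\<^bsub>GR\<^esub> p \<oplus>\<^bsub>GR\<^esub> e1 \<ominus>\<^bsub>GR\<^esub> e2"
  have "(single \<one> g \<ominus>\<^bsub>GR\<^esub> \<one>\<^bsub>GR\<^esub>) [^]\<^bsub>GR\<^esub> (p ^ Suc k)
    = ((single \<one> g \<ominus>\<^bsub>GR\<^esub> \<one>\<^bsub>GR\<^esub>) [^]\<^bsub>GR\<^esub> (p ^ k)) [^]\<^bsub>GR\<^esub> p"
    using s by (simp add: GR.nat_pow_pow mult.commute)
  also have "\<dots> = ?y [^]\<^bsub>GR\<^esub> p \<oplus>\<^bsub>GR\<^esub> e [^]\<^bsub>GR\<^esub> p \<oplus>\<^bsub>GR\<^esub> e1" using e(3) e1(3) by simp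
  also have "\<dots> = (single \<one> (g [^]\<^bsub>G\<^esub> (p ^ Suc k)) \<ominus>\<^bsub>GR\<^esub> \<one>\<^bsub>GR\<^esub>) \<oplus>\<^bsub>GR\<^esub> ?e"
    unfolding sg using y e e1 e2 GR.nat_pow_closed[OF y, of p] by (simp add: GR.ring_norm)
  finally show ?case using e e1 e2 ep by (intro bexI[of _ ?e]) (auto intro!: pi_dvd_add pi_dvd_minus)
qed

text \<open>Elements of \<open>p\<close>-power order act unipotently modulo \<open>\<pi>\<close>.\<close>

lemma fixed_vector_mod_pi:
  assumes K: "K \<subseteq> B" "\<And>c x. c \<in> carrier GR \<Longrightarrow> x \<in> K \<Longrightarrow> op c x \<in> K"
    and x: "x \<in> K" "\<omega> \<otimes> x \<notin> B"
    and P: "P \<subseteq> carrier G" "\<And>g. g \<in> P \<Longrightarrow> \<exists>k. g [^]\<^bsub>G\<^esub> (p ^ k) = \<one>\<^bsub>G\<^esub>"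
  obtains z where "z \<in> K" "\<omega> \<otimes> z \<notin> B" "\<And>g. g \<in> P \<Longrightarrow> \<omega> \<otimes> (act g z \<ominus> z) \<in> B"
proof -
  have "finite P" using finite_subset[OF P(1)] by simp
  then have "\<exists>z\<in>K. \<omega> \<otimes> z \<notin> B \<and> (\<forall>g\<in>P. \<omega> \<otimes> (act g z \<ominus> z) \<in> B)" using P
  proof (induction P)
    case empty
    then show ?case using x by auto
  next
    case (insert g P)
    then obtain z where z: "z \<in> K" "\<omega> \<otimes> z \<notin> B" "\<forall>g\<in>P. \<omega> \<otimes> (act g z \<ominus> z) \<in> B" by auto
    have zB: "z \<in> B" using K(1) z(1) by blast
    have g: "g \<in> carrier G" using insert by simp
    obtain k where k: "g [^]\<^bsub>G\<^esub> (p ^ k) = \<one>\<^bsub>G\<^esub>" using insert by blast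
    have s: "single \<one> h \<in> carrier GR" for h by (simp add: single_closed)
    let ?n = "single \<one> g \<ominus>\<^bsub>GR\<^esub> \<one>\<^bsub>GR\<^esub>"
    have n: "?n \<in> carrier GR" using s by simp
    obtain e where e: "e \<in> carrier GR" "pi_dvd e" "?n [^]\<^bsub>GR\<^esub> (p ^ k)
        = (single \<one> (g [^]\<^bsub>G\<^esub> (p ^ k)) \<ominus>\<^bsub>GR\<^esub> \<one>\<^bsub>GR\<^esub>) \<oplus>\<^bsub>GR\<^esub> e"
      using augmentation_pow[OF g, of k] by blast
    have "?n [^]\<^bsub>GR\<^esub> (p ^ k) = e"
      using e s unfolding k GR_one_single[symmetric] by (simp add: GR.minus_eq GR.r_neg)
    then have "\<omega> \<otimes> op (?n [^]\<^bsub>GR\<^esub> (p ^ k)) z \<in> B" using pi_dvd_op[OF e(1,2) zB] by simp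
    then have ex: "\<exists>i::nat. \<omega> \<otimes> op (?n [^]\<^bsub>GR\<^esub> i) z \<in> B" by blast
    \<comment> \<open>The last power of g - 1 that does not kill \<open>z\<close> modulo \<pi>
      produces a vector fixed by g modulo \<pi>. As operators commute, it stays fixed modulo \<pi>
      by the elements treated before.\<close>
    define i where "i = (LEAST i::nat. \<omega> \<otimes> op (?n [^]\<^bsub>GR\<^esub> i) z \<in> B)"
    have i: "\<omega> \<otimes> op (?n [^]\<^bsub>GR\<^esub> i) z \<in> B" unfolding i_def by (rule LeastI_ex[OF ex])
    have least: "\<omega> \<otimes> op (?n [^]\<^bsub>GR\<^esub> j) z \<notin> B" if "j < i" for j
      using not_less_Least[of j] that unfolding i_def by blast
    have "i \<noteq> 0"
    proof
      assume "i = 0"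
      then show False using i z(2) zB by (simp add: op_one)
    qed
    then obtain j where j: "i = Suc j" using not0_implies_Suc by blast
    let ?m = "?n [^]\<^bsub>GR\<^esub> j"
    have m: "?m \<in> carrier GR" using n by simp
    have "\<omega> \<otimes> (act g (op ?m z) \<ominus> op ?m z) \<in> B"
    proof -
      have "op (?n [^]\<^bsub>GR\<^esub> i) z = op ?n (op ?m z)"
        unfolding j using m n zB by (simp add: GR.m_comm[of ?m] op_mult)
      also have "\<dots> = act g (op ?m z) \<ominus> op ?m z"
        using g s m zB by (simp add: op_minus op_single op_one)
      finally show ?thesis using i by simp
    qed
    moreover have "\<omega> \<otimes> (act h (op ?m z) \<ominus> op ?m z) \<in> B" if h: "h \<in> P" for h
    proof -
      have hG: "h \<in> carrier G" using insert h by auto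
      have "act h (op ?m z) = op (single \<one> h) (op ?m z)" using hG m zB by (simp add: op_single)
      also have "\<dots> = op ?m (op (single \<one> h) z)" using s m zB by (intro op_commute) auto
      also have "\<dots> = op ?m (act h z)" using hG zB by (simp add: op_single)
      finally have "act h (op ?m z) \<ominus> op ?m z = op ?m (act h z \<ominus> z)"
        using hG m zB by (simp add: op_minus_right)
      then show ?thesis using op_omega_B[OF m, of "act h z \<ominus> z"] z(3) h hG zB by simp
    qed
    moreover have "\<omega> \<otimes> op ?m z \<notin> B" using least[of j] j by simp
    ultimately show ?case using K(2)[OF m z(1)] by blast
  qed
  then show ?thesis using that by blast
qed

end

text \<open>The set in \<open>finite_residue\<close> consists of the residue classes of
  \<open>A\<close> modulo \<pi>, so the condition expresses that the residue field is
  finite.\<close>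

locale tame_level = galois_level_p E L A \<pi> G F act p
  for E (structure) and L A \<pi> and G :: "('g, 'n) monoid_scheme" and F act p +
  assumes not_dvd: "\<not> p dvd card (carrier G)"
    and finite_residue: "finite ((\<lambda>a. {b \<in> A. \<omega> \<otimes> (a \<ominus> b) \<in> A}) ` A)"
begin

text \<open>By Bezout, p is invertible modulo the group order, so a suitable u-th power undoes the
  p-th power.\<close>

lemma pow_p_inj:
  assumes "g \<in> carrier G" "h \<in> carrier G" "g [^]\<^bsub>G\<^esub> p = h [^]\<^bsub>G\<^esub> p" shows "g = h"
proof -
  have "gcd p (card (carrier G)) = 1"
    using prime_imp_coprime[OF prime_p not_dvd] by (simp add: coprime_iff_gcd_eq_1)
  moreover obtain u v where "p * u = card (carrier G) * v + gcd p (card (carrier G))"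
    using bezout_nat[of p "card (carrier G)"] p_pos by auto
  ultimately have uv: "p * u = card (carrier G) * v + 1" by simp
  have *: "(g [^]\<^bsub>G\<^esub> p) [^]\<^bsub>G\<^esub> u = g" if g: "g \<in> carrier G" for g
  proof -
    have "g [^]\<^bsub>G\<^esub> card (carrier G) = \<one>\<^bsub>G\<^esub>" using GG.pow_order_eq_1[OF g] by (simp add: order_def)
    then have "g [^]\<^bsub>G\<^esub> (card (carrier G) * v + 1) = g"
      using g by (simp add: GG.nat_pow_mult[symmetric] GG.nat_pow_pow[symmetric])
    then show ?thesis using g uv by (simp add: GG.nat_pow_pow)
  qed
  show ?thesis by (rule trans[OF sym[OF *[OF assms(1), unfolded assms(3)]] *[OF assms(2)]])
qed

lemma omega_pow_A: assumes "a \<in> A" "\<omega> \<otimes> a [^] (n::nat) \<in> A" shows "\<omega> \<otimes> a \<in> A"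
proof (rule ccontr)
  assume "\<omega> \<otimes> a \<notin> A"
  then have u: "a \<noteq> \<zero>" "inv a \<in> A" using unit_A assms by auto
  have "(\<omega> \<otimes> a [^] n) \<otimes> inv a [^] n \<in> A" using A_closed(4)[OF assms(2) A_pow[OF u(2)]] .
  also have "(\<omega> \<otimes> a [^] n) \<otimes> inv a [^] n = \<omega>" using u assms by (simp add: m_assoc)
  finally show False using inv_pi_notin by simp
qed

text \<open>Induction on a set \<open>T\<close> containing the support. Modulo \<pi> the p-th power
  is additive, a single term with coefficient a at h contributes a^p at h^p, and by
  \<open>pow_p_inj\<close> no two terms collide.\<close>

lemma frobenius:
  assumes "finite T" "T \<subseteq> carrier G" "c \<in> carrier GR" "\<And>g. g \<in> carrier G - T \<Longrightarrow> c g = \<zero>"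
    and g: "g \<in> carrier G"
  shows "\<omega> \<otimes> ((c [^]\<^bsub>GR\<^esub> p) (g [^]\<^bsub>G\<^esub> p) \<ominus> c g [^] p) \<in> A"
  using assms(1-4)
proof (induction T arbitrary: c)
  case empty
  have "c = \<zero>\<^bsub>GR\<^esub>" using empty by (intro GR_ext) (auto simp: GR_zero)
  moreover have "\<zero>\<^bsub>GR\<^esub> [^]\<^bsub>GR\<^esub> p = \<zero>\<^bsub>GR\<^esub>" using p_pos by (intro GR.nat_pow_zero) auto
  moreover have "\<zero> [^] p = \<zero>" using p_pos by (intro nat_pow_zero) auto
  ultimately show ?case using g by (simp add: GR_zero minus_eq)
next
  case (insert h T)
  have h: "h \<in> carrier G" using insert by simp
  have chA: "c h \<in> A" using GR_mem insert h by blast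
  define c' where "c' = (\<lambda>g\<in>carrier G. if g = h then \<zero> else c g)"
  have c': "c' \<in> carrier GR" using insert.prems(2) unfolding c'_def GR_carrier by auto
  have sc: "single (c h) h \<in> carrier GR" using chA by (rule single_closed)
  have cc: "c = c' \<oplus>\<^bsub>GR\<^esub> single (c h) h"
  proof (rule GR_ext[OF insert.prems(2)])
    show "c k = (c' \<oplus>\<^bsub>GR\<^esub> single (c h) h) k" if k: "k \<in> carrier G" for k
      using k h GR_mem_F[OF insert.prems(2) k] GR_mem_F[OF insert.prems(2) h]
      by (simp add: GR_add c'_def single_def)
  qed (use c' sc in simp)
  have zp: "\<zero> [^] p = \<zero>" using p_pos by (intro nat_pow_zero) auto
  have IH: "\<omega> \<otimes> ((c' [^]\<^bsub>GR\<^esub> p) (g [^]\<^bsub>G\<^esub> p) \<ominus> c' g [^] p) \<in> A"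
  proof (rule insert.IH[OF _ c'])
    show "c' g = \<zero>" if "g \<in> carrier G - T" for g
      using insert.prems(3)[of g] that by (auto simp: c'_def)
  qed (use insert.prems in simp)
  obtain e where e: "e \<in> carrier GR" "pi_dvd e"
    "(c' \<oplus>\<^bsub>GR\<^esub> single (c h) h) [^]\<^bsub>GR\<^esub> p = c' [^]\<^bsub>GR\<^esub> p \<oplus>\<^bsub>GR\<^esub> single (c h) h [^]\<^bsub>GR\<^esub> p \<oplus>\<^bsub>GR\<^esub> e"
    using GR_freshman[OF c' sc] by blast
  have gp: "g [^]\<^bsub>G\<^esub> p \<in> carrier G" using g by simp
  have c'p: "c' [^]\<^bsub>GR\<^esub> p \<in> carrier GR" using c' by simp
  have cg: "c g \<in> F" "c' g \<in> F" using insert.prems(2) c' g by auto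
  let ?s = "if g = h then c h [^] p else \<zero>"
  have s: "(single (c h) h [^]\<^bsub>GR\<^esub> p) (g [^]\<^bsub>G\<^esub> p) = ?s"
    unfolding single_pow[OF chA h] using gp pow_p_inj[OF g h] by (auto simp: single_def)
  have "c' g [^] p \<oplus> ?s = c g [^] p"
    using g cg chA zp by (simp add: c'_def)
  then have "(c [^]\<^bsub>GR\<^esub> p) (g [^]\<^bsub>G\<^esub> p) \<ominus> c g [^] p
      = ((c' [^]\<^bsub>GR\<^esub> p) (g [^]\<^bsub>G\<^esub> p) \<oplus> ?s \<oplus> e (g [^]\<^bsub>G\<^esub> p)) \<ominus> (c' g [^] p \<oplus> ?s)"
    using e sc c'p gp s by (subst cc) (simp add: GR_add)
  also have "\<dots> = ((c' [^]\<^bsub>GR\<^esub> p) (g [^]\<^bsub>G\<^esub> p) \<ominus> c' g [^] p) \<oplus> e (g [^]\<^bsub>G\<^esub> p)"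
    using GR_mem_F[OF c'p gp] cg chA GR_mem_F[OF e(1) gp] by (auto simp: ring_norm)
  finally have "\<omega> \<otimes> ((c [^]\<^bsub>GR\<^esub> p) (g [^]\<^bsub>G\<^esub> p) \<ominus> c g [^] p)
    = \<omega> \<otimes> ((c' [^]\<^bsub>GR\<^esub> p) (g [^]\<^bsub>G\<^esub> p) \<ominus> c' g [^] p) \<oplus> \<omega> \<otimes> e (g [^]\<^bsub>G\<^esub> p)"
    using GR_mem_F[OF c'p gp] cg GR_mem_F[OF e(1) gp] by (simp add: r_distr)
  then show ?case using IH e(2) gp unfolding pi_dvd_def by simp
qed

lemma reduced_p: assumes c: "c \<in> carrier GR" and "pi_dvd (c [^]\<^bsub>GR\<^esub> p)" shows "pi_dvd c"
  unfolding pi_dvd_def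
proof
  fix g assume g: "g \<in> carrier G"
  have cg: "c g \<in> A" using GR_mem c g by blast
  have gp: "g [^]\<^bsub>G\<^esub> p \<in> carrier G" using g by simp
  have 1: "\<omega> \<otimes> ((c [^]\<^bsub>GR\<^esub> p) (g [^]\<^bsub>G\<^esub> p) \<ominus> c g [^] p) \<in> A"
    using c g by (intro frobenius[of "carrier G"]) auto
  have 2: "\<omega> \<otimes> (c [^]\<^bsub>GR\<^esub> p) (g [^]\<^bsub>G\<^esub> p) \<in> A" using assms(2) gp unfolding pi_dvd_def by blast
  have m: "(c [^]\<^bsub>GR\<^esub> p) (g [^]\<^bsub>G\<^esub> p) \<in> A" using GR_mem[OF _ gp] c by simp
  have "\<omega> \<otimes> (c [^]\<^bsub>GR\<^esub> p) (g [^]\<^bsub>G\<^esub> p) \<ominus> \<omega> \<otimes> ((c [^]\<^bsub>GR\<^esub> p) (g [^]\<^bsub>G\<^esub> p) \<ominus> c g [^] p)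
    = \<omega> \<otimes> c g [^] p" using m cg by (simp add: ring_norm)
  then have "\<omega> \<otimes> c g [^] p \<in> A" using A_minus[OF 2 1] by simp
  then show "\<omega> \<otimes> c g \<in> A" using omega_pow_A cg by blast
qed

text \<open>From the n-th power one passes to the power p^n, which is at least n, and then descends
  by \<open>reduced_p\<close> one factor p of the exponent at a time.\<close>

lemma reduced:
  assumes c: "c \<in> carrier GR" and n: "pi_dvd (c [^]\<^bsub>GR\<^esub> (n::nat))" shows "pi_dvd c"
proof -
  have *: "pi_dvd c" if "pi_dvd (c [^]\<^bsub>GR\<^esub> (p ^ k))" for k
    using that
  proof (induction k)
    case 0 then show ?case using c by simp
  next
    case (Suc k)
    have "c [^]\<^bsub>GR\<^esub> (p ^ Suc k) = (c [^]\<^bsub>GR\<^esub> (p ^ k)) [^]\<^bsub>GR\<^esub> p"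
      using c by (simp add: GR.nat_pow_pow mult.commute)
    then show ?case using Suc reduced_p[of "c [^]\<^bsub>GR\<^esub> (p ^ k)"] c by simp
  qed
  have "n \<le> p ^ n" using power_gt_expt[of p n] prime_gt_1_nat[OF prime_p] by simp
  then obtain d where "p ^ n = n + d" using le_Suc_ex by blast
  then have "c [^]\<^bsub>GR\<^esub> (p ^ n) = c [^]\<^bsub>GR\<^esub> n \<otimes>\<^bsub>GR\<^esub> c [^]\<^bsub>GR\<^esub> d" using c by (simp add: GR.nat_pow_mult)
  then have "pi_dvd (c [^]\<^bsub>GR\<^esub> (p ^ n))" using pi_dvd_mult[OF _ _ n] c by simp
  then show ?thesis by (rule *)
qed

text \<open>If \<open>c B \<subseteq> \<pi> B\<close> then \<open>c\<^sup>n B \<subseteq> \<pi>\<^sup>n B\<close>, which bounds the coefficients of \<open>c\<^sup>n\<close> up to a fixed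
  denominator; so \<open>c\<^sup>n\<close> vanishes modulo \<open>\<pi>\<close> for large \<open>n\<close>.\<close>

lemma faithful_mod_pi:
  assumes c: "c \<in> carrier GR" and cB: "\<And>x. x \<in> B \<Longrightarrow> \<omega> \<otimes> op c x \<in> B" shows "pi_dvd c"
proof -
  have pow: "\<omega> [^] n \<otimes> op (c [^]\<^bsub>GR\<^esub> n) x \<in> B" if "x \<in> B" for n :: nat and x
    using that
  proof (induction n arbitrary: x)
    case 0
    then show ?case by (simp add: op_one)
  next
    case (Suc n)
    have w: "\<omega> \<otimes> op c x \<in> B" using cB Suc by blast
    have "op (c [^]\<^bsub>GR\<^esub> Suc n) x = op (c [^]\<^bsub>GR\<^esub> n) (op c x)" using c Suc by (simp add: op_mult)
    then have "\<omega> [^] Suc n \<otimes> op (c [^]\<^bsub>GR\<^esub> Suc n) x = \<omega> [^] n \<otimes> op (c [^]\<^bsub>GR\<^esub> n) (\<omega> \<otimes> op c x)"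
      using c Suc by (simp add: op_omega m_assoc)
    then show ?case using Suc.IH[OF w] by simp
  qed
  obtain r :: nat and a y where co: "galois_coords E L A \<pi> G F act r a y" "\<And>k. k < r \<Longrightarrow> y k \<in> B"
    using integral_coordinates by blast
  interpret galois_coords E L A \<pi> G F act r a y by (rule co(1))
  have "a ` {..<r} \<subseteq> F" by auto
  then obtain j :: nat where j: "\<And>s. s \<in> a ` {..<r} \<Longrightarrow> \<pi> [^] j \<otimes> s \<in> B"
    using common_denominator_B[of "a ` {..<r}"] by blast
  \<comment> \<open>The exponent is \<open>j\<close> for the common denominator of the
    \<open>a k\<close> in \<open>op_recover\<close>, plus one for the factor \<pi> to be
    gained.\<close>
  let ?c = "c [^]\<^bsub>GR\<^esub> Suc j"
  have c': "?c \<in> carrier GR" using c by (intro GR.nat_pow_closed)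
  have "pi_dvd ?c" unfolding pi_dvd_def
  proof
    fix g assume g: "g \<in> carrier G"
    have "\<omega> \<otimes> ?c g = \<omega> \<otimes> (\<Oplus>k\<in>{..<r}. op ?c (y k) \<otimes> act g (a k))"
      using op_recover[OF GR_Pi[OF c'] g] by simp
    also have "\<dots> = (\<Oplus>k\<in>{..<r}. \<omega> \<otimes> (op ?c (y k) \<otimes> act g (a k)))"
      using op_in_F[OF c'] g by (intro finsum_rdistr) auto
    also have "\<dots> = (\<Oplus>k\<in>{..<r}. (\<omega> [^] Suc j \<otimes> op ?c (y k)) \<otimes> act g (\<pi> [^] j \<otimes> a k))"
    proof (intro finsum_cong')
      fix k assume k: "k \<in> {..<r}"
      let ?z = "op ?c (y k) \<otimes> act g (a k)"
      have z: "op ?c (y k) \<in> F" using op_in_F[OF c'] k by simp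
      have "(\<omega> [^] Suc j \<otimes> op ?c (y k)) \<otimes> act g (\<pi> [^] j \<otimes> a k) = \<omega> [^] j \<otimes> (\<pi> [^] j \<otimes> (\<omega> \<otimes> ?z))"
        using k g z by (simp add: act_mult m_ac del: inv_pow_cancel pow_inv_cancel inv_pow_cancel' pow_inv_cancel')
      then show "\<omega> \<otimes> ?z = (\<omega> [^] Suc j \<otimes> op ?c (y k)) \<otimes> act g (\<pi> [^] j \<otimes> a k)"
        using k g z by simp
    qed (use op_in_F[OF c'] g in auto)
    also have "\<dots> \<in> B"
    proof (rule B_finsum)
      fix k assume k: "k \<in> {..<r}"
      have "act g (\<pi> [^] j \<otimes> a k) \<in> B" using j[of "a k"] k by (intro B_act[OF g]) auto
      then show "(\<omega> [^] Suc j \<otimes> op ?c (y k)) \<otimes> act g (\<pi> [^] j \<otimes> a k) \<in> B"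
        using B_closed(2)[OF pow[OF co(2), of k "Suc j"]] k by blast
    qed
    finally show "\<omega> \<otimes> ?c g \<in> A" using GR_mem[OF c' g] by (intro B_L) auto
  qed
  then show ?thesis using reduced c by blast
qed

end

context galois_level
begin

lemma trace_nondegenerate:
  assumes "z \<in> F" "\<And>y. y \<in> B \<Longrightarrow> tr (z \<otimes> y) = \<zero>" shows "z = \<zero>"
proof -
  obtain r :: nat and a y where c: "galois_coords E L A \<pi> G F act r a y" "\<And>k. k < r \<Longrightarrow> y k \<in> B"
    using integral_coordinates by blast
  interpret galois_coords E L A \<pi> G F act r a y by (rule c(1))
  show ?thesis by (rule t_inj[OF assms(1)]) (simp add: t_def assms(2) c(2))
qed

definition pi_quot :: "('g \<Rightarrow> 'a) \<Rightarrow> 'g \<Rightarrow> 'a" where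
  "pi_quot c = (\<lambda>g\<in>carrier G. \<omega> \<otimes> c g)"

lemma pi_quot_closed: "pi_dvd c \<Longrightarrow> pi_quot c \<in> carrier GR"
  by (auto simp: pi_quot_def pi_dvd_def GR_carrier)

lemma op_pi_quot:
  assumes "c \<in> carrier GR" "x \<in> F" shows "op (pi_quot c) x = \<omega> \<otimes> op c x"
proof -
  have "op (pi_quot c) x = (\<Oplus>g\<in>carrier G. \<omega> \<otimes> (c g \<otimes> act g x))"
    unfolding op_def using assms by (intro finsum_cong') (auto simp: pi_quot_def m_assoc)
  then show ?thesis unfolding op_def using assms by (simp add: finsum_rdistr)
qed

end

section \<open>A vector that is free modulo \<pi>, and the generator at the first level\<close>

context tame_level
begin

definition residue :: "'a \<Rightarrow> 'a set" where
  "residue a = {b \<in> A. \<omega> \<otimes> (a \<ominus> b) \<in> A}"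

text \<open>The image of \<open>c\<close> in the group ring over the residue field, encoded as a
  function to cosets; it makes pigeonhole and counting arguments possible.\<close>

definition residues :: "('g \<Rightarrow> 'a) \<Rightarrow> 'g \<Rightarrow> 'a set" where
  "residues c = (\<lambda>g\<in>carrier G. residue (c g))"

lemma residue_eq_iff:
  assumes a: "a \<in> A" "a' \<in> A" shows "residue a = residue a' \<longleftrightarrow> \<omega> \<otimes> (a \<ominus> a') \<in> A"
proof
  assume "residue a = residue a'"
  moreover have "a' \<in> residue a'" using a by (simp add: residue_def minus_eq r_neg)
  ultimately have "a' \<in> residue a" by simp
  then show "\<omega> \<otimes> (a \<ominus> a') \<in> A" by (simp add: residue_def)
next
  assume d: "\<omega> \<otimes> (a \<ominus> a') \<in> A"
  have "\<omega> \<otimes> (a \<ominus> b) \<in> A \<longleftrightarrow> \<omega> \<otimes> (a' \<ominus> b) \<in> A" if b: "b \<in> A" for b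
  proof -
    have 1: "\<omega> \<otimes> (a \<ominus> b) = \<omega> \<otimes> (a' \<ominus> b) \<oplus> \<omega> \<otimes> (a \<ominus> a')"
      using a b by (simp add: ring_norm)
    have 2: "\<omega> \<otimes> (a' \<ominus> b) = \<omega> \<otimes> (a \<ominus> b) \<ominus> \<omega> \<otimes> (a \<ominus> a')"
      using a b by (simp add: ring_norm)
    show ?thesis
    proof
      assume "\<omega> \<otimes> (a \<ominus> b) \<in> A"
      then show "\<omega> \<otimes> (a' \<ominus> b) \<in> A" unfolding 2 using d by (rule A_minus)
    next
      assume "\<omega> \<otimes> (a' \<ominus> b) \<in> A"
      then show "\<omega> \<otimes> (a \<ominus> b) \<in> A" unfolding 1 using d by (rule A_closed(3))
    qed
  qed
  then show "residue a = residue a'" unfolding residue_def by blast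
qed

lemma residues_eq_iff:
  assumes "c \<in> carrier GR" "d \<in> carrier GR"
  shows "residues c = residues d \<longleftrightarrow> pi_dvd (c \<ominus>\<^bsub>GR\<^esub> d)"
proof -
  have eq: "residue (c g) = residue (d g) \<longleftrightarrow> \<omega> \<otimes> (c \<ominus>\<^bsub>GR\<^esub> d) g \<in> A" if g: "g \<in> carrier G" for g
    using residue_eq_iff[OF GR_mem[OF assms(1) g] GR_mem[OF assms(2) g]] GR_minus[OF assms g] by simp
  show ?thesis
  proof
    assume r: "residues c = residues d"
    show "pi_dvd (c \<ominus>\<^bsub>GR\<^esub> d)" unfolding pi_dvd_def
    proof
      fix g assume g: "g \<in> carrier G"
      have "residue (c g) = residue (d g)" using fun_cong[OF r, of g] g by (simp add: residues_def)
      then show "\<omega> \<otimes> (c \<ominus>\<^bsub>GR\<^esub> d) g \<in> A" using eq[OF g] by blast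
    qed
  next
    assume "pi_dvd (c \<ominus>\<^bsub>GR\<^esub> d)"
    then show "residues c = residues d"
      unfolding residues_def pi_dvd_def using eq by (intro restrict_ext) blast
  qed
qed

lemma finite_residues: assumes "S \<subseteq> carrier GR" shows "finite (residues ` S)"
proof (rule finite_subset)
  show "residues ` S \<subseteq> carrier G \<rightarrow>\<^sub>E residue ` A"
    using assms GR_mem unfolding residues_def by auto
  show "finite (carrier G \<rightarrow>\<^sub>E residue ` A)"
    using finite_residue by (intro finite_PiE) (auto simp: residue_def[abs_def])
qed

text \<open>The annihilator of \<open>x\<close> modulo \<pi>, as a set of lifts; for integral
  \<open>x\<close> it contains every multiple of \<pi>.\<close>

definition ann :: "'a \<Rightarrow> ('g \<Rightarrow> 'a) set" where
  "ann x = {c \<in> carrier GR. \<omega> \<otimes> op c x \<in> B}"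

text \<open>The powers of \<open>c\<close> take finitely many values modulo \<pi>, so they become
  periodic and some power is idempotent. It is nonzero modulo \<pi> because the group ring is
  reduced there.\<close>

lemma idempotent_in_ann:
  assumes x: "x \<in> B" and c: "c \<in> ann x" "\<not> pi_dvd c"
  obtains e where "e \<in> ann x" "\<not> pi_dvd e" "pi_dvd (e \<otimes>\<^bsub>GR\<^esub> e \<ominus>\<^bsub>GR\<^esub> e)"
proof -
  have cG: "c \<in> carrier GR" using c by (simp add: ann_def)
  let ?f = "\<lambda>i::nat. residues (c [^]\<^bsub>GR\<^esub> Suc i)"
  have "range ?f = residues ` range (\<lambda>i. c [^]\<^bsub>GR\<^esub> Suc i)" by auto
  moreover have "finite \<dots>" using cG by (intro finite_residues) auto
  ultimately have "\<not> inj ?f" using range_inj_infinite by metis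
  then obtain i j where "?f i = ?f j" "i \<noteq> j" by (auto simp: inj_def)
  then obtain i j where ij: "?f i = ?f j" "i < j" by (metis nat_neq_iff)
  define n d where "n = Suc i" and "d = j - i"
  have d: "d > 0" "Suc j = n + d" using ij by (auto simp: n_def d_def)
  have nd: "pi_dvd (c [^]\<^bsub>GR\<^esub> n \<ominus>\<^bsub>GR\<^esub> c [^]\<^bsub>GR\<^esub> (n + d))"
  proof (rule residues_eq_iff[THEN iffD1])
    show "residues (c [^]\<^bsub>GR\<^esub> n) = residues (c [^]\<^bsub>GR\<^esub> (n + d))"
      using ij(1) unfolding d(2)[symmetric] unfolding n_def .
  qed (use cG in auto)
  have step: "pi_dvd (c [^]\<^bsub>GR\<^esub> (n + m) \<ominus>\<^bsub>GR\<^esub> c [^]\<^bsub>GR\<^esub> (n + m + d))" for m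
  proof -
    let ?z = "c [^]\<^bsub>GR\<^esub> n \<ominus>\<^bsub>GR\<^esub> c [^]\<^bsub>GR\<^esub> (n + d)"
    have "pi_dvd (?z \<otimes>\<^bsub>GR\<^esub> c [^]\<^bsub>GR\<^esub> m)" using nd cG by (intro pi_dvd_mult) auto
    moreover have "?z \<otimes>\<^bsub>GR\<^esub> c [^]\<^bsub>GR\<^esub> m = c [^]\<^bsub>GR\<^esub> (n + m) \<ominus>\<^bsub>GR\<^esub> c [^]\<^bsub>GR\<^esub> (n + m + d)"
      using cG by (simp add: GR.minus_eq GR.l_distr GR.l_minus GR.nat_pow_mult ac_simps)
    ultimately show ?thesis by simp
  qed
  have steps: "pi_dvd (c [^]\<^bsub>GR\<^esub> (n + m) \<ominus>\<^bsub>GR\<^esub> c [^]\<^bsub>GR\<^esub> (n + m + k * d))" for m k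
  proof (induction k)
    case 0
    then show ?case using cG pi_dvd_zero by (simp add: GR.minus_eq GR.r_neg)
  next
    case (Suc k)
    let ?a = "c [^]\<^bsub>GR\<^esub> (n + m)" and ?b = "c [^]\<^bsub>GR\<^esub> (n + m + k * d)"
      and ?e = "c [^]\<^bsub>GR\<^esub> (n + m + Suc k * d)"
    have cl: "?a \<in> carrier GR" "?b \<in> carrier GR" "?e \<in> carrier GR" using cG by auto
    have "pi_dvd (?b \<ominus>\<^bsub>GR\<^esub> ?e)" using step[of "m + k * d"] by (simp add: ac_simps)
    then have "pi_dvd ((?a \<ominus>\<^bsub>GR\<^esub> ?b) \<oplus>\<^bsub>GR\<^esub> (?b \<ominus>\<^bsub>GR\<^esub> ?e))"
      using Suc cl by (intro pi_dvd_add) auto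
    moreover have "(?a \<ominus>\<^bsub>GR\<^esub> ?b) \<oplus>\<^bsub>GR\<^esub> (?b \<ominus>\<^bsub>GR\<^esub> ?e) = ?a \<ominus>\<^bsub>GR\<^esub> ?e"
      using cl by (simp add: GR.minus_eq GR.a_assoc GR.r_neg2 GR.r_neg1)
    ultimately show ?case by simp
  qed
  \<comment> \<open>The exponent \<open>n * d\<close> is a multiple of the period \<open>d\<close>
    and at least the start \<open>n\<close> of periodicity, so doubling it does not change the power
    modulo \<pi>.\<close>
  define e where "e = c [^]\<^bsub>GR\<^esub> (n * d)"
  have eG: "e \<in> carrier GR" using cG by (simp add: e_def)
  obtain d' where "d = Suc d'" using d(1) gr0_implies_Suc by blast
  then obtain m where m: "n * d = n + m" by simp
  have "pi_dvd (e \<ominus>\<^bsub>GR\<^esub> e \<otimes>\<^bsub>GR\<^esub> e)"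
    using steps[of m n] cG unfolding e_def m[symmetric] by (simp add: GR.nat_pow_mult)
  then have "pi_dvd (\<ominus>\<^bsub>GR\<^esub> (e \<ominus>\<^bsub>GR\<^esub> e \<otimes>\<^bsub>GR\<^esub> e))" using eG by (intro pi_dvd_uminus) auto
  moreover have "\<ominus>\<^bsub>GR\<^esub> (e \<ominus>\<^bsub>GR\<^esub> e \<otimes>\<^bsub>GR\<^esub> e) = e \<otimes>\<^bsub>GR\<^esub> e \<ominus>\<^bsub>GR\<^esub> e"
    using eG by (simp add: GR.minus_eq GR.minus_add GR.a_comm)
  ultimately have idem: "pi_dvd (e \<otimes>\<^bsub>GR\<^esub> e \<ominus>\<^bsub>GR\<^esub> e)" by simp
  have "\<not> pi_dvd e" using reduced[OF cG] c(2) unfolding e_def by blast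
  moreover have "e \<in> ann x"
  proof -
    obtain l where l: "n * d = Suc l" using d(1) unfolding n_def by (metis gr0_implies_Suc nat_0_less_mult_iff zero_less_Suc)
    have "op e x = op (c [^]\<^bsub>GR\<^esub> l) (op c x)" unfolding e_def l using cG x by (simp add: op_mult)
    then have "\<omega> \<otimes> op e x \<in> B"
      using op_omega_B[of "c [^]\<^bsub>GR\<^esub> l" "op c x"] c(1) cG x by (simp add: ann_def)
    then show ?thesis using eG by (simp add: ann_def)
  qed
  ultimately show ?thesis using that idem by blast
qed

text \<open>Modulo \<pi> the idempotent e kills \<open>x\<close> but, by
  \<open>faithful_mod_pi\<close>, not all of \<open>B\<close>. Adding a nonzero vector w = e v to
  \<open>x\<close> keeps \<open>x\<close> as the component under 1 - e, so the annihilator can only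
  shrink, and e drops out of it.\<close>

lemma ann_refine:
  assumes x: "x \<in> B" and c: "c \<in> ann x" "\<not> pi_dvd c"
  obtains x' where "x' \<in> B" "residues ` ann x' \<subset> residues ` ann x"
proof -
  obtain e where e: "e \<in> ann x" "\<not> pi_dvd e" "pi_dvd (e \<otimes>\<^bsub>GR\<^esub> e \<ominus>\<^bsub>GR\<^esub> e)"
    using idempotent_in_ann[OF x c] by blast
  have eG: "e \<in> carrier GR" and ex: "\<omega> \<otimes> op e x \<in> B" using e(1) by (auto simp: ann_def)
  obtain v where v: "v \<in> B" "\<omega> \<otimes> op e v \<notin> B" using faithful_mod_pi[OF eG] e(2) by blast
  define w where "w = op e v"
  have w: "w \<in> B" using eG v by (simp add: w_def)
  have ew: "\<omega> \<otimes> (op e w \<ominus> w) \<in> B"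
  proof -
    have "op (e \<otimes>\<^bsub>GR\<^esub> e \<ominus>\<^bsub>GR\<^esub> e) v = op e w \<ominus> w"
      using eG v by (simp add: op_minus op_mult w_def)
    then show ?thesis using pi_dvd_op[OF _ e(3) v(1)] eG by simp
  qed
  define x' where "x' = x \<oplus> w"
  have x': "x' \<in> B" using x w by (simp add: x'_def)
  have opx': "op d x' = op d x \<oplus> op d w" if "d \<in> carrier GR" for d
    unfolding x'_def using that x w by (simp add: op_add_right)
  have sub: "ann x' \<subseteq> ann x"
  proof
    fix d assume d: "d \<in> ann x'"
    then have dG: "d \<in> carrier GR" and dx: "\<omega> \<otimes> op d x' \<in> B" by (auto simp: ann_def)
    \<comment> \<open>The component of \<open>x'\<close> under 1 - e, which is congruent to
      \<open>x\<close> modulo \<pi>.\<close>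
    let ?y = "x' \<ominus> op e x'"
    have y: "?y = x \<ominus> (op e x \<oplus> (op e w \<ominus> w))"
      unfolding opx'[OF eG] unfolding x'_def using x w eG by (simp add: ring_norm)
    have "\<omega> \<otimes> (x \<ominus> ?y) = \<omega> \<otimes> op e x \<oplus> \<omega> \<otimes> (op e w \<ominus> w)"
      unfolding y using x w eG by (simp add: ring_norm)
    then have 1: "\<omega> \<otimes> (x \<ominus> ?y) \<in> B" using B_closed(1)[OF ex ew] by simp
    have 2: "\<omega> \<otimes> op d (x \<ominus> ?y) \<in> B" using dG x x' eG by (intro op_omega_B[OF dG _ 1]) auto
    have "op d ?y = op d x' \<ominus> op e (op d x')"
      using dG eG x' by (simp add: op_minus_right op_commute[of d e])
    moreover have "\<omega> \<otimes> op e (op d x') \<in> B" using dG x' by (intro op_omega_B[OF eG _ dx]) auto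
    ultimately have 3: "\<omega> \<otimes> op d ?y \<in> B"
      using B_closed(4)[OF dx] dG eG x' by (simp add: minus_eq r_distr r_minus)
    have "\<omega> \<otimes> op d x = \<omega> \<otimes> op d (x \<ominus> ?y) \<oplus> \<omega> \<otimes> op d ?y"
    proof -
      have yF: "?y \<in> F" using x' eG by simp
      have m: "op d x \<in> carrier E" "op d ?y \<in> carrier E" using dG x yF by auto
      have "op d (x \<ominus> ?y) = op d x \<ominus> op d ?y" using dG x yF by (intro op_minus_right) auto
      then have "op d x = op d (x \<ominus> ?y) \<oplus> op d ?y"
        using m by (simp add: minus_eq[of "op d x"] a_assoc l_neg)
      then show ?thesis using dG x x' eG by (simp add: r_distr)
    qed
    then have "\<omega> \<otimes> op d x \<in> B" using B_closed(1)[OF 2 3] by simp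
    then show "d \<in> ann x" using dG by (simp add: ann_def)
  qed
  have "residues e \<notin> residues ` ann x'"
  proof
    assume "residues e \<in> residues ` ann x'"
    then obtain d where d: "d \<in> ann x'" "residues e = residues d" by blast
    have dG: "d \<in> carrier GR" using d by (simp add: ann_def)
    have "pi_dvd (e \<ominus>\<^bsub>GR\<^esub> d)" using d(2) residues_eq_iff[OF eG dG] by simp
    then have 1: "\<omega> \<otimes> op (e \<ominus>\<^bsub>GR\<^esub> d) x' \<in> B" using x' eG dG by (intro pi_dvd_op) auto
    have 2: "\<omega> \<otimes> op d x' \<in> B" using d by (simp add: ann_def)
    have 3: "\<omega> \<otimes> op e x' = \<omega> \<otimes> op (e \<ominus>\<^bsub>GR\<^esub> d) x' \<oplus> \<omega> \<otimes> op d x'"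
      using eG dG x' by (simp add: op_minus ring_norm)
    have "\<omega> \<otimes> op e x' \<in> B" unfolding 3 by (rule B_closed(1)[OF 1 2])
    then have 4: "\<omega> \<otimes> op e x' \<ominus> \<omega> \<otimes> op e x \<in> B" using ex by (rule B_closed(4))
    have "\<omega> \<otimes> w = (\<omega> \<otimes> op e x' \<ominus> \<omega> \<otimes> op e x) \<ominus> \<omega> \<otimes> (op e w \<ominus> w)"
      unfolding opx'[OF eG] using x w eG by (simp add: ring_norm)
    also have "\<dots> \<in> B" by (rule B_closed(4)[OF 4 ew])
    finally show False using v by (simp add: w_def)
  qed
  then have "residues ` ann x' \<subset> residues ` ann x" using sub e(1) by blast
  then show ?thesis using that x' by blast
qed

text \<open>A vector whose annihilator has the fewest residue classes admits no step of
  \<open>ann_refine\<close>.\<close>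

lemma exists_free_vector: obtains x where "x \<in> B" "\<And>c. c \<in> carrier GR \<Longrightarrow> \<omega> \<otimes> op c x \<in> B \<Longrightarrow> pi_dvd c"
proof -
  obtain x where x: "x \<in> B" "\<And>x'. x' \<in> B \<Longrightarrow> card (residues ` ann x) \<le> card (residues ` ann x')"
    using ex_has_least_nat[of "\<lambda>x. x \<in> B" \<zero> "\<lambda>x. card (residues ` ann x)"] by auto
  have "pi_dvd c" if cx: "c \<in> ann x" for c
  proof (rule ccontr)
    assume "\<not> pi_dvd c"
    then obtain x' where x': "x' \<in> B" "residues ` ann x' \<subset> residues ` ann x"
      using ann_refine[OF x(1) cx] by blast
    have "finite (residues ` ann x)" by (rule finite_residues) (auto simp: ann_def)
    then show False using psubset_card_mono[OF _ x'(2)] x(2)[OF x'(1)] by simp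
  qed
  then show ?thesis using that x(1) by (auto simp: ann_def)
qed

text \<open>Elimination yields \<open>y\<close> trace-orthogonal to all nontrivial translates of the
  free vector \<open>x\<close>. Then b(z) = tr(y z) / tr(y x) is the coordinate of z at
  \<open>x\<close> with respect to the translates of \<open>x\<close>. Freeness modulo \<pi> makes
  all such coordinates integral, so the translates form a basis of \<open>B\<close>.\<close>

lemma exists_dual_generator: obtains b where "dual_generator b"
proof -
  obtain x where x: "x \<in> B" and free: "\<And>c. c \<in> carrier GR \<Longrightarrow> \<omega> \<otimes> op c x \<in> B \<Longrightarrow> pi_dvd c"
    using exists_free_vector by blast
  \<comment> \<open>Freeness modulo \<pi> lifts to divisibility by \<pi>^j: one factor is taken out
    of the coefficients at a time.\<close>
  have divide: "\<omega> [^] j \<otimes> d g \<in> A"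
    if "d \<in> carrier GR" "w \<in> B" "op d x = \<pi> [^] j \<otimes> w" "g \<in> carrier G" for d w g and j :: nat
    using that
  proof (induction j arbitrary: d)
    case 0
    then show ?case using GR_mem[OF 0(1,4)] by simp
  next
    case (Suc j)
    have e: "\<omega> \<otimes> op d x = \<pi> [^] j \<otimes> w" unfolding Suc.prems(3) using Suc.prems(2) by (simp add: m_ac mult_cancel_simps)
    have "pi_dvd d" using Suc.prems e by (intro free) auto
    then have q: "pi_quot d \<in> carrier GR" by (rule pi_quot_closed)
    have "op (pi_quot d) x = \<pi> [^] j \<otimes> w" using op_pi_quot[OF Suc.prems(1), of x] x e by simp
    then have "\<omega> [^] j \<otimes> pi_quot d g \<in> A" by (rule Suc.IH[OF q Suc.prems(2) _ Suc.prems(4)])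
    then show ?case using Suc.prems by (simp add: pi_quot_def m_assoc)
  qed
  let ?J = "carrier G - {\<one>\<^bsub>G\<^esub>}"
  let ?S = "(\<lambda>y g. tr (y \<otimes> act g x)) ` B"
  have "\<exists>s\<in>?S. s \<one>\<^bsub>G\<^esub> \<noteq> \<zero> \<and> (\<forall>j\<in>?J. s j = \<zero>)"
  proof (rule unit_vector_multiple, unfold carrier_split)
    show "\<exists>s''\<in>?S. \<forall>j\<in>carrier G. s'' j = a \<otimes> s j \<oplus> a' \<otimes> s' j"
      if sS: "s \<in> ?S" "s' \<in> ?S" and a: "a \<in> A" "a' \<in> A" for s s' a a'
    proof -
      obtain y y' where y: "y \<in> B" "y' \<in> B" "s = (\<lambda>g. tr (y \<otimes> act g x))" "s' = (\<lambda>g. tr (y' \<otimes> act g x))"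
        using sS by blast
      have "tr ((a \<otimes> y \<oplus> a' \<otimes> y') \<otimes> act j x) = a \<otimes> s j \<oplus> a' \<otimes> s' j" if "j \<in> carrier G" for j
        using that x y a by (simp add: l_distr m_assoc tr_add tr_smult)
      then show ?thesis using y a by (intro bexI[of _ "\<lambda>g. tr ((a \<otimes> y \<oplus> a' \<otimes> y') \<otimes> act g x)"]) auto
    qed
    fix c assume c: "\<And>j. j \<in> carrier G \<Longrightarrow> c j \<in> A"
      and c0: "\<And>s. s \<in> ?S \<Longrightarrow> (\<Oplus>j\<in>carrier G. c j \<otimes> s j) = \<zero>"
    define d where "d = (\<lambda>g\<in>carrier G. c g)"
    have d: "d \<in> carrier GR" using c by (auto simp: d_def GR_carrier)
    have dc: "d g = c g" if "g \<in> carrier G" for g using that by (simp add: d_def)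
    \<comment> \<open>The relation says that \<open>op d x\<close> is trace-orthogonal to
      \<open>B\<close>, hence zero; \<open>divide\<close> with w = 0 then makes every coefficient
      divisible by all powers of \<pi>.\<close>
    have "op d x = \<zero>"
    proof (rule trace_nondegenerate)
      fix y assume y: "y \<in> B"
      have lin: "lin B (\<lambda>z. tr (z \<otimes> y))" using lin_trace[OF y] .
      have "tr (op d x \<otimes> y) = (\<Oplus>g\<in>carrier G. d g \<otimes> tr (act g x \<otimes> y))"
        unfolding op_def using x GR_mem[OF d] by (intro lin_finsum_smult[OF lin submod_B]) auto
      also have "\<dots> = (\<Oplus>g\<in>carrier G. c g \<otimes> tr (y \<otimes> act g x))"
        using x y c by (intro finsum_cong') (auto simp: dc m_comm)
      also have "\<dots> = \<zero>" using y by (intro c0) auto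
      finally show "tr (op d x \<otimes> y) = \<zero>" .
    qed (use d x in simp)
    then have "\<omega> [^] j \<otimes> d g \<in> A" if "g \<in> carrier G" for g and j :: nat
      using divide[OF d, of \<zero> j g] that by simp
    then show "\<forall>j\<in>carrier G. c j = \<zero>" using c dc by (auto intro!: separated)
  qed (use x in auto)
  then obtain y where y: "y \<in> B" "tr (y \<otimes> act \<one>\<^bsub>G\<^esub> x) \<noteq> \<zero>" "\<And>j. j \<in> ?J \<Longrightarrow> tr (y \<otimes> act j x) = \<zero>" by auto
  define s where "s = tr (y \<otimes> x)"
  have s: "s \<in> A" "s \<noteq> \<zero>" using x y by (auto simp: s_def)
  obtain j :: nat and u where u: "u \<in> A" "inv u \<in> A" "s = \<pi> [^] j \<otimes> u" using factor s by blast
  have unz: "u \<noteq> \<zero>" using u s by auto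
  define d where "d z = (\<lambda>g\<in>carrier G. tr (act g y \<otimes> z))" for z
  have d: "d z \<in> carrier GR" if "z \<in> B" for z
    using that y unfolding d_def GR_carrier by auto
  \<comment> \<open>Expanding the traces and interchanging the sums leaves the sum over k of k(z)
    tr(k(y) x), in which only k = 1 survives by the choice of \<open>y\<close>.\<close>
  have op_d: "op (d z) x = s \<otimes> z" if z: "z \<in> B" for z
  proof -
    have "op (d z) x = (\<Oplus>g\<in>carrier G. \<Oplus>k\<in>carrier G. act k z \<otimes> act g (act k y \<otimes> x))"
      unfolding op_def
    proof (intro finsum_cong')
      fix g assume g: "g \<in> carrier G"
      have "d z g \<otimes> act g x = (\<Oplus>k\<in>carrier G. act k (act g y \<otimes> z) \<otimes> act g x)"
        unfolding tr_def d_def using g x y z by (simp add: finsum_ldistr)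
      also have "\<dots> = (\<Oplus>k\<in>carrier G. act k z \<otimes> act g (act k y \<otimes> x))"
      proof (intro finsum_cong')
        fix k assume k: "k \<in> carrier G"
        have "act k (act g y) = act g (act k y)"
          using g k y by (simp add: GG.m_comm flip: act_comp)
        then show "act k (act g y \<otimes> z) \<otimes> act g x = act k z \<otimes> act g (act k y \<otimes> x)"
          using g k x y z by (simp add: act_mult m_ac)
      qed (use g x y z in auto)
      finally show "d z g \<otimes> act g x = (\<Oplus>k\<in>carrier G. act k z \<otimes> act g (act k y \<otimes> x))" .
    qed (use x y z in \<open>auto intro!: finsum_closed\<close>)
    also have "\<dots> = (\<Oplus>k\<in>carrier G. \<Oplus>g\<in>carrier G. act k z \<otimes> act g (act k y \<otimes> x))"
      using x y z by (intro finsum_swap) auto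
    also have "\<dots> = (\<Oplus>k\<in>carrier G. if k = \<one>\<^bsub>G\<^esub> then z \<otimes> s else \<zero>)"
    proof (intro finsum_cong')
      fix k assume k: "k \<in> carrier G"
      have "(\<Oplus>g\<in>carrier G. act k z \<otimes> act g (act k y \<otimes> x)) = act k z \<otimes> tr (act k y \<otimes> x)"
        unfolding tr_def using k x y z by (intro finsum_rdistr[symmetric]) auto
      also have "tr (act k y \<otimes> x) = tr (act (inv\<^bsub>G\<^esub> k) (act k y \<otimes> x))"
        using k x y by (intro tr_act[symmetric]) auto
      also have "act (inv\<^bsub>G\<^esub> k) (act k y \<otimes> x) = y \<otimes> act (inv\<^bsub>G\<^esub> k) x"
        using k x y by (simp add: act_mult)
      finally show "(\<Oplus>g\<in>carrier G. act k z \<otimes> act g (act k y \<otimes> x)) = (if k = \<one>\<^bsub>G\<^esub> then z \<otimes> s else \<zero>)"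
        using y(3)[of "inv\<^bsub>G\<^esub> k"] k x z by (auto simp: s_def GG.inv_eq_1_iff)
    qed (use x y z s in auto)
    also have "\<dots> = s \<otimes> z" using z s by (subst finsum_delta[of _ "\<one>\<^bsub>G\<^esub>"]) (auto simp: m_comm)
    finally show ?thesis .
  qed
  have inv_s: "inv s = \<omega> [^] j \<otimes> inv u" using u unz by (simp add: inv_mult inv_pow)
  have dA: "inv s \<otimes> d z g \<in> A" if z: "z \<in> B" and g: "g \<in> carrier G" for z g
  proof -
    have "op (d z) x = \<pi> [^] j \<otimes> (u \<otimes> z)" using op_d[OF z] u z by (simp add: m_assoc)
    moreover have "u \<otimes> z \<in> B" using u z by simp
    ultimately have "\<omega> [^] j \<otimes> d z g \<in> A" using divide[OF d[OF z]] g by blast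
    then have "inv u \<otimes> (\<omega> [^] j \<otimes> d z g) \<in> A" using u by simp
    then show ?thesis unfolding inv_s using u GR_mem_F[OF d[OF z] g] by (simp add: m_ac)
  qed
  define b where "b z = inv s \<otimes> tr (y \<otimes> z)" for z
  have b_d: "b (act h z) = inv s \<otimes> d z (inv\<^bsub>G\<^esub> h)" if z: "z \<in> B" and h: "h \<in> carrier G" for z h
  proof -
    have "tr (y \<otimes> act h z) = tr (act (inv\<^bsub>G\<^esub> h) (y \<otimes> act h z))"
      using y z h by (intro tr_act[symmetric]) auto
    then show ?thesis using y z h by (simp add: b_def d_def act_mult)
  qed
  have "lin B b" unfolding lin_def
  proof (intro conjI ballI)
    show "b \<in> B \<rightarrow> A"
    proof
      fix z assume z: "z \<in> B"
      have "b (act \<one>\<^bsub>G\<^esub> z) \<in> A" using b_d[OF z GG.one_closed] dA[OF z GG.one_closed] by simp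
      then show "b z \<in> A" using z by simp
    qed
    show "b (z \<oplus> z') = b z \<oplus> b z'" if "z \<in> B" "z' \<in> B" for z z'
      using that y s by (simp add: b_def r_distr tr_add)
    show "b (a \<otimes> z) = a \<otimes> b z" if "a \<in> A" "z \<in> B" for a z
      using that y s by (simp add: b_def tr_smult m_lcomm[of y] m_lcomm[of "inv s"])
  qed
  moreover have "\<omega> \<otimes> z \<in> B" if z: "z \<in> B" and bz: "\<forall>g\<in>carrier G. \<omega> \<otimes> b (act g z) \<in> A" for z
  proof -
    have "z = inv s \<otimes> op (d z) x" using op_d[OF z] z s by simp
    then have "\<omega> \<otimes> z = (\<omega> \<otimes> inv s) \<otimes> op (d z) x" using z s x d[OF z] by (simp add: m_assoc)
    also have "\<dots> = (\<Oplus>g\<in>carrier G. (\<omega> \<otimes> inv s) \<otimes> (d z g \<otimes> act g x))"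
      unfolding op_def using s x d[OF z] by (intro finsum_rdistr) auto
    also have "\<dots> \<in> B"
    proof (rule B_finsum)
      fix g assume g: "g \<in> carrier G"
      have "\<omega> \<otimes> b (act (inv\<^bsub>G\<^esub> g) z) \<in> A" using bz g by blast
      then have "\<omega> \<otimes> (inv s \<otimes> d z g) \<in> A" using b_d[OF z, of "inv\<^bsub>G\<^esub> g"] g by simp
      then have "(\<omega> \<otimes> (inv s \<otimes> d z g)) \<otimes> act g x \<in> B" by (rule A_B_smult) (use g x in simp)
      then show "(\<omega> \<otimes> inv s) \<otimes> (d z g \<otimes> act g x) \<in> B"
        using g x s GR_mem_F[OF d[OF z] g] by (simp add: m_assoc)
    qed
    finally show ?thesis .
  qed
  ultimately have "dual_generator b" unfolding dual_generator_def by blast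
  then show ?thesis using that by blast
qed

end

section \<open>Inverse limits and towers of fixed fields\<close>

lemma inverse_limit_carrierD:
  assumes "x \<in> carrier (inverse_limit R \<phi>)"
  shows "1 \<le> n \<Longrightarrow> x n \<in> carrier (R n)" "1 \<le> n \<Longrightarrow> \<phi> n (x (Suc n)) = x n" "x \<in> extensional {1..}"
  using assms by (auto simp: inverse_limit_def PiE_iff)

lemma inverse_limit_carrierI:
  assumes "\<And>n. 1 \<le> n \<Longrightarrow> x n \<in> carrier (R n)" "\<And>n. 1 \<le> n \<Longrightarrow> \<phi> n (x (Suc n)) = x n" "x \<in> extensional {1..}"
  shows "x \<in> carrier (inverse_limit R \<phi>)"
  using assms by (auto simp: inverse_limit_def PiE_iff)

lemma inverse_limit_ops:
  assumes "1 \<le> n"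
  shows "(x \<otimes>\<^bsub>inverse_limit R \<phi>\<^esub> y) n = x n \<otimes>\<^bsub>R n\<^esub> y n"
    "(x \<oplus>\<^bsub>inverse_limit R \<phi>\<^esub> y) n = x n \<oplus>\<^bsub>R n\<^esub> y n"
    "\<one>\<^bsub>inverse_limit R \<phi>\<^esub> n = \<one>\<^bsub>R n\<^esub>" "\<zero>\<^bsub>inverse_limit R \<phi>\<^esub> n = \<zero>\<^bsub>R n\<^esub>"
  using assms by (auto simp: inverse_limit_def)

lemma inverse_limit_ext:
  assumes "x \<in> carrier (inverse_limit R \<phi>)" "y \<in> carrier (inverse_limit R \<phi>)" "\<And>n. 1 \<le> n \<Longrightarrow> x n = y n"
  shows "x = y"
  using extensionalityI[OF inverse_limit_carrierD(3)[OF assms(1)] inverse_limit_carrierD(3)[OF assms(2)]] assms(3)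
  by simp

lemma inverse_limit_cring:
  assumes R: "\<And>n::nat. 1 \<le> n \<Longrightarrow> cring (R n)"
    and \<phi>: "\<And>n::nat. 1 \<le> n \<Longrightarrow> \<phi> n \<in> ring_hom (R (Suc n)) (R n)"
  shows "cring (inverse_limit R \<phi>)"
proof -
  let ?L = "inverse_limit R \<phi>"
  note D = inverse_limit_carrierD
  have ext: "x \<otimes>\<^bsub>?L\<^esub> y \<in> extensional {1..}" "x \<oplus>\<^bsub>?L\<^esub> y \<in> extensional {1..}"
    "\<one>\<^bsub>?L\<^esub> \<in> extensional {1..}" "\<zero>\<^bsub>?L\<^esub> \<in> extensional {1..}" for x y
    by (auto simp: inverse_limit_def)
  have hom: "ring_hom_cring (R (Suc n)) (R n) (\<phi> n)" if "1 \<le> n" for n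
    by (rule ring_hom_cring.intro[OF R R ring_hom_cring_axioms.intro[OF \<phi>[OF that]]]) (use that in simp_all)
  have closed: "\<zero>\<^bsub>?L\<^esub> \<in> carrier ?L" "\<one>\<^bsub>?L\<^esub> \<in> carrier ?L"
    "x \<in> carrier ?L \<Longrightarrow> y \<in> carrier ?L \<Longrightarrow> x \<oplus>\<^bsub>?L\<^esub> y \<in> carrier ?L"
    "x \<in> carrier ?L \<Longrightarrow> y \<in> carrier ?L \<Longrightarrow> x \<otimes>\<^bsub>?L\<^esub> y \<in> carrier ?L" for x y
  proof -
    have z: "\<phi> n \<zero>\<^bsub>R (Suc n)\<^esub> = \<zero>\<^bsub>R n\<^esub>" "\<phi> n \<one>\<^bsub>R (Suc n)\<^esub> = \<one>\<^bsub>R n\<^esub>" if "1 \<le> n" for n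
      using ring_hom_zero[OF \<phi>[OF that] cring.axioms(1)[OF R] cring.axioms(1)[OF R[OF that]]]
        ring_hom_one[OF \<phi>[OF that]] by simp_all
    show "\<zero>\<^bsub>?L\<^esub> \<in> carrier ?L"
      by (rule inverse_limit_carrierI[OF _ _ ext(4)]) (auto simp: inverse_limit_ops z cring.cring_simprules(2)[OF R])
    show "\<one>\<^bsub>?L\<^esub> \<in> carrier ?L"
      by (rule inverse_limit_carrierI[OF _ _ ext(3)]) (auto simp: inverse_limit_ops z cring.cring_simprules(6)[OF R])
    assume x: "x \<in> carrier ?L" and y: "y \<in> carrier ?L"
    show "x \<oplus>\<^bsub>?L\<^esub> y \<in> carrier ?L"
    proof (rule inverse_limit_carrierI)
      fix n :: nat assume n: "1 \<le> n"
      show "(x \<oplus>\<^bsub>?L\<^esub> y) n \<in> carrier (R n)"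
        using cring.cring_simprules(1)[OF R[OF n] D(1)[OF x n] D(1)[OF y n]] n by (simp add: inverse_limit_ops)
      show "\<phi> n ((x \<oplus>\<^bsub>?L\<^esub> y) (Suc n)) = (x \<oplus>\<^bsub>?L\<^esub> y) n"
        using ring_hom_add[OF \<phi>[OF n], of "x (Suc n)" "y (Suc n)"] D(1)[OF x] D(1)[OF y] D(2)[OF x n] D(2)[OF y n] n
        by (simp add: inverse_limit_ops)
    qed (rule ext)
    show "x \<otimes>\<^bsub>?L\<^esub> y \<in> carrier ?L"
    proof (rule inverse_limit_carrierI)
      fix n :: nat assume n: "1 \<le> n"
      show "(x \<otimes>\<^bsub>?L\<^esub> y) n \<in> carrier (R n)"
        using cring.cring_simprules(5)[OF R[OF n] D(1)[OF x n] D(1)[OF y n]] n by (simp add: inverse_limit_ops)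
      show "\<phi> n ((x \<otimes>\<^bsub>?L\<^esub> y) (Suc n)) = (x \<otimes>\<^bsub>?L\<^esub> y) n"
        using ring_hom_mult[OF \<phi>[OF n], of "x (Suc n)" "y (Suc n)"] D(1)[OF x] D(1)[OF y] D(2)[OF x n] D(2)[OF y n] n
        by (simp add: inverse_limit_ops)
    qed (rule ext)
  qed
  have ids: "(x \<oplus>\<^bsub>?L\<^esub> y) \<oplus>\<^bsub>?L\<^esub> z = x \<oplus>\<^bsub>?L\<^esub> (y \<oplus>\<^bsub>?L\<^esub> z)" "x \<oplus>\<^bsub>?L\<^esub> y = y \<oplus>\<^bsub>?L\<^esub> x"
    "\<zero>\<^bsub>?L\<^esub> \<oplus>\<^bsub>?L\<^esub> x = x" "(x \<otimes>\<^bsub>?L\<^esub> y) \<otimes>\<^bsub>?L\<^esub> z = x \<otimes>\<^bsub>?L\<^esub> (y \<otimes>\<^bsub>?L\<^esub> z)" "x \<otimes>\<^bsub>?L\<^esub> y = y \<otimes>\<^bsub>?L\<^esub> x"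
    "\<one>\<^bsub>?L\<^esub> \<otimes>\<^bsub>?L\<^esub> x = x" "(x \<oplus>\<^bsub>?L\<^esub> y) \<otimes>\<^bsub>?L\<^esub> z = x \<otimes>\<^bsub>?L\<^esub> z \<oplus>\<^bsub>?L\<^esub> y \<otimes>\<^bsub>?L\<^esub> z"
    if "x \<in> carrier ?L" "y \<in> carrier ?L" "z \<in> carrier ?L" for x y z
    using that closed D(1)[OF that(1)] D(1)[OF that(2)] D(1)[OF that(3)]
    by (intro inverse_limit_ext[where R=R and \<phi>=\<phi>];
      auto simp: inverse_limit_ops cring.cring_simprules(7,8,10-14)[OF R])+
  show ?thesis
  proof (intro cringI abelian_groupI comm_monoidI)
    show "\<exists>y\<in>carrier ?L. y \<oplus>\<^bsub>?L\<^esub> x = \<zero>\<^bsub>?L\<^esub>" if x: "x \<in> carrier ?L" for x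
    proof
      let ?y = "\<lambda>n\<in>{1..}. \<ominus>\<^bsub>R n\<^esub> x n"
      show y: "?y \<in> carrier ?L"
      proof (rule inverse_limit_carrierI)
        fix n :: nat assume n: "1 \<le> n"
        show "?y n \<in> carrier (R n)"
          using cring.cring_simprules(3)[OF R[OF n] D(1)[OF x n]] n by simp
        show "\<phi> n (?y (Suc n)) = ?y n"
          using ring_hom_cring.hom_a_inv[OF hom[OF n] D(1)[OF x, of "Suc n"]] D(2)[OF x n] n by simp
      qed simp
      show "?y \<oplus>\<^bsub>?L\<^esub> x = \<zero>\<^bsub>?L\<^esub>"
        using closed(1) closed(3)[OF y x] D(1)[OF x]
        by (intro inverse_limit_ext[where R=R and \<phi>=\<phi>]) (auto simp: inverse_limit_ops cring.cring_simprules(9)[OF R])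
    qed
  qed (rule closed ids(1,4,7) ids(2,5)[OF _ _ closed(1)] ids(3,6)[OF _ closed(1,1)]; assumption)+
qed

lemma free_module_of_rank_one_iff:
  assumes mod: "Module.module R M"
  shows "free_module_of_rank R M 1 \<longleftrightarrow>
     (\<exists>b\<in>carrier M. \<forall>x\<in>carrier M. \<exists>!a. a \<in> carrier R \<and> x = a \<odot>\<^bsub>M\<^esub> b)"
proof -
  interpret Module.module R M by (rule mod)
  have s: "{..<1} = {0::nat}" by auto
  have sum: "(\<Oplus>\<^bsub>M\<^esub>i\<in>{..<1}. c i \<odot>\<^bsub>M\<^esub> b i) = c 0 \<odot>\<^bsub>M\<^esub> b (0::nat)"
    if "c 0 \<in> carrier R" "b 0 \<in> carrier M" for c b
    unfolding s using that by (subst finsum_insert) auto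
  show ?thesis
  proof
    assume "free_module_of_rank R M 1"
    then have "\<exists>b\<in>{..<1::nat} \<rightarrow> carrier M. \<forall>x\<in>carrier M.
      \<exists>!c. c \<in> {..<1} \<rightarrow>\<^sub>E carrier R \<and> x = (\<Oplus>\<^bsub>M\<^esub>i\<in>{..<1}. c i \<odot>\<^bsub>M\<^esub> b i)"
      unfolding free_module_of_rank_def by (rule conjunct2)
    then obtain b where b: "b \<in> {..<1::nat} \<rightarrow> carrier M" "\<forall>x\<in>carrier M.
      \<exists>!c. c \<in> {..<1} \<rightarrow>\<^sub>E carrier R \<and> x = (\<Oplus>\<^bsub>M\<^esub>i\<in>{..<1}. c i \<odot>\<^bsub>M\<^esub> b i)" by (rule bexE)
    have b0: "b 0 \<in> carrier M" using b(1) by auto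
    have "\<exists>!a. a \<in> carrier R \<and> x = a \<odot>\<^bsub>M\<^esub> b 0" if x: "x \<in> carrier M" for x
    proof -
      from bspec[OF b(2) x] obtain c where
        c': "c \<in> {..<1} \<rightarrow>\<^sub>E carrier R \<and> x = (\<Oplus>\<^bsub>M\<^esub>i\<in>{..<1}. c i \<odot>\<^bsub>M\<^esub> b i)"
        and u: "\<forall>c'. c' \<in> {..<1} \<rightarrow>\<^sub>E carrier R \<and> x = (\<Oplus>\<^bsub>M\<^esub>i\<in>{..<1}. c' i \<odot>\<^bsub>M\<^esub> b i) \<longrightarrow> c' = c"
        by (rule ex1E)
      note c = conjunct1[OF c'] conjunct2[OF c']
      have c0: "c 0 \<in> carrier R" using c(1) by auto
      show ?thesis
      proof (rule ex1I[of _ "c 0"])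
        show "c 0 \<in> carrier R \<and> x = c 0 \<odot>\<^bsub>M\<^esub> b 0" using c0 c(2) sum[of c b] b0 by simp
        fix a assume a: "a \<in> carrier R \<and> x = a \<odot>\<^bsub>M\<^esub> b 0"
        have "(\<lambda>i\<in>{..<1::nat}. a) = c"
        proof (rule u[rule_format], rule conjI)
          show "(\<lambda>i\<in>{..<1::nat}. a) \<in> {..<1} \<rightarrow>\<^sub>E carrier R" using a by auto
          show "x = (\<Oplus>\<^bsub>M\<^esub>i\<in>{..<1}. (\<lambda>i\<in>{..<1::nat}. a) i \<odot>\<^bsub>M\<^esub> b i)"
            using a sum[of "\<lambda>i\<in>{..<1::nat}. a" b] b0 by simp
        qed
        then show "a = c 0" by (metis lessThan_iff restrict_apply' zero_less_one)
      qed
    qed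
    then show "\<exists>b\<in>carrier M. \<forall>x\<in>carrier M. \<exists>!a. a \<in> carrier R \<and> x = a \<odot>\<^bsub>M\<^esub> b" using b0 by blast
  next
    assume "\<exists>b\<in>carrier M. \<forall>x\<in>carrier M. \<exists>!a. a \<in> carrier R \<and> x = a \<odot>\<^bsub>M\<^esub> b"
    then obtain b where b: "b \<in> carrier M" "\<forall>x\<in>carrier M. \<exists>!a. a \<in> carrier R \<and> x = a \<odot>\<^bsub>M\<^esub> b"
      by (rule bexE)
    have "\<exists>!c. c \<in> {..<1::nat} \<rightarrow>\<^sub>E carrier R \<and> x = (\<Oplus>\<^bsub>M\<^esub>i\<in>{..<1}. c i \<odot>\<^bsub>M\<^esub> b)" if x: "x \<in> carrier M" for x
    proof -
      from bspec[OF b(2) x] obtain a where a': "a \<in> carrier R \<and> x = a \<odot>\<^bsub>M\<^esub> b"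
        and u: "\<forall>a'. a' \<in> carrier R \<and> x = a' \<odot>\<^bsub>M\<^esub> b \<longrightarrow> a' = a" by (rule ex1E)
      note a = conjunct1[OF a'] conjunct2[OF a']
      show ?thesis
      proof (rule ex1I[of _ "\<lambda>i\<in>{..<1::nat}. a"])
        show "(\<lambda>i\<in>{..<1::nat}. a) \<in> {..<1} \<rightarrow>\<^sub>E carrier R \<and>
          x = (\<Oplus>\<^bsub>M\<^esub>i\<in>{..<1}. (\<lambda>i\<in>{..<1::nat}. a) i \<odot>\<^bsub>M\<^esub> b)"
          using a b(1) sum[of "\<lambda>i\<in>{..<1::nat}. a" "\<lambda>_. b"] by auto
        fix c assume c: "c \<in> {..<1::nat} \<rightarrow>\<^sub>E carrier R \<and> x = (\<Oplus>\<^bsub>M\<^esub>i\<in>{..<1}. c i \<odot>\<^bsub>M\<^esub> b)"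
        then have "c 0 \<in> carrier R" by auto
        then have "c 0 = a" using conjunct2[OF c] sum[of c "\<lambda>_. b"] b(1) by (intro u[rule_format]) simp
        then show "c = (\<lambda>i\<in>{..<1::nat}. a)" using c by (intro PiE_ext[of c "{..<1}" "\<lambda>_. carrier R"]) auto
      qed
    qed
    then show "free_module_of_rank R M 1"
      unfolding free_module_of_rank_def using mod b(1) by (intro conjI bexI[of _ "\<lambda>_. b"]) auto
  qed
qed

text \<open>Here \<open>N_closed\<close> says that \<open>N n\<close> is the full group fixing its
  fixed field, and \<open>\<Gamma>_fixed\<close> is the Galois property of the whole extension. The
  Krull topology is absent from these conditions and enters only when the locale is
  instantiated.\<close>

locale tower = dvr_field E L A \<pi> for E :: "('a, 'm) ring_scheme" (structure) and L A \<pi> +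
  fixes \<Gamma> :: "('a \<Rightarrow> 'a) monoid" and N :: "nat \<Rightarrow> ('a \<Rightarrow> 'a) set"
  assumes comm_\<Gamma>: "comm_group \<Gamma>"
    and hom: "\<theta> \<in> carrier \<Gamma> \<Longrightarrow> \<theta> \<in> ring_hom E E"
    and \<Gamma>_mult: "\<theta> \<in> carrier \<Gamma> \<Longrightarrow> \<tau> \<in> carrier \<Gamma> \<Longrightarrow> x \<in> carrier E \<Longrightarrow> (\<theta> \<otimes>\<^bsub>\<Gamma>\<^esub> \<tau>) x = \<theta> (\<tau> x)"
    and \<Gamma>_one [simp]: "x \<in> carrier E \<Longrightarrow> \<one>\<^bsub>\<Gamma>\<^esub> x = x"
    and \<Gamma>_L [simp]: "\<theta> \<in> carrier \<Gamma> \<Longrightarrow> x \<in> L \<Longrightarrow> \<theta> x = x"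
    and \<Gamma>_fixed: "x \<in> carrier E \<Longrightarrow> (\<And>\<theta>. \<theta> \<in> carrier \<Gamma> \<Longrightarrow> \<theta> x = x) \<Longrightarrow> x \<in> L"
    and normal_N: "1 \<le> n \<Longrightarrow> N n \<lhd> \<Gamma>"
    and N_Suc: "1 \<le> n \<Longrightarrow> N (Suc n) \<subseteq> N n"
    and N_finite: "1 \<le> n \<Longrightarrow> finite (carrier (\<Gamma> Mod N n))"
    and N_closed: "1 \<le> n \<Longrightarrow> \<theta> \<in> carrier \<Gamma> \<Longrightarrow> (\<And>x. x \<in> fixed_field E (N n) \<Longrightarrow> \<theta> x = x) \<Longrightarrow> \<theta> \<in> N n"
begin

sublocale \<Gamma>: comm_group \<Gamma> by (rule comm_\<Gamma>)

abbreviation F where "F n \<equiv> fixed_field E (N n)"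
abbreviation B where "B n \<equiv> integral_closure E A (F n)"
abbreviation Q where "Q n \<equiv> \<Gamma> Mod N n"

lemma hom_simps:
  assumes "\<theta> \<in> carrier \<Gamma>"
  shows "x \<in> carrier E \<Longrightarrow> \<theta> x \<in> carrier E"
    "x \<in> carrier E \<Longrightarrow> y \<in> carrier E \<Longrightarrow> \<theta> (x \<oplus> y) = \<theta> x \<oplus> \<theta> y"
    "x \<in> carrier E \<Longrightarrow> y \<in> carrier E \<Longrightarrow> \<theta> (x \<otimes> y) = \<theta> x \<otimes> \<theta> y"
    "\<theta> \<one> = \<one>" "\<theta> \<zero> = \<zero>"
  using ring_hom_memE[OF hom[OF assms]] ring_hom_zero[OF hom[OF assms] ring_axioms ring_axioms] by auto

lemma hom_uminus: assumes "\<theta> \<in> carrier \<Gamma>" "x \<in> carrier E" shows "\<theta> (\<ominus> x) = \<ominus> \<theta> x"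
proof -
  have "\<theta> (\<ominus> x) \<oplus> \<theta> x = \<zero>"
    using hom_simps(2)[OF assms(1), of "\<ominus> x" x] hom_simps(5)[OF assms(1)] assms by (simp add: l_neg)
  then show ?thesis using hom_simps(1)[OF assms(1)] assms by (intro sum_zero_eq_neg) auto
qed

lemma subgroup_N: "1 \<le> n \<Longrightarrow> subgroup (N n) \<Gamma>" using normal_N normal_imp_subgroup by blast

lemma N_mem: "1 \<le> n \<Longrightarrow> \<theta> \<in> N n \<Longrightarrow> \<theta> \<in> carrier \<Gamma>"
  using subgroup.subset[OF subgroup_N] by blast

lemma N_mono: assumes "1 \<le> n" "n \<le> m" shows "N m \<subseteq> N n"
  using assms(2)
proof (induction m rule: dec_induct)
  case (step m)
  then have "1 \<le> m" using assms(1) by simp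
  then show ?case using N_Suc[of m] step by blast
qed simp

lemma F_memD: "x \<in> F n \<Longrightarrow> x \<in> carrier E" "x \<in> F n \<Longrightarrow> \<theta> \<in> N n \<Longrightarrow> \<theta> x = x"
  by (auto simp: fixed_field_def)

lemma F_memI: "x \<in> carrier E \<Longrightarrow> (\<And>\<theta>. \<theta> \<in> N n \<Longrightarrow> \<theta> x = x) \<Longrightarrow> x \<in> F n"
  by (auto simp: fixed_field_def)

lemma F_mono: "1 \<le> n \<Longrightarrow> n \<le> m \<Longrightarrow> F n \<subseteq> F m"
  using N_mono[of n m] by (auto simp: fixed_field_def)

lemma B_mono: "1 \<le> n \<Longrightarrow> n \<le> m \<Longrightarrow> B n \<subseteq> B m"
  using F_mono[of n m] by (auto simp: integral_closure_def)

lemma B_inter: "x \<in> B m \<Longrightarrow> x \<in> F n \<Longrightarrow> x \<in> B n"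
  by (auto simp: integral_closure_def)

lemma F_stable:
  assumes n: "1 \<le> n" and \<theta>: "\<theta> \<in> carrier \<Gamma>" and x: "x \<in> F n" shows "\<theta> x \<in> F n"
proof (rule F_memI)
  show "\<theta> x \<in> carrier E" using hom_simps(1)[OF \<theta>] F_memD[OF x] by blast
  fix \<tau> assume \<tau>: "\<tau> \<in> N n"
  have \<tau>G: "\<tau> \<in> carrier \<Gamma>" using N_mem n \<tau> by blast
  have "\<tau> (\<theta> x) = (\<tau> \<otimes>\<^bsub>\<Gamma>\<^esub> \<theta>) x" using \<Gamma>_mult \<tau>G \<theta> F_memD(1)[OF x] by simp
  also have "\<dots> = \<theta> (\<tau> x)" using \<Gamma>_mult \<tau>G \<theta> F_memD(1)[OF x] by (simp add: \<Gamma>.m_comm[of \<tau>])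
  also have "\<dots> = \<theta> x" using F_memD(2)[OF x \<tau>] by simp
  finally show "\<tau> (\<theta> x) = \<theta> x" .
qed

lemma subfield_F: assumes n: "1 \<le> n" shows "subfield (F n) E"
proof (rule subfieldI')
  show "subring (F n) E"
  proof (rule subringI)
    show "F n \<subseteq> carrier E" by (auto simp: fixed_field_def)
    show "\<one> \<in> F n" using N_mem[OF n] hom_simps(4) by (intro F_memI) auto
    show "\<ominus> x \<in> F n" if x: "x \<in> F n" for x
    proof (rule F_memI)
      fix \<theta> assume \<theta>: "\<theta> \<in> N n"
      show "\<theta> (\<ominus> x) = \<ominus> x"
        using hom_uminus[OF N_mem[OF n \<theta>] F_memD(1)[OF x]] F_memD(2)[OF x \<theta>] by simp
    qed (use F_memD(1)[OF x] in simp)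
    fix x y assume xy: "x \<in> F n" "y \<in> F n"
    note E = F_memD(1)[OF xy(1)] F_memD(1)[OF xy(2)]
    show "x \<otimes> y \<in> F n"
    proof (rule F_memI)
      fix \<theta> assume \<theta>: "\<theta> \<in> N n"
      show "\<theta> (x \<otimes> y) = x \<otimes> y"
        using hom_simps(3)[OF N_mem[OF n \<theta>] E] F_memD(2)[OF xy(1) \<theta>] F_memD(2)[OF xy(2) \<theta>] by simp
    qed (use E in simp)
    show "x \<oplus> y \<in> F n"
    proof (rule F_memI)
      fix \<theta> assume \<theta>: "\<theta> \<in> N n"
      show "\<theta> (x \<oplus> y) = x \<oplus> y"
        using hom_simps(2)[OF N_mem[OF n \<theta>] E] F_memD(2)[OF xy(1) \<theta>] F_memD(2)[OF xy(2) \<theta>] by simp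
    qed (use E in simp)
  qed
  fix x assume x: "x \<in> F n - {\<zero>}"
  then have xE: "x \<in> carrier E" "x \<noteq> \<zero>" using F_memD by auto
  show "inv x \<in> F n"
  proof (rule F_memI)
    fix \<theta> assume \<theta>: "\<theta> \<in> N n"
    have \<theta>G: "\<theta> \<in> carrier \<Gamma>" using N_mem[OF n \<theta>] .
    have "x \<otimes> \<theta> (inv x) = \<theta> (x \<otimes> inv x)"
      using hom_simps(3)[OF \<theta>G, of x "inv x"] F_memD(2)[OF _ \<theta>, of x] x xE by simp
    also have "\<dots> = \<one>" using xE hom_simps(4)[OF \<theta>G] by simp
    finally show "\<theta> (inv x) = inv x" using xE hom_simps(1)[OF \<theta>G] by (intro comm_inv_char[symmetric]) auto
  qed (use xE in simp)
qed

text \<open>The contragredient action of cosets; it is a left action because \<open>\<Gamma>\<close> is abelian.\<close>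

definition cact :: "('a \<Rightarrow> 'a) set \<Rightarrow> 'a \<Rightarrow> 'a" where
  "cact C x = (inv\<^bsub>\<Gamma>\<^esub> (SOME \<gamma>. \<gamma> \<in> C)) x"

abbreviation cset where "cset n \<gamma> \<equiv> N n #>\<^bsub>\<Gamma>\<^esub> \<gamma>"

lemma Q_carrier: "1 \<le> n \<Longrightarrow> carrier (Q n) = {cset n \<gamma> | \<gamma>. \<gamma> \<in> carrier \<Gamma>}"
  by (auto simp: FactGroup_def RCOSETS_def)

lemma cos_in [simp]: "1 \<le> n \<Longrightarrow> \<gamma> \<in> carrier \<Gamma> \<Longrightarrow> cset n \<gamma> \<in> carrier (Q n)"
  by (auto simp: Q_carrier)

lemma cosE: assumes "1 \<le> n" "C \<in> carrier (Q n)" obtains \<gamma> where "\<gamma> \<in> carrier \<Gamma>" "C = cset n \<gamma>"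
  using assms by (auto simp: Q_carrier)

lemma Q_one: "\<one>\<^bsub>Q n\<^esub> = N n" by (simp add: FactGroup_def)

lemma Q_mult:
  "1 \<le> n \<Longrightarrow> \<gamma> \<in> carrier \<Gamma> \<Longrightarrow> \<delta> \<in> carrier \<Gamma> \<Longrightarrow> cset n \<gamma> \<otimes>\<^bsub>Q n\<^esub> cset n \<delta> = cset n (\<gamma> \<otimes>\<^bsub>\<Gamma>\<^esub> \<delta>)"
  using normal.rcos_sum[OF normal_N] by (simp add: FactGroup_def)

lemma cos_memE:
  assumes "\<gamma>' \<in> cset n \<gamma>" obtains \<theta> where "\<theta> \<in> N n" "\<gamma>' = \<theta> \<otimes>\<^bsub>\<Gamma>\<^esub> \<gamma>"
  using assms by (auto simp: r_coset_def)

lemma cos_self: "1 \<le> n \<Longrightarrow> \<gamma> \<in> carrier \<Gamma> \<Longrightarrow> \<gamma> \<in> cset n \<gamma>"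
  by (rule \<Gamma>.rcos_self[OF _ subgroup_N])

lemma inv_coset_apply:
  assumes n: "1 \<le> n" and \<gamma>: "\<gamma> \<in> carrier \<Gamma>" "\<gamma>' \<in> cset n \<gamma>" and x: "x \<in> F n"
  shows "(inv\<^bsub>\<Gamma>\<^esub> \<gamma>') x = (inv\<^bsub>\<Gamma>\<^esub> \<gamma>) x"
proof -
  obtain \<theta> where \<theta>: "\<theta> \<in> N n" "\<gamma>' = \<theta> \<otimes>\<^bsub>\<Gamma>\<^esub> \<gamma>" using \<gamma>(2) by (rule cos_memE)
  have \<theta>G: "\<theta> \<in> carrier \<Gamma>" using N_mem[OF n \<theta>(1)] .
  have i: "inv\<^bsub>\<Gamma>\<^esub> \<theta> \<in> N n" using subgroup.m_inv_closed[OF subgroup_N[OF n] \<theta>(1)] .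
  have "(inv\<^bsub>\<Gamma>\<^esub> \<gamma>') x = (inv\<^bsub>\<Gamma>\<^esub> \<gamma> \<otimes>\<^bsub>\<Gamma>\<^esub> inv\<^bsub>\<Gamma>\<^esub> \<theta>) x"
    using \<theta> \<theta>G \<gamma> by (simp add: \<Gamma>.inv_mult_group)
  also have "\<dots> = (inv\<^bsub>\<Gamma>\<^esub> \<gamma>) ((inv\<^bsub>\<Gamma>\<^esub> \<theta>) x)" using \<theta>G \<gamma> F_memD(1)[OF x] by (simp add: \<Gamma>_mult)
  also have "\<dots> = (inv\<^bsub>\<Gamma>\<^esub> \<gamma>) x" using F_memD(2)[OF x i] by simp
  finally show ?thesis .
qed

lemma cact_cset:
  assumes n: "1 \<le> n" and \<gamma>: "\<gamma> \<in> carrier \<Gamma>" and x: "x \<in> F n"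
  shows "cact (cset n \<gamma>) x = (inv\<^bsub>\<Gamma>\<^esub> \<gamma>) x"
proof -
  have "(SOME \<gamma>'. \<gamma>' \<in> cset n \<gamma>) \<in> cset n \<gamma>" by (rule someI[where P = "\<lambda>\<gamma>'. \<gamma>' \<in> cset n \<gamma>"]) (rule cos_self[OF n \<gamma>])
  then show ?thesis unfolding cact_def by (rule inv_coset_apply[OF n \<gamma> _ x])
qed

lemma cos_eq_N: "1 \<le> n \<Longrightarrow> \<gamma> \<in> N n \<Longrightarrow> cset n \<gamma> = N n"
  by (rule \<Gamma>.coset_join2[OF N_mem subgroup_N])

text \<open>Faithfulness of the quotient on the fixed field is the content of
  \<open>N_closed\<close>; the other conditions pass from automorphisms to cosets by
  \<open>cact_cset\<close>.\<close>

lemma level: assumes n: "1 \<le> n" shows "galois_level E L A \<pi> (Q n) (F n) cact"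
proof (intro galois_level.intro galois_level_axioms.intro)
  show "dvr_field E L A \<pi>" by (rule dvr_field_axioms)
  show "subfield (F n) E" by (rule subfield_F[OF n])
  show "L \<subseteq> F n" using N_mem[OF n] by (auto intro!: F_memI L_mem)
  show "finite (carrier (Q n))" by (rule N_finite[OF n])
  show "comm_group (Q n)" by (rule \<Gamma>.abelian_FactGroup[OF subgroup_N[OF n]])
next
  fix C assume C: "C \<in> carrier (Q n)"
  obtain \<gamma> where \<gamma>: "\<gamma> \<in> carrier \<Gamma>" "C = cset n \<gamma>" using cosE[OF n C] .
  have i: "inv\<^bsub>\<Gamma>\<^esub> \<gamma> \<in> carrier \<Gamma>" using \<gamma> by simp
  have FE: "x \<in> carrier E" if "x \<in> F n" for x using F_memD(1)[OF that] .
  have closed: "x \<oplus> y \<in> F n" "x \<otimes> y \<in> F n" if "x \<in> F n" "y \<in> F n" for x y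
    using subringE(6,7)[OF subfieldE(1)[OF subfield_F[OF n]]] that by auto
  show "cact C x \<in> F n" if "x \<in> F n" for x
    unfolding \<gamma>(2) cact_cset[OF n \<gamma>(1) that] by (rule F_stable[OF n i that])
  show "cact C (x \<oplus> y) = cact C x \<oplus> cact C y" if "x \<in> F n" "y \<in> F n" for x y
    unfolding \<gamma>(2) using cact_cset[OF n \<gamma>(1)] closed that hom_simps(2)[OF i] FE by simp
  show "cact C (x \<otimes> y) = cact C x \<otimes> cact C y" if "x \<in> F n" "y \<in> F n" for x y
    unfolding \<gamma>(2) using cact_cset[OF n \<gamma>(1)] closed that hom_simps(3)[OF i] FE by simp
  show "cact C x = x" if x: "x \<in> L" for x
  proof -
    have "x \<in> F n" using x N_mem[OF n] by (auto intro!: F_memI L_mem)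
    then show ?thesis unfolding \<gamma>(2) using cact_cset[OF n \<gamma>(1)] x i by simp
  qed
  show "\<exists>x\<in>F n. cact C x \<noteq> x" if ne: "C \<noteq> \<one>\<^bsub>Q n\<^esub>"
  proof (rule ccontr)
    assume "\<not> ?thesis"
    then have "(inv\<^bsub>\<Gamma>\<^esub> \<gamma>) x = x" if "x \<in> F n" for x
      using cact_cset[OF n \<gamma>(1)] that \<gamma>(2) by auto
    then have "inv\<^bsub>\<Gamma>\<^esub> \<gamma> \<in> N n" by (rule N_closed[OF n i])
    then have "\<gamma> \<in> N n" using subgroup.m_inv_closed[OF subgroup_N[OF n]] \<gamma>(1) by force
    then show False using ne cos_eq_N[OF n] unfolding \<gamma>(2) Q_one by simp
  qed
  fix D x assume D: "D \<in> carrier (Q n)" and x: "x \<in> F n"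
  obtain \<delta> where \<delta>: "\<delta> \<in> carrier \<Gamma>" "D = cset n \<delta>" using cosE[OF n D] .
  have j: "inv\<^bsub>\<Gamma>\<^esub> \<delta> \<in> carrier \<Gamma>" using \<delta> by simp
  have "cact (C \<otimes>\<^bsub>Q n\<^esub> D) x = (inv\<^bsub>\<Gamma>\<^esub> (\<gamma> \<otimes>\<^bsub>\<Gamma>\<^esub> \<delta>)) x"
    unfolding \<gamma>(2) \<delta>(2) Q_mult[OF n \<gamma>(1) \<delta>(1)] using \<gamma> \<delta> x by (intro cact_cset[OF n]) auto
  also have "inv\<^bsub>\<Gamma>\<^esub> (\<gamma> \<otimes>\<^bsub>\<Gamma>\<^esub> \<delta>) = inv\<^bsub>\<Gamma>\<^esub> \<gamma> \<otimes>\<^bsub>\<Gamma>\<^esub> inv\<^bsub>\<Gamma>\<^esub> \<delta>" using \<gamma> \<delta> by (simp add: \<Gamma>.inv_mult)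
  also have "\<dots> x = cact C (cact D x)"
    unfolding \<gamma>(2) \<delta>(2) using cact_cset[OF n \<gamma>(1)] cact_cset[OF n \<delta>(1)] F_stable[OF n j x] x i j FE[OF x]
    by (simp add: \<Gamma>_mult)
  finally show "cact (C \<otimes>\<^bsub>Q n\<^esub> D) x = cact C (cact D x)" .
next
  fix x assume x: "x \<in> F n"
  have "cact (cset n \<one>\<^bsub>\<Gamma>\<^esub>) x = x" using cact_cset[OF n \<Gamma>.one_closed x] F_memD(1)[OF x] by simp
  moreover have "cset n \<one>\<^bsub>\<Gamma>\<^esub> = N n" using cos_eq_N[OF n] subgroup.one_closed[OF subgroup_N[OF n]] by blast
  ultimately show "cact \<one>\<^bsub>Q n\<^esub> x = x" by (simp add: Q_one)
next
  fix x assume x: "x \<in> F n" and fx: "\<And>C. C \<in> carrier (Q n) \<Longrightarrow> cact C x = x"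
  show "x \<in> L"
  proof (rule \<Gamma>_fixed)
    fix \<theta> assume \<theta>: "\<theta> \<in> carrier \<Gamma>"
    then have "cact (cset n (inv\<^bsub>\<Gamma>\<^esub> \<theta>)) x = \<theta> x" using cact_cset[OF n, of "inv\<^bsub>\<Gamma>\<^esub> \<theta>"] x by simp
    then show "\<theta> x = x" using fx[of "cset n (inv\<^bsub>\<Gamma>\<^esub> \<theta>)"] n \<theta> by simp
  qed (use F_memD(1)[OF x] in simp)
qed

end

section \<open>The Iwasawa algebra and the limit of the duals\<close>

context tower
begin

abbreviation AR where "AR \<equiv> E\<lparr>carrier := A\<rparr>"
abbreviation GR where "GR n \<equiv> group_ring AR (Q n)"

definition op :: "nat \<Rightarrow> (('a \<Rightarrow> 'a) set \<Rightarrow> 'a) \<Rightarrow> 'a \<Rightarrow> 'a" where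
  "op n c x = (\<Oplus>C\<in>carrier (Q n). c C \<otimes> cact C x)"

text \<open>Facts about a single level are exported with the level as a parameter, because the
  arguments below compare two levels at once.\<close>

lemma op_facts:
  assumes n: "1 \<le> n"
  shows op_level: "galois_level.op E (Q n) cact c x = op n c x"
    and op_B: "c \<in> carrier (GR n) \<Longrightarrow> x \<in> B n \<Longrightarrow> op n c x \<in> B n"
    and op_mult: "c \<in> carrier (GR n) \<Longrightarrow> d \<in> carrier (GR n) \<Longrightarrow> x \<in> F n \<Longrightarrow>
      op n (c \<otimes>\<^bsub>GR n\<^esub> d) x = op n c (op n d x)"
    and op_add: "c \<in> carrier (GR n) \<Longrightarrow> d \<in> carrier (GR n) \<Longrightarrow> x \<in> F n \<Longrightarrow>
      op n (c \<oplus>\<^bsub>GR n\<^esub> d) x = op n c x \<oplus> op n d x"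
    and op_one: "x \<in> F n \<Longrightarrow> op n \<one>\<^bsub>GR n\<^esub> x = x"
    and op_add_right: "c \<in> carrier (GR n) \<Longrightarrow> x \<in> F n \<Longrightarrow> y \<in> F n \<Longrightarrow>
      op n c (x \<oplus> y) = op n c x \<oplus> op n c y"
    and op_smult: "c \<in> carrier (GR n) \<Longrightarrow> x \<in> F n \<Longrightarrow> a \<in> A \<Longrightarrow> op n c (a \<otimes> x) = a \<otimes> op n c x"
    and GR_cring: "cring (GR n)"
    and GR_carrier: "carrier (GR n) = carrier (Q n) \<rightarrow>\<^sub>E A"
    and GR_eqI: "c \<in> carrier (GR n) \<Longrightarrow> d \<in> carrier (GR n) \<Longrightarrow>
      (\<And>x. x \<in> B n \<Longrightarrow> op n c x = op n d x) \<Longrightarrow> c = d"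
    and submod_B: "submod (B n)"
    and subring_B: "subring (B n) E"
    and cact_B: "C \<in> carrier (Q n) \<Longrightarrow> x \<in> B n \<Longrightarrow> cact C x \<in> B n"
    and B_F: "x \<in> B n \<Longrightarrow> x \<in> F n"
proof -
  interpret l: galois_level E L A \<pi> "Q n" "F n" cact by (rule level[OF n])
  have op: "l.op = op n" by (intro ext) (simp add: l.op_def op_def)
  show "l.op c x = op n c x" by (simp add: op)
  show "c \<in> carrier (GR n) \<Longrightarrow> x \<in> B n \<Longrightarrow> op n c x \<in> B n" using l.op_B unfolding op .
  show "c \<in> carrier (GR n) \<Longrightarrow> d \<in> carrier (GR n) \<Longrightarrow> x \<in> F n \<Longrightarrow>
      op n (c \<otimes>\<^bsub>GR n\<^esub> d) x = op n c (op n d x)" using l.op_mult unfolding op .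
  show "c \<in> carrier (GR n) \<Longrightarrow> d \<in> carrier (GR n) \<Longrightarrow> x \<in> F n \<Longrightarrow>
      op n (c \<oplus>\<^bsub>GR n\<^esub> d) x = op n c x \<oplus> op n d x" using l.op_add unfolding op .
  show "x \<in> F n \<Longrightarrow> op n \<one>\<^bsub>GR n\<^esub> x = x" using l.op_one unfolding op .
  show "c \<in> carrier (GR n) \<Longrightarrow> x \<in> F n \<Longrightarrow> y \<in> F n \<Longrightarrow>
      op n c (x \<oplus> y) = op n c x \<oplus> op n c y" using l.op_add_right unfolding op .
  show "c \<in> carrier (GR n) \<Longrightarrow> x \<in> F n \<Longrightarrow> a \<in> A \<Longrightarrow> op n c (a \<otimes> x) = a \<otimes> op n c x"
    using l.op_smult A_mem_L unfolding op by blast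
  show "cring (GR n)" by (rule l.GR_cring)
  show "carrier (GR n) = carrier (Q n) \<rightarrow>\<^sub>E A" by (rule l.GR_carrier)
  show "c \<in> carrier (GR n) \<Longrightarrow> d \<in> carrier (GR n) \<Longrightarrow>
      (\<And>x. x \<in> B n \<Longrightarrow> op n c x = op n d x) \<Longrightarrow> c = d" using l.GR_eqI unfolding op .
  show "submod (B n)" by (rule l.submod_B)
  show "subring (B n) E" by (rule l.subring_B)
  show "C \<in> carrier (Q n) \<Longrightarrow> x \<in> B n \<Longrightarrow> cact C x \<in> B n" by (rule l.B_act)
  show "x \<in> B n \<Longrightarrow> x \<in> F n" by (rule l.B_F)
qed

lemma hom_B: assumes "1 \<le> n" "\<theta> \<in> carrier \<Gamma>" "x \<in> B n" shows "\<theta> x \<in> B n"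
proof -
  have "cact (cset n (inv\<^bsub>\<Gamma>\<^esub> \<theta>)) x = \<theta> x"
    using cact_cset[OF assms(1), of "inv\<^bsub>\<Gamma>\<^esub> \<theta>" x] assms B_F by simp
  then show ?thesis using cact_B[OF assms(1) _ assms(3), of "cset n (inv\<^bsub>\<Gamma>\<^esub> \<theta>)"] assms by simp
qed

lemma cset_project:
  assumes n: "1 \<le> n" "n \<le> m" and \<gamma>: "\<gamma> \<in> carrier \<Gamma>" shows "cset m \<gamma> <#>\<^bsub>\<Gamma>\<^esub> N n = cset n \<gamma>"
proof (intro equalityI subsetI)
  have m: "1 \<le> m" using n by simp
  fix \<delta> assume "\<delta> \<in> cset m \<gamma> <#>\<^bsub>\<Gamma>\<^esub> N n"
  then obtain \<gamma>' \<tau> where \<gamma>': "\<gamma>' \<in> cset m \<gamma>" "\<tau> \<in> N n" "\<delta> = \<gamma>' \<otimes>\<^bsub>\<Gamma>\<^esub> \<tau>" by (auto simp: set_mult_def)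
  obtain \<theta> where \<theta>: "\<theta> \<in> N m" "\<gamma>' = \<theta> \<otimes>\<^bsub>\<Gamma>\<^esub> \<gamma>" using \<gamma>'(1) by (rule cos_memE)
  have c: "\<theta> \<in> carrier \<Gamma>" "\<tau> \<in> carrier \<Gamma>" using N_mem[OF m \<theta>(1)] N_mem[OF n(1) \<gamma>'(2)] by auto
  have "\<theta> \<in> N n" using N_mono[OF n] \<theta> by blast
  then have "\<theta> \<otimes>\<^bsub>\<Gamma>\<^esub> \<tau> \<in> N n" using \<gamma>'(2) by (rule subgroup.m_closed[OF subgroup_N[OF n(1)]])
  moreover have "\<delta> = (\<theta> \<otimes>\<^bsub>\<Gamma>\<^esub> \<tau>) \<otimes>\<^bsub>\<Gamma>\<^esub> \<gamma>" using \<gamma>'(3) \<theta>(2) c \<gamma> by (simp add: \<Gamma>.m_ac)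
  ultimately show "\<delta> \<in> cset n \<gamma>" by (auto simp: r_coset_def)
next
  have m: "1 \<le> m" using n by simp
  fix \<delta> assume "\<delta> \<in> cset n \<gamma>"
  then obtain \<theta> where \<theta>: "\<theta> \<in> N n" "\<delta> = \<theta> \<otimes>\<^bsub>\<Gamma>\<^esub> \<gamma>" by (rule cos_memE)
  have "\<delta> = \<gamma> \<otimes>\<^bsub>\<Gamma>\<^esub> \<theta>" using \<theta> N_mem[OF n(1)] \<gamma> by (simp add: \<Gamma>.m_comm)
  then show "\<delta> \<in> cset m \<gamma> <#>\<^bsub>\<Gamma>\<^esub> N n" using \<theta>(1) cos_self[OF m \<gamma>] by (auto simp: set_mult_def)
qed

abbreviation proj where
  "proj n \<equiv> group_ring_map AR (Q (Suc n)) (Q n) (\<lambda>C. C <#>\<^bsub>\<Gamma>\<^esub> N n)"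

abbreviation \<Lambda> where "\<Lambda> \<equiv> iwasawa_algebra AR \<Gamma> N"

lemma project_coset:
  assumes n: "1 \<le> n" and C: "C \<in> carrier (Q (Suc n))"
  shows "C <#>\<^bsub>\<Gamma>\<^esub> N n \<in> carrier (Q n)" "x \<in> F n \<Longrightarrow> cact (C <#>\<^bsub>\<Gamma>\<^esub> N n) x = cact C x"
proof -
  have m: "1 \<le> Suc n" by simp
  obtain \<gamma> where \<gamma>: "\<gamma> \<in> carrier \<Gamma>" "C = cset (Suc n) \<gamma>" using cosE[OF m C] .
  have e: "C <#>\<^bsub>\<Gamma>\<^esub> N n = cset n \<gamma>" unfolding \<gamma>(2) by (rule cset_project[OF n _ \<gamma>(1)]) simp
  show "C <#>\<^bsub>\<Gamma>\<^esub> N n \<in> carrier (Q n)" unfolding e using n \<gamma> by simp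
  assume x: "x \<in> F n"
  then have "x \<in> F (Suc n)" using F_mono[OF n, of "Suc n"] by auto
  then show "cact (C <#>\<^bsub>\<Gamma>\<^esub> N n) x = cact C x"
    unfolding e unfolding \<gamma>(2) using cact_cset[OF n \<gamma>(1) x] cact_cset[OF m \<gamma>(1)] by simp
qed

lemma proj_apply:
  assumes n: "1 \<le> n" and c: "c \<in> carrier (GR (Suc n))" and D: "D \<in> carrier (Q n)"
  shows "proj n c D = (\<Oplus>C\<in>carrier (Q (Suc n)). if C <#>\<^bsub>\<Gamma>\<^esub> N n = D then c C else \<zero>)"
proof -
  have m: "1 \<le> Suc n" by simp
  interpret l: galois_level E L A \<pi> "Q n" "F n" cact by (rule level[OF n])
  have cA: "c C \<in> A" if "C \<in> carrier (Q (Suc n))" for C using c that unfolding GR_carrier[OF m] by auto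
  have "proj n c D = finsum AR c {C \<in> carrier (Q (Suc n)). c C \<noteq> \<zero> \<and> C <#>\<^bsub>\<Gamma>\<^esub> N n = D}"
    using D by (simp add: group_ring_map_def)
  also have "\<dots> = (\<Oplus>C\<in>{C \<in> carrier (Q (Suc n)). c C \<noteq> \<zero> \<and> C <#>\<^bsub>\<Gamma>\<^esub> N n = D}. c C)"
    using cA by (intro l.finsum_AR) auto
  also have "\<dots> = (\<Oplus>C\<in>carrier (Q (Suc n)). if C <#>\<^bsub>\<Gamma>\<^esub> N n = D then c C else \<zero>)"
    using cA N_finite[OF m] by (intro add.finprod_mono_neutral_cong_left) auto
  finally show ?thesis .
qed

lemma proj_closed:
  assumes n: "1 \<le> n" and c: "c \<in> carrier (GR (Suc n))" shows "proj n c \<in> carrier (GR n)"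
proof -
  have m: "1 \<le> Suc n" by simp
  have cA: "c C \<in> A" if "C \<in> carrier (Q (Suc n))" for C using c that unfolding GR_carrier[OF m] by auto
  have "proj n c D \<in> A" if "D \<in> carrier (Q n)" for D
    unfolding proj_apply[OF n c that] using cA by (intro A_finsum) simp
  moreover have "proj n c \<in> extensional (carrier (Q n))" by (simp add: group_ring_map_def)
  ultimately show ?thesis unfolding GR_carrier[OF n] by (simp add: PiE_iff)
qed

text \<open>On the smaller field, cosets of \<open>N (Suc n)\<close> act through their images, so an
  element and its projection induce the same operator. Together with \<open>GR_eqI\<close> this
  determines the projection and gives \<open>proj_hom\<close>.\<close>

lemma op_proj:
  assumes n: "1 \<le> n" and c: "c \<in> carrier (GR (Suc n))" and x: "x \<in> F n"
  shows "op n (proj n c) x = op (Suc n) c x"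
proof -
  have m: "1 \<le> Suc n" by simp
  interpret l: galois_level E L A \<pi> "Q n" "F n" cact by (rule level[OF n])
  have cA: "c C \<in> A" if "C \<in> carrier (Q (Suc n))" for C using c that unfolding GR_carrier[OF m] by auto
  let ?s = "\<lambda>D C. if C <#>\<^bsub>\<Gamma>\<^esub> N n = D then c C \<otimes> cact D x else \<zero>"
  have sm: "?s D C \<in> carrier E" if "D \<in> carrier (Q n)" "C \<in> carrier (Q (Suc n))" for C D
    using l.act_closed[OF that(1) x] cA[OF that(2)] by simp
  have "op n (proj n c) x = (\<Oplus>D\<in>carrier (Q n). \<Oplus>C\<in>carrier (Q (Suc n)). ?s D C)"
    unfolding op_def
  proof (intro finsum_cong')
    fix D assume D: "D \<in> carrier (Q n)"
    have dx: "cact D x \<in> F n" using l.act_closed[OF D x] .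
    have "proj n c D \<otimes> cact D x
      = (\<Oplus>C\<in>carrier (Q (Suc n)). (if C <#>\<^bsub>\<Gamma>\<^esub> N n = D then c C else \<zero>) \<otimes> cact D x)"
      unfolding proj_apply[OF n c D] using dx cA N_finite[OF m] by (intro finsum_ldistr) auto
    also have "\<dots> = (\<Oplus>C\<in>carrier (Q (Suc n)). ?s D C)"
      using dx cA by (intro finsum_cong') auto
    finally show "proj n c D \<otimes> cact D x = (\<Oplus>C\<in>carrier (Q (Suc n)). ?s D C)" .
  qed (use sm in \<open>auto intro!: finsum_closed\<close>)
  also have "\<dots> = (\<Oplus>C\<in>carrier (Q (Suc n)). \<Oplus>D\<in>carrier (Q n). ?s D C)"
    using sm N_finite[OF m] N_finite[OF n] by (intro finsum_swap) auto
  also have "\<dots> = op (Suc n) c x" unfolding op_def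
  proof (intro finsum_cong')
    fix C assume C: "C \<in> carrier (Q (Suc n))"
    have "(\<Oplus>D\<in>carrier (Q n). ?s D C) = ?s (C <#>\<^bsub>\<Gamma>\<^esub> N n) C"
      using N_finite[OF n] project_coset(1)[OF n C] sm[OF project_coset(1)[OF n C] C]
      by (intro finsum_delta) auto
    also have "\<dots> = c C \<otimes> cact C x" using project_coset(2)[OF n C x] by simp
    finally show "(\<Oplus>D\<in>carrier (Q n). ?s D C) = c C \<otimes> cact C x" .
  next
    show "(\<lambda>C. c C \<otimes> cact C x) \<in> carrier (Q (Suc n)) \<rightarrow> carrier E"
    proof
      fix C assume C: "C \<in> carrier (Q (Suc n))"
      have "cact C x \<in> F n"
        using l.act_closed[OF project_coset(1)[OF n C] x] project_coset(2)[OF n C x] by simp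
      then show "c C \<otimes> cact C x \<in> carrier E" using cA[OF C] by simp
    qed
  qed simp
  finally show ?thesis .
qed

lemma proj_hom: assumes n: "1 \<le> n" shows "proj n \<in> ring_hom (GR (Suc n)) (GR n)"
proof (rule ring_hom_memI)
  have m: "1 \<le> Suc n" by simp
  interpret R: cring "GR n" by (rule GR_cring[OF n])
  interpret S: cring "GR (Suc n)" by (rule GR_cring[OF m])
  have BF: "x \<in> F n" "x \<in> F (Suc n)" if "x \<in> B n" for x
    using B_F[OF n that] F_mono[OF n, of "Suc n"] by auto
  show cl: "proj n c \<in> carrier (GR n)" if "c \<in> carrier (GR (Suc n))" for c by (rule proj_closed[OF n that])
  show "proj n (c \<otimes>\<^bsub>GR (Suc n)\<^esub> d) = proj n c \<otimes>\<^bsub>GR n\<^esub> proj n d"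
    if c: "c \<in> carrier (GR (Suc n))" and d: "d \<in> carrier (GR (Suc n))" for c d
  proof (rule GR_eqI[OF n])
    fix x assume x: "x \<in> B n"
    have w: "op n (proj n d) x \<in> F n" using B_F[OF n op_B[OF n cl[OF d] x]] .
    show "op n (proj n (c \<otimes>\<^bsub>GR (Suc n)\<^esub> d)) x = op n (proj n c \<otimes>\<^bsub>GR n\<^esub> proj n d) x"
      unfolding op_proj[OF n S.m_closed[OF c d] BF(1)[OF x]] op_mult[OF m c d BF(2)[OF x]]
        op_mult[OF n cl[OF c] cl[OF d] BF(1)[OF x]]
      unfolding op_proj[OF n c w] unfolding op_proj[OF n d BF(1)[OF x]] ..
  qed (use c d cl in auto)
  show "proj n (c \<oplus>\<^bsub>GR (Suc n)\<^esub> d) = proj n c \<oplus>\<^bsub>GR n\<^esub> proj n d"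
    if c: "c \<in> carrier (GR (Suc n))" and d: "d \<in> carrier (GR (Suc n))" for c d
  proof (rule GR_eqI[OF n])
    fix x assume x: "x \<in> B n"
    show "op n (proj n (c \<oplus>\<^bsub>GR (Suc n)\<^esub> d)) x = op n (proj n c \<oplus>\<^bsub>GR n\<^esub> proj n d) x"
      unfolding op_proj[OF n S.a_closed[OF c d] BF(1)[OF x]] op_add[OF m c d BF(2)[OF x]]
        op_add[OF n cl[OF c] cl[OF d] BF(1)[OF x]] op_proj[OF n c BF(1)[OF x]]
        op_proj[OF n d BF(1)[OF x]] ..
  qed (use c d cl in auto)
  show "proj n \<one>\<^bsub>GR (Suc n)\<^esub> = \<one>\<^bsub>GR n\<^esub>"
  proof (rule GR_eqI[OF n])
    fix x assume x: "x \<in> B n"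
    show "op n (proj n \<one>\<^bsub>GR (Suc n)\<^esub>) x = op n \<one>\<^bsub>GR n\<^esub> x"
      unfolding op_proj[OF n S.one_closed BF(1)[OF x]] op_one[OF n BF(1)[OF x]] op_one[OF m BF(2)[OF x]] ..
  qed (use cl in auto)
qed

lemma \<Lambda>_cring: "cring \<Lambda>"
  unfolding iwasawa_algebra_def by (rule inverse_limit_cring) (erule GR_cring proj_hom)+

lemma \<Lambda>_memD:
  assumes "a \<in> carrier \<Lambda>" "1 \<le> n" shows "a n \<in> carrier (GR n)" "proj n (a (Suc n)) = a n"
  using assms inverse_limit_carrierD unfolding iwasawa_algebra_def by blast+

lemma \<Lambda>_memI:
  assumes "\<And>n. 1 \<le> n \<Longrightarrow> a n \<in> carrier (GR n)" "\<And>n. 1 \<le> n \<Longrightarrow> proj n (a (Suc n)) = a n" "a \<in> extensional {1..}"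
  shows "a \<in> carrier \<Lambda>"
  unfolding iwasawa_algebra_def by (rule inverse_limit_carrierI) (erule assms(1) assms(2) | rule assms(3))+

lemma \<Lambda>_ext:
  assumes "a \<in> carrier \<Lambda>" "b \<in> carrier \<Lambda>" "\<And>n. 1 \<le> n \<Longrightarrow> a n = b n" shows "a = b"
  using assms inverse_limit_ext unfolding iwasawa_algebra_def by blast

lemma \<Lambda>_ops:
  assumes "1 \<le> n"
  shows "(a \<otimes>\<^bsub>\<Lambda>\<^esub> b) n = a n \<otimes>\<^bsub>GR n\<^esub> b n" "(a \<oplus>\<^bsub>\<Lambda>\<^esub> b) n = a n \<oplus>\<^bsub>GR n\<^esub> b n"
    "\<one>\<^bsub>\<Lambda>\<^esub> n = \<one>\<^bsub>GR n\<^esub>"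
  unfolding iwasawa_algebra_def by (simp_all add: inverse_limit_ops[OF assms])

abbreviation DL where "DL \<equiv> dual_limit E A (\<lambda>n. B n) \<Gamma> N"

lemma linear_dual_iff: "f \<in> linear_dual E A Y \<longleftrightarrow> f \<in> extensional Y \<and> lin Y f"
  by (auto simp: linear_dual_def lin_def PiE_iff)

lemma DL_carrier_iff:
  "f \<in> carrier DL \<longleftrightarrow> f \<in> extensional {1..} \<and>
    (\<forall>n\<ge>1. f n \<in> extensional (B n) \<and> lin (B n) (f n)) \<and> (\<forall>n\<ge>1. \<forall>x\<in>B n. f (Suc n) x = f n x)"
proof -
  have *: "restrict (f (Suc n)) (B n) = f n \<longleftrightarrow> (\<forall>x\<in>B n. f (Suc n) x = f n x)"
    if "f n \<in> extensional (B n)" for n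
  proof
    assume "restrict (f (Suc n)) (B n) = f n"
    then show "\<forall>x\<in>B n. f (Suc n) x = f n x" by (metis restrict_apply')
  next
    assume "\<forall>x\<in>B n. f (Suc n) x = f n x"
    then show "restrict (f (Suc n)) (B n) = f n"
      using that by (intro extensionalityI[of _ "B n"]) auto
  qed
  have "f \<in> carrier DL \<longleftrightarrow> f \<in> extensional {1..} \<and>
    (\<forall>n\<ge>1. f n \<in> extensional (B n) \<and> lin (B n) (f n)) \<and> (\<forall>n\<ge>1. restrict (f (Suc n)) (B n) = f n)"
    unfolding dual_limit_def by (auto simp: PiE_iff linear_dual_iff)
  then show ?thesis using * by blast
qed

lemma DL_memD:
  assumes "f \<in> carrier DL"
  shows "f \<in> extensional {1..}" "1 \<le> n \<Longrightarrow> f n \<in> extensional (B n)" "1 \<le> n \<Longrightarrow> lin (B n) (f n)"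
    "1 \<le> n \<Longrightarrow> x \<in> B n \<Longrightarrow> f (Suc n) x = f n x"
  using assms unfolding DL_carrier_iff by blast+

lemma DL_restrict:
  assumes "f \<in> carrier DL" "1 \<le> n" "n \<le> m" "x \<in> B n" shows "f m x = f n x"
  using assms(3)
proof (induction m rule: dec_induct)
  case (step m)
  have m: "1 \<le> m" using step assms(2) by simp
  have "x \<in> B m" using B_mono[OF assms(2) step(1)] assms(4) by blast
  then show ?case using DL_memD(4)[OF assms(1) m] step by simp
qed simp

lemma DL_ext:
  assumes "f \<in> carrier DL" "g \<in> carrier DL" "\<And>n x. 1 \<le> n \<Longrightarrow> x \<in> B n \<Longrightarrow> f n x = g n x" shows "f = g"
proof (rule extensionalityI[OF DL_memD(1)[OF assms(1)] DL_memD(1)[OF assms(2)]])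
  fix n :: nat assume "n \<in> {1..}"
  then have n: "1 \<le> n" by simp
  show "f n = g n"
    by (rule extensionalityI[OF DL_memD(2)[OF assms(1) n] DL_memD(2)[OF assms(2) n]]) (rule assms(3)[OF n])
qed

lemma DL_add: "1 \<le> n \<Longrightarrow> x \<in> B n \<Longrightarrow> (f \<oplus>\<^bsub>DL\<^esub> g) n x = f n x \<oplus> g n x"
  by (simp add: dual_limit_def)

lemma DL_zero: "1 \<le> n \<Longrightarrow> x \<in> B n \<Longrightarrow> \<zero>\<^bsub>DL\<^esub> n x = \<zero>"
  by (simp add: dual_limit_def)

text \<open>The inverse of the contragredient action is already contained in \<open>cact\<close>,
  and the value under \<open>the_elem\<close> is constant on a coset; so scalar multiplication is
  precomposition with \<open>op\<close>.\<close>

lemma DL_smult: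
  assumes n: "1 \<le> n" and x: "x \<in> B n" and a: "a n \<in> carrier (GR n)" and f: "lin (B n) (f n)"
  shows "(a \<odot>\<^bsub>DL\<^esub> f) n x = f n (op n (a n) x)"
proof -
  have xF: "x \<in> F n" using B_F[OF n x] .
  have aA: "a n C \<in> A" if "C \<in> carrier (Q n)" for C using a that unfolding GR_carrier[OF n] by auto
  have te: "the_elem ((\<lambda>\<gamma>. f n ((inv\<^bsub>\<Gamma>\<^esub> \<gamma>) x)) ` C) = f n (cact C x)" if C: "C \<in> carrier (Q n)" for C
  proof -
    obtain \<gamma> where \<gamma>: "\<gamma> \<in> carrier \<Gamma>" "C = cset n \<gamma>" using cosE[OF n C] .
    have "(\<lambda>\<gamma>. f n ((inv\<^bsub>\<Gamma>\<^esub> \<gamma>) x)) ` C = {f n (cact C x)}"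
    proof (intro equalityI subsetI)
      fix v assume "v \<in> (\<lambda>\<gamma>. f n ((inv\<^bsub>\<Gamma>\<^esub> \<gamma>) x)) ` C"
      then obtain \<gamma>' where \<gamma>': "\<gamma>' \<in> cset n \<gamma>" "v = f n ((inv\<^bsub>\<Gamma>\<^esub> \<gamma>') x)" unfolding \<gamma>(2) by blast
      have "(inv\<^bsub>\<Gamma>\<^esub> \<gamma>') x = cact C x"
        unfolding \<gamma>(2) cact_cset[OF n \<gamma>(1) xF] by (rule inv_coset_apply[OF n \<gamma>(1) \<gamma>'(1) xF])
      then show "v \<in> {f n (cact C x)}" using \<gamma>'(2) by simp
    next
      fix v assume "v \<in> {f n (cact C x)}"
      then have "v = f n ((inv\<^bsub>\<Gamma>\<^esub> \<gamma>) x)" unfolding \<gamma>(2) cact_cset[OF n \<gamma>(1) xF] by simp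
      then show "v \<in> (\<lambda>\<gamma>. f n ((inv\<^bsub>\<Gamma>\<^esub> \<gamma>) x)) ` C" using cos_self[OF n \<gamma>(1)] \<gamma>(2) by blast
    qed
    then show ?thesis by simp
  qed
  have "(a \<odot>\<^bsub>DL\<^esub> f) n x = (\<Oplus>C\<in>carrier (Q n). a n C \<otimes> the_elem ((\<lambda>\<gamma>. f n ((inv\<^bsub>\<Gamma>\<^esub> \<gamma>) x)) ` C))"
    using n x by (simp add: dual_limit_def)
  also have "\<dots> = (\<Oplus>C\<in>carrier (Q n). a n C \<otimes> f n (cact C x))"
    using aA linD(1)[OF f] cact_B[OF n _ x] by (intro finsum_cong') (auto simp: te)
  also have "\<dots> = f n (op n (a n) x)" unfolding op_def
    using aA cact_B[OF n _ x] N_finite[OF n] by (intro lin_finsum_smult[OF f submod_B[OF n], symmetric]) auto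
  finally show ?thesis .
qed

lemma DL_smult_closed:
  assumes a: "a \<in> carrier \<Lambda>" and f: "f \<in> carrier DL" shows "a \<odot>\<^bsub>DL\<^esub> f \<in> carrier DL"
  unfolding DL_carrier_iff
proof (intro conjI allI impI ballI)
  show "a \<odot>\<^bsub>DL\<^esub> f \<in> extensional {1..}" by (simp add: dual_limit_def)
  fix n :: nat assume n: "1 \<le> n"
  have m: "1 \<le> Suc n" by simp
  note an = \<Lambda>_memD(1)[OF a n] and fn = DL_memD(3)[OF f n]
  have eq: "(a \<odot>\<^bsub>DL\<^esub> f) n x = f n (op n (a n) x)" if "x \<in> B n" for x
    by (rule DL_smult[where a = a and f = f, OF n that an fn])
  show "(a \<odot>\<^bsub>DL\<^esub> f) n \<in> extensional (B n)" using n by (simp add: dual_limit_def)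
  show "lin (B n) ((a \<odot>\<^bsub>DL\<^esub> f) n)" unfolding lin_def
  proof (intro conjI ballI)
    show "(a \<odot>\<^bsub>DL\<^esub> f) n \<in> B n \<rightarrow> A" using eq linD(1)[OF fn] op_B[OF n an] by simp
    fix x assume x: "x \<in> B n"
    show "(a \<odot>\<^bsub>DL\<^esub> f) n (x \<oplus> y) = (a \<odot>\<^bsub>DL\<^esub> f) n x \<oplus> (a \<odot>\<^bsub>DL\<^esub> f) n y" if y: "y \<in> B n" for y
      using eq[OF x] eq[OF y] eq[OF submodD(3)[OF submod_B[OF n] x y]] op_add_right[OF n an B_F[OF n x] B_F[OF n y]]
        linD(2)[OF fn op_B[OF n an x] op_B[OF n an y]] by simp
    show "(a \<odot>\<^bsub>DL\<^esub> f) n (b \<otimes> x) = b \<otimes> (a \<odot>\<^bsub>DL\<^esub> f) n x" if b: "b \<in> A" for b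
      using eq[OF x] eq[OF submodD(4)[OF submod_B[OF n] b x]] op_smult[OF n an B_F[OF n x] b]
        linD(3)[OF fn b op_B[OF n an x]] by simp
  qed
  fix x assume x: "x \<in> B n"
  have xm: "x \<in> B (Suc n)" using B_mono[OF n, of "Suc n"] x by auto
  have "(a \<odot>\<^bsub>DL\<^esub> f) (Suc n) x = f (Suc n) (op (Suc n) (a (Suc n)) x)"
    by (rule DL_smult[where a = a and f = f, OF m xm \<Lambda>_memD(1)[OF a m] DL_memD(3)[OF f m]])
  also have "op (Suc n) (a (Suc n)) x = op n (a n) x"
    using op_proj[OF n \<Lambda>_memD(1)[OF a m] B_F[OF n x]] \<Lambda>_memD(2)[OF a n] by simp
  also have "f (Suc n) (op n (a n) x) = f n (op n (a n) x)"
    by (rule DL_memD(4)[OF f n op_B[OF n an x]])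
  finally show "(a \<odot>\<^bsub>DL\<^esub> f) (Suc n) x = (a \<odot>\<^bsub>DL\<^esub> f) n x" using eq[OF x] by simp
qed

lemma DL_abelian_group: "abelian_group DL"
proof -
  have A: "f n x \<in> A" if "f \<in> carrier DL" "1 \<le> n" "x \<in> B n" for f n x
    using linD(1)[OF DL_memD(3)[OF that(1,2)] that(3)] .
  have Ec: "f n x \<in> carrier E" if "f \<in> carrier DL" "1 \<le> n" "x \<in> B n" for f n x
    using A[OF that] by simp
  have Bx: "x \<oplus> y \<in> B n" "a \<in> A \<Longrightarrow> a \<otimes> x \<in> B n" if "1 \<le> n" "x \<in> B n" "y \<in> B n" for n x y a
    using submodD(3,4)[OF submod_B[OF that(1)]] that by blast+
  have Bm: "x \<in> B (Suc n)" if "1 \<le> n" "x \<in> B n" for n x using B_mono[OF that(1), of "Suc n"] that by auto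
  have add: "f \<oplus>\<^bsub>DL\<^esub> g \<in> carrier DL" if f: "f \<in> carrier DL" and g: "g \<in> carrier DL" for f g
    unfolding DL_carrier_iff
  proof (intro conjI allI impI ballI)
    show "f \<oplus>\<^bsub>DL\<^esub> g \<in> extensional {1..}" by (simp add: dual_limit_def)
    fix n :: nat assume n: "1 \<le> n"
    note lf = DL_memD(3)[OF f n] and lg = DL_memD(3)[OF g n]
    show "(f \<oplus>\<^bsub>DL\<^esub> g) n \<in> extensional (B n)" using n by (simp add: dual_limit_def)
    show "lin (B n) ((f \<oplus>\<^bsub>DL\<^esub> g) n)" unfolding lin_def
    proof (intro conjI ballI)
      show "(f \<oplus>\<^bsub>DL\<^esub> g) n \<in> B n \<rightarrow> A" using A[OF f n] A[OF g n] DL_add[OF n] by simp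
      fix x assume x: "x \<in> B n"
      show "(f \<oplus>\<^bsub>DL\<^esub> g) n (x \<oplus> y) = (f \<oplus>\<^bsub>DL\<^esub> g) n x \<oplus> (f \<oplus>\<^bsub>DL\<^esub> g) n y" if y: "y \<in> B n" for y
        using x y DL_add[OF n] Bx(1)[OF n x y] linD(2)[OF lf x y] linD(2)[OF lg x y]
          Ec[OF f n x] Ec[OF g n x] Ec[OF f n y] Ec[OF g n y] by (simp add: a_ac)
      show "(f \<oplus>\<^bsub>DL\<^esub> g) n (b \<otimes> x) = b \<otimes> (f \<oplus>\<^bsub>DL\<^esub> g) n x" if b: "b \<in> A" for b
        using x b DL_add[OF n] Bx(2)[OF n x x b] linD(3)[OF lf b x] linD(3)[OF lg b x]
          Ec[OF f n x] Ec[OF g n x] by (simp add: r_distr)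
    qed
    fix x assume x: "x \<in> B n"
    show "(f \<oplus>\<^bsub>DL\<^esub> g) (Suc n) x = (f \<oplus>\<^bsub>DL\<^esub> g) n x"
      using DL_add[OF n x] DL_add[OF _ Bm[OF n x]] DL_memD(4)[OF f n x] DL_memD(4)[OF g n x] by simp
  qed
  have zero: "\<zero>\<^bsub>DL\<^esub> \<in> carrier DL"
    unfolding DL_carrier_iff
  proof (intro conjI allI impI ballI)
    show "\<zero>\<^bsub>DL\<^esub> \<in> extensional {1..}" by (simp add: dual_limit_def)
    fix n :: nat assume n: "1 \<le> n"
    show "\<zero>\<^bsub>DL\<^esub> n \<in> extensional (B n)" using n by (simp add: dual_limit_def)
    show "lin (B n) (\<zero>\<^bsub>DL\<^esub> n)" unfolding lin_def
      using DL_zero[OF n] Bx[OF n] by (simp add: Pi_iff)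
    fix x assume x: "x \<in> B n"
    show "\<zero>\<^bsub>DL\<^esub> (Suc n) x = \<zero>\<^bsub>DL\<^esub> n x" using DL_zero[OF n x] DL_zero[OF _ Bm[OF n x]] by simp
  qed
  have neg: "\<exists>g\<in>carrier DL. g \<oplus>\<^bsub>DL\<^esub> f = \<zero>\<^bsub>DL\<^esub>" if f: "f \<in> carrier DL" for f
  proof
    let ?g = "\<lambda>n\<in>{1..}. \<lambda>x\<in>B n. \<ominus> f n x"
    have gx: "?g n x = \<ominus> f n x" if "1 \<le> n" "x \<in> B n" for n x using that by simp
    show g: "?g \<in> carrier DL"
      unfolding DL_carrier_iff
    proof (intro conjI allI impI ballI)
      show "?g \<in> extensional {1..}" by simp
      fix n :: nat assume n: "1 \<le> n"
      note lf = DL_memD(3)[OF f n]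
      show "?g n \<in> extensional (B n)" using n by simp
      show "lin (B n) (?g n)" unfolding lin_def
      proof (intro conjI ballI)
        show "?g n \<in> B n \<rightarrow> A" using A[OF f n] gx[OF n] by simp
        fix x assume x: "x \<in> B n"
        show "?g n (x \<oplus> y) = ?g n x \<oplus> ?g n y" if y: "y \<in> B n" for y
          unfolding gx[OF n x] gx[OF n y] gx[OF n Bx(1)[OF n x y]] linD(2)[OF lf x y]
          using Ec[OF f n x] Ec[OF f n y] by (rule minus_add)
        show "?g n (b \<otimes> x) = b \<otimes> ?g n x" if b: "b \<in> A" for b
          unfolding gx[OF n x] gx[OF n Bx(2)[OF n x x b]] linD(3)[OF lf b x]
          using Ec[OF f n x] b by (simp add: r_minus)
      qed
      fix x assume x: "x \<in> B n"
      show "?g (Suc n) x = ?g n x"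
        using gx[OF n x] gx[OF _ Bm[OF n x]] DL_memD(4)[OF f n x] by simp
    qed
    show "?g \<oplus>\<^bsub>DL\<^esub> f = \<zero>\<^bsub>DL\<^esub>"
    proof (rule DL_ext[OF add[OF g f] zero])
      fix n x assume nx: "1 \<le> n" "x \<in> B n"
      show "(?g \<oplus>\<^bsub>DL\<^esub> f) n x = \<zero>\<^bsub>DL\<^esub> n x"
        unfolding DL_add[OF nx] DL_zero[OF nx] gx[OF nx] using Ec[OF f nx] by (rule l_neg)
    qed
  qed
  have ids: "(f \<oplus>\<^bsub>DL\<^esub> g) \<oplus>\<^bsub>DL\<^esub> h = f \<oplus>\<^bsub>DL\<^esub> (g \<oplus>\<^bsub>DL\<^esub> h)" "f \<oplus>\<^bsub>DL\<^esub> g = g \<oplus>\<^bsub>DL\<^esub> f" "\<zero>\<^bsub>DL\<^esub> \<oplus>\<^bsub>DL\<^esub> f = f"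
    if "f \<in> carrier DL" "g \<in> carrier DL" "h \<in> carrier DL" for f g h
    using that add zero Ec[OF that(1)] Ec[OF that(2)] Ec[OF that(3)]
    by (intro DL_ext; simp add: DL_add DL_zero a_ac)+
  show ?thesis
    by (rule abelian_groupI) (rule add zero neg ids(1) ids(2)[OF _ _ zero] ids(3)[OF _ zero zero]; assumption)+
qed

text \<open>Precomposition reverses the order of a product; commutativity of the group rings
  restores it.\<close>

lemma DL_module: "Module.module \<Lambda> DL"
proof (rule Module.moduleI[OF \<Lambda>_cring DL_abelian_group DL_smult_closed])
  interpret L: cring \<Lambda> by (rule \<Lambda>_cring)
  interpret M: abelian_group DL by (rule DL_abelian_group)
  note cl = DL_smult_closed and val = DL_smult and mem = \<Lambda>_memD(1) and l = DL_memD(3)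
  have sm: "(a \<odot>\<^bsub>DL\<^esub> f) n x = f n (op n (a n) x)"
    if "a \<in> carrier \<Lambda>" "f \<in> carrier DL" "1 \<le> n" "x \<in> B n" for a f n x
    by (rule DL_smult[where a = a and f = f, OF that(3,4) \<Lambda>_memD(1)[OF that(1,3)] DL_memD(3)[OF that(2,3)]])
  show "(a \<oplus>\<^bsub>\<Lambda>\<^esub> b) \<odot>\<^bsub>DL\<^esub> f = a \<odot>\<^bsub>DL\<^esub> f \<oplus>\<^bsub>DL\<^esub> b \<odot>\<^bsub>DL\<^esub> f"
    if a: "a \<in> carrier \<Lambda>" and b: "b \<in> carrier \<Lambda>" and f: "f \<in> carrier DL" for a b f
  proof (rule DL_ext)
    fix n x assume nx: "1 \<le> n" "x \<in> B n"
    note an = mem[OF a nx(1)] and bn = mem[OF b nx(1)]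
    show "((a \<oplus>\<^bsub>\<Lambda>\<^esub> b) \<odot>\<^bsub>DL\<^esub> f) n x = (a \<odot>\<^bsub>DL\<^esub> f \<oplus>\<^bsub>DL\<^esub> b \<odot>\<^bsub>DL\<^esub> f) n x"
      unfolding DL_add[OF nx] sm[OF L.a_closed[OF a b] f nx] sm[OF a f nx] sm[OF b f nx] \<Lambda>_ops(2)[OF nx(1)]
        op_add[OF nx(1) an bn B_F[OF nx]]
      by (rule linD(2)[OF l[OF f nx(1)] op_B[OF nx(1) an nx(2)] op_B[OF nx(1) bn nx(2)]])
  qed (use a b f cl in auto)
  show "a \<odot>\<^bsub>DL\<^esub> (f \<oplus>\<^bsub>DL\<^esub> g) = a \<odot>\<^bsub>DL\<^esub> f \<oplus>\<^bsub>DL\<^esub> a \<odot>\<^bsub>DL\<^esub> g"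
    if a: "a \<in> carrier \<Lambda>" and f: "f \<in> carrier DL" and g: "g \<in> carrier DL" for a f g
  proof (rule DL_ext)
    fix n x assume nx: "1 \<le> n" "x \<in> B n"
    note an = mem[OF a nx(1)]
    show "(a \<odot>\<^bsub>DL\<^esub> (f \<oplus>\<^bsub>DL\<^esub> g)) n x = (a \<odot>\<^bsub>DL\<^esub> f \<oplus>\<^bsub>DL\<^esub> a \<odot>\<^bsub>DL\<^esub> g) n x"
      unfolding DL_add[OF nx] sm[OF a M.a_closed[OF f g] nx] sm[OF a f nx] sm[OF a g nx]
      by (rule DL_add[OF nx(1) op_B[OF nx(1) an nx(2)]])
  qed (use a f g cl in auto)
  show "(a \<otimes>\<^bsub>\<Lambda>\<^esub> b) \<odot>\<^bsub>DL\<^esub> f = a \<odot>\<^bsub>DL\<^esub> (b \<odot>\<^bsub>DL\<^esub> f)"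
    if a: "a \<in> carrier \<Lambda>" and b: "b \<in> carrier \<Lambda>" and f: "f \<in> carrier DL" for a b f
  proof (rule DL_ext)
    fix n x assume nx: "1 \<le> n" "x \<in> B n"
    note an = mem[OF a nx(1)] and bn = mem[OF b nx(1)]
    interpret R: cring "GR n" by (rule GR_cring[OF nx(1)])
    show "((a \<otimes>\<^bsub>\<Lambda>\<^esub> b) \<odot>\<^bsub>DL\<^esub> f) n x = (a \<odot>\<^bsub>DL\<^esub> (b \<odot>\<^bsub>DL\<^esub> f)) n x"
      unfolding sm[OF L.m_closed[OF a b] f nx] sm[OF a cl[OF b f] nx] sm[OF b f nx(1) op_B[OF nx(1) an nx(2)]]
        \<Lambda>_ops(1)[OF nx(1)] R.m_comm[OF an bn] op_mult[OF nx(1) bn an B_F[OF nx]] ..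
  qed (use a b f cl in auto)
  show "\<one>\<^bsub>\<Lambda>\<^esub> \<odot>\<^bsub>DL\<^esub> f = f" if f: "f \<in> carrier DL" for f
  proof (rule DL_ext)
    fix n x assume nx: "1 \<le> n" "x \<in> B n"
    show "(\<one>\<^bsub>\<Lambda>\<^esub> \<odot>\<^bsub>DL\<^esub> f) n x = f n x"
      unfolding sm[OF L.one_closed f nx] \<Lambda>_ops(3)[OF nx(1)] op_one[OF nx(1) B_F[OF nx]] ..
  qed (use f cl in auto)
qed

end

section \<open>Generators and functionals across levels\<close>

context tower
begin

text \<open>The criterion of \<open>dual_generator\<close> with elements of \<open>\<Gamma>\<close>
  in place of cosets, so that different levels can be compared.\<close>

definition generates :: "nat \<Rightarrow> ('a \<Rightarrow> 'a) \<Rightarrow> bool" where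
  "generates n b \<longleftrightarrow> lin (B n) b \<and>
     (\<forall>x\<in>B n. (\<forall>\<gamma>\<in>carrier \<Gamma>. \<omega> \<otimes> b (\<gamma> x) \<in> A) \<longrightarrow> \<omega> \<otimes> x \<in> B n)"

lemma all_cosets_iff:
  assumes n: "1 \<le> n" and x: "x \<in> F n"
  shows "(\<forall>C\<in>carrier (Q n). R (cact C x)) \<longleftrightarrow> (\<forall>\<gamma>\<in>carrier \<Gamma>. R (\<gamma> x))"
proof
  assume *: "\<forall>C\<in>carrier (Q n). R (cact C x)"
  show "\<forall>\<gamma>\<in>carrier \<Gamma>. R (\<gamma> x)"
  proof
    fix \<gamma> assume \<gamma>: "\<gamma> \<in> carrier \<Gamma>"
    have "R (cact (cset n (inv\<^bsub>\<Gamma>\<^esub> \<gamma>)) x)" using * cos_in[OF n \<Gamma>.inv_closed[OF \<gamma>]] by blast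
    then show "R (\<gamma> x)" unfolding cact_cset[OF n \<Gamma>.inv_closed[OF \<gamma>] x] using \<gamma> by simp
  qed
next
  assume *: "\<forall>\<gamma>\<in>carrier \<Gamma>. R (\<gamma> x)"
  show "\<forall>C\<in>carrier (Q n). R (cact C x)"
  proof
    fix C assume C: "C \<in> carrier (Q n)"
    obtain \<gamma> where \<gamma>: "\<gamma> \<in> carrier \<Gamma>" "C = cset n \<gamma>" using cosE[OF n C] .
    show "R (cact C x)" unfolding \<gamma>(2) cact_cset[OF n \<gamma>(1) x] using * \<gamma>(1) by simp
  qed
qed

lemma generates_iff:
  assumes n: "1 \<le> n"
  shows "generates n b \<longleftrightarrow> galois_level.dual_generator E A \<pi> (Q n) (F n) cact b"
proof -
  interpret l: galois_level E L A \<pi> "Q n" "F n" cact by (rule level[OF n])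
  show ?thesis
    unfolding generates_def l.dual_generator_def
    using all_cosets_iff[OF n B_F[OF n], of _ "\<lambda>z. \<omega> \<otimes> b z \<in> A"] by simp
qed

text \<open>For k \<le> n this is the subgroup N k / N n of the quotient at level n.\<close>

definition image_N :: "nat \<Rightarrow> nat \<Rightarrow> ('a \<Rightarrow> 'a) set set" where
  "image_N n k = cset n ` N k"

lemma image_N_carrier: "1 \<le> n \<Longrightarrow> 1 \<le> k \<Longrightarrow> image_N n k \<subseteq> carrier (Q n)"
  unfolding image_N_def using N_mem cos_in by blast

lemma all_image_N_iff:
  assumes n: "1 \<le> n" and k: "1 \<le> k" and x: "x \<in> F n"
  shows "(\<forall>C\<in>image_N n k. R (cact C x)) \<longleftrightarrow> (\<forall>\<theta>\<in>N k. R (\<theta> x))"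
proof
  assume *: "\<forall>C\<in>image_N n k. R (cact C x)"
  show "\<forall>\<theta>\<in>N k. R (\<theta> x)"
  proof
    fix \<theta> assume \<theta>: "\<theta> \<in> N k"
    have i: "inv\<^bsub>\<Gamma>\<^esub> \<theta> \<in> N k" by (rule subgroup.m_inv_closed[OF subgroup_N[OF k] \<theta>])
    then have "R (cact (cset n (inv\<^bsub>\<Gamma>\<^esub> \<theta>)) x)" using * unfolding image_N_def by blast
    then show "R (\<theta> x)" unfolding cact_cset[OF n N_mem[OF k i] x] using N_mem[OF k \<theta>] by simp
  qed
next
  assume *: "\<forall>\<theta>\<in>N k. R (\<theta> x)"
  show "\<forall>C\<in>image_N n k. R (cact C x)"
  proof
    fix C assume "C \<in> image_N n k"
    then obtain \<theta> where \<theta>: "\<theta> \<in> N k" "C = cset n \<theta>" unfolding image_N_def by blast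
    have "inv\<^bsub>\<Gamma>\<^esub> \<theta> \<in> N k" by (rule subgroup.m_inv_closed[OF subgroup_N[OF k] \<theta>(1)])
    then show "R (cact C x)" unfolding \<theta>(2) cact_cset[OF n N_mem[OF k \<theta>(1)] x] using * by blast
  qed
qed

lemma invariants_image_N:
  assumes n: "1 \<le> n" and k: "1 \<le> k" and x: "x \<in> B n"
  shows "(\<forall>C\<in>image_N n k. cact C x = x) \<longleftrightarrow> x \<in> F k"
  using all_image_N_iff[OF n k B_F[OF n x], of "\<lambda>z. z = x"] F_memD(1)[OF B_F[OF n x]]
  by (auto simp: fixed_field_def)

lemma subgroup_image_N: assumes n: "1 \<le> n" and k: "1 \<le> k" shows "subgroup (image_N n k) (Q n)"
proof -
  interpret l: galois_level E L A \<pi> "Q n" "F n" cact by (rule level[OF n])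
  show ?thesis
  proof (rule l.GG.subgroupI)
    show "image_N n k \<subseteq> carrier (Q n)" by (rule image_N_carrier[OF n k])
    show "image_N n k \<noteq> {}" unfolding image_N_def using subgroup.one_closed[OF subgroup_N[OF k]] by blast
  next
    fix C assume "C \<in> image_N n k"
    then obtain \<theta> where \<theta>: "\<theta> \<in> N k" "C = cset n \<theta>" unfolding image_N_def by blast
    have i: "inv\<^bsub>\<Gamma>\<^esub> \<theta> \<in> N k" by (rule subgroup.m_inv_closed[OF subgroup_N[OF k] \<theta>(1)])
    have "cset n (inv\<^bsub>\<Gamma>\<^esub> \<theta>) \<otimes>\<^bsub>Q n\<^esub> C = cset n \<one>\<^bsub>\<Gamma>\<^esub>"
      unfolding \<theta>(2) Q_mult[OF n N_mem[OF k i] N_mem[OF k \<theta>(1)]] using N_mem[OF k \<theta>(1)] by simp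
    also have "\<dots> = \<one>\<^bsub>Q n\<^esub>" unfolding Q_one by (rule cos_eq_N[OF n subgroup.one_closed[OF subgroup_N[OF n]]])
    finally have "inv\<^bsub>Q n\<^esub> C = cset n (inv\<^bsub>\<Gamma>\<^esub> \<theta>)"
      using N_mem[OF k] \<theta> i n by (intro l.GG.inv_equality) auto
    then show "inv\<^bsub>Q n\<^esub> C \<in> image_N n k" using i unfolding image_N_def by blast
    fix D assume "D \<in> image_N n k"
    then obtain \<tau> where \<tau>: "\<tau> \<in> N k" "D = cset n \<tau>" unfolding image_N_def by blast
    have "C \<otimes>\<^bsub>Q n\<^esub> D = cset n (\<theta> \<otimes>\<^bsub>\<Gamma>\<^esub> \<tau>)"
      unfolding \<theta>(2) \<tau>(2) by (rule Q_mult[OF n N_mem[OF k \<theta>(1)] N_mem[OF k \<tau>(1)]])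
    then show "C \<otimes>\<^bsub>Q n\<^esub> D \<in> image_N n k"
      using subgroup.m_closed[OF subgroup_N[OF k] \<theta>(1) \<tau>(1)] unfolding image_N_def by blast
  qed
qed

text \<open>The invariants of \<open>N n\<close> in \<open>B (Suc n)\<close> are exactly
  \<open>B n\<close>, so this is a case of \<open>extend_from_invariants\<close>.\<close>

lemma extend_functional:
  assumes n: "1 \<le> n" and \<phi>: "lin (B n) \<phi>"
  obtains \<phi>' where "lin (B (Suc n)) \<phi>'" "\<And>x. x \<in> B n \<Longrightarrow> \<phi>' x = \<phi> x"
proof -
  have m: "1 \<le> Suc n" by simp
  interpret l: galois_level E L A \<pi> "Q (Suc n)" "F (Suc n)" cact by (rule level[OF m])
  have sub: "B n \<subseteq> B (Suc n)" using B_mono[OF n] by simp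
  have "{x \<in> B (Suc n). \<forall>C\<in>image_N (Suc n) n. cact C x = x} = B n"
  proof (intro equalityI subsetI)
    fix x assume x: "x \<in> {x \<in> B (Suc n). \<forall>C\<in>image_N (Suc n) n. cact C x = x}"
    then have "x \<in> F n" using invariants_image_N[OF m n, of x] by blast
    then show "x \<in> B n" using x B_inter by blast
  next
    fix x assume x: "x \<in> B n"
    then have xm: "x \<in> B (Suc n)" using sub by blast
    then show "x \<in> {x \<in> B (Suc n). \<forall>C\<in>image_N (Suc n) n. cact C x = x}"
      using invariants_image_N[OF m n xm] B_F[OF n x] by blast
  qed
  then have lin: "lin {x \<in> B (Suc n). \<forall>C\<in>image_N (Suc n) n. cact C x = x} \<phi>" using \<phi> by simp
  have "\<exists>\<phi>'. lin (B (Suc n)) \<phi>' \<and>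
    (\<forall>x\<in>B (Suc n). (\<forall>C\<in>image_N (Suc n) n. cact C x = x) \<longrightarrow> \<phi>' x = \<phi> x)"
  proof (rule l.extend_from_invariants[OF image_N_carrier[OF m n] lin])
    fix \<phi>' assume "lin (B (Suc n)) \<phi>'"
      and "\<And>x. x \<in> B (Suc n) \<Longrightarrow> (\<And>C. C \<in> image_N (Suc n) n \<Longrightarrow> cact C x = x) \<Longrightarrow> \<phi>' x = \<phi> x"
    then show ?thesis by (intro exI[of _ \<phi>'] conjI ballI impI) simp_all
  qed
  then obtain \<phi>' where \<phi>': "lin (B (Suc n)) \<phi>'"
    "\<forall>x\<in>B (Suc n). (\<forall>C\<in>image_N (Suc n) n. cact C x = x) \<longrightarrow> \<phi>' x = \<phi> x" by blast
  have "\<phi>' x = \<phi> x" if x: "x \<in> B n" for x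
  proof (rule \<phi>'(2)[rule_format])
    show xm: "x \<in> B (Suc n)" using x sub by blast
    show "cact C x = x" if "C \<in> image_N (Suc n) n" for C
      using invariants_image_N[OF m n xm] B_F[OF n x] that by blast
  qed
  then show ?thesis using that \<phi>'(1) by blast
qed

text \<open>Surjectivity of the projection from the limit of the duals to level \<open>n\<close>:
  extend upwards by dependent choice and restrict downwards.\<close>

lemma lift_functional:
  assumes n: "1 \<le> n" and \<phi>: "lin (B n) \<phi>"
  obtains f where "f \<in> carrier DL" "\<And>x. x \<in> B n \<Longrightarrow> f n x = \<phi> x"
proof -
  have "\<exists>g. \<forall>k. (lin (B (n + k)) (g k) \<and> (k = 0 \<longrightarrow> g k = \<phi>)) \<and> (\<forall>x\<in>B (n + k). g (Suc k) x = g k x)"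
  proof (rule dependent_nat_choice)
    show "\<exists>x. lin (B (n + 0)) x \<and> (0 = (0::nat) \<longrightarrow> x = \<phi>)" using \<phi> by auto
    fix \<psi> k assume \<psi>: "lin (B (n + k)) \<psi> \<and> (k = 0 \<longrightarrow> \<psi> = \<phi>)"
    obtain \<psi>' where "lin (B (Suc (n + k))) \<psi>'" "\<And>x. x \<in> B (n + k) \<Longrightarrow> \<psi>' x = \<psi> x"
      using extend_functional[of "n + k" \<psi>] n \<psi> by auto
    then show "\<exists>\<psi>'. (lin (B (n + Suc k)) \<psi>' \<and> (Suc k = 0 \<longrightarrow> \<psi>' = \<phi>)) \<and> (\<forall>x\<in>B (n + k). \<psi>' x = \<psi> x)"
      by auto
  qed
  then obtain g where g: "\<And>k. lin (B (n + k)) (g k)" "g 0 = \<phi>" "\<And>k x. x \<in> B (n + k) \<Longrightarrow> g (Suc k) x = g k x"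
    by metis
  \<comment> \<open>For m < n the truncated difference is 0 and \<open>f m\<close> is the
    restriction of \<open>\<phi>\<close>; for m \<ge> n it is the extension after m - n
    steps.\<close>
  define f where "f = (\<lambda>m\<in>{1..}. restrict (g (m - n)) (B m))"
  have fx: "f m x = g (m - n) x" if "1 \<le> m" "x \<in> B m" for m x using that by (simp add: f_def)
  have glin: "lin (B m) (g (m - n))" if m: "1 \<le> m" for m
  proof (cases "n \<le> m")
    case True
    then show ?thesis using g(1)[of "m - n"] by simp
  next
    case False
    then have "B m \<subseteq> B n" "m - n = 0" using B_mono[OF m] by auto
    then show ?thesis using lin_subset[OF \<phi>] g(2) by simp
  qed
  have "f \<in> carrier DL" unfolding DL_carrier_iff
  proof (intro conjI allI impI ballI)
    show "f \<in> extensional {1..}" by (simp add: f_def)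
    fix m :: nat assume m: "1 \<le> m"
    have s: "1 \<le> Suc m" by simp
    show "f m \<in> extensional (B m)" using m by (simp add: f_def)
    note D = submodD[OF submod_B[OF m]]
    show "lin (B m) (f m)" unfolding lin_def
    proof (intro conjI ballI)
      show "f m \<in> B m \<rightarrow> A" using fx[OF m] linD(1)[OF glin[OF m]] by simp
      show "f m (x \<oplus> y) = f m x \<oplus> f m y" if "x \<in> B m" "y \<in> B m" for x y
        unfolding fx[OF m that(1)] fx[OF m that(2)] fx[OF m D(3)[OF that]] by (rule linD(2)[OF glin[OF m] that])
      show "f m (b \<otimes> x) = b \<otimes> f m x" if "b \<in> A" "x \<in> B m" for b x
        unfolding fx[OF m that(2)] fx[OF m D(4)[OF that]] by (rule linD(3)[OF glin[OF m] that])
    qed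
    fix x assume x: "x \<in> B m"
    have xs: "x \<in> B (Suc m)" using B_mono[OF m, of "Suc m"] x by auto
    show "f (Suc m) x = f m x"
    proof (cases "n \<le> m")
      case True
      then have "Suc m - n = Suc (m - n)" by simp
      then show ?thesis using fx[OF m x] fx[OF s xs] g(3)[of x "m - n"] x True by simp
    next
      case False
      then show ?thesis using fx[OF m x] fx[OF s xs] by simp
    qed
  qed
  then show ?thesis using that[of f] fx[OF n] g(2) by simp
qed

text \<open>Surjectivity of the map from the first residue ring to the \<open>N 1\<close>-invariants
  of the limit, stated with lifts so that no residue ring appears.\<close>

definition invariants_lift :: bool where
  "invariants_lift \<longleftrightarrow> (\<forall>n\<ge>1. \<forall>x\<in>B n. (\<forall>\<theta>\<in>N 1. \<omega> \<otimes> (\<theta> x \<ominus> x) \<in> B n) \<longrightarrow>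
     (\<exists>y\<in>B 1. \<omega> \<otimes> (x \<ominus> y) \<in> B n))"

lemma DL_smult_mem:
  assumes "a \<in> carrier \<Lambda>" "f \<in> carrier DL" "1 \<le> n" "x \<in> B n"
  shows "(a \<odot>\<^bsub>DL\<^esub> f) n x = f n (op n (a n) x)"
  by (rule DL_smult[where a = a and f = f, OF assms(3,4) \<Lambda>_memD(1)[OF assms(1,3)] DL_memD(3)[OF assms(2,3)]])

text \<open>An element outside \<pi>B has a functional taking the value 1 on it. Lifted to the
  limit, this functional is a multiple of \<open>b\<close>, so orbit values of \<open>b\<close> in
  \<pi>A would force 1 into \<pi>A.\<close>

lemma generator_imp_generates:
  assumes b: "b \<in> carrier DL" and gen: "\<And>f. f \<in> carrier DL \<Longrightarrow> \<exists>a\<in>carrier \<Lambda>. f = a \<odot>\<^bsub>DL\<^esub> b"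
    and n: "1 \<le> n"
  shows "generates n (b n)"
  unfolding generates_def
proof (intro conjI ballI impI)
  show bl: "lin (B n) (b n)" by (rule DL_memD(3)[OF b n])
  interpret l: galois_level E L A \<pi> "Q n" "F n" cact by (rule level[OF n])
  fix x assume x: "x \<in> B n" and *: "\<forall>\<gamma>\<in>carrier \<Gamma>. \<omega> \<otimes> b n (\<gamma> x) \<in> A"
  have bx: "\<forall>C\<in>carrier (Q n). \<omega> \<otimes> b n (cact C x) \<in> A"
    using all_cosets_iff[OF n B_F[OF n x], of "\<lambda>z. \<omega> \<otimes> b n z \<in> A"] * by blast
  show "\<omega> \<otimes> x \<in> B n"
  proof (rule ccontr)
    assume "\<omega> \<otimes> x \<notin> B n"
    then obtain \<phi> where \<phi>: "lin (B n) \<phi>" "\<phi> x = \<one>" using l.unimodular_functional[OF x] by blast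
    obtain f where f: "f \<in> carrier DL" "\<And>x. x \<in> B n \<Longrightarrow> f n x = \<phi> x" using lift_functional[OF n \<phi>(1)] by blast
    obtain a where a: "a \<in> carrier \<Lambda>" "f = a \<odot>\<^bsub>DL\<^esub> b" using gen[OF f(1)] by blast
    have aA: "a n C \<in> A" if "C \<in> carrier (Q n)" for C
      using \<Lambda>_memD(1)[OF a(1) n] that unfolding GR_carrier[OF n] by auto
    have "\<one> = f n x" using f(2)[OF x] \<phi>(2) by simp
    also have "\<dots> = b n (op n (a n) x)" unfolding a(2) by (rule DL_smult_mem[OF a(1) b n x])
    also have "\<dots> = (\<Oplus>C\<in>carrier (Q n). a n C \<otimes> b n (cact C x))"
      unfolding op_def using aA cact_B[OF n _ x] N_finite[OF n]
      by (intro lin_finsum_smult[OF bl submod_B[OF n]]) auto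
    finally have "\<omega> \<otimes> \<one> = \<omega> \<otimes> (\<Oplus>C\<in>carrier (Q n). a n C \<otimes> b n (cact C x))" by simp
    also have "\<dots> = (\<Oplus>C\<in>carrier (Q n). \<omega> \<otimes> (a n C \<otimes> b n (cact C x)))"
      using aA linD(1)[OF bl cact_B[OF n _ x]] N_finite[OF n] by (intro finsum_rdistr) auto
    also have "\<dots> \<in> A"
    proof (rule A_finsum)
      fix C assume C: "C \<in> carrier (Q n)"
      have "\<omega> \<otimes> (a n C \<otimes> b n (cact C x)) = a n C \<otimes> (\<omega> \<otimes> b n (cact C x))"
        using aA[OF C] linD(1)[OF bl cact_B[OF n C x]] by (simp add: m_lcomm)
      also have "\<dots> \<in> A" using A_closed(4)[OF aA[OF C]] bx C by blast
      finally show "\<omega> \<otimes> (a n C \<otimes> b n (cact C x)) \<in> A" .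
    qed
    finally show False using inv_pi_notin by simp
  qed
qed

text \<open>The lift at level n is exactly invariant under the image of \<open>N 1\<close>, hence an
  integer of the first level by \<open>invariants_image_N\<close> and
  \<open>B_inter\<close>.\<close>

lemma generates_imp_lift:
  assumes "\<And>n. 1 \<le> n \<Longrightarrow> generates n (b n)" shows invariants_lift
  unfolding invariants_lift_def
proof (intro allI impI ballI)
  fix n :: nat and x assume n: "1 \<le> n" and x: "x \<in> B n" and *: "\<forall>\<theta>\<in>N 1. \<omega> \<otimes> (\<theta> x \<ominus> x) \<in> B n"
  have one: "1 \<le> (1::nat)" by simp
  interpret l: galois_level E L A \<pi> "Q n" "F n" cact by (rule level[OF n])
  have g: "l.dual_generator (b n)" using assms[OF n] generates_iff[OF n] by blast
  have inv: "\<omega> \<otimes> (cact C x \<ominus> x) \<in> B n" if "C \<in> image_N n 1" for C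
    using all_image_N_iff[OF n one B_F[OF n x], of "\<lambda>z. \<omega> \<otimes> (z \<ominus> x) \<in> B n"] * that by blast
  obtain z where z: "z \<in> B n" "\<And>C. C \<in> image_N n 1 \<Longrightarrow> cact C z = z" "\<omega> \<otimes> (x \<ominus> z) \<in> B n"
    using l.dual_generator_lift_invariants[OF g subgroup_image_N[OF n one] x inv] by blast
  have "z \<in> F 1" using invariants_image_N[OF n one z(1)] z(2) by blast
  then have "z \<in> B 1" by (rule B_inter[OF z(1)])
  then show "\<exists>y\<in>B 1. \<omega> \<otimes> (x \<ominus> y) \<in> B n" using z(3) by blast
qed

text \<open>Coefficients exist and are unique at each level. Uniqueness forces the projections of
  the coefficients from the next level to agree with them, so they form an element of the Iwasawa
  algebra.\<close>

lemma generates_imp_free: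
  assumes b: "b \<in> carrier DL" and gen: "\<And>n. 1 \<le> n \<Longrightarrow> generates n (b n)" and f: "f \<in> carrier DL"
  shows "\<exists>!a. a \<in> carrier \<Lambda> \<and> f = a \<odot>\<^bsub>DL\<^esub> b"
proof -
  have ex1: "\<exists>!c. c \<in> carrier (GR n) \<and> (\<forall>x\<in>B n. f n x = b n (op n c x))" if n: "1 \<le> n" for n
  proof -
    interpret l: galois_level E L A \<pi> "Q n" "F n" cact by (rule level[OF n])
    have g: "l.dual_generator (b n)" using gen[OF n] generates_iff[OF n] by blast
    have bl: "lin (B n) (b n)" by (rule DL_memD(3)[OF b n])
    have eq: "(\<Oplus>C\<in>carrier (Q n). c C \<otimes> b n (cact C x)) = b n (op n c x)"
      if c: "c \<in> carrier (Q n) \<rightarrow>\<^sub>E A" and x: "x \<in> B n" for c x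
    proof -
      have cA: "c C \<in> A" if "C \<in> carrier (Q n)" for C using c that by auto
      show ?thesis unfolding op_def using cA cact_B[OF n _ x] N_finite[OF n]
        by (intro lin_finsum_smult[OF bl submod_B[OF n], symmetric]) auto
    qed
    have "(c \<in> carrier (Q n) \<rightarrow>\<^sub>E A \<and> (\<forall>x\<in>B n. f n x = (\<Oplus>C\<in>carrier (Q n). c C \<otimes> b n (cact C x))))
      \<longleftrightarrow> (c \<in> carrier (GR n) \<and> (\<forall>x\<in>B n. f n x = b n (op n c x)))" for c
      unfolding GR_carrier[OF n] using eq[of c] by auto
    then show ?thesis using l.dual_generator_free[OF g DL_memD(3)[OF f n]] by simp
  qed
  define P where "P = (\<lambda>n c. c \<in> carrier (GR n) \<and> (\<forall>x\<in>B n. f n x = b n (op n c x)))"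
  have exP: "\<exists>!c. P n c" if "1 \<le> n" for n unfolding P_def by (rule ex1[OF that])
  define a where "a = (\<lambda>n\<in>{1..}. THE c. P n c)"
  have aP: "P n (a n)" if n: "1 \<le> n" for n
  proof -
    have "a n = (THE c. P n c)" using n by (simp add: a_def)
    then show ?thesis using theI'[OF exP[OF n]] by simp
  qed
  have an': "a n \<in> carrier (GR n) \<and> (\<forall>x\<in>B n. f n x = b n (op n (a n) x))" if "1 \<le> n" for n
    using aP[OF that] unfolding P_def .
  have an: "a n \<in> carrier (GR n)" "\<forall>x\<in>B n. f n x = b n (op n (a n) x)" if n: "1 \<le> n" for n
    by (rule conjunct1[OF an'[OF n]], rule conjunct2[OF an'[OF n]])
  have uniq: "c = a n" if n: "1 \<le> n" and c: "c \<in> carrier (GR n)" "\<forall>x\<in>B n. f n x = b n (op n c x)" for n c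
  proof -
    have "P n c" unfolding P_def using c by (rule conjI)
    then show ?thesis using exP[OF n] aP[OF n] by blast
  qed
  have a\<Lambda>: "a \<in> carrier \<Lambda>"
  proof (rule \<Lambda>_memI)
    fix n :: nat assume n: "1 \<le> n"
    have m: "1 \<le> Suc n" by simp
    show "a n \<in> carrier (GR n)" by (rule an(1)[OF n])
    show "proj n (a (Suc n)) = a n"
    proof (rule uniq[OF n proj_closed[OF n an(1)[OF m]]], rule ballI)
      fix x assume x: "x \<in> B n"
      have xm: "x \<in> B (Suc n)" using B_mono[OF n, of "Suc n"] x by auto
      have "f n x = f (Suc n) x" using DL_memD(4)[OF f n x] by simp
      also have "\<dots> = b (Suc n) (op (Suc n) (a (Suc n)) x)" using an(2)[OF m] xm by blast
      also have "\<dots> = b (Suc n) (op n (proj n (a (Suc n))) x)"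
        using op_proj[OF n an(1)[OF m] B_F[OF n x]] by simp
      also have "\<dots> = b n (op n (proj n (a (Suc n))) x)"
        by (rule DL_memD(4)[OF b n op_B[OF n proj_closed[OF n an(1)[OF m]] x]])
      finally show "f n x = b n (op n (proj n (a (Suc n))) x)" .
    qed
  qed (simp add: a_def)
  show ?thesis
  proof (rule ex1I[of _ a], rule conjI[OF a\<Lambda>])
    show "f = a \<odot>\<^bsub>DL\<^esub> b"
    proof (rule DL_ext[OF f DL_smult_closed[OF a\<Lambda> b]])
      show "f n x = (a \<odot>\<^bsub>DL\<^esub> b) n x" if "1 \<le> n" "x \<in> B n" for n x
        unfolding DL_smult_mem[OF a\<Lambda> b that] using an(2)[OF that(1)] that(2) by blast
    qed
    fix a' assume a': "a' \<in> carrier \<Lambda> \<and> f = a' \<odot>\<^bsub>DL\<^esub> b"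
    show "a' = a"
    proof (rule \<Lambda>_ext[OF conjunct1[OF a'] a\<Lambda>])
      fix n :: nat assume n: "1 \<le> n"
      show "a' n = a n"
      proof (rule uniq[OF n \<Lambda>_memD(1)[OF conjunct1[OF a'] n]], rule ballI)
        fix x assume x: "x \<in> B n"
        show "f n x = b n (op n (a' n) x)"
          by (subst conjunct2[OF a']) (rule DL_smult_mem[OF conjunct1[OF a'] b n x])
      qed
    qed
  qed
qed

end

text \<open>By \<open>p_power\<close> the image of \<open>N 1\<close> in each quotient consists of
  elements of p-power order, and \<open>index_N1\<close> makes the first level tame. The pro-p
  hypothesis is present through such consequences only.\<close>

locale p_tower = tower E L A \<pi> \<Gamma> N
  for E :: "('a, 'm) ring_scheme" (structure) and L A \<pi> and \<Gamma> :: "('a \<Rightarrow> 'a) monoid" and N +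
  fixes p :: nat
  assumes prime_p: "Factorial_Ring.prime p" and pi_dvd_p: "\<omega> \<otimes> ([p] \<cdot> \<one>) \<in> A"
    and index_N1: "\<not> p dvd card (carrier (\<Gamma> Mod N 1))"
    and p_power: "1 \<le> n \<Longrightarrow> \<theta> \<in> N 1 \<Longrightarrow> \<exists>k. \<theta> [^]\<^bsub>\<Gamma>\<^esub> (p ^ k) \<in> N n"
    and finite_residue: "finite ((\<lambda>a. {b \<in> A. \<omega> \<otimes> (a \<ominus> b) \<in> A}) ` A)"
begin

lemma level_p: assumes "1 \<le> n" shows "galois_level_p E L A \<pi> (Q n) (F n) cact p"
  by (intro galois_level_p.intro galois_level_p_axioms.intro level assms prime_p pi_dvd_p)

lemma lift_imp_generates:
  assumes lift: invariants_lift
  obtains b where "b \<in> carrier DL" "\<And>n. 1 \<le> n \<Longrightarrow> generates n (b n)"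
proof -
  have one: "1 \<le> (1::nat)" by simp
  have "tame_level E L A \<pi> (Q 1) (F 1) cact p"
    by (intro tame_level.intro tame_level_axioms.intro level_p one index_N1 finite_residue)
  then interpret t: tame_level E L A \<pi> "Q 1" "F 1" cact p .
  obtain b1 where b1: "t.dual_generator b1" using t.exists_dual_generator by blast
  then have g1: "generates 1 b1" using generates_iff[OF one] by blast
  then have "lin (B 1) b1" unfolding generates_def by blast
  then obtain b where b: "b \<in> carrier DL" "\<And>x. x \<in> B 1 \<Longrightarrow> b 1 x = b1 x" using lift_functional[OF one] by blast
  have "generates n (b n)" if n: "1 \<le> n" for n
  proof -
    interpret l: galois_level_p E L A \<pi> "Q n" "F n" cact p by (rule level_p[OF n])
    have bl: "lin (B n) (b n)" by (rule DL_memD(3)[OF b(1) n])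
    \<comment> \<open>The vectors that the criterion requires to lie in \<pi>B n. Stability of
      \<open>K\<close> under the group ring is what \<open>fixed_vector_mod_pi\<close> asks
      for.\<close>
    define K where "K = {x \<in> B n. \<forall>C\<in>carrier (Q n). \<omega> \<otimes> b n (cact C x) \<in> A}"
    have opK: "l.op c x \<in> K" if c: "c \<in> carrier (GR n)" and x: "x \<in> K" for c x
    proof -
      have xB: "x \<in> B n" using x unfolding K_def by blast
      have cA: "c C \<in> A" if "C \<in> carrier (Q n)" for C using c that unfolding GR_carrier[OF n] by auto
      have "\<omega> \<otimes> b n (cact C (l.op c x)) \<in> A" if C: "C \<in> carrier (Q n)" for C
      proof -
        have CB: "cact D (cact C x) \<in> B n" if "D \<in> carrier (Q n)" for D using that C xB by simp
        have "b n (cact C (l.op c x)) = (\<Oplus>D\<in>carrier (Q n). c D \<otimes> b n (cact D (cact C x)))"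
          unfolding l.op_act[OF c C l.B_F[OF xB]] unfolding l.op_def
          using lin_finsum_smult[OF bl submod_B[OF n] N_finite[OF n], of "\<lambda>D. cact D (cact C x)" c] CB cA by simp
        then have "\<omega> \<otimes> b n (cact C (l.op c x))
          = (\<Oplus>D\<in>carrier (Q n). \<omega> \<otimes> (c D \<otimes> b n (cact D (cact C x))))"
          using cA linD(1)[OF bl CB] N_finite[OF n] by (simp add: finsum_rdistr Pi_iff)
        also have "\<dots> \<in> A"
        proof (rule A_finsum)
          fix D assume D: "D \<in> carrier (Q n)"
          have "\<omega> \<otimes> b n (cact D (cact C x)) \<in> A"
            unfolding l.act_comp[OF D C l.B_F[OF xB], symmetric]
            using x l.GG.m_closed[OF D C] unfolding K_def by blast
          then have "c D \<otimes> (\<omega> \<otimes> b n (cact D (cact C x))) \<in> A" by (rule A_closed(4)[OF cA[OF D]])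
          then show "\<omega> \<otimes> (c D \<otimes> b n (cact D (cact C x))) \<in> A"
            using cA[OF D] linD(1)[OF bl CB[OF D]] by (simp add: m_lcomm)
        qed
        finally show ?thesis .
      qed
      then show ?thesis unfolding K_def using l.op_B[OF c xB] by blast
    qed
    have "\<omega> \<otimes> x \<in> B n" if xK: "x \<in> K" for x
    proof (rule ccontr)
      assume xn: "\<omega> \<otimes> x \<notin> B n"
      have KB: "K \<subseteq> B n" unfolding K_def by blast
      have ppow: "\<exists>k. C [^]\<^bsub>Q n\<^esub> (p ^ k) = \<one>\<^bsub>Q n\<^esub>" if CN: "C \<in> image_N n 1" for C
      proof -
        obtain \<theta> where \<theta>: "\<theta> \<in> N 1" "C = cset n \<theta>" using CN unfolding image_N_def by blast
        have \<theta>G: "\<theta> \<in> carrier \<Gamma>" using N_mem[OF one \<theta>(1)] .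
        have pw: "C [^]\<^bsub>Q n\<^esub> j = cset n (\<theta> [^]\<^bsub>\<Gamma>\<^esub> j)" for j :: nat
        proof (induction j)
          case 0
          then show ?case using cos_eq_N[OF n subgroup.one_closed[OF subgroup_N[OF n]]] by (simp add: Q_one)
        next
          case (Suc j)
          then show ?case unfolding \<theta>(2) using Q_mult[OF n _ \<theta>G, of "\<theta> [^]\<^bsub>\<Gamma>\<^esub> j"] \<theta>G by simp
        qed
        obtain k where "\<theta> [^]\<^bsub>\<Gamma>\<^esub> (p ^ k) \<in> N n" using p_power[OF n \<theta>(1)] by blast
        then have "C [^]\<^bsub>Q n\<^esub> (p ^ k) = \<one>\<^bsub>Q n\<^esub>" unfolding pw Q_one by (rule cos_eq_N[OF n])
        then show ?thesis by blast
      qed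
      have "\<exists>z\<in>K. \<omega> \<otimes> z \<notin> B n \<and> (\<forall>C\<in>image_N n 1. \<omega> \<otimes> (cact C z \<ominus> z) \<in> B n)"
      proof (rule l.fixed_vector_mod_pi[OF KB opK xK xn image_N_carrier[OF n one] ppow])
        fix z assume "z \<in> K" "\<omega> \<otimes> z \<notin> B n" "\<And>C. C \<in> image_N n 1 \<Longrightarrow> \<omega> \<otimes> (cact C z \<ominus> z) \<in> B n"
        then show ?thesis by (intro bexI[of _ z] conjI ballI)
      qed
      then obtain z where z: "z \<in> K" "\<omega> \<otimes> z \<notin> B n"
        "\<forall>C\<in>image_N n 1. \<omega> \<otimes> (cact C z \<ominus> z) \<in> B n" by blast
      have zB: "z \<in> B n" using z(1) unfolding K_def by blast
      have "\<forall>\<theta>\<in>N 1. \<omega> \<otimes> (\<theta> z \<ominus> z) \<in> B n"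
        using all_image_N_iff[OF n one B_F[OF n zB], of "\<lambda>u. \<omega> \<otimes> (u \<ominus> z) \<in> B n"] z(3) by blast
      then obtain y where y: "y \<in> B 1" "\<omega> \<otimes> (z \<ominus> y) \<in> B n"
        using lift n zB unfolding invariants_lift_def by blast
      have yB: "y \<in> B n" using B_mono[OF one n] y(1) by blast
      \<comment> \<open>As \<open>y\<close> is congruent to \<open>z\<close>, its orbit values under
        \<open>b n\<close> are divisible by \<pi>. On \<open>B 1\<close> they are values of
        \<open>b1\<close>, whose criterion makes \<open>y\<close>, and hence \<open>z\<close>,
        divisible by \<pi>.\<close>
      have "\<forall>\<gamma>\<in>carrier \<Gamma>. \<omega> \<otimes> b1 (\<gamma> y) \<in> A"
      proof
        fix \<gamma> assume \<gamma>: "\<gamma> \<in> carrier \<Gamma>"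
        have c: "z \<in> carrier E" "y \<in> carrier E" using zB yB by auto
        have \<gamma>z: "\<gamma> z \<in> B n" and \<gamma>y: "\<gamma> y \<in> B n" and \<gamma>y1: "\<gamma> y \<in> B 1"
          using hom_B[OF n \<gamma> zB] hom_B[OF n \<gamma> yB] hom_B[OF one \<gamma> y(1)] by auto
        have \<gamma>minus: "\<gamma> (z \<ominus> y) = \<gamma> z \<ominus> \<gamma> y"
          using hom_simps(2)[OF \<gamma>, of z "\<ominus> y"] hom_uminus[OF \<gamma>] c by (simp add: minus_eq)
        have "\<gamma> (\<omega> \<otimes> (z \<ominus> y)) \<in> B n" by (rule hom_B[OF n \<gamma> y(2)])
        moreover have "\<gamma> (\<omega> \<otimes> (z \<ominus> y)) = \<omega> \<otimes> (\<gamma> z \<ominus> \<gamma> y)"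
          using hom_simps(3)[OF \<gamma>, of \<omega> "z \<ominus> y"] \<Gamma>_L[OF \<gamma> omega_L] c \<gamma>minus by simp
        ultimately have d: "\<omega> \<otimes> (\<gamma> z \<ominus> \<gamma> y) \<in> B n" by simp
        have 1: "\<omega> \<otimes> (b n (\<gamma> z) \<ominus> b n (\<gamma> y)) \<in> A"
          using linD(1)[OF bl d] l.lin_omega_B[OF bl submodD(6)[OF submod_B[OF n] \<gamma>z \<gamma>y] d]
            lin_minus[OF bl submod_B[OF n] \<gamma>z \<gamma>y] by simp
        have 2: "\<omega> \<otimes> b n (\<gamma> z) \<in> A"
          using all_cosets_iff[OF n B_F[OF n zB], of "\<lambda>u. \<omega> \<otimes> b n u \<in> A"] z(1) \<gamma> unfolding K_def by blast
        have m: "b n (\<gamma> z) \<in> A" "b n (\<gamma> y) \<in> A" using linD(1)[OF bl] \<gamma>z \<gamma>y by auto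
        have "\<omega> \<otimes> b n (\<gamma> y) = \<omega> \<otimes> b n (\<gamma> z) \<ominus> \<omega> \<otimes> (b n (\<gamma> z) \<ominus> b n (\<gamma> y))"
          using m by (simp add: ring_norm)
        then have "\<omega> \<otimes> b n (\<gamma> y) \<in> A" using A_minus[OF 2 1] by simp
        moreover have "b n (\<gamma> y) = b1 (\<gamma> y)" using DL_restrict[OF b(1) one n \<gamma>y1] b(2)[OF \<gamma>y1] by simp
        ultimately show "\<omega> \<otimes> b1 (\<gamma> y) \<in> A" by simp
      qed
      then have "\<omega> \<otimes> y \<in> B 1" using g1 y(1) unfolding generates_def by blast
      then have "\<omega> \<otimes> y \<in> B n" using B_mono[OF one n] by blast
      then have "\<omega> \<otimes> (z \<ominus> y) \<oplus> \<omega> \<otimes> y \<in> B n" by (rule submodD(3)[OF submod_B[OF n] y(2)])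
      moreover have "\<omega> \<otimes> (z \<ominus> y) \<oplus> \<omega> \<otimes> y = \<omega> \<otimes> z" using zB yB by (simp add: ring_norm)
      ultimately show False using z(2) by simp
    qed
    then have "l.dual_generator (b n)" unfolding l.dual_generator_def K_def using bl by blast
    then show ?thesis using generates_iff[OF n] by blast
  qed
  then show ?thesis using that b(1) by blast
qed

theorem free_iff_invariants_lift: "free_module_of_rank \<Lambda> DL 1 \<longleftrightarrow> invariants_lift"
proof
  assume "free_module_of_rank \<Lambda> DL 1"
  then obtain b where b: "b \<in> carrier DL" "\<forall>f\<in>carrier DL. \<exists>!a. a \<in> carrier \<Lambda> \<and> f = a \<odot>\<^bsub>DL\<^esub> b"
    unfolding free_module_of_rank_one_iff[OF DL_module] by (rule bexE)
  have "\<exists>a\<in>carrier \<Lambda>. f = a \<odot>\<^bsub>DL\<^esub> b" if "f \<in> carrier DL" for f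
    using ex1_implies_ex[OF bspec[OF b(2) that]] by blast
  then show invariants_lift using generates_imp_lift generator_imp_generates[OF b(1)] by blast
next
  assume invariants_lift
  then obtain b where b: "b \<in> carrier DL" "\<And>n. 1 \<le> n \<Longrightarrow> generates n (b n)"
    using lift_imp_generates by blast
  show "free_module_of_rank \<Lambda> DL 1"
    unfolding free_module_of_rank_one_iff[OF DL_module]
    by (rule bexI[OF _ b(1)], rule ballI, rule generates_imp_free[OF b])
qed

end

section \<open>The limit of the reductions\<close>

context tower
begin

text \<open>The integers of the union of all levels. The limit of the residue rings is identified
  below with \<open>Binf\<close> modulo \<pi>, which removes the bookkeeping of levels.\<close>

definition Binf :: "'a set" where "Binf = (\<Union>n\<in>{1..}. B n)"

lemma Binf_I: "1 \<le> n \<Longrightarrow> x \<in> B n \<Longrightarrow> x \<in> Binf" by (auto simp: Binf_def)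

lemma Binf_E: assumes "x \<in> Binf" obtains n where "1 \<le> n" "x \<in> B n"
  using assms by (auto simp: Binf_def)

lemma Binf_E2:
  assumes "x \<in> Binf" "y \<in> Binf" obtains n where "1 \<le> n" "x \<in> B n" "y \<in> B n"
proof -
  obtain n where n: "1 \<le> n" "x \<in> B n" using assms(1) by (rule Binf_E)
  obtain m where m: "1 \<le> m" "y \<in> B m" using assms(2) by (rule Binf_E)
  have "x \<in> B (max n m)" using B_mono[OF n(1), of "max n m"] n(2) by auto
  moreover have "y \<in> B (max n m)" using B_mono[OF m(1), of "max n m"] m(2) by auto
  moreover have "1 \<le> max n m" using n(1) by simp
  ultimately show ?thesis using that by blast
qed

lemma Binf_mem: "x \<in> Binf \<Longrightarrow> x \<in> carrier E"
  by (erule Binf_E) (rule submodD(1)[OF submod_B])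

lemma Binf_closed:
  assumes "x \<in> Binf" "y \<in> Binf"
  shows "x \<oplus> y \<in> Binf" "x \<ominus> y \<in> Binf" "x \<otimes> y \<in> Binf" "\<theta> \<in> carrier \<Gamma> \<Longrightarrow> \<theta> x \<in> Binf"
proof -
  obtain n where n: "1 \<le> n" "x \<in> B n" "y \<in> B n" using assms by (rule Binf_E2)
  show "x \<oplus> y \<in> Binf" by (rule Binf_I[OF n(1) submodD(3)[OF submod_B[OF n(1)] n(2,3)]])
  show "x \<ominus> y \<in> Binf" by (rule Binf_I[OF n(1) submodD(6)[OF submod_B[OF n(1)] n(2,3)]])
  show "x \<otimes> y \<in> Binf" by (rule Binf_I[OF n(1) subringE(6)[OF subring_B[OF n(1)] n(2,3)]])
  show "\<theta> \<in> carrier \<Gamma> \<Longrightarrow> \<theta> x \<in> Binf" by (rule Binf_I[OF n(1) hom_B[OF n(1) _ n(2)]])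
qed

definition congr :: "'a \<Rightarrow> 'a \<Rightarrow> bool" where "congr x y \<longleftrightarrow> \<omega> \<otimes> (x \<ominus> y) \<in> Binf"

lemma B_if_Binf:
  assumes n: "1 \<le> n" and x: "x \<in> F n" and "x \<in> Binf" shows "x \<in> B n"
  using assms(3) by (rule Binf_E) (rule B_inter[OF _ x])

text \<open>The quotient by \<pi> already lies in the field of level \<open>n\<close>, so its
  integrality can be tested at any higher level. In other words, the transition maps of the residue
  rings are injective.\<close>

lemma congr_B_iff:
  assumes n: "1 \<le> n" and x: "x \<in> B n" "y \<in> B n" shows "congr x y \<longleftrightarrow> \<omega> \<otimes> (x \<ominus> y) \<in> B n"
proof
  interpret l: galois_level E L A \<pi> "Q n" "F n" cact by (rule level[OF n])
  have "\<omega> \<otimes> (x \<ominus> y) \<in> F n" using x by simp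
  then show "congr x y \<Longrightarrow> \<omega> \<otimes> (x \<ominus> y) \<in> B n" unfolding congr_def by (rule B_if_Binf[OF n])
  show "\<omega> \<otimes> (x \<ominus> y) \<in> B n \<Longrightarrow> congr x y" unfolding congr_def by (rule Binf_I[OF n])
qed

lemma congr_refl: assumes "x \<in> Binf" shows "congr x x"
  using Binf_closed(2)[OF assms assms] Binf_mem[OF assms] by (simp add: congr_def minus_eq r_neg)

lemma congr_sym: assumes "x \<in> Binf" "y \<in> Binf" "congr x y" shows "congr y x"
proof -
  note m = Binf_mem[OF assms(1)] Binf_mem[OF assms(2)]
  have z: "\<zero> \<in> Binf" using Binf_closed(2)[OF assms(1,1)] m by (simp add: minus_eq r_neg)
  have "\<zero> \<ominus> \<omega> \<otimes> (x \<ominus> y) \<in> Binf" using assms(3) unfolding congr_def by (rule Binf_closed(2)[OF z])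
  moreover have "\<zero> \<ominus> \<omega> \<otimes> (x \<ominus> y) = \<omega> \<otimes> (y \<ominus> x)" using m by (simp add: ring_norm)
  ultimately show ?thesis by (simp add: congr_def)
qed

lemma congr_trans:
  assumes "x \<in> Binf" "y \<in> Binf" "z \<in> Binf" "congr x y" "congr y z" shows "congr x z"
proof -
  note m = Binf_mem[OF assms(1)] Binf_mem[OF assms(2)] Binf_mem[OF assms(3)]
  have "\<omega> \<otimes> (x \<ominus> y) \<oplus> \<omega> \<otimes> (y \<ominus> z) \<in> Binf"
    using assms(4,5) unfolding congr_def by (rule Binf_closed(1))
  moreover have "\<omega> \<otimes> (x \<ominus> y) \<oplus> \<omega> \<otimes> (y \<ominus> z) = \<omega> \<otimes> (x \<ominus> z)" using m by (simp add: ring_norm)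
  ultimately show ?thesis by (simp add: congr_def)
qed

lemma congr_add:
  assumes "x \<in> Binf" "y \<in> Binf" "x' \<in> Binf" "y' \<in> Binf" "congr x x'" "congr y y'"
  shows "congr (x \<oplus> y) (x' \<oplus> y')"
proof -
  note m = assms(1-4)[THEN Binf_mem]
  have "\<omega> \<otimes> (x \<ominus> x') \<oplus> \<omega> \<otimes> (y \<ominus> y') \<in> Binf"
    using assms(5,6) unfolding congr_def by (rule Binf_closed(1))
  moreover have "\<omega> \<otimes> (x \<ominus> x') \<oplus> \<omega> \<otimes> (y \<ominus> y') = \<omega> \<otimes> ((x \<oplus> y) \<ominus> (x' \<oplus> y'))" using m by (simp add: ring_norm)
  ultimately show ?thesis by (simp add: congr_def)
qed

lemma congr_mult:
  assumes "x \<in> Binf" "y \<in> Binf" "x' \<in> Binf" "y' \<in> Binf" "congr x x'" "congr y y'"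
  shows "congr (x \<otimes> y) (x' \<otimes> y')"
proof -
  note m = assms(1-4)[THEN Binf_mem]
  have "(\<omega> \<otimes> (x \<ominus> x')) \<otimes> y \<in> Binf"
    using assms(5) unfolding congr_def by (rule Binf_closed(3)) (rule assms(2))
  moreover have "x' \<otimes> (\<omega> \<otimes> (y \<ominus> y')) \<in> Binf"
    using assms(6) unfolding congr_def by (rule Binf_closed(3)[OF assms(3)])
  ultimately have "(\<omega> \<otimes> (x \<ominus> x')) \<otimes> y \<oplus> x' \<otimes> (\<omega> \<otimes> (y \<ominus> y')) \<in> Binf" by (rule Binf_closed(1))
  moreover have "(\<omega> \<otimes> (x \<ominus> x')) \<otimes> y \<oplus> x' \<otimes> (\<omega> \<otimes> (y \<ominus> y')) = \<omega> \<otimes> ((x \<otimes> y) \<ominus> (x' \<otimes> y'))"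
    using m by (simp add: ring_norm)
  ultimately show ?thesis by (simp add: congr_def)
qed

lemma congr_hom:
  assumes "x \<in> Binf" "y \<in> Binf" "congr x y" "\<theta> \<in> carrier \<Gamma>" shows "congr (\<theta> x) (\<theta> y)"
proof -
  note m = assms(1,2)[THEN Binf_mem]
  have "\<theta> (\<omega> \<otimes> (x \<ominus> y)) \<in> Binf"
    using assms(3) unfolding congr_def by (rule Binf_closed(4)[OF _ assms(1) assms(4)])
  moreover have "\<theta> (\<omega> \<otimes> (x \<ominus> y)) = \<omega> \<otimes> (\<theta> x \<ominus> \<theta> y)"
    using m hom_simps(2)[OF assms(4), of x "\<ominus> y"] hom_simps(3)[OF assms(4), of \<omega> "x \<ominus> y"]
      hom_uminus[OF assms(4)] \<Gamma>_L[OF assms(4) omega_L] by (simp add: minus_eq)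
  ultimately show ?thesis by (simp add: congr_def)
qed

text \<open>The coset x + \<pi>B n as a subset of \<open>E\<close>; for integral \<open>x\<close>
  its elements are automatically integral.\<close>

definition cl :: "nat \<Rightarrow> 'a \<Rightarrow> 'a set" where
  "cl n x = {z \<in> carrier E. \<omega> \<otimes> (z \<ominus> x) \<in> B n}"

abbreviation R where "R \<equiv> \<lambda>n. reduction E (B n) \<pi>"
abbreviation J where "J n \<equiv> PIdl\<^bsub>E\<lparr>carrier := B n\<rparr>\<^esub> \<pi>"
abbreviation rmap where "rmap \<equiv> reduction_map E (\<lambda>n. B n) \<pi>"

lemma J_iff: assumes n: "1 \<le> n" shows "x \<in> J n \<longleftrightarrow> x \<in> carrier E \<and> \<omega> \<otimes> x \<in> B n"
proof
  assume "x \<in> J n"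
  then obtain y where y: "y \<in> B n" "x = y \<otimes> \<pi>" by (auto simp: cgenideal_def)
  have "y \<in> carrier E" by (rule submodD(1)[OF submod_B[OF n] y(1)])
  then show "x \<in> carrier E \<and> \<omega> \<otimes> x \<in> B n" using y by (simp add: m_comm[of y] )
next
  assume x: "x \<in> carrier E \<and> \<omega> \<otimes> x \<in> B n"
  then have "x = (\<omega> \<otimes> x) \<otimes> \<pi>" by (simp add: m_comm[of "\<omega> \<otimes> x"])
  then show "x \<in> J n" using x unfolding cgenideal_def by auto
qed

lemma coset_cl: assumes n: "1 \<le> n" and x: "x \<in> B n" shows "J n +>\<^bsub>E\<lparr>carrier := B n\<rparr>\<^esub> x = cl n x"
proof -
  have xE: "x \<in> carrier E" by (rule submodD(1)[OF submod_B[OF n] x])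
  have "z \<in> J n +>\<^bsub>E\<lparr>carrier := B n\<rparr>\<^esub> x \<longleftrightarrow> z \<in> cl n x" for z
  proof
    assume "z \<in> J n +>\<^bsub>E\<lparr>carrier := B n\<rparr>\<^esub> x"
    then obtain j where j: "j \<in> J n" "z = j \<oplus> x" by (auto simp: a_r_coset_def' )
    then have jE: "j \<in> carrier E" "\<omega> \<otimes> j \<in> B n" using J_iff[OF n] by auto
    have "z \<ominus> x = j" using j jE xE by (simp add: minus_eq a_assoc r_neg)
    then show "z \<in> cl n x" using j jE xE by (simp add: cl_def)
  next
    assume z: "z \<in> cl n x"
    then have zE: "z \<in> carrier E" "\<omega> \<otimes> (z \<ominus> x) \<in> B n" by (auto simp: cl_def)
    have "z \<ominus> x \<in> J n" using J_iff[OF n] zE xE by simp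
    moreover have "z = (z \<ominus> x) \<oplus> x" using zE xE by (simp add: minus_eq a_assoc l_neg)
    ultimately show "z \<in> J n +>\<^bsub>E\<lparr>carrier := B n\<rparr>\<^esub> x" by (auto simp: a_r_coset_def')
  qed
  then show ?thesis by blast
qed

lemma cl_eq_iff:
  assumes n: "1 \<le> n" and x: "x \<in> B n" and y: "y \<in> B n" shows "cl n x = cl n y \<longleftrightarrow> congr x y"
proof -
  have E: "x \<in> carrier E" "y \<in> carrier E" using submodD(1)[OF submod_B[OF n]] x y by auto
  have Bz: "\<zero> \<in> B n" by (rule submodD(2)[OF submod_B[OF n]])
  show ?thesis unfolding congr_B_iff[OF n x y]
  proof
    assume e: "cl n x = cl n y"
    have "x \<in> cl n x" using E Bz by (simp add: cl_def minus_eq r_neg)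
    then show "\<omega> \<otimes> (x \<ominus> y) \<in> B n" unfolding e by (simp add: cl_def)
  next
    assume d: "\<omega> \<otimes> (x \<ominus> y) \<in> B n"
    have "\<omega> \<otimes> (z \<ominus> x) \<in> B n \<longleftrightarrow> \<omega> \<otimes> (z \<ominus> y) \<in> B n" if z: "z \<in> carrier E" for z
    proof
      assume "\<omega> \<otimes> (z \<ominus> x) \<in> B n"
      then have "\<omega> \<otimes> (z \<ominus> x) \<oplus> \<omega> \<otimes> (x \<ominus> y) \<in> B n" by (rule submodD(3)[OF submod_B[OF n] _ d])
      moreover have "\<omega> \<otimes> (z \<ominus> x) \<oplus> \<omega> \<otimes> (x \<ominus> y) = \<omega> \<otimes> (z \<ominus> y)" using z E by (simp add: ring_norm)
      ultimately show "\<omega> \<otimes> (z \<ominus> y) \<in> B n" by simp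
    next
      assume "\<omega> \<otimes> (z \<ominus> y) \<in> B n"
      then have "\<omega> \<otimes> (z \<ominus> y) \<ominus> \<omega> \<otimes> (x \<ominus> y) \<in> B n" by (rule submodD(6)[OF submod_B[OF n] _ d])
      moreover have "\<omega> \<otimes> (z \<ominus> y) \<ominus> \<omega> \<otimes> (x \<ominus> y) = \<omega> \<otimes> (z \<ominus> x)" using z E by (simp add: ring_norm)
      ultimately show "\<omega> \<otimes> (z \<ominus> x) \<in> B n" by simp
    qed
    then show "cl n x = cl n y" unfolding cl_def by blast
  qed
qed

lemma J_ideal: assumes n: "1 \<le> n" shows "ideal (J n) (E\<lparr>carrier := B n\<rparr>)"
proof -
  have "subcring (B n) E" by (rule subcringI'[OF subring_B[OF n]])
  then have "cring (E\<lparr>carrier := B n\<rparr>)" by (rule subcring_iff[THEN iffD1, rotated]) (auto dest: submodD(1)[OF submod_B[OF n]])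
  then show ?thesis
  proof (rule cring.cgenideal_ideal)
    interpret l: galois_level E L A \<pi> "Q n" "F n" cact by (rule level[OF n])
    show "\<pi> \<in> carrier (E\<lparr>carrier := B n\<rparr>)" by (simp add: l.A_B)
  qed
qed

lemma R_facts:
  assumes n: "1 \<le> n"
  shows R_carrier: "carrier (R n) = cl n ` B n"
    and R_mult: "x \<in> B n \<Longrightarrow> y \<in> B n \<Longrightarrow> cl n x \<otimes>\<^bsub>R n\<^esub> cl n y = cl n (x \<otimes> y)"
    and R_add: "x \<in> B n \<Longrightarrow> y \<in> B n \<Longrightarrow> cl n x \<oplus>\<^bsub>R n\<^esub> cl n y = cl n (x \<oplus> y)"
    and R_one: "\<one>\<^bsub>R n\<^esub> = cl n \<one>"
proof -
  interpret I: ideal "J n" "E\<lparr>carrier := B n\<rparr>" by (rule J_ideal[OF n])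
  have one: "\<one> \<in> B n" using subringE(3)[OF subring_B[OF n]] .
  note cosets = coset_cl[OF n]
  show "carrier (R n) = cl n ` B n"
    unfolding reduction_def FactRing_def A_RCOSETS_def' using cosets by auto
  show "\<one>\<^bsub>R n\<^esub> = cl n \<one>" unfolding reduction_def FactRing_def using cosets[OF one] by simp
  show "cl n x \<otimes>\<^bsub>R n\<^esub> cl n y = cl n (x \<otimes> y)" if x: "x \<in> B n" and y: "y \<in> B n"
    using I.rcoset_mult_add[of x y] x y cosets[OF x] cosets[OF y] cosets[OF subringE(6)[OF subring_B[OF n] x y]]
    unfolding reduction_def FactRing_def by simp
  show "cl n x \<oplus>\<^bsub>R n\<^esub> cl n y = cl n (x \<oplus> y)" if x: "x \<in> B n" and y: "y \<in> B n"
    using I.a_rcos_sum[of x y] x y cosets[OF x] cosets[OF y] cosets[OF subringE(7)[OF subring_B[OF n] x y]]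
    unfolding reduction_def FactRing_def by simp
qed

lemma rmap_cl:
  assumes n: "1 \<le> n" and nm: "n \<le> m" and x: "x \<in> B n" shows "rmap n m (cl n x) = cl m x"
proof -
  have m: "1 \<le> m" using n nm by simp
  have xE: "x \<in> carrier E" by (rule submodD(1)[OF submod_B[OF n] x])
  have "z \<in> cl n x <+>\<^bsub>E\<^esub> J m \<longleftrightarrow> z \<in> cl m x" for z
  proof
    assume "z \<in> cl n x <+>\<^bsub>E\<^esub> J m"
    then obtain u j where u: "u \<in> cl n x" "j \<in> J m" "z = u \<oplus> j" by (auto simp: set_add_def')
    have uE: "u \<in> carrier E" "\<omega> \<otimes> (u \<ominus> x) \<in> B m" using u(1) B_mono[OF n nm] by (auto simp: cl_def)
    have jE: "j \<in> carrier E" "\<omega> \<otimes> j \<in> B m" using u(2) J_iff[OF m] by auto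
    have "\<omega> \<otimes> (u \<ominus> x) \<oplus> \<omega> \<otimes> j \<in> B m" by (rule submodD(3)[OF submod_B[OF m] uE(2) jE(2)])
    moreover have "\<omega> \<otimes> (u \<ominus> x) \<oplus> \<omega> \<otimes> j = \<omega> \<otimes> (z \<ominus> x)" using u(3) uE jE xE by (simp add: ring_norm)
    ultimately show "z \<in> cl m x" using u(3) uE jE by (simp add: cl_def)
  next
    assume z: "z \<in> cl m x"
    then have zE: "z \<in> carrier E" "\<omega> \<otimes> (z \<ominus> x) \<in> B m" by (auto simp: cl_def)
    have "x \<in> cl n x" using xE submodD(2)[OF submod_B[OF n]] by (simp add: cl_def minus_eq r_neg)
    moreover have "z \<ominus> x \<in> J m" using zE xE J_iff[OF m] by simp
    moreover have "z = x \<oplus> (z \<ominus> x)" using zE xE by (simp add: minus_eq add_cancel_simps)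
    ultimately show "z \<in> cl n x <+>\<^bsub>E\<^esub> J m" by (auto simp: set_add_def')
  qed
  then show ?thesis unfolding reduction_map_def by blast
qed

section \<open>The direct limit as integers modulo \<pi>\<close>

abbreviation rel where "rel \<equiv> direct_limit_rel R rmap"
abbreviation Lim where "Lim \<equiv> reduction_limit E (\<lambda>n. B n) \<pi>"

text \<open>The class of \<open>x\<close> in the direct limit: elements of the quotient are
  equivalence classes, so it has to list all representatives at all levels.\<close>

definition germ :: "'a \<Rightarrow> (nat \<times> 'a set) set" where
  "germ x = {(m, cl m y) | m y. 1 \<le> m \<and> y \<in> B m \<and> congr x y}"

lemma rel_iff:
  assumes n: "1 \<le> n" "x \<in> B n" and m: "1 \<le> m" "y \<in> B m"
  shows "((n, cl n x), (m, cl m y)) \<in> rel \<longleftrightarrow> congr x y"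
proof -
  have "((n, cl n x), (m, cl m y)) \<in> rel \<longleftrightarrow> (\<exists>k. n \<le> k \<and> m \<le> k \<and> rmap n k (cl n x) = rmap m k (cl m y))"
    unfolding direct_limit_rel_def using n m R_carrier by auto
  also have "\<dots> \<longleftrightarrow> (\<exists>k. n \<le> k \<and> m \<le> k \<and> congr x y)"
  proof -
    have "rmap n k (cl n x) = rmap m k (cl m y) \<longleftrightarrow> congr x y" if k: "n \<le> k" "m \<le> k" for k
    proof -
      have "1 \<le> k" using k n by simp
      moreover have "x \<in> B k" "y \<in> B k" using B_mono[OF n(1) k(1)] B_mono[OF m(1) k(2)] n(2) m(2) by auto
      ultimately show ?thesis unfolding rmap_cl[OF n(1) k(1) n(2)] rmap_cl[OF m(1) k(2) m(2)]
        by (rule cl_eq_iff)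
    qed
    then show ?thesis by blast
  qed
  also have "\<dots> \<longleftrightarrow> congr x y" using max.cobounded1 max.cobounded2 by blast
  finally show ?thesis .
qed

lemma in_germ:
  assumes n: "1 \<le> n" "x \<in> B n" shows "direct_limit_in R rmap n (cl n x) = germ x"
proof (intro equalityI subsetI)
  fix c assume "c \<in> direct_limit_in R rmap n (cl n x)"
  then have c: "((n, cl n x), c) \<in> rel" by (simp add: direct_limit_in_def)
  then obtain m Y where mY: "c = (m, Y)" "1 \<le> m" "Y \<in> carrier (R m)" by (auto simp: direct_limit_rel_def)
  obtain y where y: "y \<in> B m" "Y = cl m y" using mY(3) unfolding R_carrier[OF mY(2)] by blast
  have "congr x y" using c unfolding mY(1) y(2) rel_iff[OF n mY(2) y(1)] .
  then show "c \<in> germ x" unfolding germ_def mY(1) y(2) using mY(2) y(1) by blast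
next
  fix c assume "c \<in> germ x"
  then obtain m y where y: "c = (m, cl m y)" "1 \<le> m" "y \<in> B m" "congr x y" unfolding germ_def by blast
  then show "c \<in> direct_limit_in R rmap n (cl n x)"
    unfolding direct_limit_in_def y(1) using rel_iff[OF n y(2,3)] by blast
qed

lemma germ_eq_iff:
  assumes x: "x \<in> Binf" and y: "y \<in> Binf" shows "germ x = germ y \<longleftrightarrow> congr x y"
proof
  assume e: "germ x = germ y"
  obtain n where n: "1 \<le> n" "y \<in> B n" using y by (rule Binf_E)
  have "(n, cl n y) \<in> germ y" unfolding germ_def using n congr_refl[OF y] by blast
  then have "(n, cl n y) \<in> germ x" by (simp only: e)
  then obtain m y' where mY: "(n, cl n y) = (m, cl m y')" "y' \<in> B m" "congr x y'" unfolding germ_def by blast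
  have "m = n" using mY(1) by simp
  then have y': "cl n y = cl n y'" "y' \<in> B n" "congr x y'" using mY by simp_all
  have "congr y y'" using y'(1) cl_eq_iff[OF n(1,2) y'(2)] by blast
  then show "congr x y" using congr_trans[OF x Binf_I[OF n(1) y'(2)] y y'(3)] congr_sym[OF y Binf_I[OF n(1) y'(2)]] by blast
next
  assume c: "congr x y"
  have "congr x z \<longleftrightarrow> congr y z" if z: "z \<in> Binf" for z
    using congr_trans[OF x y z c] congr_trans[OF y x z congr_sym[OF x y c]] by blast
  then show "germ x = germ y" unfolding germ_def using Binf_I by blast
qed

lemma germ_nonempty: assumes "x \<in> Binf" shows "germ x \<noteq> {}"
proof -
  obtain n where n: "1 \<le> n" "x \<in> B n" using assms by (rule Binf_E)
  then have "(n, cl n x) \<in> germ x" unfolding germ_def using congr_refl[OF assms] by blast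
  then show ?thesis by blast
qed

lemma Lim_carrier: "carrier Lim = germ ` Binf"
proof -
  have "carrier Lim = (SIGMA n:{1..}. carrier (R n)) // rel"
    by (simp add: reduction_limit_def direct_limit_def)
  also have "\<dots> = germ ` Binf"
  proof (intro equalityI subsetI)
    fix c assume "c \<in> (SIGMA n:{1..}. carrier (R n)) // rel"
    then obtain n U where nU: "1 \<le> n" "U \<in> carrier (R n)" "c = rel `` {(n, U)}" by (auto simp: quotient_def)
    obtain x where x: "x \<in> B n" "U = cl n x" using nU(2) unfolding R_carrier[OF nU(1)] by blast
    have "c = germ x" using in_germ[OF nU(1) x(1)] nU(3) x(2) by (simp add: direct_limit_in_def)
    then show "c \<in> germ ` Binf" using Binf_I[OF nU(1) x(1)] by blast
  next
    fix c assume "c \<in> germ ` Binf"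
    then obtain x where x: "x \<in> Binf" "c = germ x" by blast
    obtain n where n: "1 \<le> n" "x \<in> B n" using x(1) by (rule Binf_E)
    have "c = rel `` {(n, cl n x)}" using in_germ[OF n] x(2) by (simp add: direct_limit_in_def)
    moreover have "(n, cl n x) \<in> (SIGMA n:{1..}. carrier (R n))" using n R_carrier[OF n(1)] by auto
    ultimately show "c \<in> (SIGMA n:{1..}. carrier (R n)) // rel" unfolding quotient_def by blast
  qed
  finally show ?thesis .
qed

text \<open>All representatives give the same class, so the double union in the definition of the
  direct limit collapses. An arbitrary operation \<open>h\<close> lets sums and products share the
  argument.\<close>

lemma germ_binop:
  assumes x: "x \<in> Binf" and y: "y \<in> Binf"
    and f: "\<And>k u v. 1 \<le> k \<Longrightarrow> u \<in> B k \<Longrightarrow> v \<in> B k \<Longrightarrow> f k (cl k u) (cl k v) = cl k (h u v) \<and> h u v \<in> B k"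
    and h: "\<And>u v. u \<in> Binf \<Longrightarrow> v \<in> Binf \<Longrightarrow> congr x u \<Longrightarrow> congr y v \<Longrightarrow> congr (h x y) (h u v)"
    and hB: "h x y \<in> Binf"
  shows "(\<Union>(n, U)\<in>germ x. \<Union>(m, Y)\<in>germ y. direct_limit_in R rmap (max n m)
    (f (max n m) (rmap n (max n m) U) (rmap m (max n m) Y))) = germ (h x y)"
proof -
  have *: "direct_limit_in R rmap (max n m) (f (max n m) (rmap n (max n m) U) (rmap m (max n m) Y)) = germ (h x y)"
    if U: "(n, U) \<in> germ x" and Y: "(m, Y) \<in> germ y" for n U m Y
  proof -
    obtain u where u: "1 \<le> n" "u \<in> B n" "U = cl n u" "congr x u" using U unfolding germ_def by blast
    obtain v where v: "1 \<le> m" "v \<in> B m" "Y = cl m v" "congr y v" using Y unfolding germ_def by blast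
    let ?k = "max n m"
    have k: "1 \<le> ?k" "n \<le> ?k" "m \<le> ?k" using u(1) by auto
    have uk: "u \<in> B ?k" and vk: "v \<in> B ?k" using B_mono[OF u(1) k(2)] B_mono[OF v(1) k(3)] u(2) v(2) by auto
    note uv = Binf_I[OF u(1,2)] Binf_I[OF v(1,2)]
    have "f ?k (rmap n ?k U) (rmap m ?k Y) = cl ?k (h u v)"
      unfolding u(3) v(3) rmap_cl[OF u(1) k(2) u(2)] rmap_cl[OF v(1) k(3) v(2)] using f[OF k(1) uk vk] by blast
    then have "direct_limit_in R rmap ?k (f ?k (rmap n ?k U) (rmap m ?k Y)) = germ (h u v)"
      using in_germ[OF k(1)] f[OF k(1) uk vk] by simp
    also have "\<dots> = germ (h x y)"
      using germ_eq_iff[OF hB Binf_I[OF k(1)], of "h u v"] f[OF k(1) uk vk] h[OF uv u(4) v(4)] by blast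
    finally show ?thesis .
  qed
  have "(\<Union>(n, U)\<in>germ x. \<Union>(m, Y)\<in>germ y. direct_limit_in R rmap (max n m)
    (f (max n m) (rmap n (max n m) U) (rmap m (max n m) Y))) = (\<Union>c\<in>germ x. \<Union>d\<in>germ y. germ (h x y))"
    using * by (intro SUP_cong) auto
  also have "\<dots> = germ (h x y)" using germ_nonempty[OF x] germ_nonempty[OF y] by auto
  finally show ?thesis .
qed

lemma Lim_mult:
  assumes x: "x \<in> Binf" and y: "y \<in> Binf" shows "germ x \<otimes>\<^bsub>Lim\<^esub> germ y = germ (x \<otimes> y)"
proof -
  have "germ x \<otimes>\<^bsub>Lim\<^esub> germ y = (\<Union>(n, U)\<in>germ x. \<Union>(m, Y)\<in>germ y. direct_limit_in R rmap (max n m)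
    (rmap n (max n m) U \<otimes>\<^bsub>R (max n m)\<^esub> rmap m (max n m) Y))"
    by (simp add: reduction_limit_def direct_limit_def)
  also have "\<dots> = germ (x \<otimes> y)"
  proof (rule germ_binop[where f = "\<lambda>k U Y. U \<otimes>\<^bsub>R k\<^esub> Y" and h = "\<lambda>u v. u \<otimes> v", OF x y])
    show "cl k u \<otimes>\<^bsub>R k\<^esub> cl k v = cl k (u \<otimes> v) \<and> u \<otimes> v \<in> B k" if "1 \<le> k" "u \<in> B k" "v \<in> B k" for k u v
      using R_mult[OF that] subringE(6)[OF subring_B[OF that(1)] that(2,3)] by blast
    show "congr (x \<otimes> y) (u \<otimes> v)" if "u \<in> Binf" "v \<in> Binf" "congr x u" "congr y v" for u v
      by (rule congr_mult[OF x y that])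
    show "x \<otimes> y \<in> Binf" by (rule Binf_closed(3)[OF x y])
  qed
  finally show ?thesis .
qed

lemma Lim_add:
  assumes x: "x \<in> Binf" and y: "y \<in> Binf" shows "germ x \<oplus>\<^bsub>Lim\<^esub> germ y = germ (x \<oplus> y)"
proof -
  have "germ x \<oplus>\<^bsub>Lim\<^esub> germ y = (\<Union>(n, U)\<in>germ x. \<Union>(m, Y)\<in>germ y. direct_limit_in R rmap (max n m)
    (rmap n (max n m) U \<oplus>\<^bsub>R (max n m)\<^esub> rmap m (max n m) Y))"
    by (simp add: reduction_limit_def direct_limit_def)
  also have "\<dots> = germ (x \<oplus> y)"
  proof (rule germ_binop[where f = "\<lambda>k U Y. U \<oplus>\<^bsub>R k\<^esub> Y" and h = "\<lambda>u v. u \<oplus> v", OF x y])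
    show "cl k u \<oplus>\<^bsub>R k\<^esub> cl k v = cl k (u \<oplus> v) \<and> u \<oplus> v \<in> B k" if "1 \<le> k" "u \<in> B k" "v \<in> B k" for k u v
      using R_add[OF that] subringE(7)[OF subring_B[OF that(1)] that(2,3)] by blast
    show "congr (x \<oplus> y) (u \<oplus> v)" if "u \<in> Binf" "v \<in> Binf" "congr x u" "congr y v" for u v
      by (rule congr_add[OF x y that])
    show "x \<oplus> y \<in> Binf" by (rule Binf_closed(1)[OF x y])
  qed
  finally show ?thesis .
qed

text \<open>One inclusion holds for every element of the group; applied to the inverse automorphism
  it yields the other.\<close>

lemma hom_image_cl:
  assumes n: "1 \<le> n" and \<theta>: "\<theta> \<in> carrier \<Gamma>" and x: "x \<in> B n" shows "\<theta> ` cl n x = cl n (\<theta> x)"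
proof -
  have sub: "\<tau> ` cl n u \<subseteq> cl n (\<tau> u)" if \<tau>: "\<tau> \<in> carrier \<Gamma>" and u: "u \<in> B n" for \<tau> u
  proof
    fix w assume "w \<in> \<tau> ` cl n u"
    then obtain z where z: "z \<in> carrier E" "\<omega> \<otimes> (z \<ominus> u) \<in> B n" "w = \<tau> z" by (auto simp: cl_def)
    have uE: "u \<in> carrier E" by (rule submodD(1)[OF submod_B[OF n] u])
    have "\<tau> (\<omega> \<otimes> (z \<ominus> u)) \<in> B n" by (rule hom_B[OF n \<tau> z(2)])
    moreover have "\<tau> (\<omega> \<otimes> (z \<ominus> u)) = \<omega> \<otimes> (\<tau> z \<ominus> \<tau> u)"
      using z uE hom_simps(2)[OF \<tau>, of z "\<ominus> u"] hom_simps(3)[OF \<tau>, of \<omega> "z \<ominus> u"]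
        hom_uminus[OF \<tau>] \<Gamma>_L[OF \<tau> omega_L] by (simp add: minus_eq)
    ultimately show "w \<in> cl n (\<tau> u)" using z hom_simps(1)[OF \<tau> z(1)] by (simp add: cl_def)
  qed
  show ?thesis
  proof
    show "\<theta> ` cl n x \<subseteq> cl n (\<theta> x)" by (rule sub[OF \<theta> x])
    have xE: "x \<in> carrier E" by (rule submodD(1)[OF submod_B[OF n] x])
    have invc: "\<theta> ((inv\<^bsub>\<Gamma>\<^esub> \<theta>) z) = z" "(inv\<^bsub>\<Gamma>\<^esub> \<theta>) (\<theta> z) = z" if "z \<in> carrier E" for z
      using \<Gamma>_mult[OF \<theta> \<Gamma>.inv_closed[OF \<theta>] that] \<Gamma>_mult[OF \<Gamma>.inv_closed[OF \<theta>] \<theta> that] \<theta> that by simp_all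
    show "cl n (\<theta> x) \<subseteq> \<theta> ` cl n x"
    proof
      fix w assume w: "w \<in> cl n (\<theta> x)"
      then have "(inv\<^bsub>\<Gamma>\<^esub> \<theta>) w \<in> cl n ((inv\<^bsub>\<Gamma>\<^esub> \<theta>) (\<theta> x))"
        using sub[OF \<Gamma>.inv_closed[OF \<theta>] hom_B[OF n \<theta> x]] by blast
      then have "(inv\<^bsub>\<Gamma>\<^esub> \<theta>) w \<in> cl n x" unfolding invc(2)[OF xE] .
      moreover have "w = \<theta> ((inv\<^bsub>\<Gamma>\<^esub> \<theta>) w)" using invc(1)[of w] w by (simp add: cl_def)
      ultimately show "w \<in> \<theta> ` cl n x" by (rule rev_image_eqI)
    qed
  qed
qed

lemma action_germ:
  assumes \<theta>: "\<theta> \<in> carrier \<Gamma>" and x: "x \<in> Binf"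
  shows "reduction_limit_action \<theta> (germ x) = germ (\<theta> x)"
proof -
  have sub: "reduction_limit_action \<tau> (germ u) \<subseteq> germ (\<tau> u)" if \<tau>: "\<tau> \<in> carrier \<Gamma>" and u: "u \<in> Binf" for \<tau> u
  proof
    fix c assume "c \<in> reduction_limit_action \<tau> (germ u)"
    then obtain m y where y: "1 \<le> m" "y \<in> B m" "congr u y" "c = (m, \<tau> ` cl m y)"
      unfolding reduction_limit_action_def germ_def by auto
    show "c \<in> germ (\<tau> u)" unfolding y(4) hom_image_cl[OF y(1) \<tau> y(2)] germ_def
      using y(1) hom_B[OF y(1) \<tau> y(2)] congr_hom[OF u Binf_I[OF y(1,2)] y(3) \<tau>] by blast
  qed
  have xE: "x \<in> carrier E" by (rule Binf_mem[OF x])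
  have invc: "\<theta> ((inv\<^bsub>\<Gamma>\<^esub> \<theta>) z) = z" "(inv\<^bsub>\<Gamma>\<^esub> \<theta>) (\<theta> z) = z" if "z \<in> carrier E" for z
    using \<Gamma>_mult[OF \<theta> \<Gamma>.inv_closed[OF \<theta>] that] \<Gamma>_mult[OF \<Gamma>.inv_closed[OF \<theta>] \<theta> that] \<theta> that by simp_all
  show ?thesis
  proof
    show "reduction_limit_action \<theta> (germ x) \<subseteq> germ (\<theta> x)" by (rule sub[OF \<theta> x])
    show "germ (\<theta> x) \<subseteq> reduction_limit_action \<theta> (germ x)"
    proof
      fix c assume "c \<in> germ (\<theta> x)"
      then obtain m y where y: "1 \<le> m" "y \<in> B m" "congr (\<theta> x) y" "c = (m, cl m y)" unfolding germ_def by blast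
      let ?y = "(inv\<^bsub>\<Gamma>\<^esub> \<theta>) y"
      have yE: "y \<in> carrier E" by (rule submodD(1)[OF submod_B[OF y(1)] y(2)])
      have yB: "?y \<in> B m" by (rule hom_B[OF y(1) \<Gamma>.inv_closed[OF \<theta>] y(2)])
      have "congr ((inv\<^bsub>\<Gamma>\<^esub> \<theta>) (\<theta> x)) ?y"
        by (rule congr_hom[OF Binf_closed(4)[OF x x \<theta>] Binf_I[OF y(1,2)] y(3) \<Gamma>.inv_closed[OF \<theta>]])
      then have "(m, cl m ?y) \<in> germ x" unfolding invc(2)[OF xE] germ_def using y(1) yB by blast
      moreover have "c = (m, \<theta> ` cl m ?y)"
        unfolding hom_image_cl[OF y(1) \<theta> yB] invc(1)[OF yE] by (rule y(4))
      ultimately show "c \<in> reduction_limit_action \<theta> (germ x)"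
        unfolding reduction_limit_action_def by (intro image_eqI[where x = "(m, cl m ?y)"]) (simp_all only: prod.case)
    qed
  qed
qed

text \<open>The map is always a homomorphism into the invariants, and it is injective by
  \<open>germ_eq_iff\<close> and \<open>cl_eq_iff\<close>. What remains is surjectivity, which is
  \<open>invariants_lift\<close> read through germs.\<close>

theorem iso_iff_invariants_lift:
  "(\<lambda>Y. direct_limit_in R rmap 1 Y) \<in> ring_iso (R 1) (reduction_limit_invariants E (\<lambda>n. B n) \<pi> (N 1))
    \<longleftrightarrow> invariants_lift"
proof -
  let ?h = "\<lambda>Y. direct_limit_in R rmap 1 Y"
  let ?I = "reduction_limit_invariants E (\<lambda>n. B n) \<pi> (N 1)"
  have one: "1 \<le> (1::nat)" by simp
  have hcl: "?h (cl 1 x) = germ x" if "x \<in> B 1" for x by (rule in_germ[OF one that])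
  have inf: "x \<in> Binf" if "x \<in> B 1" for x by (rule Binf_I[OF one that])
  have Ic: "carrier ?I = {germ x | x. x \<in> Binf \<and> (\<forall>\<theta>\<in>N 1. congr (\<theta> x) x)}"
  proof -
    have "(\<forall>\<theta>\<in>N 1. reduction_limit_action \<theta> (germ x) = germ x) \<longleftrightarrow> (\<forall>\<theta>\<in>N 1. congr (\<theta> x) x)"
      if x: "x \<in> Binf" for x
      using action_germ[OF N_mem[OF one] x] germ_eq_iff[OF Binf_closed(4)[OF x x N_mem[OF one]] x] by auto
    then show ?thesis unfolding reduction_limit_invariants_def by (auto simp: Lim_carrier)
  qed
  have Iops: "germ x \<otimes>\<^bsub>?I\<^esub> germ y = germ (x \<otimes> y)" "germ x \<oplus>\<^bsub>?I\<^esub> germ y = germ (x \<oplus> y)"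
    if "x \<in> Binf" "y \<in> Binf" for x y
    using Lim_mult[OF that] Lim_add[OF that] by (simp_all add: reduction_limit_invariants_def)
  have oneB: "\<one> \<in> B 1" using subringE(3)[OF subring_B[OF one]] .
  have Ione: "\<one>\<^bsub>?I\<^esub> = germ \<one>"
    using hcl[OF oneB] R_one[OF one] by (simp add: reduction_limit_invariants_def reduction_limit_def direct_limit_def)
  have hom: "?h \<in> ring_hom (R 1) ?I"
  proof (rule ring_hom_memI)
    fix Y assume "Y \<in> carrier (R 1)"
    then obtain x where x: "x \<in> B 1" "Y = cl 1 x" unfolding R_carrier[OF one] by blast
    have "\<forall>\<theta>\<in>N 1. congr (\<theta> x) x"
    proof
      fix \<theta> assume "\<theta> \<in> N 1"
      then have "\<theta> x = x" by (rule F_memD(2)[OF B_F[OF one x(1)]])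
      then show "congr (\<theta> x) x" using congr_refl[OF inf[OF x(1)]] by simp
    qed
    then show "?h Y \<in> carrier ?I" unfolding x(2) hcl[OF x(1)] Ic using inf[OF x(1)] by blast
    fix Z assume "Z \<in> carrier (R 1)"
    then obtain z where z: "z \<in> B 1" "Z = cl 1 z" unfolding R_carrier[OF one] by blast
    show "?h (Y \<otimes>\<^bsub>R 1\<^esub> Z) = ?h Y \<otimes>\<^bsub>?I\<^esub> ?h Z"
      unfolding x(2) z(2) R_mult[OF one x(1) z(1)] hcl[OF x(1)] hcl[OF z(1)]
        hcl[OF subringE(6)[OF subring_B[OF one] x(1) z(1)]] Iops(1)[OF inf[OF x(1)] inf[OF z(1)]] ..
    show "?h (Y \<oplus>\<^bsub>R 1\<^esub> Z) = ?h Y \<oplus>\<^bsub>?I\<^esub> ?h Z"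
      unfolding x(2) z(2) R_add[OF one x(1) z(1)] hcl[OF x(1)] hcl[OF z(1)]
        hcl[OF subringE(7)[OF subring_B[OF one] x(1) z(1)]] Iops(2)[OF inf[OF x(1)] inf[OF z(1)]] ..
  next
    show "?h \<one>\<^bsub>R 1\<^esub> = \<one>\<^bsub>?I\<^esub>" unfolding R_one[OF one] hcl[OF oneB] Ione ..
  qed
  have inj: "inj_on ?h (carrier (R 1))"
  proof (rule inj_onI)
    fix Y Z assume YZ: "Y \<in> carrier (R 1)" "Z \<in> carrier (R 1)" and e: "?h Y = ?h Z"
    obtain x where x: "x \<in> B 1" "Y = cl 1 x" using YZ(1) unfolding R_carrier[OF one] by blast
    obtain z where z: "z \<in> B 1" "Z = cl 1 z" using YZ(2) unfolding R_carrier[OF one] by blast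
    have "congr x z" using e unfolding x(2) z(2) hcl[OF x(1)] hcl[OF z(1)] germ_eq_iff[OF inf[OF x(1)] inf[OF z(1)]] .
    then show "Y = Z" unfolding x(2) z(2) cl_eq_iff[OF one x(1) z(1)] .
  qed
  have "?h \<in> ring_iso (R 1) ?I \<longleftrightarrow> ?h ` carrier (R 1) = carrier ?I"
    unfolding ring_iso_def bij_betw_def using hom inj by blast
  also have "\<dots> \<longleftrightarrow> (\<forall>x\<in>Binf. (\<forall>\<theta>\<in>N 1. congr (\<theta> x) x) \<longrightarrow> (\<exists>y\<in>B 1. congr x y))"
  proof -
    have im: "?h ` carrier (R 1) = germ ` B 1"
      unfolding R_carrier[OF one] image_image using hcl by (intro image_cong) auto
    have sub: "?h ` carrier (R 1) \<subseteq> carrier ?I" using ring_hom_memE(1)[OF hom] by blast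
    have "?h ` carrier (R 1) = carrier ?I \<longleftrightarrow> carrier ?I \<subseteq> germ ` B 1" using im sub by blast
    also have "\<dots> \<longleftrightarrow> (\<forall>x\<in>Binf. (\<forall>\<theta>\<in>N 1. congr (\<theta> x) x) \<longrightarrow> germ x \<in> germ ` B 1)" unfolding Ic by blast
    also have "\<dots> \<longleftrightarrow> (\<forall>x\<in>Binf. (\<forall>\<theta>\<in>N 1. congr (\<theta> x) x) \<longrightarrow> (\<exists>y\<in>B 1. congr x y))"
    proof -
      have "germ x \<in> germ ` B 1 \<longleftrightarrow> (\<exists>y\<in>B 1. congr x y)" if x: "x \<in> Binf" for x
        using germ_eq_iff[OF x inf] by blast
      then show ?thesis by blast
    qed
    finally show ?thesis .
  qed
  also have "\<dots> \<longleftrightarrow> invariants_lift"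
  proof -
    have eq: "((\<forall>\<theta>\<in>N 1. congr (\<theta> x) x) \<longrightarrow> (\<exists>y\<in>B 1. congr x y)) \<longleftrightarrow>
      ((\<forall>\<theta>\<in>N 1. \<omega> \<otimes> (\<theta> x \<ominus> x) \<in> B n) \<longrightarrow> (\<exists>y\<in>B 1. \<omega> \<otimes> (x \<ominus> y) \<in> B n))"
      if n: "1 \<le> n" and x: "x \<in> B n" for n x
    proof -
      have 1: "congr (\<theta> x) x \<longleftrightarrow> \<omega> \<otimes> (\<theta> x \<ominus> x) \<in> B n" if "\<theta> \<in> N 1" for \<theta>
        by (rule congr_B_iff[OF n hom_B[OF n N_mem[OF one that] x] x])
      have 2: "congr x y \<longleftrightarrow> \<omega> \<otimes> (x \<ominus> y) \<in> B n" if "y \<in> B 1" for y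
      proof -
        have "y \<in> B n" using B_mono[OF one n] that by blast
        then show ?thesis by (rule congr_B_iff[OF n x])
      qed
      show ?thesis using 1 2 by simp
    qed
    have *: "(\<forall>x\<in>Binf. Q x) \<longleftrightarrow> (\<forall>n\<ge>1. \<forall>x\<in>B n. Q x)" for Q using Binf_I Binf_E by metis
    show ?thesis unfolding * invariants_lift_def
      by (rule all_cong1, rule imp_cong[OF refl], rule ball_cong[OF refl], rule eq)
  qed
  finally show ?thesis .
qed

end

section \<open>The \<open>p\<close>-adic integers\<close>

abbreviation (input) Zp where "Zp \<equiv> padic_integers"

text \<open>The canonical map from the integers to the p-adic integers.\<close>

definition padic :: "nat \<Rightarrow> int \<Rightarrow> nat \<Rightarrow> int" where
  "padic p k = (\<lambda>n\<in>{1..}. k mod int p ^ n)"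

lemma padic_carrier_iff:
  "c \<in> carrier (Zp p) \<longleftrightarrow>
    (\<forall>n\<ge>1. 0 \<le> c n \<and> c n < int p ^ n \<and> c (Suc n) mod int p ^ n = c n) \<and> c \<in> extensional {1..}"
  by (force simp: padic_integers_def inverse_limit_def PiE_def residue_ring_def)

lemma padic_ops:
  "c \<otimes>\<^bsub>Zp p\<^esub> d = (\<lambda>n\<in>{1..}. c n * d n mod int p ^ n)"
  "c \<oplus>\<^bsub>Zp p\<^esub> d = (\<lambda>n\<in>{1..}. (c n + d n) mod int p ^ n)"
  "\<one>\<^bsub>Zp p\<^esub> = (\<lambda>n\<in>{1..}. 1)" "\<zero>\<^bsub>Zp p\<^esub> = (\<lambda>n\<in>{1..}. 0)"
  by (simp_all add: padic_integers_def inverse_limit_def residue_ring_def)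

lemma int_div_less:
  assumes "(0::int) < q" "a < b * q"
  shows "a div q < b"
proof -
  have "a div q * q \<le> a" using minus_mod_eq_div_mult[of a q] pos_mod_sign[OF assms(1), of a] by linarith
  then have "a div q * q < b * q" using assms(2) by linarith
  then show ?thesis using assms(1) by (simp add: mult_less_cancel_right_pos)
qed

lemma padic_memI:
  assumes "1 < p" "\<And>n. 1 \<le> n \<Longrightarrow> [f (Suc n) = f n] (mod int p ^ n)"
  shows "(\<lambda>n\<in>{1..}. f n mod int p ^ n) \<in> carrier (Zp p)"
proof -
  have "f (Suc n) mod int p ^ Suc n mod int p ^ n = f n mod int p ^ n" if "1 \<le> n" for n
    using assms(2)[OF that] by (simp add: cong_def mod_mod_cancel)
  then show ?thesis using assms(1) unfolding padic_carrier_iff by auto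
qed

lemma padic_memI':
  assumes "\<And>n. 1 \<le> n \<Longrightarrow> 0 \<le> f n" "\<And>n. 1 \<le> n \<Longrightarrow> f n < int p ^ n"
    "\<And>n. 1 \<le> n \<Longrightarrow> f (Suc n) mod int p ^ n = f n"
  shows "(\<lambda>n\<in>{1..}. f n) \<in> carrier (Zp p)"
  using assms unfolding padic_carrier_iff by auto

lemma padic_range:
  assumes "c \<in> carrier (Zp p)" "1 \<le> n"
  shows "0 \<le> c n" "c n < int p ^ n" "c n mod int p ^ n = c n"
  using assms unfolding padic_carrier_iff by auto

lemma padic_compat:
  assumes "c \<in> carrier (Zp p)" "1 \<le> m" "m \<le> n"
  shows "c n mod int p ^ m = c m"
  using assms(3)
proof (induction n rule: dec_induct)
  case base
  show ?case using padic_range[OF assms(1,2)] by simp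
next
  case (step n)
  have "c (Suc n) mod int p ^ n mod int p ^ m = c (Suc n) mod int p ^ m"
    using step(1) by (intro mod_mod_cancel le_imp_power_dvd)
  moreover have "c (Suc n) mod int p ^ n = c n"
    using assms step(1) unfolding padic_carrier_iff by auto
  ultimately show ?case using step by simp
qed

lemma padic_ext:
  assumes "c \<in> extensional {1..}" "d \<in> extensional {1..}" "\<And>n. 1 \<le> n \<Longrightarrow> c n = (d n :: int)"
  shows "c = d"
  using extensionalityI[OF assms(1,2)] assms(3) by auto

text \<open>Inverses modulo each p^n exist by coprimality, and they are compatible because an
  inverse modulo p^n is unique.\<close>

lemma padic_unit:
  assumes p: "Factorial_Ring.prime p" and u: "u \<in> carrier (Zp p)" "u 1 \<noteq> 0"
  obtains v where "v \<in> carrier (Zp p)" "u \<otimes>\<^bsub>Zp p\<^esub> v = \<one>\<^bsub>Zp p\<^esub>"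
proof -
  have p1: "1 < p" using p prime_gt_1_nat by blast
  have co: "coprime (u i) (int p ^ i)" if "1 \<le> i" for i
  proof -
    have "u i mod int p ^ 1 = u 1" by (rule padic_compat[OF u(1) _ that]) simp
    then have "\<not> int p dvd u i" using u(2) by auto
    then have "coprime (int p) (u i)" using p by (intro prime_imp_coprime) auto
    then show ?thesis by (simp add: coprime_commute)
  qed
  have "\<forall>i. \<exists>x. 1 \<le> i \<longrightarrow> [u i * x = 1] (mod int p ^ i)"
    using cong_solve_coprime_int co by blast
  then obtain x where x: "\<And>i. 1 \<le> i \<Longrightarrow> [u i * x i = 1] (mod int p ^ i)" by metis
  define v where "v = (\<lambda>n\<in>{1..}. x n mod int p ^ n)"
  have "v \<in> carrier (Zp p)" unfolding v_def
  proof (rule padic_memI[OF p1])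
    fix n :: nat assume n: "1 \<le> n"
    have "[u (Suc n) * x (Suc n) = 1] (mod int p ^ n)"
      using x[of "Suc n"] by (rule cong_dvd_modulus) auto
    moreover have "[u n * x (Suc n) = u (Suc n) * x (Suc n)] (mod int p ^ n)"
      using padic_compat[OF u(1) n, of "Suc n"] padic_range[OF u(1) n]
      by (intro cong_mult) (auto simp: cong_def)
    ultimately have "[u n * x (Suc n) = u n * x n] (mod int p ^ n)"
      using x[OF n] by (meson cong_sym cong_trans)
    then show "[x (Suc n) = x n] (mod int p ^ n)" using co[OF n] by (simp add: cong_mult_lcancel)
  qed
  moreover have "u \<otimes>\<^bsub>Zp p\<^esub> v = \<one>\<^bsub>Zp p\<^esub>"
  proof (rule padic_ext)
    fix n :: nat assume n: "1 \<le> n"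
    have "1 < int p ^ n" using p1 n by (intro one_less_power) auto
    then show "(u \<otimes>\<^bsub>Zp p\<^esub> v) n = \<one>\<^bsub>Zp p\<^esub> n"
      using x[OF n] n by (simp add: padic_ops v_def cong_def mod_mult_right_eq)
  qed (auto simp: padic_ops)
  ultimately show ?thesis using that by blast
qed

lemma padic_decompose:
  assumes p: "Factorial_Ring.prime p" and c: "c \<in> carrier (Zp p)" "c \<noteq> \<zero>\<^bsub>Zp p\<^esub>"
  obtains j u v where "u \<in> carrier (Zp p)" "v \<in> carrier (Zp p)"
    "c = padic p (int p ^ j) \<otimes>\<^bsub>Zp p\<^esub> u"
    "u \<otimes>\<^bsub>Zp p\<^esub> v = \<one>\<^bsub>Zp p\<^esub>"
proof -
  have p1: "1 < p" using p prime_gt_1_nat by blast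
  have "\<exists>n. c (Suc n) \<noteq> 0"
  proof (rule ccontr)
    assume "\<nexists>n. c (Suc n) \<noteq> 0"
    then have "c n = 0" if "1 \<le> n" for n using that by (cases n) auto
    then have "c = \<zero>\<^bsub>Zp p\<^esub>"
      using c(1) by (intro padic_ext) (auto simp: padic_ops padic_carrier_iff)
    then show False using c(2) by blast
  qed
  \<comment> \<open>The p-adic valuation of \<open>c\<close>: component \<open>Suc j\<close> is the
    first nonzero one, so the components from there on are divisible by p^j.\<close>
  define j where "j = (LEAST n. c (Suc n) \<noteq> 0)"
  have j: "c (Suc j) \<noteq> 0" unfolding j_def using \<open>\<exists>n. c (Suc n) \<noteq> 0\<close> by (rule LeastI_ex)
  have dv: "int p ^ j dvd c (i + j)" if "1 \<le> i" for i
  proof (cases j)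
    case (Suc k)
    then have "c j = 0" using not_less_Least[of k "\<lambda>n. c (Suc n) \<noteq> 0"] unfolding j_def[symmetric] by auto
    then show ?thesis using padic_compat[OF c(1), of j "i + j"] Suc by auto
  qed simp
  have pj: "0 < int p ^ j" for j using p1 by simp
  \<comment> \<open>Division by p^j costs j digits of precision, so component i of the quotient
    comes from component i + j of \<open>c\<close>.\<close>
  define u where "u = (\<lambda>i\<in>{1..}. c (i + j) div int p ^ j)"
  have uu: "c (i + j) = int p ^ j * u i" if "1 \<le> i" for i using dv[OF that] that by (simp add: u_def)
  have u: "u \<in> carrier (Zp p)" unfolding u_def
  proof (rule padic_memI')
    fix n :: nat assume n: "1 \<le> n"
    have r: "0 \<le> c (n + j)" "c (n + j) < int p ^ n * int p ^ j" using padic_range[OF c(1), of "n + j"] n by (auto simp: power_add)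
    show "0 \<le> c (n + j) div int p ^ j" using r pj by (simp add: pos_imp_zdiv_nonneg_iff)
    show "c (n + j) div int p ^ j < int p ^ n" using r pj by (intro int_div_less)
    have "int p ^ j * u (Suc n) mod (int p ^ j * int p ^ n) = int p ^ j * u n"
      using padic_compat[OF c(1), of "n + j" "Suc n + j"] n uu[of n] uu[of "Suc n"] by (simp add: power_add mult.commute)
    then have "u (Suc n) mod int p ^ n = u n" using p1 by (simp add: mult_mod_right[symmetric])
    then show "c (Suc n + j) div int p ^ j mod int p ^ n = c (n + j) div int p ^ j" using n by (simp add: u_def)
  qed
  have "u 1 \<noteq> 0" using uu[of 1] j by auto
  then obtain v where v: "v \<in> carrier (Zp p)" "u \<otimes>\<^bsub>Zp p\<^esub> v = \<one>\<^bsub>Zp p\<^esub>"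
    using padic_unit[OF p u] by blast
  have "c = padic p (int p ^ j) \<otimes>\<^bsub>Zp p\<^esub> u"
  proof (rule padic_ext)
    fix n :: nat assume n: "1 \<le> n"
    have "c n = c (n + j) mod int p ^ n" using padic_compat[OF c(1) n, of "n + j"] by simp
    then show "c n = (padic p (int p ^ j) \<otimes>\<^bsub>Zp p\<^esub> u) n"
      using uu[OF n] n by (simp add: padic_ops padic_def mod_mult_left_eq)
  qed (use c in \<open>auto simp: padic_ops padic_carrier_iff\<close>)
  then show ?thesis using that[OF u v(1) _ v(2)] by blast
qed

lemma padic_residue:
  assumes p: "1 < p" and c: "c \<in> carrier (Zp p)"
  obtains i d where "i < p" "d \<in> carrier (Zp p)"
    "c = padic p (int i) \<oplus>\<^bsub>Zp p\<^esub> (padic p (int p) \<otimes>\<^bsub>Zp p\<^esub> d)"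
proof -
  \<comment> \<open>Division by p costs one digit, hence the component \<open>Suc n\<close>; the
    remainder is the first component \<open>c 1\<close>.\<close>
  define d where "d = (\<lambda>n\<in>{1..}. c (Suc n) div int p)"
  have p0: "0 < int p" using p by simp
  have d: "d \<in> carrier (Zp p)" unfolding d_def
  proof (rule padic_memI')
    fix n :: nat assume n: "1 \<le> n"
    have r: "0 \<le> c (Suc n)" "c (Suc n) < int p ^ n * int p" using padic_range[OF c, of "Suc n"] n by (auto simp: mult.commute)
    show "0 \<le> c (Suc n) div int p" using r p0 by (simp add: pos_imp_zdiv_nonneg_iff)
    show "c (Suc n) div int p < int p ^ n" using r p0 by (intro int_div_less)
    have "c (Suc n) = c (Suc (Suc n)) mod (int p * int p ^ n)"
      using padic_compat[OF c, of "Suc n" "Suc (Suc n)"] by simp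
    also have "\<dots> = int p * (c (Suc (Suc n)) div int p mod int p ^ n) + c (Suc (Suc n)) mod int p"
      by (rule zmod_zmult2_eq) simp
    finally show "c (Suc (Suc n)) div int p mod int p ^ n = c (Suc n) div int p" using p0 by simp
  qed
  have r1: "0 \<le> c 1" "c 1 < int p" using padic_range[OF c, of 1] by auto
  have "c = padic p (int (nat (c 1))) \<oplus>\<^bsub>Zp p\<^esub> (padic p (int p) \<otimes>\<^bsub>Zp p\<^esub> d)"
  proof (rule padic_ext)
    fix n :: nat assume n: "1 \<le> n"
    have "c (Suc n) mod int p = c 1" using padic_compat[OF c, of 1 "Suc n"] by simp
    then have "c (Suc n) = c 1 + int p * (c (Suc n) div int p)" by (metis mod_mult_div_eq)
    moreover have "c n = c (Suc n) mod int p ^ n" using padic_compat[OF c n, of "Suc n"] by simp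
    ultimately have "c n = (c 1 + int p * d n) mod int p ^ n" using n by (simp add: d_def)
    then show "c n = (padic p (int (nat (c 1))) \<oplus>\<^bsub>Zp p\<^esub> (padic p (int p) \<otimes>\<^bsub>Zp p\<^esub> d)) n"
      using n r1 by (simp add: padic_ops padic_def mod_mult_left_eq mod_add_eq)
  qed (use c in \<open>auto simp: padic_ops padic_carrier_iff\<close>)
  moreover have "nat (c 1) < p" using r1 by linarith
  ultimately show ?thesis using that d by blast
qed

lemma padic_mem: "1 < p \<Longrightarrow> padic p k \<in> carrier (Zp p)"
  unfolding padic_def by (intro padic_memI) auto

lemma padic_simps:
  assumes "1 < p"
  shows "padic p 0 = \<zero>\<^bsub>Zp p\<^esub>" "padic p 1 = \<one>\<^bsub>Zp p\<^esub>"
    "padic p (a + b) = padic p a \<oplus>\<^bsub>Zp p\<^esub> padic p b"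
    "padic p (a * b) = padic p a \<otimes>\<^bsub>Zp p\<^esub> padic p b"
proof -
  have "1 < int p ^ n" if "1 \<le> n" for n using assms that by (intro one_less_power) auto
  then show "padic p 1 = \<one>\<^bsub>Zp p\<^esub>"
    by (intro padic_ext) (auto simp: padic_def padic_ops)
qed (intro padic_ext; auto simp: padic_def padic_ops mod_mult_eq mod_add_eq)+

lemma padic_neg:
  assumes "1 < p" "c \<in> carrier (Zp p)"
  obtains d where "d \<in> carrier (Zp p)" "c \<oplus>\<^bsub>Zp p\<^esub> d = \<zero>\<^bsub>Zp p\<^esub>"
proof
  show "(\<lambda>n\<in>{1..}. (- c n) mod int p ^ n) \<in> carrier (Zp p)"
  proof (rule padic_memI[OF assms(1)])
    fix n :: nat assume n: "1 \<le> n"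
    then show "[- c (Suc n) = - c n] (mod int p ^ n)"
      using padic_compat[OF assms(2) n, of "Suc n"] padic_range[OF assms(2) n]
      by (intro cong_uminus) (simp add: cong_def)
  qed
  show "c \<oplus>\<^bsub>Zp p\<^esub> (\<lambda>n\<in>{1..}. (- c n) mod int p ^ n) = \<zero>\<^bsub>Zp p\<^esub>"
    by (intro padic_ext) (auto simp: padic_ops mod_add_right_eq)
qed

lemma padic_closed:
  assumes "1 < p" "c \<in> carrier (Zp p)" "d \<in> carrier (Zp p)"
  shows "c \<oplus>\<^bsub>Zp p\<^esub> d \<in> carrier (Zp p)"
    "c \<otimes>\<^bsub>Zp p\<^esub> d \<in> carrier (Zp p)"
proof -
  have "[c (Suc n) = c n] (mod int p ^ n)" "[d (Suc n) = d n] (mod int p ^ n)" if n: "1 \<le> n" for n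
    using padic_compat[OF assms(2) n, of "Suc n"] padic_compat[OF assms(3) n, of "Suc n"]
      padic_range[OF assms(2) n] padic_range[OF assms(3) n] by (auto simp: cong_def)
  then show "c \<oplus>\<^bsub>Zp p\<^esub> d \<in> carrier (Zp p)"
    "c \<otimes>\<^bsub>Zp p\<^esub> d \<in> carrier (Zp p)"
    unfolding padic_ops using assms(1) by (intro padic_memI cong_add cong_mult; blast)+
qed

section \<open>The copy of the p-adic integers inside the field\<close>

locale padic_subring = field E for E :: "('a, 'm) ring_scheme" (structure) +
  fixes \<iota> :: "(nat \<Rightarrow> int) \<Rightarrow> 'a" and p :: nat
  assumes prime_p: "Factorial_Ring.prime p"
    and embedding: "\<iota> \<in> ring_hom (Zp p) E" "inj_on \<iota> (carrier (Zp p))"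
begin

abbreviation W where "W \<equiv> \<iota> ` carrier (Zp p)"
abbreviation P where "P \<equiv> [p] \<cdot> \<one>"

lemma p1: "1 < p" using prime_p prime_gt_1_nat by blast

lemma W_carrier: "w \<in> W \<Longrightarrow> w \<in> carrier E"
  using ring_hom_memE(1)[OF embedding(1)] by auto

lemma W_add: "v \<in> W \<Longrightarrow> w \<in> W \<Longrightarrow> v \<oplus> w \<in> W"
  using padic_closed(1)[OF p1] by (auto simp: ring_hom_memE(3)[OF embedding(1), symmetric])

lemma W_mult: "v \<in> W \<Longrightarrow> w \<in> W \<Longrightarrow> v \<otimes> w \<in> W"
  using padic_closed(2)[OF p1] by (auto simp: ring_hom_memE(2)[OF embedding(1), symmetric])

lemma embed_zero: "\<iota> \<zero>\<^bsub>Zp p\<^esub> = \<zero>"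
proof -
  have z: "\<zero>\<^bsub>Zp p\<^esub> \<in> carrier (Zp p)"
    using padic_mem[OF p1, of 0] padic_simps(1)[OF p1] by simp
  have "\<zero>\<^bsub>Zp p\<^esub> \<oplus>\<^bsub>Zp p\<^esub> \<zero>\<^bsub>Zp p\<^esub> = \<zero>\<^bsub>Zp p\<^esub>"
    by (intro padic_ext) (auto simp: padic_ops)
  then have "\<iota> \<zero>\<^bsub>Zp p\<^esub> \<oplus> \<iota> \<zero>\<^bsub>Zp p\<^esub> = \<iota> \<zero>\<^bsub>Zp p\<^esub>"
    using ring_hom_memE(3)[OF embedding(1) z z] by simp
  then show ?thesis using W_carrier z by (metis image_eqI add.l_cancel_one)
qed

lemma W_uminus: assumes "w \<in> W" shows "\<ominus> w \<in> W"
proof -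
  obtain c where c: "c \<in> carrier (Zp p)" "w = \<iota> c" using assms by auto
  obtain d where d: "d \<in> carrier (Zp p)" "c \<oplus>\<^bsub>Zp p\<^esub> d = \<zero>\<^bsub>Zp p\<^esub>"
    using padic_neg[OF p1 c(1)] by blast
  have "w \<oplus> \<iota> d = \<zero>" using ring_hom_memE(3)[OF embedding(1) c(1) d(1)] d(2) embed_zero c(2) by simp
  then have "\<ominus> w = \<iota> d" using assms W_carrier d(1) by (metis image_eqI add.m_comm minus_equality)
  then show ?thesis using d(1) by simp
qed

lemma embed_nat: "\<iota> (padic p (int k)) = [k] \<cdot> \<one>"
proof (induction k)
  case 0
  show ?case using embed_zero padic_simps(1)[OF p1] by simp
next
  case (Suc k)
  have "padic p (int (Suc k)) = padic p (int k) \<oplus>\<^bsub>Zp p\<^esub> \<one>\<^bsub>Zp p\<^esub>"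
    using padic_simps(3)[OF p1, of "int k" 1] padic_simps(2)[OF p1] by (simp add: add.commute)
  moreover have "\<one>\<^bsub>Zp p\<^esub> \<in> carrier (Zp p)"
    using padic_mem[OF p1, of 1] padic_simps(2)[OF p1] by simp
  ultimately show ?case
    using ring_hom_memE(3)[OF embedding(1) padic_mem[OF p1]] ring_hom_memE(4)[OF embedding(1)] Suc
    by (simp add: add.nat_pow_Suc)
qed

lemma W_nat: "[(k::nat)] \<cdot> \<one> \<in> W"
  using embed_nat[of k] padic_mem[OF p1] by (metis image_eqI)

lemma W_one: "\<one> \<in> W" using W_nat[of 1] by simp

lemma W_zero: "\<zero> \<in> W" using W_nat[of 0] by simp

lemma P_carrier [simp]: "P \<in> carrier E" by (rule W_carrier[OF W_nat])

lemma P_nz [simp]: "P \<noteq> \<zero>"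
proof
  assume "P = \<zero>"
  then have "\<iota> (padic p (int p)) = \<iota> (padic p 0)"
    using embed_nat[of p] embed_zero padic_simps(1)[OF p1] by simp
  then have "padic p (int p) = padic p 0"
    using inj_onD[OF embedding(2)] padic_mem[OF p1] by blast
  then have "padic p (int p) 2 = padic p 0 2" by simp
  moreover have "int p mod (int p)\<^sup>2 = int p" using p1 by (intro mod_pos_pos_trivial) (auto simp: power2_eq_square)
  ultimately show False using p1 by (simp add: padic_def)
qed

text \<open>The first component of a multiple of p is 0, while that of the unit element is
  1.\<close>

lemma P_not_unit: "w \<in> W \<Longrightarrow> P \<otimes> w \<noteq> \<one>"
proof
  assume "w \<in> W" "P \<otimes> w = \<one>"
  then obtain c where c: "c \<in> carrier (Zp p)" "w = \<iota> c" by auto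
  have "\<one>\<^bsub>Zp p\<^esub> \<in> carrier (Zp p)"
    using padic_mem[OF p1, of 1] padic_simps(2)[OF p1] by simp
  moreover have "\<iota> (padic p (int p) \<otimes>\<^bsub>Zp p\<^esub> c) = \<iota> \<one>\<^bsub>Zp p\<^esub>"
    using ring_hom_memE(2)[OF embedding(1) padic_mem[OF p1] c(1)] embed_nat[of p] c(2)
      \<open>P \<otimes> w = \<one>\<close> ring_hom_memE(4)[OF embedding(1)] by simp
  ultimately have "padic p (int p) \<otimes>\<^bsub>Zp p\<^esub> c = \<one>\<^bsub>Zp p\<^esub>"
    using inj_onD[OF embedding(2)] padic_closed(2)[OF p1 padic_mem[OF p1] c(1)] by blast
  then have "(padic p (int p) \<otimes>\<^bsub>Zp p\<^esub> c) 1 = \<one>\<^bsub>Zp p\<^esub> 1" by simp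
  then show False by (simp add: padic_ops padic_def)
qed

lemma embed_P_pow: "\<iota> (padic p (int p ^ j)) = P [^] j"
proof (induction j)
  case 0
  show ?case using W_one ring_hom_memE(4)[OF embedding(1)] padic_simps(2)[OF p1] by simp
next
  case (Suc j)
  have "padic p (int p ^ Suc j) = padic p (int p ^ j) \<otimes>\<^bsub>Zp p\<^esub> padic p (int p)"
    using padic_simps(4)[OF p1, of "int p ^ j" "int p"] by (simp add: mult.commute)
  then show ?case
    using ring_hom_memE(2)[OF embedding(1) padic_mem[OF p1] padic_mem[OF p1]] Suc embed_nat[of p] by simp
qed

lemma W_decompose:
  assumes "w \<in> W" "w \<noteq> \<zero>"
  obtains j :: nat and u where "u \<in> W" "inv u \<in> W" "u \<noteq> \<zero>" "w = P [^] j \<otimes> u"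
proof -
  obtain c where c: "c \<in> carrier (Zp p)" "w = \<iota> c" using assms by auto
  have "c \<noteq> \<zero>\<^bsub>Zp p\<^esub>" using assms c embed_zero by auto
  then obtain j u v where u: "u \<in> carrier (Zp p)" "v \<in> carrier (Zp p)"
    "c = padic p (int p ^ j) \<otimes>\<^bsub>Zp p\<^esub> u" "u \<otimes>\<^bsub>Zp p\<^esub> v = \<one>\<^bsub>Zp p\<^esub>"
    using padic_decompose[OF prime_p c(1)] by blast
  have "w = P [^] j \<otimes> \<iota> u"
    using c(2) u(3) ring_hom_memE(2)[OF embedding(1) padic_mem[OF p1] u(1)] embed_P_pow by simp
  moreover have e: "\<iota> u \<otimes> \<iota> v = \<one>" using ring_hom_memE(2)[OF embedding(1) u(1,2)] u(4) ring_hom_memE(4)[OF embedding(1)] by simp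
  moreover have cc: "\<iota> u \<in> carrier E" "\<iota> v \<in> carrier E" using W_carrier u by auto
  moreover have "inv (\<iota> u) = \<iota> v" using comm_inv_char[OF cc e] .
  moreover have "\<iota> u \<noteq> \<zero>" using e cc by (metis l_null zero_not_one)
  ultimately show ?thesis using that[of "\<iota> u" j] u by auto
qed

lemma W_residue:
  assumes "w \<in> W"
  obtains i v where "i < p" "v \<in> W" "w = [i] \<cdot> \<one> \<oplus> P \<otimes> v"
proof -
  obtain c where c: "c \<in> carrier (Zp p)" "w = \<iota> c" using assms by auto
  obtain i d where d: "i < p" "d \<in> carrier (Zp p)"
    "c = padic p (int i) \<oplus>\<^bsub>Zp p\<^esub> (padic p (int p) \<otimes>\<^bsub>Zp p\<^esub> d)"
    using padic_residue[OF p1 c(1)] by blast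
  have "w = [i] \<cdot> \<one> \<oplus> P \<otimes> \<iota> d"
    using c(2) d(3) ring_hom_memE(2)[OF embedding(1) padic_mem[OF p1] d(2), of "int p"]
      ring_hom_memE(3)[OF embedding(1) padic_mem[OF p1] padic_closed(2)[OF p1 padic_mem[OF p1] d(2)], of "int i" "int p"]
      embed_nat by simp
  then show ?thesis using that d by blast
qed

end

section \<open>Rings of integers\<close>

locale local_field = padic_subring E \<iota> p for E :: "('a, 'm) ring_scheme" (structure) and \<iota> p +
  fixes L :: "'a set" and \<pi> :: 'a
  assumes extension: "finite_extension_of_Qp p E L \<iota>"
    and uniformizer_pi: "uniformizer (E\<lparr>carrier := integral_closure E W L\<rparr>) \<pi>"
begin

abbreviation oL where "oL \<equiv> integral_closure E W L"

lemma subfield_L: "subfield L E" using extension unfolding finite_extension_of_Qp_def by blast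

lemma L_carrier: "x \<in> L \<Longrightarrow> x \<in> carrier E" using subfieldE(3)[OF subfield_L] by blast

lemma W_L: "w \<in> W \<Longrightarrow> w \<in> L" using extension unfolding finite_extension_of_Qp_def by blast

lemma oL_L: "x \<in> oL \<Longrightarrow> x \<in> L" by (simp add: integral_closure_def)

lemma oL_carrier [simp]: "x \<in> oL \<Longrightarrow> x \<in> carrier E" using oL_L L_carrier by blast

lemma W_oL: assumes "w \<in> W" shows "w \<in> oL"
proof -
  have "set [\<ominus> w] \<subseteq> W" "eval (\<one> # [\<ominus> w]) w = \<zero>" using assms W_uminus W_carrier[OF assms] by (auto simp: r_neg)
  then show ?thesis using W_L[OF assms] unfolding integral_closure_def by blast
qed

text \<open>The hypothesis on the uniformizer speaks of a maximal ideal, and this notion includes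
  that the ambient structure is a ring. All closure properties of \<open>oL\<close> are read off
  from here.\<close>

lemma ring_oL: "ring (E\<lparr>carrier := oL\<rparr>)"
  using uniformizer_pi unfolding uniformizer_def
  by (meson ideal.axioms(2) maximalideal.axioms(1))

lemma oL_closed [simp]:
  "\<zero> \<in> oL" "\<one> \<in> oL" "x \<in> oL \<Longrightarrow> y \<in> oL \<Longrightarrow> x \<oplus> y \<in> oL" "x \<in> oL \<Longrightarrow> y \<in> oL \<Longrightarrow> x \<otimes> y \<in> oL"
  "x \<in> oL \<Longrightarrow> \<ominus> x \<in> oL"
proof -
  interpret R: ring "E\<lparr>carrier := oL\<rparr>" by (rule ring_oL)
  show "\<zero> \<in> oL" "\<one> \<in> oL" using R.zero_closed R.one_closed by auto
  show "x \<in> oL \<Longrightarrow> y \<in> oL \<Longrightarrow> x \<oplus> y \<in> oL" "x \<in> oL \<Longrightarrow> y \<in> oL \<Longrightarrow> x \<otimes> y \<in> oL"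
    using R.a_closed[of x y] R.m_closed[of x y] by auto
  assume x: "x \<in> oL"
  then obtain y where y: "y \<in> oL" "y \<oplus> x = \<zero>"
    using R.a_inv_closed[of x] R.l_neg[of x] by auto
  then have "\<ominus> x = y" using x by (intro minus_equality) auto
  then show "\<ominus> x \<in> oL" using y by simp
qed

lemma subring_oL: "subring oL E" by (rule subringI) auto

lemma oL_minus [simp]: "x \<in> oL \<Longrightarrow> y \<in> oL \<Longrightarrow> x \<ominus> y \<in> oL" by (simp add: minus_eq)

lemma oL_pow [simp]: "x \<in> oL \<Longrightarrow> x [^] (n::nat) \<in> oL" by (induction n) auto

lemma oL_eval: "set cs \<subseteq> oL \<Longrightarrow> x \<in> oL \<Longrightarrow> eval cs x \<in> oL" by (induction cs) auto

lemma W_list: "set cs \<subseteq> W \<Longrightarrow> set cs \<subseteq> carrier E" using W_carrier by blast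

lemma P_oL [simp]: "P \<in> oL" by (rule W_oL[OF W_nat])

text \<open>Multiplying a monic equation of degree d for 1/p by p^d makes every term but the leading
  1 divisible by p, so p would be a unit of \<open>W\<close>.\<close>

lemma inv_P_notin: "inv P \<notin> oL"
proof
  assume "inv P \<in> oL"
  then obtain cs where cs: "set cs \<subseteq> W" "eval (\<one> # cs) (inv P) = \<zero>" unfolding integral_closure_def by blast
  have "\<exists>w\<in>W. P [^] length cs \<otimes> eval cs (inv P) = P \<otimes> w" using cs(1)
  proof (induction cs)
    case Nil
    have "P [^] length ([] :: 'a list) \<otimes> eval [] (inv P) = P \<otimes> \<zero>" by simp
    then show ?case using W_zero by blast
  next
    case (Cons a cs)
    then obtain w where w: "w \<in> W" "P [^] length cs \<otimes> eval cs (inv P) = P \<otimes> w" by auto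
    have c: "a \<in> carrier E" "w \<in> carrier E" "eval cs (inv P) \<in> carrier E"
      using Cons.prems w W_carrier by (auto intro!: eval_in_carrier)
    have "P [^] length (a # cs) \<otimes> eval (a # cs) (inv P)
      = P \<otimes> (P [^] length cs \<otimes> inv P [^] length cs \<otimes> a) \<oplus> P \<otimes> (P [^] length cs \<otimes> eval cs (inv P))"
      using c by (simp add: r_distr m_ac)
    also have "\<dots> = P \<otimes> (a \<oplus> P \<otimes> w)" unfolding w using c by (simp add: r_distr)
    finally show ?case using Cons.prems w W_nat[of p] by (intro bexI[of _ "a \<oplus> P \<otimes> w"] W_add W_mult) auto
  qed
  then obtain w where w: "w \<in> W" "P [^] length cs \<otimes> eval cs (inv P) = P \<otimes> w" by blast
  have c: "w \<in> carrier E" "eval cs (inv P) \<in> carrier E"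
    using w W_carrier W_list[OF cs(1)] by (auto intro!: eval_in_carrier)
  have "P [^] length cs \<otimes> eval (\<one> # cs) (inv P) = \<one> \<oplus> P \<otimes> w"
    using c w(2) by (simp add: r_distr)
  then have "\<one> \<oplus> P \<otimes> w = \<zero>" using cs(2) by simp
  then have "P \<otimes> \<ominus> w = \<one>" using c by (metis P_carrier m_closed minus_equality minus_minus one_closed r_minus)
  then show False using P_not_unit[OF W_uminus[OF w(1)]] by blast
qed

text \<open>A nonzero constant term of a monic equation for \<open>x\<close> is a unit times a power
  of p, and \<open>x\<close> divides it. Vanishing constant terms are stripped first; as coefficient
  lists start with the leading one, the induction runs from the end.\<close>

lemma divides_P_pow:
  assumes x: "x \<in> oL" "x \<noteq> \<zero>"
  obtains j :: nat and c where "c \<in> oL" "x \<otimes> c = P [^] j"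
proof -
  have "\<exists>j::nat. \<exists>c\<in>oL. x \<otimes> c = P [^] j" if "set cs \<subseteq> W" "eval (\<one> # cs) x = \<zero>" for cs
    using that
  proof (induction cs rule: rev_induct)
    case Nil
    then show ?case using x by simp
  next
    case (snoc w ds)
    define e where "e = eval (\<one> # ds) x"
    have c: "w \<in> carrier E" "set (\<one> # ds) \<subseteq> oL" "w \<in> W" using snoc.prems W_carrier W_oL by auto
    have e: "e \<in> oL" using oL_eval[OF c(2)] x unfolding e_def by blast
    have "eval ((\<one> # ds) @ [w]) x = e \<otimes> x \<oplus> w"
      unfolding e_def using c x by (intro eval_append_aux) auto
    then have z: "e \<otimes> x \<oplus> w = \<zero>" using snoc.prems by simp
    show ?case
    proof (cases "w = \<zero>")
      case True
      then have "e = \<zero>" using z e x integral_iff[of e x] by simp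
      then show ?thesis using snoc unfolding e_def by auto
    next
      case False
      obtain j :: nat and u where u: "u \<in> W" "inv u \<in> W" "u \<noteq> \<zero>" "w = P [^] j \<otimes> u"
        by (rule W_decompose[OF c(3) False])
      have uc: "u \<in> carrier E" using u W_carrier by blast
      have ex: "e \<otimes> x = \<ominus> w" using z e x c by (intro minus_equality[symmetric]) auto
      have "x \<otimes> (\<ominus> (inv u) \<otimes> e) = \<ominus> (inv u) \<otimes> (e \<otimes> x)"
        using e x uc u by (simp add: m_ac l_minus r_minus)
      also have "\<dots> = inv u \<otimes> (P [^] j \<otimes> u)" unfolding ex unfolding u(4) using uc u(3) by (simp add: l_minus r_minus)
      also have "\<dots> = P [^] j" using uc u(3) by (simp add: mult_cancel_simps)
      finally show ?thesis using e W_oL[OF u(2)] by (intro exI[of _ j] bexI[of _ "\<ominus> (inv u) \<otimes> e"]) auto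
    qed
  qed
  moreover obtain cs where "set cs \<subseteq> W" "eval (\<one> # cs) x = \<zero>" using x(1) unfolding integral_closure_def by blast
  ultimately show ?thesis using that by blast
qed

lemma nonunit_iff:
  assumes x: "x \<in> oL"
  shows "(\<exists>y\<in>oL. x = y \<otimes> \<pi>) \<longleftrightarrow> \<not> (x \<noteq> \<zero> \<and> inv x \<in> oL)"
proof -
  have "PIdl\<^bsub>E\<lparr>carrier := oL\<rparr>\<^esub> \<pi> = oL - Units (E\<lparr>carrier := oL\<rparr>)"
    using uniformizer_pi unfolding uniformizer_def by simp
  then have "(\<exists>y\<in>oL. x = y \<otimes> \<pi>) \<longleftrightarrow> x \<notin> Units (E\<lparr>carrier := oL\<rparr>)"
    using x unfolding cgenideal_def by auto
  also have "x \<in> Units (E\<lparr>carrier := oL\<rparr>) \<longleftrightarrow> x \<noteq> \<zero> \<and> inv x \<in> oL"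
  proof
    assume "x \<in> Units (E\<lparr>carrier := oL\<rparr>)"
    then obtain y where y: "y \<in> oL" "x \<otimes> y = \<one>" unfolding Units_def by auto
    then have "inv x = y" using x by (intro comm_inv_char) auto
    moreover have "x \<noteq> \<zero>" using y by auto
    ultimately show "x \<noteq> \<zero> \<and> inv x \<in> oL" using y by blast
  next
    assume "x \<noteq> \<zero> \<and> inv x \<in> oL"
    then show "x \<in> Units (E\<lparr>carrier := oL\<rparr>)" using x unfolding Units_def by (auto intro!: bexI[of _ "inv x"])
  qed
  finally show ?thesis by blast
qed

lemma pi_oL [simp]: "\<pi> \<in> oL" using uniformizer_pi unfolding uniformizer_def by simp

lemma pi_nz [simp]: "\<pi> \<noteq> \<zero>"
proof
  assume "\<pi> = \<zero>"
  moreover have "\<exists>y\<in>oL. P = y \<otimes> \<pi>" using nonunit_iff[OF P_oL] inv_P_notin by blast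
  ultimately show False by auto
qed

lemma inv_pi_notin: "inv \<pi> \<notin> oL"
  using nonunit_iff[OF pi_oL] pi_nz by (metis l_one oL_carrier oL_closed(2) pi_oL)

lemma nonunit: assumes "x \<in> oL" "x = \<zero> \<or> inv x \<notin> oL" shows "inv \<pi> \<otimes> x \<in> oL"
proof -
  obtain y where "y \<in> oL" "x = y \<otimes> \<pi>" using nonunit_iff assms by blast
  then show ?thesis by (simp add: mult_cancel_simps)
qed

lemma not_unit: assumes "x \<in> oL" "inv \<pi> \<otimes> x \<in> oL" "x \<noteq> \<zero>" shows "inv x \<notin> oL"
proof
  assume "inv x \<in> oL"
  from this have "(inv \<pi> \<otimes> x) \<otimes> inv x \<in> oL" by (rule oL_closed(4)[OF assms(2)])
  moreover have "(inv \<pi> \<otimes> x) \<otimes> inv x = inv \<pi>" using assms by (simp add: m_assoc)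
  ultimately show False using inv_pi_notin by metis
qed

lemma unit_plus:
  assumes "u \<in> oL" "u \<noteq> \<zero>" "inv u \<in> oL" "y \<in> oL" "inv \<pi> \<otimes> y \<in> oL"
  shows "u \<oplus> y \<noteq> \<zero>" "inv (u \<oplus> y) \<in> oL"
proof -
  have "\<not> (u \<oplus> y = \<zero> \<or> inv (u \<oplus> y) \<notin> oL)"
  proof
    assume "u \<oplus> y = \<zero> \<or> inv (u \<oplus> y) \<notin> oL"
    then have "inv \<pi> \<otimes> (u \<oplus> y) \<in> oL" using assms by (intro nonunit) auto
    then have "inv \<pi> \<otimes> (u \<oplus> y) \<ominus> inv \<pi> \<otimes> y \<in> oL" using assms by (intro oL_minus)
    then have "inv \<pi> \<otimes> u \<in> oL" using assms by (simp add: ring_norm)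
    then show False using not_unit assms by blast
  qed
  then show "u \<oplus> y \<noteq> \<zero>" "inv (u \<oplus> y) \<in> oL" by auto
qed

text \<open>In a monic equation for \<pi>, constant terms divisible by p are moved to the right-hand
  side. At the first constant term that is a unit, the remaining left-hand factor is a unit, and a
  power of \<pi> is a multiple of p; if there is none, the leading coefficient 1 takes that
  part.\<close>

lemma P_divides_pow_pi:
  obtains m :: nat and c where "c \<in> oL" "\<pi> [^] m = P \<otimes> c"
proof -
  \<comment> \<open>The factor \<pi>^k collects one \<pi> for each constant term removed, and
    \<open>c\<close> collects the multiples of p moved to the right.\<close>
  have main: "\<exists>(m::nat) c. c \<in> oL \<and> \<pi> [^] m = P \<otimes> c"
    if "set cs \<subseteq> W" "c \<in> oL" "eval (\<one> # cs) \<pi> \<otimes> \<pi> [^] k = P \<otimes> c" for cs c and k :: nat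
    using that
  proof (induction cs arbitrary: c k rule: rev_induct)
    case Nil
    then show ?case by (intro exI[of _ k] exI[of _ c]) simp
  next
    case (snoc w ds)
    define e where "e = eval (\<one> # ds) \<pi>"
    have w: "w \<in> W" and ds: "set (\<one> # ds) \<subseteq> oL" "set ds \<subseteq> W" using snoc.prems(1) W_oL by auto
    have e: "e \<in> oL" unfolding e_def by (rule oL_eval[OF ds(1) pi_oL])
    have wo: "w \<in> oL" by (rule W_oL[OF w])
    have "eval ((\<one> # ds) @ [w]) \<pi> = e \<otimes> \<pi> \<oplus> w"
      unfolding e_def using ds(1) wo by (intro eval_append_aux) auto
    then have z: "(e \<otimes> \<pi> \<oplus> w) \<otimes> \<pi> [^] k = P \<otimes> c" using snoc.prems(3) by simp
    have shift: ?case if h: "b \<in> oL" "w = P \<otimes> b" for b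
    proof (rule snoc.IH[OF ds(2)])
      show "c \<ominus> b \<otimes> \<pi> [^] k \<in> oL" using snoc.prems(2) h(1) by simp
      have "e \<otimes> \<pi> [^] Suc k = (e \<otimes> \<pi> \<oplus> w) \<otimes> \<pi> [^] k \<ominus> P \<otimes> b \<otimes> \<pi> [^] k"
        unfolding h(2) using e h(1) by (simp add: ring_norm)
      then show "eval (\<one> # ds) \<pi> \<otimes> \<pi> [^] Suc k = P \<otimes> (c \<ominus> b \<otimes> \<pi> [^] k)"
        unfolding z e_def[symmetric] using snoc.prems(2) h(1) by (simp add: ring_norm)
    qed
    show ?case
    proof (cases "w = \<zero>")
      case True
      then show ?thesis by (intro shift[OF oL_closed(1)]) simp
    next
      case False
      obtain j :: nat and u where u: "u \<in> W" "inv u \<in> W" "u \<noteq> \<zero>" "w = P [^] j \<otimes> u"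
        by (rule W_decompose[OF w False])
      have uo: "u \<in> oL" "inv u \<in> oL" using u W_oL by auto
      show ?thesis
      proof (cases j)
        case 0
        then have wu: "w = u" using u(4) uo by simp
        have "inv \<pi> \<otimes> (e \<otimes> \<pi>) = e" using e by (simp add: mult_cancel_simps)
        then have un: "u \<oplus> e \<otimes> \<pi> \<noteq> \<zero>" "inv (u \<oplus> e \<otimes> \<pi>) \<in> oL"
          using unit_plus[OF uo(1) u(3) uo(2), of "e \<otimes> \<pi>"] e by simp_all
        have c: "u \<oplus> e \<otimes> \<pi> \<in> carrier E" using e uo by simp
        have "(u \<oplus> e \<otimes> \<pi>) \<otimes> \<pi> [^] k = P \<otimes> c" using z e uo unfolding wu by (simp add: a_comm)
        then have "\<pi> [^] k = inv (u \<oplus> e \<otimes> \<pi>) \<otimes> (P \<otimes> c)"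
          using inv_l'[OF c un(1), of "\<pi> [^] k"] by simp
        also have "\<dots> = P \<otimes> (inv (u \<oplus> e \<otimes> \<pi>) \<otimes> c)" using un(2) snoc.prems(2) by (intro m_lcomm) auto
        finally show ?thesis using un(2) snoc.prems(2) by (intro exI[of _ k] exI[of _ "inv (u \<oplus> e \<otimes> \<pi>) \<otimes> c"]) simp
      next
        case (Suc i)
        have "w = P \<otimes> (P [^] i \<otimes> u)" using uo unfolding u(4) Suc by (simp add: m_ac)
        moreover have "P [^] i \<otimes> u \<in> oL" using uo by simp
        ultimately show ?thesis by (intro shift)
      qed
    qed
  qed
  obtain cs where cs: "set cs \<subseteq> W" "eval (\<one> # cs) \<pi> = \<zero>"
    using pi_oL unfolding integral_closure_def by blast
  have "eval (\<one> # cs) \<pi> \<otimes> \<pi> [^] (0::nat) = P \<otimes> \<zero>" unfolding cs(2) by simp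
  then obtain m :: nat and c where "c \<in> oL" "\<pi> [^] m = P \<otimes> c"
    using main[OF cs(1) oL_closed(1)] by blast
  then show ?thesis by (rule that)
qed

lemma P_pow_divides_pow_pi:
  obtains m :: nat and c where "c \<in> oL" "\<pi> [^] m = P [^] (j::nat) \<otimes> c"
proof -
  obtain m :: nat and c where c: "c \<in> oL" "\<pi> [^] m = P \<otimes> c" by (rule P_divides_pow_pi)
  have "\<pi> [^] (m * j) = P [^] j \<otimes> c [^] j"
    using c nat_pow_distrib[of P c j] by (simp add: nat_pow_pow[symmetric])
  then show ?thesis using that[of "c [^] j" "m * j"] c(1) by simp
qed

text \<open>Some multiple of \<open>x\<close> is p^j and some \<pi>^m is a multiple of p^(j+1), so
  divisibility of \<open>x\<close> by all powers of \<pi> would make p a unit. Dividing by \<pi> as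
  often as possible leaves an element outside \<pi>oL, hence a unit.\<close>

lemma factor:
  assumes x: "x \<in> oL" "x \<noteq> \<zero>"
  shows "\<exists>(j::nat) u. u \<in> oL \<and> inv u \<in> oL \<and> x = \<pi> [^] j \<otimes> u"
proof -
  have xc: "x \<in> carrier E" using x by simp
  have "\<exists>j::nat. inv \<pi> [^] Suc j \<otimes> x \<notin> oL"
  proof (rule ccontr)
    assume "\<nexists>j::nat. inv \<pi> [^] Suc j \<otimes> x \<notin> oL"
    then have all: "inv \<pi> [^] i \<otimes> x \<in> oL" for i :: nat using x(1) by (cases i) auto
    obtain j :: nat and c where c: "c \<in> oL" "x \<otimes> c = P [^] j" using divides_P_pow[OF x] by blast
    obtain m :: nat and d where d: "d \<in> oL" "\<pi> [^] m = P [^] Suc j \<otimes> d" by (rule P_pow_divides_pow_pi[of "Suc j"])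
    let ?y = "inv \<pi> [^] m \<otimes> x \<otimes> c \<otimes> d"
    have y: "?y \<in> oL" using all c d by simp
    have nz: "\<pi> [^] m \<noteq> \<zero>" by simp
    have "\<pi> [^] m \<otimes> ?y = (x \<otimes> c) \<otimes> d" using xc c(1) d(1) by (simp add: m_ac mult_cancel_simps)
    then have "P \<otimes> (\<pi> [^] m \<otimes> ?y) = P [^] Suc j \<otimes> d" using d(1) unfolding c(2) by (simp add: m_ac)
    then have "P \<otimes> (\<pi> [^] m \<otimes> ?y) = \<pi> [^] m" using d(2) by simp
    moreover have "P \<otimes> (\<pi> [^] m \<otimes> ?y) = \<pi> [^] m \<otimes> (P \<otimes> ?y)" using y xc c d by (intro m_lcomm) auto
    ultimately have "\<pi> [^] m \<otimes> (P \<otimes> ?y) = \<pi> [^] m \<otimes> \<one>" by simp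
    then have "P \<otimes> ?y = \<one>" using nz y by (subst (asm) m_lcancel) auto
    then have "inv P = ?y" using y by (intro comm_inv_char) auto
    then show False using inv_P_notin y by simp
  qed
  define j where "j = (LEAST j. inv \<pi> [^] Suc j \<otimes> x \<notin> oL)"
  have j: "inv \<pi> [^] Suc j \<otimes> x \<notin> oL" unfolding j_def using \<open>\<exists>j::nat. inv \<pi> [^] Suc j \<otimes> x \<notin> oL\<close> by (rule LeastI_ex)
  have u: "inv \<pi> [^] j \<otimes> x \<in> oL"
  proof (cases j)
    case (Suc i)
    then show ?thesis using not_less_Least[of i "\<lambda>j. inv \<pi> [^] Suc j \<otimes> x \<notin> oL"] unfolding j_def[symmetric] by auto
  qed (use x in simp)
  have "inv \<pi> \<otimes> (inv \<pi> [^] j \<otimes> x) = inv \<pi> [^] Suc j \<otimes> x" using xc by (simp add: m_ac)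
  then have "inv (inv \<pi> [^] j \<otimes> x) \<in> oL" using nonunit[OF u] j by auto
  then show ?thesis using u xc by (intro exI[of _ j] exI[of _ "inv \<pi> [^] j \<otimes> x"]) auto
qed

section \<open>Denominators over the copy of the p-adic field\<close>

abbreviation K0 where "K0 \<equiv> generate_field E W"

lemma subfield_K0: "subfield K0 E"
  by (rule generate_field_is_subfield) (use W_carrier in blast)

lemma K0_carrier: "x \<in> K0 \<Longrightarrow> x \<in> carrier E" using subfieldE(3)[OF subfield_K0] by blast

lemma K0_denominator: "s \<in> K0 \<Longrightarrow> \<exists>r\<in>W. r \<noteq> \<zero> \<and> r \<otimes> s \<in> W"
proof (induction rule: generate_field.induct)
  case one
  show ?case using W_one by (intro bexI[of _ \<one>]) auto
next
  case (incl h)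
  then show ?case using W_one W_carrier by (intro bexI[of _ \<one>]) auto
next
  case (a_inv h)
  then obtain r where r: "r \<in> W" "r \<noteq> \<zero>" "r \<otimes> h \<in> W" by blast
  have "r \<otimes> \<ominus> h = \<ominus> (r \<otimes> h)" using r W_carrier K0_carrier[OF a_inv.hyps] by (simp add: r_minus)
  then show ?case using r W_uminus by (intro bexI[of _ r]) auto
next
  case (m_inv h)
  then obtain r where r: "r \<in> W" "r \<noteq> \<zero>" "r \<otimes> h \<in> W" by blast
  have c: "r \<in> carrier E" "h \<in> carrier E" using r W_carrier K0_carrier m_inv.hyps(1) by auto
  have "r \<otimes> h \<otimes> inv h = r" using c m_inv.hyps by (simp add: m_assoc)
  moreover have "r \<otimes> h \<noteq> \<zero>" using c r m_inv.hyps by (simp add: integral_iff)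
  ultimately show ?case using r by (intro bexI[of _ "r \<otimes> h"]) auto
next
  case (eng_add h1 h2)
  then obtain r s where r: "r \<in> W" "r \<noteq> \<zero>" "r \<otimes> h1 \<in> W" "s \<in> W" "s \<noteq> \<zero>" "s \<otimes> h2 \<in> W" by blast
  have c: "r \<in> carrier E" "h1 \<in> carrier E" "s \<in> carrier E" "h2 \<in> carrier E"
    using r W_carrier K0_carrier eng_add.hyps by auto
  have "r \<otimes> s \<otimes> (h1 \<oplus> h2) = s \<otimes> (r \<otimes> h1) \<oplus> r \<otimes> (s \<otimes> h2)" using c by (simp add: r_distr m_ac)
  moreover have "s \<otimes> (r \<otimes> h1) \<oplus> r \<otimes> (s \<otimes> h2) \<in> W" by (rule W_add[OF W_mult[OF r(4,3)] W_mult[OF r(1,6)]])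
  moreover have "r \<otimes> s \<noteq> \<zero>" using c r by (simp add: integral_iff)
  ultimately show ?case using r W_mult by (intro bexI[of _ "r \<otimes> s"]) auto
next
  case (eng_mult h1 h2)
  then obtain r s where r: "r \<in> W" "r \<noteq> \<zero>" "r \<otimes> h1 \<in> W" "s \<in> W" "s \<noteq> \<zero>" "s \<otimes> h2 \<in> W" by blast
  have c: "r \<in> carrier E" "h1 \<in> carrier E" "s \<in> carrier E" "h2 \<in> carrier E"
    using r W_carrier K0_carrier eng_mult.hyps by auto
  have "r \<otimes> s \<otimes> (h1 \<otimes> h2) = (r \<otimes> h1) \<otimes> (s \<otimes> h2)" using c by (simp add: m_ac)
  moreover have "(r \<otimes> h1) \<otimes> (s \<otimes> h2) \<in> W" by (rule W_mult[OF r(3,6)])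
  moreover have "r \<otimes> s \<noteq> \<zero>" using c r by (simp add: integral_iff)
  ultimately show ?case using r W_mult by (intro bexI[of _ "r \<otimes> s"]) auto
qed

lemma K0_common_denominator:
  assumes "set q \<subseteq> K0"
  obtains r where "r \<in> W" "r \<noteq> \<zero>" "\<And>s. s \<in> set q \<Longrightarrow> r \<otimes> s \<in> W"
proof -
  have "\<exists>r\<in>W. r \<noteq> \<zero> \<and> (\<forall>s\<in>set q. r \<otimes> s \<in> W)" using assms
  proof (induction q)
    case Nil
    show ?case using W_one by (intro bexI[of _ \<one>]) auto
  next
    case (Cons a q)
    then obtain r where r: "r \<in> W" "r \<noteq> \<zero>" "\<forall>s\<in>set q. r \<otimes> s \<in> W" by auto
    have "a \<in> K0" using Cons.prems by simp
    then obtain t where t: "t \<in> W" "t \<noteq> \<zero>" "t \<otimes> a \<in> W" by (blast dest: K0_denominator)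
    have c: "r \<in> carrier E" "t \<in> carrier E" "a \<in> carrier E" using r t W_carrier K0_carrier Cons.prems by auto
    have "r \<otimes> t \<otimes> s \<in> W" if s: "s \<in> set (a # q)" for s
    proof (cases "s = a")
      case True
      then show ?thesis using W_mult[OF r(1) t(3)] c by (simp add: m_assoc)
    next
      case False
      then have "s \<in> set q" "s \<in> carrier E" using s K0_carrier Cons.prems by auto
      then show ?thesis using W_mult[OF t(1), of "r \<otimes> s"] r c by (simp add: m_ac)
    qed
    moreover have "r \<otimes> t \<noteq> \<zero>" using c r t by (simp add: integral_iff)
    ultimately show ?case using r t W_mult by (intro bexI[of _ "r \<otimes> t"]) auto
  qed
  then show ?thesis using that by blast
qed

lemma eval_scale:
  assumes "set q \<subseteq> carrier E" "x \<in> carrier E" "b \<in> carrier E"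
  shows "eval (map ((\<otimes>) b) q) x = b \<otimes> eval q x"
  using assms(1)
proof (induction q)
  case (Cons a q)
  then show ?case using assms(2,3) eval_in_carrier[of q x] by (simp add: r_distr m_assoc)
qed (use assms in simp)

text \<open>After clearing denominators in an algebraic equation for \<open>x\<close>,
  multiplication of \<open>x\<close> by its leading coefficient b gives an integral element.\<close>

lemma integral_multiple:
  assumes x: "x \<in> L"
  obtains b where "b \<in> W" "b \<noteq> \<zero>" "b \<otimes> x \<in> oL"
proof -
  have xc: "x \<in> carrier E" using x L_carrier by blast
  have "finite_dimension K0 L" using extension unfolding finite_extension_of_Qp_def by blast
  then have "(algebraic over K0) x"
    using finite_dimension_imp_algebraic[OF subfield_K0 subfieldE(1)[OF subfield_L] _ x] by blast
  then obtain f where f: "f \<in> carrier (K0[X])" "f \<noteq> []" "eval f x = \<zero>"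
    using algebraicE[OF subfieldE(1)[OF subfield_K0] xc] by blast
  then have ff: "set f \<subseteq> K0" "hd f \<noteq> \<zero>" by (auto simp: univ_poly_def polynomial_def)
  obtain a q where aq: "f = a # q" using f(2) by (cases f) auto
  obtain r where r: "r \<in> W" "r \<noteq> \<zero>" "\<And>s. s \<in> set f \<Longrightarrow> r \<otimes> s \<in> W" using K0_common_denominator[OF ff(1)] by blast
  have rc: "r \<in> carrier E" using r W_carrier by blast
  have ac: "a \<in> carrier E" "set q \<subseteq> carrier E" using ff K0_carrier unfolding aq by auto
  define b where "b = r \<otimes> a"
  define g where "g = map ((\<otimes>) r) q"
  have b: "b \<in> W" "b \<noteq> \<zero>" using r(1,2) r(3)[of a] ff ac rc unfolding aq b_def by (auto simp: integral_iff)
  have bc: "b \<in> carrier E" using b W_carrier by blast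
  have g: "set g \<subseteq> W" using r(3) unfolding aq g_def by auto
  have "r \<otimes> eval f x = b \<otimes> x [^] length g \<oplus> eval g x"
    using eval_scale[OF ac(2) xc rc] ac xc rc eval_in_carrier[OF ac(2) xc]
    unfolding aq b_def g_def by (simp add: r_distr m_assoc)
  then have e: "b \<otimes> x [^] length g \<oplus> eval g x = \<zero>" using f(3) rc by simp
  let ?y = "b \<otimes> x"
  have yc: "?y \<in> carrier E" using bc xc by simp
  \<comment> \<open>The list \<open>h\<close> is \<open>g\<close> with coefficients multiplied by 1,
    b, b^2, ... from the front, that is, the substitution x = y / b; the factor b on the left keeps
    the exponents nonnegative.\<close>
  have "\<exists>h. set h \<subseteq> W \<and> length h = length g \<and> b \<otimes> eval h ?y = b [^] length g \<otimes> eval g x" using g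
  proof (induction g)
    case Nil
    then show ?case using bc by simp
  next
    case (Cons c g)
    then obtain h where h: "set h \<subseteq> W" "length h = length g" "b \<otimes> eval h ?y = b [^] length g \<otimes> eval g x" by auto
    have cc: "c \<in> carrier E" "eval h ?y \<in> carrier E" "eval g x \<in> carrier E"
      using Cons.prems W_carrier W_list h(1) yc xc by (auto intro!: eval_in_carrier)
    have "b \<otimes> eval (c # map ((\<otimes>) b) h) ?y = b \<otimes> (c \<otimes> ?y [^] length g) \<oplus> b \<otimes> (b \<otimes> eval h ?y)"
      using eval_scale[OF W_list[OF h(1)] yc bc] cc yc bc h(2) by (simp add: r_distr)
    also have "\<dots> = b [^] length (c # g) \<otimes> eval (c # g) x"
      unfolding h(3) using cc bc xc by (simp add: r_distr nat_pow_distrib m_ac)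
    finally show ?case using h Cons.prems b W_mult by (intro exI[of _ "c # map ((\<otimes>) b) h"]) auto
  qed
  then obtain h where h: "set h \<subseteq> W" "length h = length g" "b \<otimes> eval h ?y = b [^] length g \<otimes> eval g x" by blast
  have hc: "eval h ?y \<in> carrier E" "eval g x \<in> carrier E" using W_list h(1) g yc xc by (auto intro!: eval_in_carrier)
  have "b \<otimes> eval (\<one> # h) ?y = b \<otimes> ?y [^] length g \<oplus> b \<otimes> eval h ?y" using h(2) hc bc yc by (simp add: r_distr)
  also have "\<dots> = b [^] length g \<otimes> (b \<otimes> x [^] length g \<oplus> eval g x)"
    unfolding h(3) using hc bc xc by (simp add: r_distr nat_pow_distrib m_ac)
  also have "\<dots> = \<zero>" unfolding e using bc by simp
  finally have "b \<otimes> eval (\<one> # h) ?y = \<zero>" .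
  moreover have "eval (\<one> # h) ?y \<in> carrier E" using hc yc by simp
  ultimately have "eval (\<one> # h) ?y = \<zero>" using b bc by (metis integral_iff)
  moreover have "?y \<in> L" using b(1) W_L x subringE(6)[OF subfieldE(1)[OF subfield_L]] by blast
  ultimately have "?y \<in> oL" using h(1) unfolding integral_closure_def by blast
  then show ?thesis using that b by blast
qed

lemma frac:
  assumes x: "x \<in> L"
  shows "\<exists>j::nat. \<pi> [^] j \<otimes> x \<in> oL"
proof -
  have xc: "x \<in> carrier E" using x L_carrier by blast
  obtain b where b: "b \<in> W" "b \<noteq> \<zero>" "b \<otimes> x \<in> oL" using integral_multiple[OF x] by blast
  obtain j :: nat and u where u: "u \<in> W" "inv u \<in> W" "u \<noteq> \<zero>" "b = P [^] j \<otimes> u" by (rule W_decompose[OF b(1,2)])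
  obtain m :: nat and c where c: "c \<in> oL" "\<pi> [^] m = P [^] j \<otimes> c" by (rule P_pow_divides_pow_pi[of j])
  have uc: "u \<in> carrier E" using u W_carrier by blast
  have "\<pi> [^] m \<otimes> x = c \<otimes> (inv u \<otimes> (b \<otimes> x))"
    unfolding c(2) u(4) using c(1) uc u(3) xc by (simp add: m_ac mult_cancel_simps)
  moreover have "c \<otimes> (inv u \<otimes> (b \<otimes> x)) \<in> oL" using c b W_oL[OF u(2)] by simp
  ultimately show ?thesis by (intro exI[of _ m]) simp
qed

lemma dvr: "dvr_field E L oL \<pi>"
  by (intro dvr_field.intro dvr_field_axioms.intro field_axioms subfield_L subring_oL
    pi_oL pi_nz inv_pi_notin factor frac) (auto intro: oL_L)

lemma P_in_pi: "inv \<pi> \<otimes> P \<in> oL" by (rule nonunit) (use inv_P_notin in auto)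

text \<open>An integral fraction with a positive power of p left in its denominator would, after
  multiplication by integral elements, put 1/p into \<open>oL\<close>.\<close>

lemma K0_integral: assumes k: "k \<in> K0" "k \<in> oL" shows "k \<in> W"
proof (cases "k = \<zero>")
  case True
  then show ?thesis using W_zero by simp
next
  case False
  have kc: "k \<in> carrier E" using k by simp
  obtain r where r: "r \<in> W" "r \<noteq> \<zero>" "r \<otimes> k \<in> W" using K0_denominator[OF k(1)] by blast
  have rc: "r \<in> carrier E" using r W_carrier by blast
  obtain j :: nat and u where u: "u \<in> W" "inv u \<in> W" "u \<noteq> \<zero>" "r = P [^] j \<otimes> u" by (rule W_decompose[OF r(1,2)])
  have "r \<otimes> k \<noteq> \<zero>" using r rc kc False by (simp add: integral_iff)
  then obtain i :: nat and v where v: "v \<in> W" "inv v \<in> W" "v \<noteq> \<zero>" "r \<otimes> k = P [^] i \<otimes> v" by (rule W_decompose[OF r(3)])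
  have uc: "u \<in> carrier E" "v \<in> carrier E" using u v W_carrier by auto
  have e: "P [^] j \<otimes> (u \<otimes> k) = P [^] i \<otimes> v" using v(4) uc kc unfolding u(4) by (simp add: m_assoc)
  show ?thesis
  proof (cases "j \<le> i")
    case True
    then obtain d where d: "i = j + d" using le_Suc_ex by blast
    have "P [^] j \<otimes> (u \<otimes> k) = P [^] j \<otimes> (P [^] d \<otimes> v)" using e uc unfolding d by (simp add: nat_pow_mult[symmetric] m_assoc)
    then have e': "u \<otimes> k = P [^] d \<otimes> v" using uc kc by (subst (asm) m_lcancel) auto
    have "k = inv u \<otimes> (u \<otimes> k)" using uc kc u(3) by simp
    also have "\<dots> = inv u \<otimes> (P [^] d \<otimes> v)" unfolding e' ..
    also have "P [^] d \<in> W" by (induction d) (use W_one W_mult W_nat[of p] in auto)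
    then have "inv u \<otimes> (P [^] d \<otimes> v) \<in> W" using u v by (intro W_mult)
    finally show ?thesis .
  next
    case False
    then obtain d where d: "j = Suc (i + d)" using less_imp_Suc_add not_le by blast
    have "P [^] i \<otimes> (P \<otimes> (P [^] d \<otimes> u \<otimes> k)) = P [^] i \<otimes> v"
      using e uc kc unfolding d by (simp add: nat_pow_mult[symmetric] m_ac)
    then have e': "P \<otimes> (P [^] d \<otimes> u \<otimes> k) = v" using uc kc by (subst (asm) m_lcancel) auto
    have "P \<otimes> (P [^] d \<otimes> u \<otimes> k \<otimes> inv v) = (P \<otimes> (P [^] d \<otimes> u \<otimes> k)) \<otimes> inv v"
      using uc kc v(3) by (simp add: m_assoc)
    also have "\<dots> = \<one>" unfolding e' using uc v(3) by simp
    finally have "inv P = P [^] d \<otimes> u \<otimes> k \<otimes> inv v" using uc kc v(3) by (intro comm_inv_char) auto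
    moreover have "P [^] d \<otimes> u \<otimes> k \<otimes> inv v \<in> oL" using k(2) W_oL u v by simp
    ultimately show ?thesis using inv_P_notin by simp
  qed
qed

end

section \<open>Finiteness of the residue field\<close>

context local_field
begin

interpretation D: dvr_field E L oL \<pi> by (rule dvr)

text \<open>The independence criterion of the vector space theory admits coefficient lists of any
  length; here they are cut or padded with zeros to the length of \<open>xs\<close>.\<close>

lemma set_take_pad:
  assumes "set Ks \<subseteq> K0" "set xs \<subseteq> carrier E" "combine Ks xs = \<zero>"
  obtains Js where "set Js \<subseteq> K0" "length Js = length xs" "combine Js xs = \<zero>"
    "set (take (length xs) Ks) \<subseteq> set Js"
proof -
  let ?Js = "take (length xs) Ks @ replicate (length xs - length Ks) \<zero>"
  have z: "\<zero> \<in> K0" using subringE(2)[OF subfieldE(1)[OF subfield_K0]] .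
  have c: "set (take (length xs) Ks) \<subseteq> K0" using assms(1) set_take_subset by force
  then have "set ?Js \<subseteq> K0" using z by auto
  moreover have "length ?Js = length xs" by simp
  moreover have "combine ?Js xs = \<zero>"
    by (simp only: combine_append_replicate[OF assms(2)] combine_take assms(3))
  moreover have "set (take (length xs) Ks) \<subseteq> set ?Js" by simp
  ultimately show ?thesis by (rule that)
qed

text \<open>Linear independence of the residues of \<open>xs\<close> over the residue field of the
  p-adic integers, expressed with lifts; by \<open>K0_integral\<close> the set
  \<open>oL \<inter> K0\<close> is \<open>W\<close>.\<close>

definition independent_mod :: "'a list \<Rightarrow> bool" where
  "independent_mod xs \<longleftrightarrow> (\<forall>Ks. set Ks \<subseteq> oL \<inter> K0 \<and> length Ks = length xs \<and> inv \<pi> \<otimes> combine Ks xs \<in> oL \<longrightarrow>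
     (\<forall>k\<in>set Ks. inv \<pi> \<otimes> k \<in> oL))"

text \<open>Dividing a nontrivial relation by a coefficient of least valuation makes all
  coefficients integral and one of them equal to 1, against independence modulo \<pi>.\<close>

lemma independent_mod_imp:
  assumes xs: "set xs \<subseteq> oL" and ind: "independent_mod xs"
  shows "independent K0 xs"
proof (rule trivial_combine_imp_independent[OF subfield_K0])
  show xc: "set xs \<subseteq> carrier E" using xs by auto
  fix Ks assume Ks: "set Ks \<subseteq> K0" "combine Ks xs = \<zero>"
  obtain Js where J: "set Js \<subseteq> K0" "length Js = length xs" "combine Js xs = \<zero>"
    "set (take (length xs) Ks) \<subseteq> set Js" using set_take_pad[OF Ks(1) xc Ks(2)] by blast
  have "set Js \<subseteq> {\<zero>}"
  proof (rule ccontr)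
    assume "\<not> set Js \<subseteq> {\<zero>}"
    then obtain k0 where k0: "k0 \<in> set Js" "k0 \<noteq> \<zero>" by blast
    obtain r where r: "r \<in> W" "r \<noteq> \<zero>" "\<And>s. s \<in> set Js \<Longrightarrow> r \<otimes> s \<in> W" using K0_common_denominator[OF J(1)] by blast
    have rc: "r \<in> carrier E" using r W_carrier by blast
    have Jc: "s \<in> carrier E" if "s \<in> set Js" for s using J(1) K0_carrier that by blast
    let ?S = "(\<lambda>s. r \<otimes> s) ` set Js"
    have S: "?S \<subseteq> oL" using r(3) W_oL by blast
    have m: "r \<otimes> k0 \<in> ?S" "r \<otimes> k0 \<noteq> \<zero>" using k0 r(2) rc Jc[OF k0(1)] by (auto simp: integral_iff)
    obtain s where s: "s \<in> ?S" "s \<noteq> \<zero>" "\<And>x. x \<in> ?S \<Longrightarrow> x \<otimes> inv s \<in> oL" by (rule D.min_val[OF S m]) blast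
    have sK: "s \<in> K0" using s(1) r(3) generate_field.incl[of _ W E] by blast
    have sc: "s \<in> carrier E" using sK K0_carrier by blast
    have iK: "inv s \<in> K0" by (rule generate_field.m_inv[OF sK s(2)])
    let ?Ls = "map (\<lambda>x. (inv s \<otimes> r) \<otimes> x) Js"
    have e: "(inv s \<otimes> r) \<otimes> x = (r \<otimes> x) \<otimes> inv s" if "x \<in> set Js" for x using Jc[OF that] rc sc s(2) by (simp add: m_ac)
    have "(inv s \<otimes> r) \<otimes> x \<in> oL" if x: "x \<in> set Js" for x unfolding e[OF x] by (rule s(3)) (use x in blast)
    moreover have "(inv s \<otimes> r) \<otimes> x \<in> K0" if x: "x \<in> set Js" for x unfolding e[OF x]
      by (rule generate_field.eng_mult[OF generate_field.incl[OF r(3)[OF x]] iK])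
    ultimately have "set ?Ls \<subseteq> oL \<inter> K0" by auto
    moreover have "length ?Ls = length xs" using J(2) by simp
    moreover have "combine ?Ls xs = \<zero>"
      using combine_r_distr[OF _ xc, of Js "inv s \<otimes> r"] Jc rc sc s(2) J(3) by (auto simp: subset_iff)
    then have "inv \<pi> \<otimes> combine ?Ls xs \<in> oL" by simp
    ultimately have al: "\<And>k. k \<in> set ?Ls \<Longrightarrow> inv \<pi> \<otimes> k \<in> oL" using ind unfolding independent_mod_def by blast
    obtain x where x: "x \<in> set Js" "s = r \<otimes> x" using s(1) by blast
    have "(inv s \<otimes> r) \<otimes> x = \<one>" unfolding e[OF x(1)] using x(2) sc s(2) by simp
    then have "\<one> \<in> set ?Ls" using x(1) by (metis image_eqI set_map)
    then have "inv \<pi> \<in> oL" using al by fastforce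
    then show False using inv_pi_notin by blast
  qed
  then show "set (take (length xs) Ks) \<subseteq> {\<zero>}" using J(4) by blast
qed

text \<open>Each coefficient in \<open>W\<close> is congruent modulo p to one of p digits, and p
  lies in \<pi>oL.\<close>

lemma residue_representatives:
  assumes "set Js \<subseteq> W" "set xs \<subseteq> oL" "length Js = length xs"
  shows "\<exists>Ts. set Ts \<subseteq> (\<lambda>i. [i] \<cdot> \<one>) ` {..<p} \<and> length Ts = length xs \<and>
    inv \<pi> \<otimes> (combine Js xs \<ominus> combine Ts xs) \<in> oL"
  using assms(3,1,2)
proof (induction Js xs rule: list_induct2)
  case Nil
  then show ?case by (simp add: minus_eq)
next
  case (Cons j Js x xs)
  then obtain Ts where T: "set Ts \<subseteq> (\<lambda>i. [i] \<cdot> \<one>) ` {..<p}" "length Ts = length xs"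
    "inv \<pi> \<otimes> (combine Js xs \<ominus> combine Ts xs) \<in> oL" by auto
  have "j \<in> W" using Cons.prems by simp
  then obtain i v where i: "i < p" "v \<in> W" "j = [i] \<cdot> \<one> \<oplus> P \<otimes> v" by (rule W_residue)
  have ic: "[i] \<cdot> \<one> \<in> carrier E" "v \<in> carrier E" "x \<in> carrier E" using W_nat W_carrier i Cons.prems by auto
  have tc: "set Ts \<subseteq> carrier E" using T(1) W_nat W_carrier by blast
  have jc: "set Js \<subseteq> carrier E" "set xs \<subseteq> carrier E" using Cons.prems W_carrier by auto
  have cc: "combine Js xs \<in> carrier E" "combine Ts xs \<in> carrier E" using tc jc by auto
  have "inv \<pi> \<otimes> (combine (j # Js) (x # xs) \<ominus> combine ([i] \<cdot> \<one> # Ts) (x # xs))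
    = (inv \<pi> \<otimes> P) \<otimes> (v \<otimes> x) \<oplus> inv \<pi> \<otimes> (combine Js xs \<ominus> combine Ts xs)"
    unfolding i(3) using cc ic P_carrier by (simp add: ring_norm del: add.nat_pow_one)
  moreover have "(inv \<pi> \<otimes> P) \<otimes> (v \<otimes> x) \<oplus> inv \<pi> \<otimes> (combine Js xs \<ominus> combine Ts xs) \<in> oL"
    using W_oL[OF i(2)] Cons.prems(2) by (intro oL_closed(3)[OF _ T(3)] oL_closed(4)[OF P_in_pi]) auto
  ultimately show ?case using T(1,2) i(1) by (intro exI[of _ "[i] \<cdot> \<one> # Ts"]) auto
qed

text \<open>Families independent modulo \<pi> have length at most the degree of \<open>L\<close>
  over \<open>K0\<close>. For one of maximal length, every residue class is represented by the
  negative of a combination with digits as coefficients, and there are finitely many of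
  these.\<close>

theorem finite_residue: "finite ((\<lambda>a. {b \<in> oL. inv \<pi> \<otimes> (a \<ominus> b) \<in> oL}) ` oL)"
proof -
  have "finite_dimension K0 L" using extension unfolding finite_extension_of_Qp_def by blast
  then obtain n where n: "dimension n K0 L" by (auto simp: finite_dimension_def)
  define attained where "attained l \<longleftrightarrow> (\<exists>xs. set xs \<subseteq> oL \<and> independent_mod xs \<and> length xs = l)" for l
  have bound: "l \<le> n" if h: "attained l" for l
  proof -
    obtain xs where xs: "set xs \<subseteq> oL" "independent_mod xs" "length xs = l" using h unfolding attained_def by blast
    have "set xs \<subseteq> L" using xs(1) oL_L by blast
    then show ?thesis using independent_length_le_dimension[OF subfield_K0 n independent_mod_imp[OF xs(1,2)]] xs(3) by simp
  qed
  have "attained 0" by (auto simp: attained_def independent_mod_def)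
  then have att: "attained (Greatest attained)" by (rule GreatestI_nat[OF _ bound])
  define l where "l = Greatest attained"
  obtain xs where xs: "set xs \<subseteq> oL" "independent_mod xs" "length xs = l"
    using att unfolding l_def attained_def by blast
  have xc: "set xs \<subseteq> carrier E" using xs by auto
  let ?T = "(\<lambda>i. [i] \<cdot> \<one>) ` {..<p} :: 'a set"
  let ?C = "\<lambda>a. {b \<in> oL. inv \<pi> \<otimes> (a \<ominus> b) \<in> oL}"
  have "(?C ` oL) \<subseteq> (\<lambda>Ts. ?C (\<ominus> combine Ts xs)) ` {Ts. set Ts \<subseteq> ?T \<and> length Ts = l}"
  proof
    fix Z assume "Z \<in> ?C ` oL"
    then obtain a where a: "a \<in> oL" "Z = ?C a" by blast
    have ac: "a \<in> carrier E" using a by simp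
    have "\<not> independent_mod (a # xs)"
    proof
      assume i: "independent_mod (a # xs)"
      have "set (a # xs) \<subseteq> oL" using a xs by simp
      then have "attained (length (a # xs))" using i unfolding attained_def by blast
      then have "length (a # xs) \<le> l" unfolding l_def by (rule Greatest_le_nat[OF _ bound])
      then show False using xs(3) by simp
    qed
    then obtain Ms where Ms: "set Ms \<subseteq> oL \<inter> K0" "length Ms = length (a # xs)"
      "inv \<pi> \<otimes> combine Ms (a # xs) \<in> oL" "\<not> (\<forall>k\<in>set Ms. inv \<pi> \<otimes> k \<in> oL)"
      unfolding independent_mod_def by blast
    obtain k Is where kI: "Ms = k # Is" using Ms(2) by (cases Ms) auto
    have k: "k \<in> oL" "k \<in> K0" "set Is \<subseteq> oL \<inter> K0" "length Is = length xs" using Ms unfolding kI by auto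
    have Ic: "set Is \<subseteq> carrier E" using k(3) by auto
    have cc: "combine Is xs \<in> carrier E" "k \<in> carrier E" using Ic xc k(1) by auto
    have e: "inv \<pi> \<otimes> (k \<otimes> a \<oplus> combine Is xs) \<in> oL" using Ms(3) unfolding kI by simp
    \<comment> \<open>Otherwise the term with \<open>a\<close> would drop out modulo \<pi>, leaving
      a nontrivial relation among the \<open>xs\<close> alone.\<close>
    have nk: "inv \<pi> \<otimes> k \<notin> oL"
    proof
      assume h: "inv \<pi> \<otimes> k \<in> oL"
      have "inv \<pi> \<otimes> (k \<otimes> a \<oplus> combine Is xs) \<ominus> (inv \<pi> \<otimes> k) \<otimes> a \<in> oL"
        by (rule oL_minus[OF e oL_closed(4)[OF h a(1)]])
      moreover have "inv \<pi> \<otimes> (k \<otimes> a \<oplus> combine Is xs) \<ominus> (inv \<pi> \<otimes> k) \<otimes> a = inv \<pi> \<otimes> combine Is xs"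
        using cc ac by (simp add: ring_norm)
      ultimately have "inv \<pi> \<otimes> combine Is xs \<in> oL" by simp
      then have "\<forall>k\<in>set Is. inv \<pi> \<otimes> k \<in> oL" using xs(2) k(3,4) unfolding independent_mod_def by blast
      then show False using Ms(4) h unfolding kI by simp
    qed
    have u: "k \<noteq> \<zero>" "inv k \<in> oL" using D.unit_A[OF k(1) nk] by auto
    have iK: "inv k \<in> K0" by (rule generate_field.m_inv[OF k(2) u(1)])
    let ?Js = "map ((\<otimes>) (inv k)) Is"
    have J: "set ?Js \<subseteq> W"
    proof
      fix y assume "y \<in> set ?Js"
      then obtain z where z: "z \<in> set Is" "y = inv k \<otimes> z" by auto
      then have "z \<in> oL" "z \<in> K0" using k(3) by auto
      then show "y \<in> W" unfolding z(2)
        by (intro K0_integral generate_field.eng_mult[OF iK] oL_closed(4)[OF u(2)])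
    qed
    have "combine ?Js xs = inv k \<otimes> combine Is xs" using combine_r_distr[OF Ic xc] cc u(1) by simp
    moreover have "inv k \<otimes> (inv \<pi> \<otimes> (k \<otimes> a \<oplus> combine Is xs)) = inv \<pi> \<otimes> (a \<oplus> inv k \<otimes> combine Is xs)"
      using cc ac u(1) by (simp add: r_distr m_ac mult_cancel_simps)
    ultimately have e2: "inv \<pi> \<otimes> (a \<oplus> combine ?Js xs) \<in> oL" using oL_closed(4)[OF u(2) e] by simp
    obtain Ts where T: "set Ts \<subseteq> ?T" "length Ts = length xs" "inv \<pi> \<otimes> (combine ?Js xs \<ominus> combine Ts xs) \<in> oL"
      using residue_representatives[OF J xs(1)] k(4) by auto
    have tc: "combine Ts xs \<in> carrier E" "combine ?Js xs \<in> carrier E"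
    proof -
      have "set Ts \<subseteq> carrier E" using T(1) W_nat W_carrier by blast
      then show "combine Ts xs \<in> carrier E" using xc by blast
      have "set ?Js \<subseteq> carrier E" by (rule W_list[OF J])
      then show "combine ?Js xs \<in> carrier E" using xc by blast
    qed
    have "inv \<pi> \<otimes> (a \<oplus> combine ?Js xs) \<ominus> inv \<pi> \<otimes> (combine ?Js xs \<ominus> combine Ts xs) \<in> oL"
      by (rule oL_minus[OF e2 T(3)])
    moreover have "inv \<pi> \<otimes> (a \<oplus> j) \<ominus> inv \<pi> \<otimes> (j \<ominus> t) = inv \<pi> \<otimes> (a \<ominus> \<ominus> t)"
      if "j \<in> carrier E" "t \<in> carrier E" for j t using ac that by (simp add: ring_norm)
    ultimately have e3: "inv \<pi> \<otimes> (a \<ominus> \<ominus> combine Ts xs) \<in> oL" using tc by simp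
    let ?t = "\<ominus> combine Ts xs"
    have tcc: "?t \<in> carrier E" using tc by simp
    have eq: "inv \<pi> \<otimes> (a \<ominus> b) = inv \<pi> \<otimes> (a \<ominus> ?t) \<oplus> inv \<pi> \<otimes> (?t \<ominus> b)" "inv \<pi> \<otimes> (?t \<ominus> b) = inv \<pi> \<otimes> (a \<ominus> b) \<ominus> inv \<pi> \<otimes> (a \<ominus> ?t)"
      if "b \<in> oL" for b
      using ac tc oL_carrier[OF that] by (simp_all add: ring_norm)
    have "?C a = ?C ?t"
    proof (rule Collect_cong, rule conj_cong[OF refl])
      fix b assume b: "b \<in> oL"
      show "(inv \<pi> \<otimes> (a \<ominus> b) \<in> oL) = (inv \<pi> \<otimes> (?t \<ominus> b) \<in> oL)"
      proof
        assume "inv \<pi> \<otimes> (a \<ominus> b) \<in> oL"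
        then show "inv \<pi> \<otimes> (?t \<ominus> b) \<in> oL" unfolding eq(2)[OF b] by (rule oL_minus[OF _ e3])
      next
        assume "inv \<pi> \<otimes> (?t \<ominus> b) \<in> oL"
        then show "inv \<pi> \<otimes> (a \<ominus> b) \<in> oL" unfolding eq(1)[OF b] by (rule oL_closed(3)[OF e3])
      qed
    qed
    moreover have "length Ts = l" using T(2) xs(3) by simp
    ultimately show "Z \<in> (\<lambda>Ts. ?C (\<ominus> combine Ts xs)) ` {Ts. set Ts \<subseteq> ?T \<and> length Ts = l}"
      using a(2) T(1) by blast
  qed
  moreover have "finite {Ts. set Ts \<subseteq> ?T \<and> length Ts = l}" by (rule finite_lists_length_eq) simp
  ultimately show ?thesis by (rule finite_surj[rotated])
qed

end

section \<open>Krull topology and Galois towers\<close>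

text \<open>With t_k the sum of the \<open>S\<close>-translates of y_k, the sum of a_k g(t_k) is 1
  for the identity and 0 for g outside \<open>S\<close>. An element g that fixes the
  \<open>S\<close>-invariants fixes each t_k, so the two values would coincide.\<close>

lemma (in galois_level) fixing_imp_mem:
  assumes S: "subgroup S G" and g: "g \<in> carrier G"
    and fix_g: "\<And>x. x \<in> F \<Longrightarrow> (\<And>s. s \<in> S \<Longrightarrow> act s x = x) \<Longrightarrow> act g x = x"
  shows "g \<in> S"
proof (rule ccontr)
  assume gS: "g \<notin> S"
  have sG: "s \<in> carrier G" if "s \<in> S" for s using subgroup.mem_carrier[OF S that] .
  have finS: "finite S" using finite_subset[OF subgroup.subset[OF S] fin_G] .
  obtain r :: nat and a y where a: "\<And>k. k < r \<Longrightarrow> a k \<in> F" and y: "\<And>k. k < r \<Longrightarrow> y k \<in> F"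
    and d: "\<And>g. g \<in> carrier G \<Longrightarrow> (\<Oplus>k\<in>{..<r}. a k \<otimes> act g (y k)) = (if g = \<one>\<^bsub>G\<^esub> then \<one> else \<zero>)"
    by (rule coordinates) blast
  define t where "t k = (\<Oplus>s\<in>S. act s (y k))" for k
  have tF: "t k \<in> F" if k: "k < r" for k
    unfolding t_def by (rule finsum_mem) (use y[OF k] sG in auto)
  have shift: "act h (t k) = (\<Oplus>s\<in>S. act (h \<otimes>\<^bsub>G\<^esub> s) (y k))" if h: "h \<in> carrier G" and k: "k < r" for h k
  proof -
    have "act h (t k) = (\<Oplus>s\<in>S. act h (act s (y k)))"
      unfolding t_def by (rule act_finsum[OF h finS]) (use y[OF k] sG in auto)
    also have "\<dots> = (\<Oplus>s\<in>S. act (h \<otimes>\<^bsub>G\<^esub> s) (y k))"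
      by (rule finsum_cong') (use y[OF k] sG h in \<open>auto simp: act_comp\<close>)
    finally show ?thesis .
  qed
  have inv_t: "act h (t k) = t k" if h: "h \<in> S" and k: "k < r" for h k
  proof -
    have inj: "inj_on (\<lambda>s. h \<otimes>\<^bsub>G\<^esub> s) S" using sG h by (intro inj_onI) (auto simp: GG.l_cancel)
    have "(\<lambda>s. h \<otimes>\<^bsub>G\<^esub> s) ` S \<subseteq> S" using subgroup.m_closed[OF S h] by blast
    then have im: "(\<lambda>s. h \<otimes>\<^bsub>G\<^esub> s) ` S = S" using endo_inj_surj[OF finS] inj by blast
    have "(\<Oplus>s\<in>(\<lambda>s. h \<otimes>\<^bsub>G\<^esub> s) ` S. act s (y k)) = (\<Oplus>s\<in>S. act (h \<otimes>\<^bsub>G\<^esub> s) (y k))"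
      by (rule finsum_reindex[OF _ inj]) (use y[OF k] sG in \<open>auto simp: im\<close>)
    then show ?thesis using shift[OF sG[OF h] k] unfolding im by (simp add: t_def)
  qed
  have fixed: "act g (t k) = t k" if k: "k < r" for k
    by (rule fix_g[OF tF[OF k]]) (rule inv_t[OF _ k])
  have swap: "(\<Oplus>k\<in>{..<r}. a k \<otimes> act h (t k)) = (\<Oplus>s\<in>S. if h \<otimes>\<^bsub>G\<^esub> s = \<one>\<^bsub>G\<^esub> then \<one> else \<zero>)" if h: "h \<in> carrier G" for h
  proof -
    have "(\<Oplus>k\<in>{..<r}. a k \<otimes> act h (t k)) = (\<Oplus>k\<in>{..<r}. \<Oplus>s\<in>S. a k \<otimes> act (h \<otimes>\<^bsub>G\<^esub> s) (y k))"
    proof (rule finsum_cong'[OF refl])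
      show "(\<lambda>k. \<Oplus>s\<in>S. a k \<otimes> act (h \<otimes>\<^bsub>G\<^esub> s) (y k)) \<in> {..<r} \<rightarrow> carrier E"
        using a y sG h by (auto intro!: finsum_closed)
      fix k assume "k \<in> {..<r}"
      then have k: "k < r" by simp
      show "a k \<otimes> act h (t k) = (\<Oplus>s\<in>S. a k \<otimes> act (h \<otimes>\<^bsub>G\<^esub> s) (y k))"
        unfolding shift[OF h k] by (rule finsum_rdistr[OF finS]) (use a[OF k] y[OF k] sG h in auto)
    qed
    also have "\<dots> = (\<Oplus>s\<in>S. \<Oplus>k\<in>{..<r}. a k \<otimes> act (h \<otimes>\<^bsub>G\<^esub> s) (y k))"
      by (rule finsum_swap) (use finS a y sG h in auto)
    also have "\<dots> = (\<Oplus>s\<in>S. if h \<otimes>\<^bsub>G\<^esub> s = \<one>\<^bsub>G\<^esub> then \<one> else \<zero>)"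
      by (rule finsum_cong') (use d sG h in auto)
    finally show ?thesis .
  qed
  have "(\<Oplus>s\<in>S. if \<one>\<^bsub>G\<^esub> \<otimes>\<^bsub>G\<^esub> s = \<one>\<^bsub>G\<^esub> then \<one> else \<zero>) = (if \<one>\<^bsub>G\<^esub> \<otimes>\<^bsub>G\<^esub> \<one>\<^bsub>G\<^esub> = \<one>\<^bsub>G\<^esub> then \<one> else \<zero>)"
    by (rule finsum_delta[OF finS subgroup.one_closed[OF S]]) (use sG in auto)
  then have one: "(\<Oplus>k\<in>{..<r}. a k \<otimes> act \<one>\<^bsub>G\<^esub> (t k)) = \<one>" using swap[OF GG.one_closed] by simp
  have ne: "g \<otimes>\<^bsub>G\<^esub> s \<noteq> \<one>\<^bsub>G\<^esub>" if s: "s \<in> S" for s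
  proof
    assume "g \<otimes>\<^bsub>G\<^esub> s = \<one>\<^bsub>G\<^esub>"
    then have "inv\<^bsub>G\<^esub> s = g" using GG.inv_equality[OF _ sG[OF s] g] by simp
    then show False using subgroup.m_inv_closed[OF S s] gS by simp
  qed
  have "(\<Oplus>s\<in>S. if g \<otimes>\<^bsub>G\<^esub> s = \<one>\<^bsub>G\<^esub> then \<one> else \<zero>) = (\<Oplus>s\<in>S. \<zero>)"
    by (rule finsum_cong') (use ne in auto)
  then have zero: "(\<Oplus>k\<in>{..<r}. a k \<otimes> act g (t k)) = \<zero>" using swap[OF g] by (simp add: finsum_zero)
  have "(\<Oplus>k\<in>{..<r}. a k \<otimes> act g (t k)) = (\<Oplus>k\<in>{..<r}. a k \<otimes> act \<one>\<^bsub>G\<^esub> (t k))"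
    by (rule finsum_cong') (use fixed tF a in auto)
  then show False using one zero by simp
qed

text \<open>The Galois correspondence of the finite quotient at level \<open>n\<close>, pulled back
  to subgroups containing \<open>N n\<close>.\<close>

lemma (in tower) fixing_imp_mem:
  assumes H: "subgroup H \<Gamma>" "N n \<subseteq> H" and n: "1 \<le> n" and \<theta>: "\<theta> \<in> carrier \<Gamma>"
    and fix_\<theta>: "\<And>x. x \<in> fixed_field E H \<Longrightarrow> \<theta> x = x"
  shows "\<theta> \<in> H"
proof -
  interpret l: galois_level E L A \<pi> "Q n" "F n" cact by (rule level[OF n])
  have HG: "h \<in> carrier \<Gamma>" if "h \<in> H" for h using subgroup.mem_carrier[OF H(1) that] .
  have "group_hom \<Gamma> (Q n) (\<lambda>\<gamma>. cset n \<gamma>)"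
    by (intro group_hom.intro group_hom_axioms.intro \<Gamma>.is_group l.GG.is_group normal.r_coset_hom_Mod[OF normal_N[OF n]])
  then have S: "subgroup ((\<lambda>\<gamma>. cset n \<gamma>) ` H) (Q n)" using H(1) by (rule group_hom.subgroup_img_is_subgroup)
  have i: "inv\<^bsub>\<Gamma>\<^esub> \<theta> \<in> carrier \<Gamma>" using \<theta> by simp
  have "cset n (inv\<^bsub>\<Gamma>\<^esub> \<theta>) \<in> (\<lambda>\<gamma>. cset n \<gamma>) ` H"
  proof (rule l.fixing_imp_mem[OF S cos_in[OF n i]])
    fix x assume x: "x \<in> F n" and fx: "\<And>s. s \<in> (\<lambda>\<gamma>. cset n \<gamma>) ` H \<Longrightarrow> cact s x = x"
    have "h x = x" if h: "h \<in> H" for h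
    proof -
      have ih: "inv\<^bsub>\<Gamma>\<^esub> h \<in> H" using subgroup.m_inv_closed[OF H(1) h] .
      have "cact (cset n (inv\<^bsub>\<Gamma>\<^esub> h)) x = x" by (rule fx) (rule imageI[OF ih])
      then show ?thesis using cact_cset[OF n HG[OF ih] x] HG[OF h] by simp
    qed
    then have "x \<in> fixed_field E H" using F_memD(1)[OF x] unfolding fixed_field_def by blast
    then show "cact (cset n (inv\<^bsub>\<Gamma>\<^esub> \<theta>)) x = x"
      using cact_cset[OF n i x] \<theta> fix_\<theta> by simp
  qed
  then obtain h where h: "h \<in> H" "cset n (inv\<^bsub>\<Gamma>\<^esub> \<theta>) = cset n h" by blast
  have "inv\<^bsub>\<Gamma>\<^esub> \<theta> \<in> cset n h" using cos_self[OF n i] h(2) by simp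
  then obtain u where u: "u \<in> N n" "inv\<^bsub>\<Gamma>\<^esub> \<theta> = u \<otimes>\<^bsub>\<Gamma>\<^esub> h" by (rule cos_memE)
  then have "inv\<^bsub>\<Gamma>\<^esub> \<theta> \<in> H" using subgroup.m_closed[OF H(1) _ h(1)] H(2) by auto
  then show ?thesis using subgroup.m_inv_closed[OF H(1), of "inv\<^bsub>\<Gamma>\<^esub> \<theta>"] \<theta> by simp
qed

lemma (in group) finite_index_trans:
  assumes U: "subgroup U G" and H: "subgroup H G"
    and UH: "finite ((\<lambda>a. U #> a) ` H)" and HG: "finite ((\<lambda>a. H #> a) ` carrier G)"
  shows "finite ((\<lambda>a. U #> a) ` carrier G)"
proof -
  obtain R where R: "R \<subseteq> carrier G" "finite R" "(\<lambda>a. H #> a) ` carrier G = (\<lambda>a. H #> a) ` R"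
    using finite_subset_image[OF HG subset_refl] by blast
  obtain S where S: "S \<subseteq> H" "finite S" "(\<lambda>a. U #> a) ` H = (\<lambda>a. U #> a) ` S"
    using finite_subset_image[OF UH subset_refl] by blast
  have "(\<lambda>a. U #> a) ` carrier G \<subseteq> (\<lambda>(s, r). U #> (s \<otimes> r)) ` (S \<times> R)"
  proof
    fix C assume "C \<in> (\<lambda>a. U #> a) ` carrier G"
    then obtain a where a: "a \<in> carrier G" "C = U #> a" by blast
    then obtain r where r: "r \<in> R" "H #> a = H #> r" using R(3) by blast
    have rG: "r \<in> carrier G" using r(1) R(1) by blast
    have "a \<in> H #> r" using rcos_self[OF a(1) H] r(2) by simp
    then obtain h where h: "h \<in> H" "a = h \<otimes> r" unfolding r_coset_def by blast
    then obtain s where s: "s \<in> S" "U #> h = U #> s" using S(3) by blast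
    have hG: "h \<in> carrier G" "s \<in> carrier G" using h(1) s(1) S(1) subgroup.mem_carrier[OF H] by auto
    have "U #> a = (U #> h) #> r" unfolding h(2) using coset_mult_assoc[OF subgroup.subset[OF U] hG(1) rG] by simp
    also have "\<dots> = U #> (s \<otimes> r)" unfolding s(2) by (rule coset_mult_assoc[OF subgroup.subset[OF U] hG(2) rG])
    finally have "C = U #> (s \<otimes> r)" using a(2) by simp
    then show "C \<in> (\<lambda>(s, r). U #> (s \<otimes> r)) ` (S \<times> R)" using s(1) r(1) by auto
  qed
  then show ?thesis using finite_surj[of "S \<times> R"] S(2) R(2) by blast
qed

lemma carrier_FactGroup: "carrier (G Mod H) = (\<lambda>a. H #>\<^bsub>G\<^esub> a) ` carrier G"
  by (auto simp: FactGroup_def RCOSETS_def)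

lemma r_coset_restrict: "H #>\<^bsub>G\<lparr>carrier := K\<rparr>\<^esub> a = H #>\<^bsub>G\<^esub> a"
  by (simp add: r_coset_def)

lemma Gal_carrier: "carrier (Gal E K) = {\<theta> \<in> Bij (carrier E). \<theta> \<in> ring_hom E E \<and> (\<forall>x\<in>K. \<theta> x = x)}"
  by (simp add: Gal_def)

lemma Gal_mult: "\<theta> \<in> carrier (Gal E K) \<Longrightarrow> \<tau> \<in> carrier (Gal E K) \<Longrightarrow> \<theta> \<otimes>\<^bsub>Gal E K\<^esub> \<tau> = compose (carrier E) \<theta> \<tau>"
  by (simp add: Gal_def BijGroup_def)

lemma Gal_one: "\<one>\<^bsub>Gal E K\<^esub> = (\<lambda>x\<in>carrier E. x)"
  by (simp add: Gal_def BijGroup_def)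

lemma Gal_mono: "K \<subseteq> M \<Longrightarrow> carrier (Gal E M) \<subseteq> carrier (Gal E K)"
  by (auto simp: Gal_carrier)

lemma Gal_Un: "carrier (Gal E (K \<union> M)) = carrier (Gal E K) \<inter> carrier (Gal E M)"
  by (auto simp: Gal_carrier)

lemma subgroup_Gal:
  assumes "group (Gal E K)" "K \<subseteq> M" "M \<subseteq> carrier E" "ring E"
  shows "subgroup (carrier (Gal E M)) (Gal E K)"
proof -
  interpret G: group "Gal E K" by (rule assms(1))
  note sub = Gal_mono[OF assms(2), of E]
  have app: "(\<theta> \<otimes>\<^bsub>Gal E K\<^esub> \<tau>) x = \<theta> (\<tau> x)"
    if "\<theta> \<in> carrier (Gal E K)" "\<tau> \<in> carrier (Gal E K)" "x \<in> M" for \<theta> \<tau> x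
    using that assms(3) by (auto simp: Gal_mult compose_def)
  have memI: "\<theta> \<in> carrier (Gal E M)" if "\<theta> \<in> carrier (Gal E K)" "\<And>x. x \<in> M \<Longrightarrow> \<theta> x = x" for \<theta>
    using that by (auto simp: Gal_carrier)
  have memD: "\<theta> x = x" if "\<theta> \<in> carrier (Gal E M)" "x \<in> M" for \<theta> x
    using that by (auto simp: Gal_carrier)
  show ?thesis
  proof (rule G.subgroupI)
    show "carrier (Gal E M) \<subseteq> carrier (Gal E K)" by (rule sub)
    have "\<one>\<^bsub>Gal E K\<^esub> \<in> carrier (Gal E M)" by (rule memI[OF G.one_closed]) (use assms(3) in \<open>auto simp: Gal_one\<close>)
    then show "carrier (Gal E M) \<noteq> {}" by blast
  next
    fix \<theta> assume t: "\<theta> \<in> carrier (Gal E M)"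
    then have tK: "\<theta> \<in> carrier (Gal E K)" using sub by blast
    show "inv\<^bsub>Gal E K\<^esub> \<theta> \<in> carrier (Gal E M)"
    proof (rule memI)
      show iK: "inv\<^bsub>Gal E K\<^esub> \<theta> \<in> carrier (Gal E K)" using tK by simp
      fix x assume x: "x \<in> M"
      have "(inv\<^bsub>Gal E K\<^esub> \<theta>) x = (inv\<^bsub>Gal E K\<^esub> \<theta>) (\<theta> x)" using memD[OF t x] by simp
      also have "\<dots> = (inv\<^bsub>Gal E K\<^esub> \<theta> \<otimes>\<^bsub>Gal E K\<^esub> \<theta>) x" using app[OF iK tK x] by simp
      also have "\<dots> = x" using tK x assms(3) by (auto simp: Gal_one)
      finally show "(inv\<^bsub>Gal E K\<^esub> \<theta>) x = x" .
    qed
  next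
    fix \<theta> \<tau> assume t: "\<theta> \<in> carrier (Gal E M)" "\<tau> \<in> carrier (Gal E M)"
    then have tK: "\<theta> \<in> carrier (Gal E K)" "\<tau> \<in> carrier (Gal E K)" using sub by blast+
    show "\<theta> \<otimes>\<^bsub>Gal E K\<^esub> \<tau> \<in> carrier (Gal E M)"
    proof (rule memI[OF G.m_closed[OF tK]])
      show "(\<theta> \<otimes>\<^bsub>Gal E K\<^esub> \<tau>) x = x" if x: "x \<in> M" for x
        by (simp only: app[OF tK x] memD[OF t(2) x] memD[OF t(1) x])
    qed
  qed
qed

text \<open>Neighbourhoods are indexed by subsets \<open>Y\<close> rather than by subfields: an
  intersection of two such groups belongs to the union of the two sets, by \<open>Gal_Un\<close>, so
  no compositum has to be formed.\<close>

lemma krull_open_contains: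
  assumes G: "group (Gal E K)" "ring E" and W: "openin (krull_topology E K) W" "\<theta> \<in> W" "K \<subseteq> carrier E"
  obtains Y where "K \<subseteq> Y" "Y \<subseteq> carrier E" "openin (krull_topology E K) (carrier (Gal E Y))"
    "\<theta> <#\<^bsub>Gal E K\<^esub> carrier (Gal E Y) \<subseteq> W"
proof -
  interpret G: group "Gal E K" by (rule G(1))
  let ?S = "{\<theta> <#\<^bsub>Gal E K\<^esub> carrier (Gal E M) | \<theta> M.
        \<theta> \<in> carrier (Gal E K) \<and> subfield M E \<and> K \<subseteq> M \<and> ring.finite_dimension E K M}"
  let ?P = "\<lambda>\<theta> W. \<exists>Y. K \<subseteq> Y \<and> Y \<subseteq> carrier E \<and> openin (krull_topology E K) (carrier (Gal E Y)) \<and>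
    \<theta> <#\<^bsub>Gal E K\<^esub> carrier (Gal E Y) \<subseteq> W"
  have "generate_topology_on ?S W"
    using W(1) unfolding krull_topology_def openin_topology_generated_by_iff .
  then have "\<forall>\<theta>\<in>W. ?P \<theta> W"
  proof (induction rule: generate_topology_on.induct)
    case Empty
    then show ?case by simp
  next
    case (Int a b)
    show ?case
    proof
      fix \<theta> assume t: "\<theta> \<in> a \<inter> b"
      obtain Y where Y: "K \<subseteq> Y" "Y \<subseteq> carrier E" "openin (krull_topology E K) (carrier (Gal E Y))"
        "\<theta> <#\<^bsub>Gal E K\<^esub> carrier (Gal E Y) \<subseteq> a" using Int.IH(1) t by blast
      obtain Z where Z: "K \<subseteq> Z" "Z \<subseteq> carrier E" "openin (krull_topology E K) (carrier (Gal E Z))"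
        "\<theta> <#\<^bsub>Gal E K\<^esub> carrier (Gal E Z) \<subseteq> b" using Int.IH(2) t by blast
      have "\<theta> <#\<^bsub>Gal E K\<^esub> carrier (Gal E (Y \<union> Z)) \<subseteq> a \<inter> b" using Y(4) Z(4) unfolding Gal_Un l_coset_def by blast
      moreover have "openin (krull_topology E K) (carrier (Gal E (Y \<union> Z)))" unfolding Gal_Un by (rule openin_Int[OF Y(3) Z(3)])
      ultimately show "?P \<theta> (a \<inter> b)" using Y(1,2) Z(2) by (intro exI[of _ "Y \<union> Z"]) auto
    qed
  next
    case (UN \<K>)
    show ?case
    proof
      fix \<theta> assume "\<theta> \<in> \<Union> \<K>"
      then obtain k where k: "k \<in> \<K>" "\<theta> \<in> k" by blast
      then show "?P \<theta> (\<Union> \<K>)" using UN.IH[OF k(1)] by (meson Union_upper subset_trans)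
    qed
  next
    case (Basis s)
    then obtain \<tau> M where M: "s = \<tau> <#\<^bsub>Gal E K\<^esub> carrier (Gal E M)" "\<tau> \<in> carrier (Gal E K)" "subfield M E" "K \<subseteq> M"
      "ring.finite_dimension E K M" by blast
    have Mc: "M \<subseteq> carrier E" using subfieldE(3)[OF M(3)] .
    have sg: "subgroup (carrier (Gal E M)) (Gal E K)" by (rule subgroup_Gal[OF G(1) M(4) Mc G(2)])
    have "\<one>\<^bsub>Gal E K\<^esub> <#\<^bsub>Gal E K\<^esub> carrier (Gal E M) = carrier (Gal E M)"
      by (rule G.lcos_mult_one[OF subgroup.subset[OF sg]])
    moreover have "openin (krull_topology E K) (\<one>\<^bsub>Gal E K\<^esub> <#\<^bsub>Gal E K\<^esub> carrier (Gal E M))"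
      unfolding krull_topology_def using M by (intro topology_generated_by_Basis) blast
    ultimately have op: "openin (krull_topology E K) (carrier (Gal E M))" by simp
    show ?case
    proof
      fix \<theta> assume t: "\<theta> \<in> s"
      then obtain g where g: "g \<in> carrier (Gal E M)" "\<theta> = \<tau> \<otimes>\<^bsub>Gal E K\<^esub> g" unfolding M(1) l_coset_def by blast
      have "\<theta> \<otimes>\<^bsub>Gal E K\<^esub> h \<in> s" if h: "h \<in> carrier (Gal E M)" for h
      proof -
        have "\<theta> \<otimes>\<^bsub>Gal E K\<^esub> h = \<tau> \<otimes>\<^bsub>Gal E K\<^esub> (g \<otimes>\<^bsub>Gal E K\<^esub> h)"
          unfolding g(2) using M(2) subgroup.mem_carrier[OF sg] g(1) h by (simp add: G.m_assoc)
        then show ?thesis using subgroup.m_closed[OF sg g(1) h] unfolding M(1) l_coset_def by blast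
      qed
      then have "\<theta> <#\<^bsub>Gal E K\<^esub> carrier (Gal E M) \<subseteq> s" unfolding l_coset_def by blast
      then show "?P \<theta> s" using M(4) Mc op by blast
    qed
  qed
  then show ?thesis using W(2) that by blast
qed

text \<open>The cosets of \<open>U\<close> in \<open>H\<close> form a finite-index quotient of the
  restricted group; Lagrange's theorem in this quotient gives the second claim.\<close>

lemma pro_p_index:
  assumes G: "comm_group G" and pro_p: "pro_p_group p (G\<lparr>carrier := H\<rparr>) (subtopology T H)"
    and H: "subgroup H G" and U: "subgroup U G" "U \<subseteq> H" "openin T U"
  shows "\<exists>k. card ((\<lambda>a. U #>\<^bsub>G\<^esub> a) ` H) = p ^ k"
    and "card ((\<lambda>a. U #>\<^bsub>G\<^esub> a) ` H) = m \<Longrightarrow> a \<in> H \<Longrightarrow> a [^]\<^bsub>G\<^esub> m \<in> U"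
proof -
  interpret G: comm_group G by (rule G)
  let ?H = "G\<lparr>carrier := H\<rparr>"
  have grp: "group ?H" by (rule G.subgroup_imp_group[OF H])
  have nU: "U \<lhd> ?H" by (rule G.normal_restrict_supergroup[OF H G.subgroup_imp_normal[OF U(1)] U(2)])
  have op: "openin (subtopology T H) U" unfolding openin_subtopology using U(2,3) by (intro exI[of _ U]) auto
  have car: "carrier (?H Mod U) = (\<lambda>a. U #>\<^bsub>G\<^esub> a) ` H" by (simp add: carrier_FactGroup r_coset_restrict)
  show "\<exists>k. card ((\<lambda>a. U #>\<^bsub>G\<^esub> a) ` H) = p ^ k"
    using pro_p nU op unfolding pro_p_group_def car[symmetric] by blast
  assume m: "card ((\<lambda>a. U #>\<^bsub>G\<^esub> a) ` H) = m" and a: "a \<in> H"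
  interpret Q: group "?H Mod U" by (rule normal.factorgroup_is_group[OF nU])
  have aH: "a \<in> carrier ?H" using a by simp
  have c: "U #>\<^bsub>?H\<^esub> a \<in> carrier (?H Mod U)" unfolding carrier_FactGroup using aH by blast
  have "order (?H Mod U) = m" using m unfolding order_def car .
  then have "(U #>\<^bsub>?H\<^esub> a) [^]\<^bsub>?H Mod U\<^esub> m = \<one>\<^bsub>?H Mod U\<^esub>"
    using Q.pow_eq_id[OF c, of m] Q.ord_dvd_group_order[OF c] by simp
  then have "U #>\<^bsub>?H\<^esub> (a [^]\<^bsub>?H\<^esub> m) = U"
    using hom_nat_pow[OF normal.r_coset_hom_Mod[OF nU] aH grp Q.is_group, of m] by (simp add: FactGroup_def)
  then have "U #>\<^bsub>G\<^esub> (a [^]\<^bsub>G\<^esub> m) = U" by (simp add: r_coset_restrict G.nat_pow_consistent[symmetric])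
  moreover have "a [^]\<^bsub>G\<^esub> m \<in> U #>\<^bsub>G\<^esub> (a [^]\<^bsub>G\<^esub> m)"
    by (rule G.rcos_self[OF _ U(1)]) (use subgroup.mem_carrier[OF H a] in simp)
  ultimately show "a [^]\<^bsub>G\<^esub> m \<in> U" by simp
qed

lemma tower_Gal:
  assumes "dvr_field E L A \<pi>" "comm_group (Gal E L)" and gal: "fixed_field E (carrier (Gal E L)) = L"
    and "\<And>n. 1 \<le> n \<Longrightarrow> N n \<lhd> Gal E L" "\<And>n. 1 \<le> n \<Longrightarrow> N (Suc n) \<subseteq> N n"
    and "\<And>n. 1 \<le> n \<Longrightarrow> finite (carrier (Gal E L Mod N n))"
    and "\<And>n \<theta>. 1 \<le> n \<Longrightarrow> \<theta> \<in> carrier (Gal E L) \<Longrightarrow>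
      (\<And>x. x \<in> fixed_field E (N n) \<Longrightarrow> \<theta> x = x) \<Longrightarrow> \<theta> \<in> N n"
  shows "tower E L A \<pi> (Gal E L) N"
proof (rule tower.intro[OF assms(1)], rule tower_axioms.intro)
  show "\<theta> \<in> ring_hom E E" if "\<theta> \<in> carrier (Gal E L)" for \<theta> using that by (simp add: Gal_carrier)
  show "(\<theta> \<otimes>\<^bsub>Gal E L\<^esub> \<tau>) x = \<theta> (\<tau> x)"
    if "\<theta> \<in> carrier (Gal E L)" "\<tau> \<in> carrier (Gal E L)" "x \<in> carrier E" for \<theta> \<tau> x
    using that by (simp add: Gal_mult compose_def)
  show "\<one>\<^bsub>Gal E L\<^esub> x = x" if "x \<in> carrier E" for x using that by (simp add: Gal_one)
  show "\<theta> x = x" if "\<theta> \<in> carrier (Gal E L)" "x \<in> L" for \<theta> x using that by (simp add: Gal_carrier)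
  show "x \<in> L" if "x \<in> carrier E" "\<And>\<theta>. \<theta> \<in> carrier (Gal E L) \<Longrightarrow> \<theta> x = x" for x
    using that gal unfolding fixed_field_def by blast
qed (fact assms)+

text \<open>Here the topology is converted into algebra: the pro-p condition gives finite indices
  and elements of p-power order, and openness gives that \<open>N n\<close> is determined by its
  fixed field.\<close>

lemma p_tower_Gal:
  assumes p: "Factorial_Ring.prime p" and E: "field E" and ext: "finite_extension_of_Qp p E L \<iota>"
    and unif: "uniformizer (E\<lparr>carrier := integral_closure E (\<iota> ` carrier (padic_integers p)) L\<rparr>) \<pi>"
    and gal: "galois_extension E L" and comm: "comm_group (Gal E L)"
    and N: "\<And>n. 1 \<le> n \<Longrightarrow> N n \<lhd> Gal E L"
    and opN: "\<And>n. 1 \<le> n \<Longrightarrow> openin (krull_topology E L) (N n)"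
    and N_Suc: "\<And>n. 1 \<le> n \<Longrightarrow> N (Suc n) \<subseteq> N n"
    and index: "\<not> p dvd card (carrier (Gal E L Mod N 1))"
    and pro_p: "pro_p_group p ((Gal E L)\<lparr>carrier := N 1\<rparr>) (subtopology (krull_topology E L) (N 1))"
  shows "p_tower E L (integral_closure E (\<iota> ` carrier (padic_integers p)) L) \<pi> (Gal E L) N p"
proof -
  interpret E: field E by (rule E)
  have "local_field E \<iota> p L \<pi>"
    using p ext unif
    by (intro local_field.intro local_field_axioms.intro padic_subring.intro padic_subring_axioms.intro E)
      (auto simp: finite_extension_of_Qp_def)
  then interpret l: local_field E \<iota> p L \<pi> .
  interpret G: comm_group "Gal E L" by (rule comm)
  have LE: "L \<subseteq> carrier E" using subfieldE(3)[OF l.subfield_L] .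
  have gal': "fixed_field E (carrier (Gal E L)) = L" using gal unfolding galois_extension_def by blast
  have subN: "subgroup (N n) (Gal E L)" if "1 \<le> n" for n using N[OF that] normal_imp_subgroup by blast
  have one: "1 \<le> (1::nat)" by simp
  have N1: "N n \<subseteq> N 1" if "1 \<le> n" for n
    using that by (induction n rule: dec_induct) (use N_Suc in auto)
  \<comment> \<open>An infinite set has cardinality 0, which p divides, so the index hypothesis
    contains finiteness of the quotient. The same device with a power of p settles open subgroups of
    \<open>N 1\<close>.\<close>
  have "card (carrier (Gal E L Mod N 1)) \<noteq> 0" using index by (metis dvd_0_right)
  then have fin1: "finite ((\<lambda>a. N 1 #>\<^bsub>Gal E L\<^esub> a) ` carrier (Gal E L))"
    unfolding carrier_FactGroup by (metis card.infinite)
  have p0: "p ^ k \<noteq> 0" for k using l.p1 by simp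
  have fin: "finite (carrier (Gal E L Mod U))"
    if h: "subgroup U (Gal E L)" "U \<subseteq> N 1" "openin (krull_topology E L) U" for U
  proof -
    have "card ((\<lambda>a. U #>\<^bsub>Gal E L\<^esub> a) ` N 1) \<noteq> 0"
      using pro_p_index(1)[OF comm pro_p subN[OF one] h] p0 by metis
    then have "finite ((\<lambda>a. U #>\<^bsub>Gal E L\<^esub> a) ` N 1)" by (metis card.infinite)
    then show ?thesis
      unfolding carrier_FactGroup by (rule G.finite_index_trans[OF h(1) subN[OF one] _ fin1])
  qed
  have closed: "\<theta> \<in> N n" if n: "1 \<le> n" and \<theta>: "\<theta> \<in> carrier (Gal E L)"
    and fx: "\<And>x. x \<in> fixed_field E (N n) \<Longrightarrow> \<theta> x = x" for n \<theta>
  proof -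
    obtain Y where Y: "L \<subseteq> Y" "Y \<subseteq> carrier E" "openin (krull_topology E L) (carrier (Gal E Y))"
      "\<one>\<^bsub>Gal E L\<^esub> <#\<^bsub>Gal E L\<^esub> carrier (Gal E Y) \<subseteq> N n"
      by (rule krull_open_contains[OF G.is_group E.ring_axioms opN[OF n] subgroup.one_closed[OF subN[OF n]] LE])
    let ?U = "carrier (Gal E Y)"
    have U: "subgroup ?U (Gal E L)" by (rule subgroup_Gal[OF G.is_group Y(1,2) E.ring_axioms])
    have UN: "?U \<subseteq> N n" using Y(4) G.lcos_mult_one[OF subgroup.subset[OF U]] by simp
    \<comment> \<open>A constant auxiliary tower on \<open>?U\<close>, the group fixing
      \<open>Y\<close>: for it the closedness condition is immediate, since \<open>Y\<close> lies in
      the fixed field. Its correspondence then applies to \<open>N n\<close>, which contains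
      \<open>?U\<close>.\<close>
    have "tower E L l.oL \<pi> (Gal E L) (\<lambda>_. ?U)"
    proof (rule tower_Gal[OF l.dvr comm gal'])
      show "?U \<lhd> Gal E L" by (rule G.subgroup_imp_normal[OF U])
      show "finite (carrier (Gal E L Mod ?U))" using fin[OF U _ Y(3)] UN N1[OF n] by blast
      fix \<tau> assume t: "\<tau> \<in> carrier (Gal E L)" "\<And>x. x \<in> fixed_field E ?U \<Longrightarrow> \<tau> x = x"
      have "y \<in> fixed_field E ?U" if "y \<in> Y" for y
        using that Y(2) unfolding fixed_field_def Gal_carrier by auto
      then show "\<tau> \<in> ?U" using t unfolding Gal_carrier by blast
    qed auto
    then show ?thesis by (rule tower.fixing_imp_mem[OF _ subN[OF n] UN one \<theta> fx])
  qed
  have tw: "tower E L l.oL \<pi> (Gal E L) N"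
  proof (rule tower_Gal[OF l.dvr comm gal'])
    show "finite (carrier (Gal E L Mod N n))" if "1 \<le> n" for n
      by (rule fin[OF subN[OF that] N1[OF that] opN[OF that]])
    show "\<theta> \<in> N n" if "1 \<le> n" "\<theta> \<in> carrier (Gal E L)"
      "\<And>x. x \<in> fixed_field E (N n) \<Longrightarrow> \<theta> x = x" for n \<theta>
      using that by (rule closed)
  qed (fact N N_Suc)+
  show ?thesis
  proof (rule p_tower.intro[OF tw], rule p_tower_axioms.intro)
    show "\<exists>k. \<theta> [^]\<^bsub>Gal E L\<^esub> p ^ k \<in> N n" if n: "1 \<le> n" and t: "\<theta> \<in> N 1" for n \<theta>
    proof -
      note idx = pro_p_index[OF comm pro_p subN[OF one] subN[OF n] N1[OF n] opN[OF n]]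
      obtain k where "card ((\<lambda>a. N n #>\<^bsub>Gal E L\<^esub> a) ` N 1) = p ^ k" using idx(1) by blast
      then show ?thesis using idx(2)[OF _ t] by blast
    qed
  qed (fact p l.P_in_pi index l.finite_residue)+
qed

theorem theorem5p22:
  fixes p :: nat
    and E :: "('a, 'm) ring_scheme"
    and L :: "'a set"
    and \<iota> :: "(nat \<Rightarrow> int) \<Rightarrow> 'a"
    and \<pi> :: 'a
    and \<Gamma> :: "('a \<Rightarrow> 'a) monoid"
    and N :: "nat \<Rightarrow> ('a \<Rightarrow> 'a) set"
    and oL :: "'a set"
    and oN :: "nat \<Rightarrow> 'a set"
  defines "\<Gamma> \<equiv> Gal E L"
    and "oL \<equiv> integral_closure E (\<iota> ` carrier (padic_integers p)) L"
    and "oN \<equiv> \<lambda>n. integral_closure E oL (fixed_field E (N n))"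
  assumes "Factorial_Ring.prime p"
    and "field E"
    and "finite_extension_of_Qp p E L \<iota>"
    and "uniformizer (E\<lparr>carrier := oL\<rparr>) \<pi>"
    and "galois_extension E L"
    and "\<not> ring.finite_dimension E L (carrier E)"
    and "\<And>n. n \<ge> 1 \<Longrightarrow> N n \<lhd> \<Gamma>"
    and "\<And>n. n \<ge> 1 \<Longrightarrow> openin (krull_topology E L) (N n)"
    and "\<And>n. n \<ge> 1 \<Longrightarrow> N (Suc n) \<subseteq> N n"
    and "(\<Inter>n\<in>{1..}. N n) = {\<one>\<^bsub>\<Gamma>\<^esub>}"
    and "comm_group \<Gamma>"
    and "\<not> p dvd card (carrier (\<Gamma> Mod N 1))"
    and "torsion_free (\<Gamma>\<lparr>carrier := N 1\<rparr>)"
    and "pro_p_group p (\<Gamma>\<lparr>carrier := N 1\<rparr>) (subtopology (krull_topology E L) (N 1))"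
    and "finite_rank (\<Gamma>\<lparr>carrier := N 1\<rparr>) (subtopology (krull_topology E L) (N 1))"
  shows "free_module_of_rank (iwasawa_algebra (E\<lparr>carrier := oL\<rparr>) \<Gamma> N) (dual_limit E oL oN \<Gamma> N) 1
     \<longleftrightarrow> (\<lambda>Y. direct_limit_in (\<lambda>n. reduction E (oN n) \<pi>) (reduction_map E oN \<pi>) 1 Y)
           \<in> ring_iso (reduction E (oN 1) \<pi>) (reduction_limit_invariants E oN \<pi> (N 1))"
proof -
  note hyps = assms(4-)[unfolded assms(1,2)]
  have "p_tower E L oL \<pi> \<Gamma> N p"
    unfolding assms(1,2) by (rule p_tower_Gal[where N = N]) (fact hyps)+
  then interpret p_tower E L oL \<pi> \<Gamma> N p .
  show ?thesis
    unfolding assms(3) free_iff_invariants_lift iso_iff_invariants_lift ..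
qed

end
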